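(* Let $\star$ be the normal product over $\mathbb R^{k+2}$ corresponding to the permutation relations $[\mathbf C,\mathbf B]=\lambda^\hbar(\mathbf A)$, $\mathbf C\mathbf A=\gamma^\hbar(\mathbf A)\mathbf C$, $[\mathbf A_\mu,\mathbf A_\nu]=0$, and let $*$ be the Wick product over the surface of revolution $\mathcal X_a\subset\mathbb R^{k+2}$ generated by the hypergeometric Kähler form $\omega=i\hbar\,\bar\partial\partial\ln k(|z|^2)$. Then for any polynomial $f=f(B,A,C)$ on $\mathbb R^{k+2}$ the quantum restriction to the surface $\mathcal X_a$ is given by $$f\big|_{\widehat{\mathcal X}_a}\equiv f_a=\frac1{\mathcal K}\,f\big(\stackrel3{\widehat B_a},\stackrel2{\widehat A_a},\stackrel1{\widehat C_a}\big)(\mathcal K),$$ where $$\widehat A_a=\gamma^{\hbar\bar z\bar\partial+\hbar}(a),\qquad\widehat B_a=\mathcal D(\hbar\bar z\bar\partial)\cdot\bar z,\qquad\widehat C_a=\frac1{\bar z}\cdot\mathcal E(\hbar\bar z\bar\partial)$$ are differential operators and $\mathcal K=k(\bar zz)$ with the hypergeometric function $k$ defined in the context. The following conditions are satisfied: $$f\big|_{\widehat{\mathcal X}_a}=f\big|_{\mathcal X_a}+\hbar e_1(f)+\hbar^2e_2(f)+\dots\ (\hbar\to0,\ e_j\text{ differential operators}),\qquad f\big|_{\widehat{\mathcal X}_a}*g\big|_{\widehat{\mathcal X}_a}=(f\star g)\big|_{\widehat{\mathcal X}_a}.$$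
   Context: Let $\hbar>0$. On $\mathbb R^{k+2}$ with coordinates $S_1,S_2,A=(A_1,\dots,A_k)$ put $C=\overline B=S_1+iS_2$. Let $\rho,\varkappa_1,\dots,\varkappa_{k-1}$ be real polynomials on $\mathbb R^k$ ($\varkappa_j$ independent), $v$ a polynomial vector field on $\mathbb R^k$ annulling all $\varkappa_j$, with flow $\gamma^t$ such that $\gamma^t(A)$ is polynomial in $A$ and $t$. Put $\lambda^\hbar(A)=\rho(A)-\rho(\gamma^{-\hbar}(A))$. The product $\star$ on polynomials $f(B,A,C)$ is the one defined by normal ordering: $[f(\stackrel3{\mathbf B},\stackrel2{\mathbf A},\stackrel1{\mathbf C})][g(\stackrel3{\mathbf B},\stackrel2{\mathbf A},\stackrel1{\mathbf C})]=(f\star g)(\stackrel3{\mathbf B},\stackrel2{\mathbf A},\stackrel1{\mathbf C})$ (index 1 acts first). Explicitly, $(f\star g)(B,A,C)=f(\stackrel3{L_B},\stackrel2{L_A},\stackrel1{L_C})g(B,A,C)$ with $L_B=B$, $L_A=\gamma^{\hbar B\partial/\partial B}(A)$, $L_C=C\gamma^{\hbar*}+\Lambda^\hbar(A,\stackrel2B\,\stackrel1{\partial/\partial B})\,\partial/\partial B$, where $(\gamma^{\hbar*}f)(A)=f(\gamma^\hbar(A))$ and $\Lambda^\hbar(A,t)=\frac{\exp\{t(\gamma^{\hbar*}-I)\}-I}{t(\gamma^{\hbar*}-I)}\lambda^\hbar(A)$. Fix $a\in\mathbb R^k$, not a point of local minimum or maximum of $\rho$. $\mathcal X_a$ is the connected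 component containing the vacuum point $(S_1,S_2,A)=(0,0,a)$ of $\{S_1^2+S_2^2=\rho(A)-\rho(a),\ \varkappa_j(A)=\varkappa_j(a)\}$. Along $\mathcal X_a$ points are $A=\gamma^t(a)$; either $\rho(\gamma^t(a))>\rho(a)$ for all $t>0$ (then put $t^*=\infty$), or there is $t^*<\infty$ with $\rho(\gamma^t(a))>\rho(a)$ for $0<t<t^*$ and $\rho(\gamma^{t^*}(a))=\rho(a)$; in the latter case $a^*=\gamma^{t^*}(a)$ and it is assumed that $t^*=(N+1)\hbar$, $N\in\mathbb Z_+$. Choose a polynomial $g$ which is an integral of motion of $\gamma^t$ with $g(a)=\rho(a)$, $\rho(A)>g(A)$ for $A\ne a$ near $a$, and a factorization into polynomials $\rho(A)-g(A)=D(A)E(A)$ with $D(a)\ne0$, $E(a)=0$, and, if $t^*<\infty$, $D(a^* )=0$. The complex structure on $\mathcal X_a$ is given by the complex coordinate $z=C/\overline D(A)$ (all over $\mathcal X_a$ except the polar point $A=a^*$ when $t^*<\infty$, which corresponds to $z=\infty$ and near which the coordinate is $z'=1/z$). Put $\mathcal D(t)=D(\gamma^t(a))$, $\mathcal E(t)=E(\gamma^t(a))$, $\mathcal H=\overline{\mathcal E}/\mathcal D$, and $$k(r)=1+\sum_{n=1}^N\frac{r^n}{\mathcal H(\hbar)\mathcal H(2\hbar)\cdots\mathcal H(n\hbar)},$$ with $N=\infty$ if $t^*=\infty$; in this case it is assumed that the series converges for all $r$. $\mathcal L_a$ is the Hilbert space of antiholomorphic $u(\bar z)=\sum_{n=0}^N\bar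 z^nu_n$ with norm $\|u\|^2=\sum_n\mathcal H(\hbar)\cdots\mathcal H(n\hbar)|u_n|^2$; its reproducing kernel is $\mathcal K(\bar z|z)=k(\bar zz)$. The Wick symbol of an operator $T$ in $\mathcal L_a$ is $\psi(\bar z|z)=\frac1{\mathcal K}T\mathcal K$ ($T$ acting in the variable $\bar z$); one writes $T=\widehat\psi$. The Wick product $*$ is given by $\widehat{\psi*\chi}=\widehat\psi\,\widehat\chi$. The symbol $f_a$ is the Wick symbol of the operator representing $f$ in the irreducible Hermitian representation in $\mathcal L_a$ of the algebra with generators $\mathbf B,\mathbf A=(\mathbf A_1,\dots,\mathbf A_k),\mathbf C$ and relations $[\mathbf C,\mathbf B]=\lambda^\hbar(\mathbf A)$, $\mathbf C\mathbf A=\gamma^\hbar(\mathbf A)\mathbf C$, $[\mathbf A_\mu,\mathbf A_\nu]=0$, $\mathbf C=\mathbf B^*$, $\mathbf A=\mathbf A^*$, given by $\mathbf A\to\widehat A_a$, $\mathbf B\to\widehat B_a$, $\mathbf C\to\widehat C_a$. In the classical restriction $f|_{\mathcal X_a}$ the points of $\mathcal X_a$ are parametrized by $z$ through the complex structure on $\mathcal X_a$ given by the complex coordinate $z=C/\overline D(A)$. *)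

theory Defs
  imports
    "HOL-Analysis.Analysis"
    "HOL-Computational_Algebra.Polynomial"
    "HOL-Library.Poly_Mapping"
    "HOL-Library.Function_Algebras"
    "HOL-Library.Extended_Nat"
begin

text \<open>
  Polynomials in the variables \<^typ>\<open>'v\<close> are finitely supported functions from exponents to
  coefficients.
\<close>

type_synonym ('v, 'c) mpoly = "('v \<Rightarrow>\<^sub>0 nat) \<Rightarrow>\<^sub>0 'c"

definition mp_const :: "'c::zero \<Rightarrow> ('v, 'c) mpoly" where
  "mp_const c = Poly_Mapping.single 0 c"

definition mp_var :: "'v \<Rightarrow> ('v, 'c::zero_neq_one) mpoly" where
  "mp_var v = Poly_Mapping.single (Poly_Mapping.single v 1) 1"

text \<open>\<open>h\<close> embeds the coefficients into the target ring, \<open>x\<close> gives the values of the variables.\<close>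

definition mp_eval ::
  "('c::zero \<Rightarrow> 'r::comm_ring_1) \<Rightarrow> ('v \<Rightarrow> 'r) \<Rightarrow> ('v, 'c) mpoly \<Rightarrow> 'r" where
  "mp_eval h x p =
     (\<Sum>m\<in>Poly_Mapping.keys p. h (Poly_Mapping.lookup p m) *
        (\<Prod>v\<in>Poly_Mapping.keys m. x v ^ Poly_Mapping.lookup m v))"

text \<open>
  The iterated partial derivative of multi-order \<open>\<alpha>\<close>.  If some \<open>\<alpha>\<close>-exponent exceeds the exponent
  in the monomial \<open>m\<close>, the product of the truncated differences contains the factor 0.
\<close>

definition mp_diff :: "('v \<Rightarrow>\<^sub>0 nat) \<Rightarrow> ('v, 'c::comm_ring_1) mpoly \<Rightarrow> ('v, 'c) mpoly" where
  "mp_diff \<alpha> p =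
     (\<Sum>m\<in>Poly_Mapping.keys p. Poly_Mapping.single (m - \<alpha>)
        (of_nat (\<Prod>v\<in>Poly_Mapping.keys \<alpha>. \<Prod>i<Poly_Mapping.lookup \<alpha> v. Poly_Mapping.lookup m v - i)
          * Poly_Mapping.lookup p m))"

abbreviation mp_pd :: "'v \<Rightarrow> ('v, 'c::comm_ring_1) mpoly \<Rightarrow> ('v, 'c) mpoly" where
  "mp_pd v \<equiv> mp_diff (Poly_Mapping.single v 1)"

definition rval :: "('n::finite, real) mpoly \<Rightarrow> real ^ 'n \<Rightarrow> real" where
  "rval p A = mp_eval (\<lambda>c. c) (\<lambda>i. A $ i) p"

definition cval :: "('n::finite, complex) mpoly \<Rightarrow> real ^ 'n \<Rightarrow> complex" where
  "cval p A = mp_eval (\<lambda>c. c) (\<lambda>i. complex_of_real (A $ i)) p"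


subsection \<open>The classical data\<close>

text \<open>
  The dimension is \<open>k = CARD('n)\<close>.  The flow is given by its components \<open>gam i\<close>, polynomials in the
  time whose coefficients are polynomials in \<open>A\<close>.  Of the functions \<open>kap j\<close> only those with
  \<open>1 \<le> j < k\<close> matter.  The polynomials \<open>Dp\<close>, \<open>Ep\<close> (the factors \<open>D\<close>, \<open>E\<close>) are complex, \<open>igm\<close> is the
  integral of motion \<open>g\<close>.
\<close>

record ('n::finite) surface =
  rho :: "('n, real) mpoly"
  kap :: "nat \<Rightarrow> ('n, real) mpoly"
  vf :: "'n \<Rightarrow> ('n, real) mpoly"
  gam :: "'n \<Rightarrow> ('n, real) mpoly poly"
  pt :: "real ^ 'n"
  tstar :: ereal
  igm :: "('n, real) mpoly"
  Dp :: "('n, complex) mpoly"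
  Ep :: "('n, complex) mpoly"

definition flow :: "'n::finite surface \<Rightarrow> real \<Rightarrow> real ^ 'n \<Rightarrow> real ^ 'n" where
  "flow S t A = (\<chi> i. poly (map_poly (\<lambda>q. rval q A) (gam S i)) t)"

definition is_flow :: "'n::finite surface \<Rightarrow> bool" where
  "is_flow S \<longleftrightarrow>
     (\<forall>A. flow S 0 A = A) \<and>
     (\<forall>A t. ((\<lambda>s. flow S s A) has_vector_derivative (\<chi> i. rval (vf S i) (flow S t A))) (at t))"

text \<open>Functional independence: the gradients are linearly independent on a dense set.\<close>

definition kap_independent :: "'n::finite surface \<Rightarrow> bool" where
  "kap_independent S \<longleftrightarrow>
     closure {A. \<forall>c. (\<forall>l. (\<Sum>j\<in>{1..<CARD('n)}. c j * rval (mp_pd l (kap S j)) A) = 0)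
                    \<longrightarrow> (\<forall>j\<in>{1..<CARD('n)}. c j = 0)} = (UNIV :: (real ^ 'n) set)"

definition kap_annulled :: "'n::finite surface \<Rightarrow> bool" where
  "kap_annulled S \<longleftrightarrow> (\<forall>j\<in>{1..<CARD('n)}. (\<Sum>l\<in>UNIV. vf S l * mp_pd l (kap S j)) = 0)"

text \<open>Points of \<open>\<real>\<^bsup>k+2\<^esup>\<close> are pairs \<open>(C, A)\<close> with \<open>C = S\<^sub>1 + i S\<^sub>2\<close>.\<close>

definition XX :: "'n::finite surface \<Rightarrow> (complex \<times> (real ^ 'n)) set" where
  "XX S = connected_component_set
     {(C, A). (Re C)\<^sup>2 + (Im C)\<^sup>2 = rval (rho S) A - rval (rho S) (pt S) \<and>
              (\<forall>j\<in>{1..<CARD('n)}. rval (kap S j) A = rval (kap S j) (pt S))}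
     (0, pt S)"

definition polar :: "'n::finite surface \<Rightarrow> complex \<times> (real ^ 'n)" where
  "polar S = (0, flow S (real_of_ereal (tstar S)) (pt S))"

definition XX' :: "'n::finite surface \<Rightarrow> (complex \<times> (real ^ 'n)) set" where
  "XX' S = (if tstar S = \<infinity> then XX S else XX S - {polar S})"

fun zcoord :: "'n::finite surface \<Rightarrow> complex \<times> (real ^ 'n) \<Rightarrow> complex" where
  "zcoord S (C, A) = C / cnj (cval (Dp S) A)"

definition surf_pt :: "'n::finite surface \<Rightarrow> complex \<Rightarrow> complex \<times> (real ^ 'n)" where
  "surf_pt S = the_inv_into (XX' S) (zcoord S)"

text \<open>
  \<open>C\<^sup>\<infinity>\<close> in the real sense: \<open>d i j\<close> is the partial derivative of order \<open>i\<close> in \<open>Re z\<close> and \<open>j\<close> in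
  \<open>Im z\<close>.
\<close>

definition smooth_plane :: "(complex \<Rightarrow> 'b::real_normed_vector) \<Rightarrow> bool" where
  "smooth_plane f \<longleftrightarrow>
     (\<exists>d :: nat \<Rightarrow> nat \<Rightarrow> complex \<Rightarrow> 'b. d 0 0 = f \<and>
        (\<forall>i j z. (d i j has_derivative
           (\<lambda>h. Re h *\<^sub>R d (Suc i) j z + Im h *\<^sub>R d i (Suc j) z)) (at z)))"

text \<open>
  \<open>z\<close> is a coordinate on all of the surface except the polar point, and \<open>1/z\<close> is a coordinate near
  the polar point, whose value there is 0.
\<close>

definition complex_coordinate :: "'n::finite surface \<Rightarrow> bool" where
  "complex_coordinate S \<longleftrightarrow>
     bij_betw (zcoord S) (XX' S) UNIV \<and> smooth_plane (surf_pt S) \<and>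
     (tstar S \<noteq> \<infinity> \<longrightarrow>
        polar S \<in> XX S \<and>
        smooth_plane (\<lambda>w. if w = 0 then polar S else surf_pt S (1 / w)))"


subsection \<open>The algebra with permutation relations and the normal product\<close>

datatype 'n gen = gB | gA 'n | gC

definition lift_A :: "('n, real) mpoly \<Rightarrow> ('n gen, complex) mpoly" where
  "lift_A = mp_eval (\<lambda>c. mp_const (complex_of_real c)) (\<lambda>i. mp_var (gA i))"

text \<open>\<open>flow_at S s i\<close> is the polynomial \<open>A \<mapsto> \<gamma>\<^sup>s(A)\<^sub>i\<close>, and \<open>pull S s p\<close> is \<open>p \<circ> \<gamma>\<^sup>s\<close>.\<close>

definition flow_at :: "'n::finite surface \<Rightarrow> real \<Rightarrow> 'n \<Rightarrow> ('n, real) mpoly" where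
  "flow_at S s i = poly (gam S i) (mp_const s)"

definition pull :: "'n::finite surface \<Rightarrow> real \<Rightarrow> ('n, real) mpoly \<Rightarrow> ('n, real) mpoly" where
  "pull S s = mp_eval mp_const (flow_at S s)"

text \<open>From here on, \<open>h\<close> is Planck's constant.\<close>

definition lam :: "'n::finite surface \<Rightarrow> real \<Rightarrow> ('n, real) mpoly" where
  "lam S h = rho S - pull S (- h) (rho S)"

definition idx_list :: "'n::finite list" where
  "idx_list = (SOME xs. distinct xs \<and> set xs = UNIV)"

text \<open>
  \<open>normal_ordered s Bo Ao Co f u\<close> is \<open>f(B, A, C)\<close> applied to \<open>u\<close>, where the operators \<open>Co\<close> act first,
  then the \<open>Ao i\<close>, then \<open>Bo\<close>; \<open>s\<close> is multiplication by scalars.  It is only used where the \<open>Ao i\<close>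
  commute, so that their order \<^term>\<open>idx_list\<close> is immaterial.
\<close>

definition normal_ordered ::
  "(complex \<Rightarrow> 'x \<Rightarrow> 'x) \<Rightarrow> ('x \<Rightarrow> 'x) \<Rightarrow> ('n::finite \<Rightarrow> 'x \<Rightarrow> 'x) \<Rightarrow> ('x \<Rightarrow> 'x) \<Rightarrow>
     ('n gen, complex) mpoly \<Rightarrow> 'x::comm_monoid_add \<Rightarrow> 'x" where
  "normal_ordered s Bo Ao Co f u =
     (\<Sum>m\<in>Poly_Mapping.keys f. s (Poly_Mapping.lookup f m)
        ((Bo ^^ Poly_Mapping.lookup m gB)
          (foldr (\<lambda>i. Ao i ^^ Poly_Mapping.lookup m (gA i)) idx_list
            ((Co ^^ Poly_Mapping.lookup m gC) u))))"

definition L_B :: "('n gen, complex) mpoly \<Rightarrow> ('n gen, complex) mpoly" where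
  "L_B f = mp_var gB * f"

definition L_A :: "'n::finite surface \<Rightarrow> real \<Rightarrow> 'n \<Rightarrow> ('n gen, complex) mpoly \<Rightarrow> ('n gen, complex) mpoly"
  where
  "L_A S h i f =
     (\<Sum>j\<le>degree (gam S i). lift_A (coeff (gam S i) j) *
        ((\<lambda>p. mp_const (complex_of_real h) * (mp_var gB * mp_pd gB p)) ^^ j) f)"

definition flow_subst ::
  "'n::finite surface \<Rightarrow> real \<Rightarrow> ('n gen, complex) mpoly \<Rightarrow> ('n gen, complex) mpoly" where
  "flow_subst S h = mp_eval mp_const
     (\<lambda>v. case v of gB \<Rightarrow> mp_var gB | gA i \<Rightarrow> lift_A (flow_at S h i) | gC \<Rightarrow> mp_var gC)"

text \<open>
  With \<open>\<Delta>p = p \<circ> \<gamma>\<^sup>h - p\<close> one has \<open>\<Lambda>(A,t) = (\<Sum>n. t\<^sup>n \<Delta>\<^sup>n \<lambda>(A) / (n+1)!)\<close>, and in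
  \<open>\<Lambda>(A, B \<partial>/\<partial>B)\<close> the derivative acts first, so \<open>t\<^sup>n\<close> becomes \<open>B\<^sup>n (\<partial>/\<partial>B)\<^sup>n\<close>.  The sum over \<open>n\<close> is
  finite on every polynomial.
\<close>

definition L_C :: "'n::finite surface \<Rightarrow> real \<Rightarrow> ('n gen, complex) mpoly \<Rightarrow> ('n gen, complex) mpoly"
  where
  "L_C S h f =
     mp_var gC * flow_subst S h f +
     Sum_any (\<lambda>n. mp_const (1 / fact (Suc n)) *
        lift_A (((\<lambda>p. pull S h p - p) ^^ n) (lam S h)) * mp_var gB ^ n * (mp_pd gB ^^ Suc n) f)"

definition star ::
  "'n::finite surface \<Rightarrow> real \<Rightarrow> ('n gen, complex) mpoly \<Rightarrow> ('n gen, complex) mpoly \<Rightarrow> ('n gen, complex) mpoly"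
  where
  "star S h f g = normal_ordered (\<lambda>c p. mp_const c * p) L_B (L_A S h) (L_C S h) f g"

text \<open>The free algebra on the generators: the monoid algebra of the words in the generators.\<close>

datatype 'v word = Word (letters: "'v list")

instantiation word :: (type) monoid_add
begin
definition zero_word :: "'a word" where "0 = Word []"
definition plus_word :: "'a word \<Rightarrow> 'a word \<Rightarrow> 'a word" where
  "x + y = Word (letters x @ letters y)"
instance by standard (auto simp: zero_word_def plus_word_def)
end

type_synonym 'n free_alg = "'n gen word \<Rightarrow>\<^sub>0 complex"

definition fgen :: "'n gen \<Rightarrow> 'n free_alg" where
  "fgen v = Poly_Mapping.single (Word [v]) 1"

definition fnormal :: "('n::finite gen, complex) mpoly \<Rightarrow> 'n free_alg" where
  "fnormal f = normal_ordered (\<lambda>c x. Poly_Mapping.single 0 c * x)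
     ((*) (fgen gB)) (\<lambda>i. (*) (fgen (gA i))) ((*) (fgen gC)) f 1"

definition relators :: "'n::finite surface \<Rightarrow> real \<Rightarrow> 'n free_alg set" where
  "relators S h =
     {fgen gC * fgen gB - fgen gB * fgen gC - fnormal (lift_A (lam S h))} \<union>
     {fgen gC * fgen (gA i) - fnormal (lift_A (flow_at S h i)) * fgen gC | i. True} \<union>
     {fgen (gA i) * fgen (gA j) - fgen (gA j) * fgen (gA i) | i j. True}"


subsection \<open>The space \<open>\<L>\<^sub>a\<close>\<close>

text \<open>\<open>along S P\<close> is the polynomial \<open>t \<mapsto> P(\<gamma>\<^sup>t(a))\<close>.\<close>

definition base_poly :: "'n::finite surface \<Rightarrow> 'n \<Rightarrow> complex poly" where
  "base_poly S i = map_poly (\<lambda>q. complex_of_real (rval q (pt S))) (gam S i)"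

definition along :: "'n::finite surface \<Rightarrow> ('n, complex) mpoly \<Rightarrow> complex poly" where
  "along S P = mp_eval (\<lambda>c. [:c:]) (base_poly S) P"

definition HH :: "'n::finite surface \<Rightarrow> real \<Rightarrow> complex" where
  "HH S t = cnj (poly (along S (Ep S)) (of_real t)) / poly (along S (Dp S)) (of_real t)"

definition wt :: "'n::finite surface \<Rightarrow> real \<Rightarrow> nat \<Rightarrow> complex" where
  "wt S h n = (\<Prod>j=1..n. HH S (real j * h))"

definition topN :: "'n::finite surface \<Rightarrow> real \<Rightarrow> enat" where
  "topN S h = (if tstar S = \<infinity> then \<infinity> else enat (THE N. tstar S = ereal ((real N + 1) * h)))"

definition admissible :: "'n::finite surface \<Rightarrow> real \<Rightarrow> bool" where
  "admissible S h \<longleftrightarrow> h > 0 \<and>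
     (tstar S = \<infinity> \<longrightarrow> (\<forall>r :: complex. summable (\<lambda>n. r ^ n / wt S h n))) \<and>
     (tstar S \<noteq> \<infinity> \<longrightarrow> (\<exists>N :: nat. tstar S = ereal ((real N + 1) * h)))"

definition kfun :: "'n::finite surface \<Rightarrow> real \<Rightarrow> complex \<Rightarrow> complex" where
  "kfun S h r = suminf (\<lambda>n. if enat n \<le> topN S h then r ^ n / wt S h n else 0)"

text \<open>
  Antiholomorphic functions \<open>u\<close> are written as functions of the variable \<open>w\<close> that stands for the
  conjugate of \<open>z\<close>, so the operator \<open>\<partial>/\<partial>\<close> in the conjugate variable is \<^term>\<open>deriv\<close>.
\<close>

definition ker :: "'n::finite surface \<Rightarrow> real \<Rightarrow> complex \<Rightarrow> complex \<Rightarrow> complex" where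
  "ker S h w z = kfun S h (w * z)"

definition tcoeff :: "(complex \<Rightarrow> complex) \<Rightarrow> nat \<Rightarrow> complex" where
  "tcoeff u n = (deriv ^^ n) u 0 / fact n"

text \<open>The numbers \<open>wt S h n\<close> with \<open>n \<le> N\<close> are positive reals, as \<open>D E\<close> is real and positive there.\<close>

definition LL :: "'n::finite surface \<Rightarrow> real \<Rightarrow> (complex \<Rightarrow> complex) set" where
  "LL S h = {u. (\<forall>w. (\<lambda>n. tcoeff u n * w ^ n) sums u w) \<and>
                (\<forall>n. topN S h < enat n \<longrightarrow> tcoeff u n = 0) \<and>
                summable (\<lambda>n. Re (wt S h n) * (norm (tcoeff u n))\<^sup>2)}"

definition ip :: "'n::finite surface \<Rightarrow> real \<Rightarrow> (complex \<Rightarrow> complex) \<Rightarrow> (complex \<Rightarrow> complex) \<Rightarrow> complex"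
  where
  "ip S h u v = suminf (\<lambda>n. wt S h n * tcoeff u n * cnj (tcoeff v n))"

definition euler :: "real \<Rightarrow> (complex \<Rightarrow> complex) \<Rightarrow> complex \<Rightarrow> complex" where
  "euler h u = (\<lambda>w. of_real h * w * deriv u w)"

text \<open>
  The operators are unbounded if \<open>t\<^sup>* = \<infinity>\<close>.  Their common invariant domain is the dense subspace of
  the smooth vectors of the number operator; it is all of \<open>\<L>\<^sub>a\<close> if \<open>t\<^sup>* < \<infinity>\<close>.  Operators in \<open>\<L>\<^sub>a\<close> are
  the linear maps of this domain into itself that have an adjoint on it.
\<close>

definition dom_L :: "'n::finite surface \<Rightarrow> real \<Rightarrow> (complex \<Rightarrow> complex) set" where
  "dom_L S h = {u. \<forall>p. (euler 1 ^^ p) u \<in> LL S h}"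

definition adjoint_on ::
  "'n::finite surface \<Rightarrow> real \<Rightarrow> ((complex \<Rightarrow> complex) \<Rightarrow> complex \<Rightarrow> complex) \<Rightarrow>
     ((complex \<Rightarrow> complex) \<Rightarrow> complex \<Rightarrow> complex) \<Rightarrow> bool" where
  "adjoint_on S h T T' \<longleftrightarrow>
     (\<forall>u\<in>dom_L S h. \<forall>v\<in>dom_L S h. ip S h (T u) v = ip S h u (T' v))"

definition operators ::
  "'n::finite surface \<Rightarrow> real \<Rightarrow> ((complex \<Rightarrow> complex) \<Rightarrow> complex \<Rightarrow> complex) set" where
  "operators S h = {T.
     (\<forall>u\<in>dom_L S h. T u \<in> dom_L S h) \<and>
     (\<forall>u\<in>dom_L S h. \<forall>v\<in>dom_L S h. \<forall>c.
        T (\<lambda>w. c * u w + v w) = (\<lambda>w. c * T u w + T v w)) \<and>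
     (\<exists>T'. (\<forall>u\<in>dom_L S h. T' u \<in> dom_L S h) \<and> adjoint_on S h T T')}"

text \<open>The symbol \<open>\<psi>(w|z)\<close> is a function of the two variables \<open>w\<close> (conjugate of \<open>z\<close>) and \<open>z\<close>.\<close>

definition wick_symbol ::
  "'n::finite surface \<Rightarrow> real \<Rightarrow> ((complex \<Rightarrow> complex) \<Rightarrow> complex \<Rightarrow> complex) \<Rightarrow>
     complex \<Rightarrow> complex \<Rightarrow> complex" where
  "wick_symbol S h T = (\<lambda>w z. 1 / ker S h w z * T (\<lambda>w'. ker S h w' z) w)"

text \<open>An operator is determined on \<^const>\<open>dom_L\<close> by its symbol.\<close>

definition wick_hat ::
  "'n::finite surface \<Rightarrow> real \<Rightarrow> (complex \<Rightarrow> complex \<Rightarrow> complex) \<Rightarrow>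
     (complex \<Rightarrow> complex) \<Rightarrow> complex \<Rightarrow> complex" where
  "wick_hat S h \<psi> = (SOME T. T \<in> operators S h \<and> wick_symbol S h T = \<psi>)"

definition wick_prod ::
  "'n::finite surface \<Rightarrow> real \<Rightarrow> (complex \<Rightarrow> complex \<Rightarrow> complex) \<Rightarrow>
     (complex \<Rightarrow> complex \<Rightarrow> complex) \<Rightarrow> complex \<Rightarrow> complex \<Rightarrow> complex" where
  "wick_prod S h \<psi> \<phi> = wick_symbol S h (wick_hat S h \<psi> \<circ> wick_hat S h \<phi>)"

definition wirt_z :: "(complex \<Rightarrow> complex) \<Rightarrow> complex \<Rightarrow> complex" where
  "wirt_z \<phi> z = (frechet_derivative \<phi> (at z) 1 - \<i> * frechet_derivative \<phi> (at z) \<i>) / 2"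

definition wirt_zbar :: "(complex \<Rightarrow> complex) \<Rightarrow> complex \<Rightarrow> complex" where
  "wirt_zbar \<phi> z = (frechet_derivative \<phi> (at z) 1 + \<i> * frechet_derivative \<phi> (at z) \<i>) / 2"

text \<open>
  The coefficient of \<open>d\<close>conj\<open>(z) \<and> dz\<close> in the form \<open>\<omega>\<close>, the form whose potential is the logarithm of
  the reproducing kernel on the diagonal.
\<close>

definition kahler_coeff :: "'n::finite surface \<Rightarrow> real \<Rightarrow> complex \<Rightarrow> complex" where
  "kahler_coeff S h z =
     \<i> * of_real h * wirt_zbar (wirt_z (\<lambda>y. Ln (kfun S h (of_real ((norm y)\<^sup>2))))) z"


subsection \<open>The representation and the quantum restriction\<close>

definition poly_op ::
  "complex poly \<Rightarrow> ((complex \<Rightarrow> complex) \<Rightarrow> complex \<Rightarrow> complex) \<Rightarrow> (complex \<Rightarrow> complex) \<Rightarrow> complex \<Rightarrow> complex"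
  where
  "poly_op p T u = (\<lambda>w. \<Sum>j\<le>degree p. coeff p j * (T ^^ j) u w)"

definition A_op :: "'n::finite surface \<Rightarrow> real \<Rightarrow> 'n \<Rightarrow> (complex \<Rightarrow> complex) \<Rightarrow> complex \<Rightarrow> complex" where
  "A_op S h i = poly_op (base_poly S i) (\<lambda>u w. euler h u w + of_real h * u w)"

definition B_op :: "'n::finite surface \<Rightarrow> real \<Rightarrow> (complex \<Rightarrow> complex) \<Rightarrow> complex \<Rightarrow> complex" where
  "B_op S h u = poly_op (along S (Dp S)) (euler h) (\<lambda>w. w * u w)"

text \<open>Since \<open>E(a) = 0\<close>, the function divided by \<open>w\<close> vanishes at 0 and the quotient is entire.\<close>

definition C_op :: "'n::finite surface \<Rightarrow> real \<Rightarrow> (complex \<Rightarrow> complex) \<Rightarrow> complex \<Rightarrow> complex" where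
  "C_op S h u =
     (let v = poly_op (along S (Ep S)) (euler h) u
      in (\<lambda>w. if w = 0 then deriv v 0 else 1 / w * v w))"

definition gen_op ::
  "'n::finite surface \<Rightarrow> real \<Rightarrow> 'n gen \<Rightarrow> (complex \<Rightarrow> complex) \<Rightarrow> complex \<Rightarrow> complex" where
  "gen_op S h v = (case v of gB \<Rightarrow> B_op S h | gA i \<Rightarrow> A_op S h i | gC \<Rightarrow> C_op S h)"

definition rep ::
  "'n::finite surface \<Rightarrow> real \<Rightarrow> 'n free_alg \<Rightarrow> (complex \<Rightarrow> complex) \<Rightarrow> complex \<Rightarrow> complex" where
  "rep S h x u = (\<lambda>w. \<Sum>q\<in>Poly_Mapping.keys x.
     Poly_Mapping.lookup x q * foldr (gen_op S h) (letters q) u w)"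

text \<open>
  A representation of the algebra is a representation of the free algebra that annihilates the
  relators.  Irreducible: it is not the orthogonal sum of two nonzero representations.
\<close>

definition hermitian_rep :: "'n::finite surface \<Rightarrow> real \<Rightarrow> bool" where
  "hermitian_rep S h \<longleftrightarrow>
     (\<forall>x. rep S h x \<in> operators S h) \<and>
     (\<forall>x\<in>relators S h. \<forall>u\<in>dom_L S h. rep S h x u = (\<lambda>w. 0)) \<and>
     adjoint_on S h (B_op S h) (C_op S h) \<and>
     (\<forall>i. adjoint_on S h (A_op S h i) (A_op S h i))"

definition invariant_subspace :: "'n::finite surface \<Rightarrow> real \<Rightarrow> (complex \<Rightarrow> complex) set \<Rightarrow> bool" where
  "invariant_subspace S h V \<longleftrightarrow>
     V \<subseteq> dom_L S h \<and> (\<lambda>w. 0) \<in> V \<and>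
     (\<forall>u\<in>V. \<forall>v\<in>V. \<forall>c. (\<lambda>w. c * u w + v w) \<in> V) \<and>
     (\<forall>x. \<forall>u\<in>V. rep S h x u \<in> V)"

definition irreducible_rep :: "'n::finite surface \<Rightarrow> real \<Rightarrow> bool" where
  "irreducible_rep S h \<longleftrightarrow>
     dom_L S h \<noteq> {\<lambda>w. 0} \<and>
     (\<forall>V W. invariant_subspace S h V \<and> invariant_subspace S h W \<and>
        (\<forall>v\<in>V. \<forall>w\<in>W. ip S h v w = 0) \<and>
        (\<forall>u\<in>dom_L S h. \<exists>v\<in>V. \<exists>w\<in>W. u = (\<lambda>x. v x + w x))
        \<longrightarrow> V = {\<lambda>w. 0} \<or> W = {\<lambda>w. 0})"

definition quantum_restriction ::
  "'n::finite surface \<Rightarrow> real \<Rightarrow> ('n gen, complex) mpoly \<Rightarrow> complex \<Rightarrow> complex \<Rightarrow> complex" where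
  "quantum_restriction S h f = wick_symbol S h (rep S h (fnormal f))"


subsection \<open>Classical restriction and differential operators\<close>

definition classical_restriction ::
  "'n::finite surface \<Rightarrow> ('n gen, complex) mpoly \<Rightarrow> complex \<Rightarrow> complex" where
  "classical_restriction S f z =
     (let (C, A) = surf_pt S z in
      mp_eval (\<lambda>c. c) (\<lambda>v. case v of gB \<Rightarrow> cnj C | gA i \<Rightarrow> of_real (A $ i) | gC \<Rightarrow> C) f)"

text \<open>
  A differential operator from functions on \<open>\<real>\<^bsup>k+2\<^esup>\<close> to functions on the surface is given by finitely
  many coefficients, smooth on the surface; \<open>c \<alpha>\<close> is the coefficient of the derivative of
  multi-order \<open>\<alpha>\<close> in \<open>B, A, C\<close>.
\<close>

definition diff_op_coeffs :: "(('n::finite gen \<Rightarrow>\<^sub>0 nat) \<Rightarrow> complex \<Rightarrow> complex) \<Rightarrow> bool" where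
  "diff_op_coeffs c \<longleftrightarrow> finite {\<alpha>. c \<alpha> \<noteq> (\<lambda>z. 0)} \<and> (\<forall>\<alpha>. smooth_plane (c \<alpha>))"

definition diff_op ::
  "'n::finite surface \<Rightarrow> (('n gen \<Rightarrow>\<^sub>0 nat) \<Rightarrow> complex \<Rightarrow> complex) \<Rightarrow>
     ('n gen, complex) mpoly \<Rightarrow> complex \<Rightarrow> complex" where
  "diff_op S c f z =
     (\<Sum>\<alpha> | c \<alpha> \<noteq> (\<lambda>z. 0). c \<alpha> z * classical_restriction S (mp_diff \<alpha> f) z)"

end

theory Submission
  imports Defs
begin

text \<open>
  Along the orbit of the base point \<open>a\<close> everything is a polynomial in the time \<open>t\<close>.  Put
  \<open>R(t) = \<rho>(\<gamma>\<^sup>t(a)) - \<rho>(a)\<close> and \<open>Q = \<bar>D\<bar>\<^sup>2\<close>.  As \<open>g\<close> is an integral of motion, the factorization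
  gives \<open>R = D E\<close> on the orbit (\<open>DE\<close>), so the quotient of the conjugate of \<open>E\<close> by \<open>D\<close> is the real
  function \<open>H = R / Q\<close> (\<open>HH_eq\<close>).  On Taylor coefficients \<open>u\<^sub>n\<close> the operators are weighted shifts:
  \<open>A\<close> multiplies by \<open>\<gamma>\<^bsup>(n+1)h\<^esup>(a)\<close>, \<open>B\<close> raises the degree from \<open>n - 1\<close> to \<open>n\<close> with the factor
  \<open>D(n h)\<close>, and \<open>C\<close> lowers it from \<open>n\<close> to \<open>n - 1\<close> with the factor \<open>E(n h)\<close>.  Hence \<open>B C\<close> and \<open>C B\<close>
  are diagonal with the entries \<open>R(n h)\<close> and \<open>R((n + 1) h)\<close>.

  The exact statements follow from this.  The permutation relations express the group law of the
  flow (\<open>flow_flow\<close>, \<open>relators_vanish\<close>), and \<open>B\<^sup>* = C\<close> holds because the weights of the norm are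
  products of values of \<open>H\<close> and \<open>H D\<close> is the conjugate of \<open>E\<close> (\<open>adjoint_B\<close>).  The constants are the
  kernel of \<open>B C\<close> and generate all monomials under \<open>B\<close>, which gives irreducibility
  (\<open>number_kernel\<close>, \<open>vacuum_cyclic\<close>, \<open>irreducible\<close>).  An operator with an adjoint is determined by
  its Wick symbol, so the Wick product of symbols is the symbol of the product
  (\<open>wick_symbol_determines\<close>, \<open>wick_prod_symbols\<close>); and normal ordering intertwines left
  multiplication by \<open>L_B\<close>, \<open>L_A\<close>, \<open>L_C\<close> with the operators \<open>B\<close>, \<open>A\<close>, \<open>C\<close> (\<open>nseq_star\<close>).  The only
  intricate case is \<open>L_C\<close>: the commutator of \<open>C\<close> with \<open>B\<^sup>b\<close> involves \<open>R\<close> at times that are \<open>b h\<close>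
  apart, which Newton's forward difference formula turns into the series \<open>\<Lambda>\<close>.  The Kaehler form is
  positive because its coefficient is a variance (\<open>variance_pos\<close>).

  The behaviour for small \<open>h\<close> is a statement of probability.  For \<open>x = \<bar>z\<bar>\<^sup>2\<close> let the time \<open>n h\<close>
  have the probability proportional to \<open>x\<^sup>n / (H(h) \<dots> H(n h))\<close> for \<open>n \<le> N\<close>.  Since
  \<open>C\<close> acts on the reproducing kernel as multiplication by an explicit function of the time, the
  symbol of \<open>f\<close> on the diagonal is the expectation of an explicit function of the time
  (\<open>quantum_restriction_EE\<close>).  The complex coordinate forces \<open>H\<close> to be an increasing bijection onto
  the half line with nowhere vanishing derivative (\<open>Hr_strict\<close>, \<open>Hr_surj\<close>, \<open>G1_nonzero\<close>), so there is exactly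
  one time \<open>T\<close> with \<open>H(T) = x\<close>: the time of the point of the surface with the coordinate \<open>z\<close>.
  The recurrence between consecutive weights is an integration by parts: it makes the expectation of
  \<open>(R - x Q) s\<close> equal to \<open>h x\<close> times that of a difference quotient of \<open>Q s\<close>, with step \<open>h\<close>
  (\<open>EE_stein\<close>, \<open>mean_drift\<close>).  As \<open>R - x Q\<close> vanishes to first order at \<open>T\<close> and has the sign of \<open>t - T\<close>, the
  distribution concentrates at \<open>T\<close> with fluctuations of order \<open>\<surd>h\<close> (\<open>concentration\<close>), and the same
  identity, solved for the moments one after the other, yields their expansions in powers of \<open>h\<close>
  (\<open>expands_moments\<close>).  Taylor's formula for \<open>f\<close> at the classical point (\<open>mp_taylor\<close>) reduces the
  symbol of \<open>f\<close> to the symbols of the centred monomials \<open>(X - y)\<^sup>\<beta>\<close>.  Such a symbol is of order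
  \<open>h\<^bsup>\<bar>\<beta>\<bar>/2\<^esup>\<close> (\<open>filt_fsym_monomial\<close>), so only finitely many derivatives of \<open>f\<close> contribute to a given
  power of \<open>h\<close>: the coefficients are differential operators (\<open>semiclassical_expansion\<close>).
\<close>

section \<open>Polynomials in several variables\<close>

lemma poly_mapping_sum_singles:
  "p = (\<Sum>k\<in>Poly_Mapping.keys p. Poly_Mapping.single k (Poly_Mapping.lookup p k))"
proof (rule poly_mapping_eqI)
  fix k
  show "Poly_Mapping.lookup p k = Poly_Mapping.lookup
     (\<Sum>k\<in>Poly_Mapping.keys p. Poly_Mapping.single k (Poly_Mapping.lookup p k)) k"
    by (simp add: lookup_sum lookup_single when_def in_keys_iff)
qed

text \<open>Additive statements about polynomials need checking on monomials only.\<close>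

lemma poly_mapping_single_induct [case_names zero single add]:
  fixes p :: "'a \<Rightarrow>\<^sub>0 'b::comm_monoid_add"
  assumes "P 0" "\<And>k c. P (Poly_Mapping.single k c)" "\<And>p q. P p \<Longrightarrow> P q \<Longrightarrow> P (p + q)"
  shows "P p"
proof -
  have "P (\<Sum>k\<in>A. Poly_Mapping.single k (Poly_Mapping.lookup p k))" if "finite A" for A
    using that by (induction A rule: finite_induct) (auto intro: assms)
  then show ?thesis
    by (subst poly_mapping_sum_singles) simp
qed

lemma keys_sum_superset:
  assumes "\<And>k. \<phi> k 0 = 0" "finite A" "Poly_Mapping.keys p \<subseteq> A"
  shows "(\<Sum>k\<in>Poly_Mapping.keys p. \<phi> k (Poly_Mapping.lookup p k))
    = (\<Sum>k\<in>A. \<phi> k (Poly_Mapping.lookup p k))"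
  using assms by (intro sum.mono_neutral_left) (auto simp: in_keys_iff)

text \<open>
  Whatever is defined by a sum over the support and is additive in the coefficient is additive in the
  polynomial, although supports may shrink under addition.
\<close>

lemma keys_sum_add:
  assumes "\<And>k. \<phi> k 0 = 0" "\<And>k a b. \<phi> k (a + b) = \<phi> k a + \<phi> k b"
  shows "(\<Sum>k\<in>Poly_Mapping.keys (p + q). \<phi> k (Poly_Mapping.lookup (p + q) k))
    = (\<Sum>k\<in>Poly_Mapping.keys p. \<phi> k (Poly_Mapping.lookup p k))
    + (\<Sum>k\<in>Poly_Mapping.keys q. \<phi> k (Poly_Mapping.lookup q k))"
proof -
  let ?A = "Poly_Mapping.keys p \<union> Poly_Mapping.keys q"
  have sub: "Poly_Mapping.keys (p + q) \<subseteq> ?A" by (rule Poly_Mapping.keys_add)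
  have "(\<Sum>k\<in>Poly_Mapping.keys (p + q). \<phi> k (Poly_Mapping.lookup (p + q) k))
    = (\<Sum>k\<in>?A. \<phi> k (Poly_Mapping.lookup (p + q) k))"
    using sub by (intro keys_sum_superset assms) auto
  moreover have "(\<Sum>k\<in>Poly_Mapping.keys p. \<phi> k (Poly_Mapping.lookup p k)) = (\<Sum>k\<in>?A. \<phi> k (Poly_Mapping.lookup p k))"
    by (intro keys_sum_superset assms) auto
  moreover have "(\<Sum>k\<in>Poly_Mapping.keys q. \<phi> k (Poly_Mapping.lookup q k)) = (\<Sum>k\<in>?A. \<phi> k (Poly_Mapping.lookup q k))"
    by (intro keys_sum_superset assms) auto
  ultimately show ?thesis by (simp add: lookup_add assms(2) sum.distrib)
qed

definition mon :: "('v \<Rightarrow> 'r::comm_monoid_mult) \<Rightarrow> ('v \<Rightarrow>\<^sub>0 nat) \<Rightarrow> 'r" where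
  "mon x m = (\<Prod>v\<in>Poly_Mapping.keys m. x v ^ Poly_Mapping.lookup m v)"

lemma mon_superset:
  assumes "finite V" "Poly_Mapping.keys m \<subseteq> V"
  shows "mon x m = (\<Prod>v\<in>V. x v ^ Poly_Mapping.lookup m v)"
  unfolding mon_def using assms
  by (intro prod.mono_neutral_left) (auto simp: in_keys_iff)

lemma mon_UNIV: "mon x (m :: 'v::finite \<Rightarrow>\<^sub>0 nat) = (\<Prod>v\<in>UNIV. x v ^ Poly_Mapping.lookup m v)"
  by (rule mon_superset) auto

lemma mon_zero [simp]: "mon x 0 = 1"
  by (simp add: mon_def)

lemma mon_add: "mon x (m + n) = mon x m * mon x n"
proof -
  let ?V = "Poly_Mapping.keys m \<union> Poly_Mapping.keys n"
  have "Poly_Mapping.keys (m + n) \<subseteq> ?V" by (rule Poly_Mapping.keys_add)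
  then show ?thesis
    by (simp add: mon_superset[of ?V] lookup_add power_add prod.distrib)
qed

lemma mon_single [simp]: "mon x (Poly_Mapping.single v k) = x v ^ k"
  by (cases "k = 0") (auto simp: mon_def)

definition ring_hom :: "('a::comm_ring_1 \<Rightarrow> 'b::comm_ring_1) \<Rightarrow> bool" where
  "ring_hom \<phi> \<longleftrightarrow> \<phi> 1 = 1 \<and> (\<forall>a b. \<phi> (a + b) = \<phi> a + \<phi> b) \<and> (\<forall>a b. \<phi> (a * b) = \<phi> a * \<phi> b)"

lemma ring_hom_simps:
  assumes "ring_hom \<phi>"
  shows "\<phi> 0 = 0" "\<phi> 1 = 1" "\<phi> (a + b) = \<phi> a + \<phi> b" "\<phi> (a * b) = \<phi> a * \<phi> b"
    "\<phi> (- a) = - \<phi> a" "\<phi> (a - b) = \<phi> a - \<phi> b" "\<phi> (a ^ n) = \<phi> a ^ n"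
proof -
  have add: "\<phi> (a + b) = \<phi> a + \<phi> b" for a b using assms by (auto simp: ring_hom_def)
  show z: "\<phi> 0 = 0" using add[of 0 0] by simp
  show m: "\<phi> (- a) = - \<phi> a" for a using add[of a "-a"] z by (simp add: eq_neg_iff_add_eq_0 add.commute)
  show "\<phi> (a - b) = \<phi> a - \<phi> b" using add[of a "-b"] m by simp
  show "\<phi> (a ^ n) = \<phi> a ^ n" by (induction n) (use assms in \<open>auto simp: ring_hom_def\<close>)
qed (use assms in \<open>auto simp: ring_hom_def\<close>)

lemma ring_hom_sum: "ring_hom \<phi> \<Longrightarrow> \<phi> (sum f A) = (\<Sum>a\<in>A. \<phi> (f a))"
  by (induction A rule: infinite_finite_induct) (auto simp: ring_hom_simps[of \<phi>])

lemma ring_hom_prod: "ring_hom \<phi> \<Longrightarrow> \<phi> (prod f A) = (\<Prod>a\<in>A. \<phi> (f a))"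
  by (induction A rule: infinite_finite_induct) (auto simp: ring_hom_simps[of \<phi>])

lemma ring_hom_mon: "ring_hom \<phi> \<Longrightarrow> \<phi> (mon x m) = mon (\<lambda>v. \<phi> (x v)) m"
  by (simp add: mon_def ring_hom_prod[of \<phi>] ring_hom_simps[of \<phi>])

lemma ring_hom_id [simp]: "ring_hom (\<lambda>c. c)"
  by (simp add: ring_hom_def)

lemma ring_hom_mp_const [simp]: "ring_hom mp_const"
  by (simp add: ring_hom_def mp_const_def single_add mult_single)

lemma ring_hom_of_real [simp]: "ring_hom (of_real :: real \<Rightarrow> complex)"
  by (simp add: ring_hom_def)

lemma ring_hom_pCons [simp]: "ring_hom (\<lambda>c. [:c:])"
  by (simp add: ring_hom_def)

lemma ring_hom_poly [simp]: "ring_hom (\<lambda>p. poly p t)"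
  by (simp add: ring_hom_def)

lemma ring_hom_comp: "ring_hom f \<Longrightarrow> ring_hom g \<Longrightarrow> ring_hom (\<lambda>x. f (g x))"
  by (simp add: ring_hom_def)

lemma mp_eval_alt: "mp_eval h x p =
  (\<Sum>m\<in>Poly_Mapping.keys p. (\<lambda>m c. h c * mon x m) m (Poly_Mapping.lookup p m))"
  by (simp add: mp_eval_def mon_def)

lemma mp_eval_add: "ring_hom h \<Longrightarrow> mp_eval h x (p + q) = mp_eval h x p + mp_eval h x q"
  unfolding mp_eval_alt by (rule keys_sum_add) (auto simp: ring_hom_simps[of h] algebra_simps)

lemma mp_eval_single: "ring_hom h \<Longrightarrow> mp_eval h x (Poly_Mapping.single m c) = h c * mon x m"
  unfolding mp_eval_alt by (cases "c = 0") (auto simp: ring_hom_simps[of h])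

lemma mp_eval_zero [simp]: "mp_eval h x 0 = 0"
  by (simp add: mp_eval_def)

lemma mp_eval_const [simp]: "ring_hom h \<Longrightarrow> mp_eval h x (mp_const c) = h c"
  by (simp add: mp_const_def mp_eval_single)

lemma mp_eval_var [simp]: "ring_hom h \<Longrightarrow> mp_eval h x (mp_var v) = x v"
  by (simp add: mp_var_def mp_eval_single ring_hom_simps[of h])

lemma mp_eval_mult:
  assumes h: "ring_hom h"
  shows "mp_eval h x (p * q) = mp_eval h x p * mp_eval h x q"
proof (induction p rule: poly_mapping_single_induct)
  case (single m c)
  show ?case
  proof (induction q rule: poly_mapping_single_induct)
    case (single m' c')
    show ?case by (simp add: mult_single mp_eval_single h mon_add ring_hom_simps[OF h])
  qed (simp_all add: mp_eval_add h algebra_simps)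
qed (simp_all add: mp_eval_add h algebra_simps)

lemma ring_hom_mp_eval [simp]: "ring_hom h \<Longrightarrow> ring_hom (mp_eval h x)"
  by (simp add: ring_hom_def mp_eval_add mp_eval_mult)
     (metis mp_eval_const mp_const_def ring_hom_def single_one)

lemma mp_const_simps: "mp_const 0 = 0" "mp_const 1 = 1" "mp_const (a + b) = mp_const a + mp_const b"
  "mp_const (a * b) = mp_const a * mp_const b"
  by (simp_all add: mp_const_def single_add mult_single)

lemma mon_mp_var: "mon mp_var m = Poly_Mapping.single m (1::'c::comm_ring_1)"
proof (induction m rule: poly_mapping_single_induct)
  case (single v k)
  have "mp_var v ^ k = Poly_Mapping.single (Poly_Mapping.single v k) (1::'c)"
    by (induction k) (simp_all add: mp_var_def mult_single flip: single_add)
  then show ?case by simp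
qed (simp_all add: mon_add mult_single)

lemma single_conv_mon: "Poly_Mapping.single m (c::'c::comm_ring_1) = mp_const c * mon mp_var m"
  by (simp add: mon_mp_var mp_const_def mult_single)

text \<open>
  For multiplicative statements: monomials are products of variables, so constants, variables and
  closure under the ring operations suffice.
\<close>

lemma mpoly_induct [case_names const var add mult]:
  fixes p :: "('v, 'c::comm_ring_1) mpoly"
  assumes "\<And>c. P (mp_const c)" "\<And>v. P (mp_var v)"
    "\<And>p q. P p \<Longrightarrow> P q \<Longrightarrow> P (p + q)" "\<And>p q. P p \<Longrightarrow> P q \<Longrightarrow> P (p * q)"
  shows "P p"
proof (induction p rule: poly_mapping_single_induct)
  case zero
  show ?case using assms(1)[of 0] by (simp add: mp_const_def)
next
  case (single m c)
  have one: "P 1" using assms(1)[of 1] by (simp add: mp_const_def)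
  have pw: "P (mp_var v ^ k)" for v k by (induction k) (auto intro: assms one)
  have "P (\<Prod>v\<in>V. mp_var v ^ Poly_Mapping.lookup m v)" if "finite V" for V
    using that by (induction V rule: finite_induct) (auto intro: assms pw one)
  then show ?case by (simp add: single_conv_mon assms mon_def)
qed (auto intro: assms)

lemma ring_hom_mp_eval_comp:
  assumes "ring_hom \<phi>" "ring_hom h"
  shows "\<phi> (mp_eval h x p) = mp_eval (\<lambda>c. \<phi> (h c)) (\<lambda>v. \<phi> (x v)) p"
  unfolding mp_eval_alt by (simp add: ring_hom_sum[OF assms(1)] ring_hom_simps[OF assms(1)] ring_hom_mon[OF assms(1)])

lemma ring_hom_poly_comp:
  assumes "ring_hom \<phi>"
  shows "\<phi> (poly q s) = poly (map_poly \<phi> q) (\<phi> s)"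
  by (induction q) (auto simp: ring_hom_simps[OF assms] map_poly_pCons)

text \<open>
  The congruence modulo \<open>d\<close> is compatible with the ring operations.  Used with \<open>d = t\<^sup>m\<close> to compare
  polynomial solutions of a differential equation.
\<close>

lemma mp_eval_diff_dvd:
  assumes "ring_hom h" "\<And>v. d dvd x v - y v"
  shows "d dvd mp_eval h x p - mp_eval h y p"
proof (induction p rule: mpoly_induct)
  case (add p q)
  have "mp_eval h x (p + q) - mp_eval h y (p + q) =
    (mp_eval h x p - mp_eval h y p) + (mp_eval h x q - mp_eval h y q)"
    by (simp add: mp_eval_add assms)
  then show ?case using add by (metis dvd_add)
next
  case (mult p q)
  have "mp_eval h x (p * q) - mp_eval h y (p * q) =
    (mp_eval h x p - mp_eval h y p) * mp_eval h x q + mp_eval h y p * (mp_eval h x q - mp_eval h y q)"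
    by (simp add: mp_eval_mult assms algebra_simps)
  then show ?case using mult by (metis dvd_add dvd_mult dvd_mult2)
qed (simp_all add: assms)

lemma gen_UNIV: "(UNIV :: 'n gen set) = insert gB (insert gC (range gA))"
proof -
  have "x \<in> insert gB (insert gC (range gA))" for x :: "'n gen" by (cases x) auto
  then show ?thesis by auto
qed

instance gen :: (finite) finite
  by standard (simp add: gen_UNIV)

lemma prod_gen: "(\<Prod>v\<in>(UNIV :: 'n::finite gen set). f v) = f gB * (\<Prod>i\<in>UNIV. f (gA i)) * f gC"
  by (simp add: gen_UNIV image_iff prod.reindex inj_on_def mult_ac)

subsection \<open>Taylor's formula\<close>

lemma mp_diff_alt: "mp_diff \<alpha> p = (\<Sum>m\<in>Poly_Mapping.keys p.
   (\<lambda>m c. Poly_Mapping.single (m - \<alpha>)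
        (of_nat (\<Prod>v\<in>Poly_Mapping.keys \<alpha>. \<Prod>i<Poly_Mapping.lookup \<alpha> v. Poly_Mapping.lookup m v - i)
          * c)) m (Poly_Mapping.lookup p m))"
  by (simp add: mp_diff_def)

lemma mp_diff_add: "mp_diff \<alpha> (p + q) = mp_diff \<alpha> p + mp_diff \<alpha> q"
  unfolding mp_diff_alt by (rule keys_sum_add) (auto simp: single_add algebra_simps)

lemma mp_diff_zero [simp]: "mp_diff \<alpha> 0 = 0"
  by (simp add: mp_diff_def)

lemma mp_diff_single: "mp_diff \<alpha> (Poly_Mapping.single m c) = Poly_Mapping.single (m - \<alpha>)
   (of_nat (\<Prod>v\<in>Poly_Mapping.keys \<alpha>. \<Prod>i<Poly_Mapping.lookup \<alpha> v. Poly_Mapping.lookup m v - i) * c)"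
  unfolding mp_diff_alt by (cases "c = 0") auto

text \<open>
  The product of truncated differences vanishes for \<open>k > n\<close>, as the binomial coefficient does.
\<close>

lemma falling_choose: "(\<Prod>i<k. n - i) = fact k * (n choose k)" for n k :: nat
proof (cases "k \<le> n")
  case True
  have "(\<Prod>i<k. n - i) * fact (n - k) = fact n"
    using True
  proof (induction k)
    case (Suc k)
    then have "fact (n - k) = (n - k) * fact (n - Suc k)"
      by (metis Suc_diff_Suc Suc_le_lessD fact_Suc of_nat_id)
    with Suc show ?case by (simp add: algebra_simps)
  qed simp
  also have "\<dots> = fact k * fact (n - k) * (n choose k)" using True by (simp add: binomial_fact_lemma)
  finally show ?thesis by (simp add: algebra_simps)
next
  case False
  then show ?thesis by (simp add: binomial_eq_0) (rule bexI[of _ n]; simp)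
qed

lemma mp_diff_single_UNIV:
  fixes \<alpha> :: "'v::finite \<Rightarrow>\<^sub>0 nat"
  shows "mp_diff \<alpha> (Poly_Mapping.single m c) = Poly_Mapping.single (m - \<alpha>)
   (of_nat (\<Prod>v\<in>UNIV. fact (Poly_Mapping.lookup \<alpha> v) * (Poly_Mapping.lookup m v choose Poly_Mapping.lookup \<alpha> v)) * c)"
proof -
  have "(\<Prod>v\<in>Poly_Mapping.keys \<alpha>. \<Prod>i<Poly_Mapping.lookup \<alpha> v. Poly_Mapping.lookup m v - i)
    = (\<Prod>v\<in>UNIV. \<Prod>i<Poly_Mapping.lookup \<alpha> v. Poly_Mapping.lookup m v - i)"
    by (rule prod.mono_neutral_left) (auto simp: in_keys_iff)
  then show ?thesis by (simp add: mp_diff_single falling_choose)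
qed

definition tdeg :: "('v::finite \<Rightarrow>\<^sub>0 nat) \<Rightarrow> nat" where
  "tdeg \<alpha> = (\<Sum>v\<in>UNIV. Poly_Mapping.lookup \<alpha> v)"

definition pfact :: "('v::finite \<Rightarrow>\<^sub>0 nat) \<Rightarrow> nat" where
  "pfact \<alpha> = (\<Prod>v\<in>UNIV. fact (Poly_Mapping.lookup \<alpha> v))"

definition mfun :: "('v::finite \<Rightarrow> nat) \<Rightarrow> ('v \<Rightarrow>\<^sub>0 nat)" where
  "mfun g = Abs_poly_mapping g"

lemma lookup_mfun [simp]: "Poly_Mapping.lookup (mfun g) = g"
  by (simp add: mfun_def)

lemma mfun_lookup [simp]: "mfun (Poly_Mapping.lookup m) = m"
  by (simp add: mfun_def)

lemma finite_tdeg: "finite {\<alpha> :: 'v::finite \<Rightarrow>\<^sub>0 nat. tdeg \<alpha> \<le> d}"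
proof -
  have "{\<alpha> :: 'v \<Rightarrow>\<^sub>0 nat. tdeg \<alpha> \<le> d} \<subseteq> mfun ` (Pi\<^sub>E UNIV (\<lambda>_. {..d}))"
  proof
    fix \<alpha> :: "'v \<Rightarrow>\<^sub>0 nat" assume "\<alpha> \<in> {\<alpha>. tdeg \<alpha> \<le> d}"
    then have "Poly_Mapping.lookup \<alpha> v \<le> d" for v
      using member_le_sum[of v UNIV "Poly_Mapping.lookup \<alpha>"] by (auto simp: tdeg_def)
    then have "Poly_Mapping.lookup \<alpha> \<in> Pi\<^sub>E UNIV (\<lambda>_. {..d})" by auto
    then show "\<alpha> \<in> mfun ` (Pi\<^sub>E UNIV (\<lambda>_. {..d}))"
      by (metis image_eqI mfun_lookup)
  qed
  then show ?thesis by (rule finite_subset) (rule finite_imageI, rule finite_PiE; simp)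
qed

abbreviation taylor_term ::
  "('v::finite, complex) mpoly \<Rightarrow> ('v \<Rightarrow> complex) \<Rightarrow> ('v \<Rightarrow>\<^sub>0 nat) \<Rightarrow> ('v, complex) mpoly" where
  "taylor_term f y \<alpha> \<equiv> mp_const (mp_eval (\<lambda>c. c) y (mp_diff \<alpha> f) / of_nat (pfact \<alpha>)) *
     mon (\<lambda>v. mp_var v - mp_const (y v)) \<alpha>"

text \<open>
  For a monomial this is the product of the binomial formulas in the single variables.  The sum may
  run over any finite set that contains the orders \<open>\<alpha>\<close> of the nonzero derivatives, which
  makes the formula additive in \<open>f\<close> and lets one set serve all points \<open>y\<close>.
\<close>

lemma mp_taylor:
  fixes f :: "('v::finite, complex) mpoly" and y :: "'v \<Rightarrow> complex"
  shows "\<exists>A. finite A \<and> (\<forall>\<alpha>. \<alpha> \<notin> A \<longrightarrow> mp_diff \<alpha> f = 0) \<and> (\<forall>B y. finite B \<and> A \<subseteq> B \<longrightarrow>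
     f = (\<Sum>\<alpha>\<in>B. taylor_term f y \<alpha>))"
proof (induction f rule: poly_mapping_single_induct)
  case zero
  show ?case by (rule exI[of _ "{}"]) (simp add: mp_const_simps)
next
  case (add p q)
  obtain A1 where A1: "finite A1 \<and> (\<forall>\<alpha>. \<alpha> \<notin> A1 \<longrightarrow> mp_diff \<alpha> p = 0) \<and> (\<forall>B y. finite B \<and> A1 \<subseteq> B \<longrightarrow>
     p = (\<Sum>\<alpha>\<in>B. taylor_term p y \<alpha>))" using add(1) by (rule exE)
  obtain A2 where A2: "finite A2 \<and> (\<forall>\<alpha>. \<alpha> \<notin> A2 \<longrightarrow> mp_diff \<alpha> q = 0) \<and> (\<forall>B y. finite B \<and> A2 \<subseteq> B \<longrightarrow>
     q = (\<Sum>\<alpha>\<in>B. taylor_term q y \<alpha>))" using add(2) by (rule exE)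
  show ?case
  proof (rule exI[of _ "A1 \<union> A2"], intro conjI allI impI)
    fix B y assume B: "finite B \<and> A1 \<union> A2 \<subseteq> B"
    show "p + q = (\<Sum>\<alpha>\<in>B. taylor_term (p + q) y \<alpha>)"
    proof -
      have 1: "p = (\<Sum>\<alpha>\<in>B. taylor_term p y \<alpha>)" using A1 B by auto
      have 2: "q = (\<Sum>\<alpha>\<in>B. taylor_term q y \<alpha>)" using A2 B by auto
      show ?thesis
        by (subst 1, subst 2)
          (simp add: mp_diff_add mp_eval_add add_divide_distrib mp_const_simps distrib_right sum.distrib)
    qed
  qed (use A1 A2 in \<open>auto simp: mp_diff_add\<close>)
next
  case (single m c)
  let ?L = Poly_Mapping.lookup
  let ?A = "mfun ` (Pi\<^sub>E UNIV (\<lambda>v. {..?L m v}))"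
  have out: "mp_diff \<alpha> (Poly_Mapping.single m c) = 0" if "\<alpha> \<notin> ?A" for \<alpha>
  proof -
    \<comment> \<open>an order that is not below the exponents of \<open>m\<close> kills the monomial\<close>
    have "\<exists>v. ?L \<alpha> v > ?L m v"
    proof (rule ccontr)
      assume "\<nexists>v. ?L \<alpha> v > ?L m v"
      then have "?L \<alpha> \<in> Pi\<^sub>E UNIV (\<lambda>v. {..?L m v})" by (auto simp: not_less)
      then show False using that by (metis image_eqI mfun_lookup)
    qed
    then have "(\<Prod>v\<in>UNIV. fact (?L \<alpha> v) * (?L m v choose ?L \<alpha> v)) = 0"
      by (metis (no_types, lifting) UNIV_I binomial_eq_0 finite mult_is_0 prod_zero)
    then show ?thesis by (simp only: mp_diff_single_UNIV) simp
  qed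
  have fin: "finite ?A" by (rule finite_imageI, rule finite_PiE; simp)
  have inj: "inj_on mfun (Pi\<^sub>E UNIV (\<lambda>v. {..?L m v}))"
    by (rule inj_onI, drule arg_cong[where f = Poly_Mapping.lookup], simp)
  have main: "Poly_Mapping.single m c = (\<Sum>\<alpha>\<in>?A. taylor_term (Poly_Mapping.single m c) y \<alpha>)" for y
  proof -
    have "mon mp_var m = (\<Prod>v\<in>UNIV. ((mp_var v - mp_const (y v)) + mp_const (y v)) ^ ?L m v)"
      by (simp add: mon_UNIV)
    also have "\<dots> = (\<Prod>v\<in>UNIV. \<Sum>k\<in>{..?L m v}. of_nat (?L m v choose k) * (mp_var v - mp_const (y v)) ^ k * mp_const (y v) ^ (?L m v - k))"
      by (simp only: binomial_ring)
    also have "\<dots> = (\<Sum>g\<in>Pi\<^sub>E UNIV (\<lambda>v. {..?L m v}). \<Prod>v\<in>UNIV. of_nat (?L m v choose g v) * (mp_var v - mp_const (y v)) ^ g v * mp_const (y v) ^ (?L m v - g v))"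
      by (rule prod_sum_PiE) auto
    also have "\<dots> = (\<Sum>g\<in>Pi\<^sub>E UNIV (\<lambda>v. {..?L m v}). mp_const (\<Prod>v\<in>UNIV. of_nat (?L m v choose g v) * y v ^ (?L m v - g v)) * mon (\<lambda>v. mp_var v - mp_const (y v)) (mfun g))"
    proof (rule sum.cong)
      fix g assume "g \<in> Pi\<^sub>E UNIV (\<lambda>v. {..?L m v})"
      have *: "mp_const (of_nat n) = of_nat n" for n by (simp add: mp_const_def)
      show "(\<Prod>v\<in>UNIV. of_nat (?L m v choose g v) * (mp_var v - mp_const (y v)) ^ g v * mp_const (y v) ^ (?L m v - g v))
        = mp_const (\<Prod>v\<in>UNIV. of_nat (?L m v choose g v) * y v ^ (?L m v - g v)) * mon (\<lambda>v. mp_var v - mp_const (y v)) (mfun g)"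
        by (simp add: mon_UNIV ring_hom_prod[OF ring_hom_mp_const] mp_const_simps * ring_hom_simps[OF ring_hom_mp_const]
            flip: prod.distrib) (simp add: mult_ac)
    qed simp
    also have "\<dots> = (\<Sum>\<alpha>\<in>?A. mp_const (\<Prod>v\<in>UNIV. of_nat (?L m v choose ?L \<alpha> v) * y v ^ (?L m v - ?L \<alpha> v)) * mon (\<lambda>v. mp_var v - mp_const (y v)) \<alpha>)"
      by (simp add: sum.reindex[OF inj])
    finally have "Poly_Mapping.single m c = mp_const c * \<dots>" by (simp add: single_conv_mon)
    also have "\<dots> = (\<Sum>\<alpha>\<in>?A. taylor_term (Poly_Mapping.single m c) y \<alpha>)"
      unfolding sum_distrib_left
    proof (rule sum.cong)
      fix \<alpha> :: "'v \<Rightarrow>\<^sub>0 nat"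
      have "(\<Prod>v\<in>UNIV. of_nat (fact (?L \<alpha> v)) :: complex) \<noteq> 0" by simp
      then have "mp_eval (\<lambda>c. c) y (mp_diff \<alpha> (Poly_Mapping.single m c)) / of_nat (pfact \<alpha>)
         = c * (\<Prod>v\<in>UNIV. of_nat (?L m v choose ?L \<alpha> v) * y v ^ (?L m v - ?L \<alpha> v))"
        by (simp add: mp_diff_single_UNIV mp_eval_single mon_UNIV pfact_def prod.distrib lookup_minus)
      then show "mp_const c * (mp_const (\<Prod>v\<in>UNIV. of_nat (?L m v choose ?L \<alpha> v) * y v ^ (?L m v - ?L \<alpha> v)) * mon (\<lambda>v. mp_var v - mp_const (y v)) \<alpha>)
        = taylor_term (Poly_Mapping.single m c) y \<alpha>"
        by (simp add: mp_const_simps mult_ac)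
    qed simp
    finally show ?thesis .
  qed
  show ?case
  proof (rule exI[of _ ?A], intro conjI allI impI)
    fix B y assume B: "finite B \<and> ?A \<subseteq> B"
    have "(\<Sum>\<alpha>\<in>?A. taylor_term (Poly_Mapping.single m c) y \<alpha>) = (\<Sum>\<alpha>\<in>B. taylor_term (Poly_Mapping.single m c) y \<alpha>)"
      using B by (intro sum.mono_neutral_left) (auto simp: out mp_const_simps)
    then show "Poly_Mapping.single m c = (\<Sum>\<alpha>\<in>B. taylor_term (Poly_Mapping.single m c) y \<alpha>)" using main[of y] by simp
  qed (use fin out in auto)
qed

section \<open>Polynomial flows\<close>

lemma ring_hom_const_poly_eval: "poly (mp_eval (\<lambda>c. [:c:]) x p) t = mp_eval (\<lambda>c. c) (\<lambda>v. poly (x v) t) p"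
  for t :: "'a::comm_ring_1"
  by (subst ring_hom_mp_eval_comp[where \<phi> = "\<lambda>p. poly p t"]) simp_all

text \<open>
  If \<open>t\<^sup>m\<close> divides the difference of two solutions, it divides the difference of the right-hand
  sides, hence of the derivatives, and then \<open>t\<^bsup>m+1\<^esup>\<close> divides the difference of the solutions.
\<close>

lemma poly_ode_unique:
  fixes x y :: "'v \<Rightarrow> real poly"
  assumes x: "\<And>i. pderiv (x i) = mp_eval (\<lambda>c. [:c:]) x (f i)"
    and y: "\<And>i. pderiv (y i) = mp_eval (\<lambda>c. [:c:]) y (f i)"
    and init: "\<And>i. poly (x i) 0 = poly (y i) 0"
  shows "x i = y i"
proof -
  have dvd: "\<forall>i. monom 1 m dvd x i - y i" for m
  proof (induction m)
    case (Suc m)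
    show ?case
    proof
      fix i
      have "monom 1 m dvd pderiv (x i - y i)"
        unfolding pderiv_diff x y by (rule mp_eval_diff_dvd) (use Suc in auto)
      then have "\<forall>k<m. coeff (pderiv (x i - y i)) k = 0" by (simp add: monom_1_dvd_iff')
      then have 1: "\<forall>k<m. coeff (x i - y i) (Suc k) = 0"
        by (simp add: coeff_pderiv del: of_nat_Suc)
      have 2: "coeff (x i - y i) 0 = 0" using init by (simp add: poly_0_coeff_0)
      have "coeff (x i - y i) k = 0" if "k < Suc m" for k
        using that 1 2 by (cases k) auto
      then show "monom 1 (Suc m) dvd x i - y i" by (simp add: monom_1_dvd_iff')
    qed
  qed simp
  have "coeff (x i - y i) k = 0" for k
    using dvd[of "Suc k"] by (simp add: monom_1_dvd_iff')
  then show ?thesis by (simp add: poly_eq_iff)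
qed

lemma smult_sum_right: "smult c (sum f A) = (\<Sum>a\<in>A. smult c (f a))"
  by (induction A rule: infinite_finite_induct) (auto simp: smult_add_right)

text \<open>The chain rule.\<close>

lemma pderiv_mp_eval:
  fixes x :: "'v::finite \<Rightarrow> real poly"
  shows "pderiv (mp_eval (\<lambda>c. [:c:]) x p) = (\<Sum>l\<in>UNIV. mp_eval (\<lambda>c. [:c:]) x (mp_pd l p) * pderiv (x l))"
proof (induction p rule: poly_mapping_single_induct)
  case (single m c)
  let ?L = Poly_Mapping.lookup
  have "mp_eval (\<lambda>c. [:c:]) x (mp_pd l (Poly_Mapping.single m c)) * pderiv (x l) =
    [:c:] * ((\<Prod>v\<in>UNIV - {l}. x v ^ ?L m v) * pderiv (x l ^ ?L m l))" for l
  proof -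
    have 0: "?L (Poly_Mapping.single l (1::nat)) v = (if v = l then 1 else 0)" for v
      by (simp add: lookup_single when_def)
    have 1: "(\<Prod>v\<in>Poly_Mapping.keys (Poly_Mapping.single l (Suc 0)). \<Prod>i<?L (Poly_Mapping.single l (Suc 0)) v. ?L m v - i) = ?L m l"
      by simp
    have 2: "mon x (m - Poly_Mapping.single l 1) = x l ^ (?L m l - 1) * (\<Prod>v\<in>UNIV - {l}. x v ^ ?L m v)"
      unfolding mon_UNIV
      by (subst prod.remove[of _ l]) (auto simp: lookup_minus lookup_single intro!: prod.cong)
    show ?thesis
      by (simp add: mp_diff_single 1 mp_eval_single 2[simplified] pderiv_power mult_ac)
  qed
  then show ?case
    by (simp add: mp_eval_single mon_UNIV pderiv_smult pderiv_prod smult_sum_right)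
qed (simp_all add: mp_eval_add pderiv_add mp_diff_add distrib_right sum.distrib)

text \<open>
  For a fixed point \<open>A\<close> the orbit is a polynomial curve; all arguments about the flow are carried out
  for these curves.
\<close>

definition flow_poly :: "'n::finite surface \<Rightarrow> real ^ 'n \<Rightarrow> 'n \<Rightarrow> real poly" where
  "flow_poly S A i = map_poly (\<lambda>q. rval q A) (gam S i)"

lemma flow_nth: "flow S t A $ i = poly (flow_poly S A i) t"
  by (simp add: flow_def flow_poly_def)

lemma ring_hom_rval [simp]: "ring_hom (\<lambda>p. rval p A)"
  unfolding rval_def by simp

lemma rval_flow: "rval p (flow S t A) = poly (mp_eval (\<lambda>c. [:c:]) (flow_poly S A) p) t"
  by (simp add: ring_hom_const_poly_eval rval_def flow_nth)

context
  fixes S :: "'n::finite surface"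
  assumes flow: "is_flow S"
begin

lemma flow_0 [simp]: "flow S 0 A = A"
  using flow by (simp add: is_flow_def)

lemma flow_poly_0 [simp]: "poly (flow_poly S A i) 0 = A $ i"
  by (metis flow_0 flow_nth)

lemma pderiv_flow_poly: "pderiv (flow_poly S A i) = mp_eval (\<lambda>c. [:c:]) (flow_poly S A) (vf S i)"
proof -
  have "poly (pderiv (flow_poly S A i)) t = poly (mp_eval (\<lambda>c. [:c:]) (flow_poly S A) (vf S i)) t" for t
  proof -
    have "((\<lambda>s. flow S s A) has_vector_derivative (\<chi> i. rval (vf S i) (flow S t A))) (at t)"
      using flow by (simp add: is_flow_def)
    from bounded_linear.has_vector_derivative[OF bounded_linear_vec_nth this, of i]
    have "((\<lambda>s. poly (flow_poly S A i) s) has_field_derivative rval (vf S i) (flow S t A)) (at t)"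
      by (simp add: flow_nth has_real_derivative_iff_has_vector_derivative)
    with poly_DERIV[of "flow_poly S A i" t] show ?thesis
      by (metis DERIV_unique rval_flow)
  qed
  then show ?thesis by (simp add: poly_eq_poly_eq_iff[symmetric] fun_eq_iff)
qed

text \<open>
  Both sides are polynomial solutions of the same equation with the same initial value.
\<close>

lemma flow_flow: "flow S s (flow S t A) = flow S (s + t) A"
proof -
  define y where "y = (\<lambda>i. pcompose (flow_poly S A i) [:t, 1:])"
  have hom: "ring_hom (\<lambda>p. pcompose p [:t, 1:])"
    by (simp add: ring_hom_def pcompose_add pcompose_mult pcompose_1)
  have "flow_poly S (flow S t A) i = y i" for i
  proof (rule poly_ode_unique[where f = "vf S"])
    fix i
    show "pderiv (y i) = mp_eval (\<lambda>c. [:c:]) y (vf S i)"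
      unfolding y_def using ring_hom_mp_eval_comp[OF hom ring_hom_pCons, of "flow_poly S A" "vf S i"]
      by (simp add: pderiv_pcompose pderiv_flow_poly pderiv_pCons pcompose_pCons)
    show "poly (flow_poly S (flow S t A) i) 0 = poly (y i) 0"
      by (simp add: y_def poly_pcompose flow_nth)
  qed (rule pderiv_flow_poly)
  then show ?thesis
    by (simp add: vec_eq_iff flow_nth y_def poly_pcompose add.commute)
qed

text \<open>Where the velocity of the orbit vanishes, the constant curve is another solution.\<close>

lemma flow_stationary:
  assumes "\<And>i. poly (pderiv (flow_poly S A i)) t = 0"
  shows "flow S s A = A"
proof -
  define b where "b = flow S t A"
  have "flow_poly S b i = [:b $ i:]" for i
  proof (rule poly_ode_unique[where f = "vf S"])
    fix i
    have "rval (vf S i) b = 0" using assms[of i] by (simp add: pderiv_flow_poly b_def rval_flow)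
    moreover have "mp_eval (\<lambda>c. [:c:]) (\<lambda>i. [:b $ i:]) (vf S i) = [:rval (vf S i) b:]"
      using ring_hom_mp_eval_comp[OF ring_hom_pCons ring_hom_id, of "\<lambda>i. b $ i" "vf S i"] by (simp add: rval_def)
    ultimately show "pderiv [:b $ i:] = mp_eval (\<lambda>c. [:c:]) (\<lambda>i. [:b $ i:]) (vf S i)"
      by (simp add: pderiv_pCons)
  qed (simp_all add: pderiv_flow_poly)
  then have b: "flow S s b = b" for s by (simp add: vec_eq_iff flow_nth)
  have "flow S s A = b" for s using b[of "s - t"] by (simp add: b_def flow_flow)
  from this[of s] this[of 0] show ?thesis by simp
qed

text \<open>
  A periodic polynomial curve takes each of its values infinitely often, so it is constant.
\<close>

lemma flow_periodic:
  assumes "flow S t A = flow S t' A" "t \<noteq> t'"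
  shows "flow S s A = A"
proof -
  define p where "p = t' - t"
  have per: "flow S (s + p) A = flow S s A" for s
  proof -
    have "flow S (s + p) A = flow S (s - t) (flow S t' A)" by (simp add: flow_flow p_def algebra_simps)
    also have "\<dots> = flow S s A" by (simp add: assms(1)[symmetric] flow_flow)
    finally show ?thesis .
  qed
  \<comment> \<open>the period is \<open>p\<close>, so all its multiples are roots of \<open>flow - A\<close>\<close>
  have n: "flow S (real n * p) A = A" for n
    by (induction n) (use per in \<open>simp_all add: distrib_right add.commute[of p]\<close>)
  have "flow_poly S A i = [:A $ i:]" for i
  proof (rule ccontr)
    assume "flow_poly S A i \<noteq> [:A $ i:]"
    then have "finite {s. poly (flow_poly S A i - [:A $ i:]) s = 0}"
      by (intro poly_roots_finite) auto
    moreover have "range (\<lambda>n. real n * p) \<subseteq> {s. poly (flow_poly S A i - [:A $ i:]) s = 0}"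
      using n by (auto simp: flow_nth[symmetric])
    moreover have "infinite (range (\<lambda>n. real n * p))"
      using assms(2) by (intro range_inj_infinite) (auto simp: inj_def p_def)
    ultimately show False using finite_subset by blast
  qed
  then show ?thesis by (simp add: vec_eq_iff flow_nth)
qed

text \<open>
  The derivative of \<open>\<kappa>\<close> along an orbit is the vector field applied to \<open>\<kappa>\<close>.
\<close>

lemma kap_const:
  assumes "kap_annulled S" "j \<in> {1..<CARD('n)}"
  shows "rval (kap S j) (flow S t A) = rval (kap S j) A"
proof -
  have "pderiv (mp_eval (\<lambda>c. [:c:]) (flow_poly S A) (kap S j)) =
    mp_eval (\<lambda>c. [:c:]) (flow_poly S A) (\<Sum>l\<in>UNIV. vf S l * mp_pd l (kap S j))"
    by (simp add: pderiv_mp_eval pderiv_flow_poly ring_hom_sum[OF ring_hom_mp_eval] mp_eval_mult mult.commute)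
  also have "\<dots> = 0" using assms by (simp add: kap_annulled_def)
  finally obtain c where "mp_eval (\<lambda>c. [:c:]) (flow_poly S A) (kap S j) = [:c:]"
    by (metis pderiv_iszero)
  then have "rval (kap S j) (flow S t A) = c" for t by (simp add: rval_flow)
  from this[of t] this[of 0] show ?thesis by simp
qed

end

lemma map_poly_comp_hom:
  assumes "f 0 = 0" "g 0 = 0"
  shows "map_poly f (map_poly g p) = map_poly (\<lambda>x. f (g x)) p"
  using assms by (simp add: map_poly_map_poly o_def)

lemma rval_0 [simp]: "rval 0 A = 0" by (simp add: rval_def)

lemma base_poly_alt: "base_poly S i = map_poly of_real (flow_poly S (pt S) i)"
  by (simp add: base_poly_def flow_poly_def map_poly_comp_hom)

lemma poly_base_poly: "poly (base_poly S i) (of_real t) = of_real (flow S t (pt S) $ i)"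
  by (simp add: base_poly_alt flow_nth ring_hom_poly_comp[OF ring_hom_of_real])

lemma poly_along: "poly (along S P) (of_real t) = cval P (flow S t (pt S))"
  by (simp add: along_def ring_hom_const_poly_eval cval_def poly_base_poly)

lemma rval_pull: "rval (pull S s p) A = rval p (flow S s A)"
proof -
  have "rval (flow_at S s i) A = flow S s A $ i" for i
    by (simp add: flow_at_def ring_hom_poly_comp[OF ring_hom_rval] flow_nth flow_poly_def) (simp add: rval_def)
  then show ?thesis
    unfolding pull_def by (subst ring_hom_mp_eval_comp[OF ring_hom_rval ring_hom_mp_const]) (simp add: rval_def)
qed

lemma rval_flow_at: "rval (flow_at S s i) A = flow S s A $ i"
  by (simp add: flow_at_def ring_hom_poly_comp[OF ring_hom_rval] flow_nth flow_poly_def) (simp add: rval_def)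

lemma rval_lam: "rval (lam S h) A = rval (rho S) A - rval (rho S) (flow S (- h) A)"
  by (simp add: lam_def ring_hom_simps[OF ring_hom_rval] rval_pull)

section \<open>The surface of revolution\<close>

lemma poly_map_Re: "poly (map_poly Re p) t = Re (poly p (of_real t))"
  by (induction p) (auto simp: map_poly_pCons)

lemma poly_map_Im: "poly (map_poly Im p) t = Im (poly p (of_real t))"
  by (induction p) (auto simp: map_poly_pCons)

text \<open>
  The difference quotient of a polynomial is a polynomial; it allows difference quotients of functions
  like \<open>t0\<close> to be computed from equations that these functions satisfy.
\<close>

lemma poly_factor:
  fixes p :: "real poly"
  obtains q where "\<And>t. poly p t - poly p c = (t - c) * poly q t" "poly q c = poly (pderiv p) c"
proof -
  have "poly (p - [:poly p c:]) c = 0" by simp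
  then obtain q where q: "p - [:poly p c:] = [:-c, 1:] * q"
    by (auto simp only: poly_eq_0_iff_dvd elim: dvdE)
  have "poly p t - poly p c = (t - c) * poly q t" for t
    using arg_cong[OF q, of "\<lambda>p. poly p t"] by (simp add: algebra_simps)
  moreover have "poly q c = poly (pderiv p) c"
    using arg_cong[OF q, of "\<lambda>p. poly (pderiv p) c"] by (simp add: pderiv_diff pderiv_mult pderiv_pCons pderiv_smult)
  ultimately show ?thesis using that by blast
qed

text \<open>The geometric hypotheses; Planck's constant enters only later.\<close>

locale revolution_surface =
  fixes S :: "'n::finite surface"
  assumes flow: "is_flow S"
    and kap_annulled: "kap_annulled S"
    and tstar_cases:
      "tstar S = \<infinity> \<and> (\<forall>t>0. rval (rho S) (flow S t (pt S)) > rval (rho S) (pt S)) \<or>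
       (\<exists>T>0. tstar S = ereal T \<and>
          (\<forall>t. 0 < t \<and> t < T \<longrightarrow> rval (rho S) (flow S t (pt S)) > rval (rho S) (pt S)) \<and>
          rval (rho S) (flow S T (pt S)) = rval (rho S) (pt S))"
    and points: "\<forall>(C, A)\<in>XX S. \<exists>t\<ge>0. ereal t \<le> tstar S \<and> A = flow S t (pt S)"
    and g_integral: "\<forall>t A. rval (igm S) (flow S t A) = rval (igm S) A"
    and g_base: "rval (igm S) (pt S) = rval (rho S) (pt S)"
    and factorization:
      "\<forall>A. complex_of_real (rval (rho S) A - rval (igm S) A) = cval (Dp S) A * cval (Ep S) A"
    and D_base: "cval (Dp S) (pt S) \<noteq> 0"
    and E_base: "cval (Ep S) (pt S) = 0"
    and D_polar: "tstar S \<noteq> \<infinity> \<longrightarrow> cval (Dp S) (flow S (real_of_ereal (tstar S)) (pt S)) = 0"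
    and coordinate: "complex_coordinate S"
begin

definition Dt :: "real \<Rightarrow> complex" where "Dt t = poly (along S (Dp S)) (of_real t)"
definition Et :: "real \<Rightarrow> complex" where "Et t = poly (along S (Ep S)) (of_real t)"

text \<open>
  \<open>R\<close> and \<open>Q = \<bar>D\<bar>\<^sup>2\<close> as real polynomials in the time; their quotient \<open>Hr\<close> turns out to be \<open>H\<close>
  (\<open>HH_eq\<close>).
\<close>

definition Rp :: "real poly" where
  "Rp = mp_eval (\<lambda>c. [:c:]) (flow_poly S (pt S)) (rho S) - [:rval (rho S) (pt S):]"

definition Qp :: "real poly" where
  "Qp = map_poly Re (along S (Dp S)) ^ 2 + map_poly Im (along S (Dp S)) ^ 2"

definition Hr :: "real \<Rightarrow> real" where "Hr t = poly Rp t / poly Qp t"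

text \<open>The times of the points of the surface other than the polar point.\<close>

definition in_range :: "real \<Rightarrow> bool" where "in_range t \<longleftrightarrow> 0 \<le> t \<and> ereal t < tstar S"

lemma Rp_eq: "poly Rp t = rval (rho S) (flow S t (pt S)) - rval (rho S) (pt S)"
  by (simp add: Rp_def rval_flow)

lemma Qp_eq: "poly Qp t = (cmod (Dt t))\<^sup>2"
  by (simp add: Qp_def poly_map_Re poly_map_Im Dt_def cmod_power2)

lemma Qp_eq': "of_real (poly Qp t) = Dt t * cnj (Dt t)"
  unfolding Qp_eq by (metis complex_norm_square of_real_power)

lemma Dt_cval: "Dt t = cval (Dp S) (flow S t (pt S))"
  by (simp add: Dt_def poly_along)

text \<open>
  \<open>g\<close> is constant on the orbit with the value \<open>\<rho>(a)\<close>, so \<open>\<rho> - g\<close> restricts to \<open>R\<close>.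
\<close>

lemma DE: "of_real (poly Rp t) = Dt t * Et t"
  using factorization[rule_format, of "flow S t (pt S)"] g_base g_integral
  by (simp add: Rp_eq Dt_def Et_def poly_along)

lemma Rp_0 [simp]: "poly Rp 0 = 0"
  by (simp add: Rp_eq flow_0[OF flow])

lemma in_range_0 [simp]: "in_range 0"
  using tstar_cases by (auto simp: in_range_def)

lemma in_range_mono: "in_range t \<Longrightarrow> 0 \<le> s \<Longrightarrow> s \<le> t \<Longrightarrow> in_range s"
  unfolding in_range_def by (metis ereal_less_eq(3) le_less_trans)

lemma Rp_pos: "in_range t \<Longrightarrow> t > 0 \<Longrightarrow> poly Rp t > 0"
  using tstar_cases by (auto simp: in_range_def Rp_eq)

lemma Rp_nonneg: "in_range t \<Longrightarrow> poly Rp t \<ge> 0"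
  using Rp_pos[of t] by (cases "t = 0") (auto simp: in_range_def)

lemma Dt_nonzero: "in_range t \<Longrightarrow> Dt t \<noteq> 0"
  using Rp_pos[of t] DE[of t] D_base by (cases "t = 0") (auto simp: in_range_def Dt_cval flow_0[OF flow])

lemma Qp_pos: "in_range t \<Longrightarrow> poly Qp t > 0"
  using Dt_nonzero[of t] by (simp add: Qp_eq)

lemma Qp_nonneg: "poly Qp t \<ge> 0"
  by (simp add: Qp_eq)

lemma Et_0 [simp]: "Et 0 = 0"
  using E_base poly_along[of S "Ep S" 0] by (simp add: Et_def flow_0[OF flow])

text \<open>
  Expanding the fraction by the conjugate of \<open>D\<close> gives \<open>R / Q\<close>.  Where \<open>D\<close> vanishes, both sides are
  0 because they are quotients by 0.
\<close>

lemma HH_eq: "HH S t = of_real (Hr t)"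
proof (cases "Dt t = 0")
  case True
  then show ?thesis using Qp_eq[of t] by (simp add: HH_def Hr_def Dt_def)
next
  case False
  have "cnj (Et t) / Dt t = cnj (Dt t * Et t) / (Dt t * cnj (Dt t))" using False by simp
  also have "\<dots> = of_real (Hr t)"
    unfolding DE[symmetric] Qp_eq'[symmetric] by (simp add: Hr_def)
  finally show ?thesis by (simp add: HH_def Dt_def Et_def)
qed

lemma Hr_pos: "in_range t \<Longrightarrow> t > 0 \<Longrightarrow> Hr t > 0"
  using Rp_pos Qp_pos by (simp add: Hr_def)

lemma Hr_0 [simp]: "Hr 0 = 0" by (simp add: Hr_def)

lemma Rp_Hr: "in_range t \<Longrightarrow> poly Rp t = Hr t * poly Qp t"
  using Qp_pos[of t] by (simp add: Hr_def)

subsection \<open>The parameter of the orbit as a function on the plane\<close>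

lemma flow_cont: "continuous_on X (\<lambda>t. flow S t A)"
  unfolding flow_def by (intro continuous_intros)

lemma flow_not_fixed: "\<exists>s. flow S s (pt S) \<noteq> pt S"
proof -
  obtain t where "t > 0" "in_range t"
    using tstar_cases
  proof (elim disjE conjE exE)
    fix T assume "T > 0" "tstar S = ereal T" then show thesis by (intro that[of "T / 2"]) (auto simp: in_range_def)
  qed (auto intro!: that[of 1] simp: in_range_def)
  then have "poly Rp t > 0" by (rule Rp_pos[rotated])
  then show ?thesis by (intro exI[of _ t]) (auto simp: Rp_eq)
qed

text \<open>
  A repeated value would make the orbit constant, but \<open>\<rho>\<close> is not constant on it.
\<close>

lemma flow_inj: "flow S t (pt S) = flow S t' (pt S) \<Longrightarrow> t = t'"
  using flow_periodic[OF flow] flow_not_fixed by blast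

text \<open>
  Moving along the orbit and keeping the argument of \<open>C\<close> fixed connects the point with the vacuum
  point inside the level set.
\<close>

lemma in_XX:
  assumes t: "in_range t" and C: "(cmod C)\<^sup>2 = poly Rp t"
  shows "(C, flow S t (pt S)) \<in> XX S"
proof -
  define u where "u = (if C = 0 then 1 else C / of_real (cmod C))"
  have u: "cmod u = 1" "C = of_real (cmod C) * u" by (auto simp: u_def norm_divide)
  have C': "cmod C = sqrt (poly Rp t)" using C by (metis norm_ge_zero real_sqrt_unique)
  define p where "p = (\<lambda>s. (complex_of_real (sqrt (poly Rp s)) * u, flow S s (pt S)))"
  have "continuous_on {0..t} p"
    unfolding p_def by (intro continuous_intros flow_cont)
  then have conn: "connected (p ` {0..t})" by (intro connected_continuous_image) auto
  have sub: "p s \<in> {(C, A). (Re C)\<^sup>2 + (Im C)\<^sup>2 = rval (rho S) A - rval (rho S) (pt S) \<and>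
              (\<forall>j\<in>{1..<CARD('n)}. rval (kap S j) A = rval (kap S j) (pt S))}" if "s \<in> {0..t}" for s
  proof -
    have "poly Rp s \<ge> 0" using in_range_mono[OF t, of s] that by (auto intro: Rp_nonneg)
    then have "(cmod (complex_of_real (sqrt (poly Rp s)) * u))\<^sup>2 = poly Rp s"
      by (simp add: norm_mult u power_mult_distrib)
    then show ?thesis using kap_const[OF flow kap_annulled] by (simp add: p_def cmod_power2 Rp_eq)
  qed
  have "p 0 = (0, pt S)" by (simp add: p_def flow_0[OF flow])
  moreover have "p t = (C, flow S t (pt S))" using u C' by (simp add: p_def)
  moreover have "0 \<le> t" using t by (simp add: in_range_def)
  ultimately show ?thesis
    unfolding XX_def mem_Collect_eq connected_component_def
    using sub conn
    by (intro exI[of _ "p ` {0..t}"] conjI image_subsetI) (assumption, assumption, force+)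
qed

lemma in_XX':
  assumes t: "in_range t" and z: "(cmod z)\<^sup>2 = Hr t"
  shows "(z * cnj (Dt t), flow S t (pt S)) \<in> XX' S" "zcoord S (z * cnj (Dt t), flow S t (pt S)) = z"
proof -
  have "(cmod (z * cnj (Dt t)))\<^sup>2 = poly Rp t"
    using z by (simp add: norm_mult power_mult_distrib Rp_Hr[OF t] Qp_eq)
  from in_XX[OF t this] have 1: "(z * cnj (Dt t), flow S t (pt S)) \<in> XX S" .
  have "flow S t (pt S) \<noteq> flow S (real_of_ereal (tstar S)) (pt S)" if "tstar S \<noteq> \<infinity>"
    using flow_inj[of t "real_of_ereal (tstar S)"] t that tstar_cases by (auto simp: in_range_def)
  with 1 show "(z * cnj (Dt t), flow S t (pt S)) \<in> XX' S" by (auto simp: XX'_def polar_def)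
  show "zcoord S (z * cnj (Dt t), flow S t (pt S)) = z"
    using Dt_nonzero[OF t] by (simp add: Dt_cval[symmetric])
qed

text \<open>
  The point over \<open>z\<close> is known as soon as some time \<open>t\<close> with \<open>H(t) = \<bar>z\<bar>\<^sup>2\<close> is known, because \<open>z\<close> is an
  injective coordinate.
\<close>

lemma surf_pt_eq:
  assumes "in_range t" "(cmod z)\<^sup>2 = Hr t"
  shows "surf_pt S z = (z * cnj (Dt t), flow S t (pt S))"
proof -
  have "inj_on (zcoord S) (XX' S)"
    using coordinate by (simp add: complex_coordinate_def bij_betw_def)
  from the_inv_into_f_f[OF this in_XX'(1)[OF assms]] show ?thesis
    by (simp only: surf_pt_def in_XX'(2)[OF assms])
qed

text \<open>
  Two times with the same value \<open>\<bar>z\<bar>\<^sup>2\<close> of \<open>H\<close> would belong to the same point of the surface.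
\<close>

lemma Hr_inj:
  assumes "in_range t" "in_range t'" "Hr t = Hr t'"
  shows "t = t'"
proof -
  have "Hr t \<ge> 0" using Hr_pos[of t] assms by (cases "t = 0") (auto simp: in_range_def)
  then have z: "(cmod (of_real (sqrt (Hr t))))\<^sup>2 = Hr t" by simp
  show ?thesis
    using surf_pt_eq[OF assms(1) z] surf_pt_eq[OF assms(2), of "of_real (sqrt (Hr t))"] z assms(3)
    by (auto intro: flow_inj)
qed

text \<open>
  The coordinate takes the value \<open>\<surd>x\<close> at some point of the surface, and the time of this point is the
  one required.
\<close>

lemma Hr_surj:
  assumes "x \<ge> 0"
  obtains t where "in_range t" "Hr t = x"
proof -
  define z where "z = complex_of_real (sqrt x)"
  obtain C A where p: "surf_pt S z = (C, A)" by (cases "surf_pt S z")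
  have "z \<in> zcoord S ` XX' S" "inj_on (zcoord S) (XX' S)"
    using coordinate by (auto simp: complex_coordinate_def bij_betw_def)
  then have *: "(C, A) \<in> XX' S" "zcoord S (C, A) = z"
    using the_inv_into_into[of "zcoord S" "XX' S" z "XX' S"] f_the_inv_into_f[of "zcoord S" "XX' S" z] p
    by (auto simp: surf_pt_def)
  then have XX: "(C, A) \<in> XX S" by (auto simp: XX'_def split: if_splits)
  obtain t where t: "t \<ge> 0" "ereal t \<le> tstar S" "A = flow S t (pt S)" using points XX by blast
  have C: "(cmod C)\<^sup>2 = poly Rp t"
    using connected_component_subset[of _ "(0, pt S)"] XX t(3) unfolding XX_def cmod_power2 Rp_eq by blast
  have "in_range t"
  proof (rule ccontr)
    assume "\<not> in_range t"
    with t have ts: "tstar S = ereal t" by (auto simp: in_range_def)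
    then have "poly Rp t = 0" using tstar_cases by (auto simp: Rp_eq)
    then have "(C, A) = polar S" using C t ts by (simp add: polar_def)
    with * ts show False by (auto simp: XX'_def)
  qed
  moreover have "Hr t = x"
  proof -
    have "z = C / cnj (Dt t)" using * t by (simp add: Dt_cval)
    then have "(cmod z)\<^sup>2 = poly Rp t / poly Qp t" using C by (simp add: norm_divide power_divide Qp_eq)
    then show ?thesis using assms by (simp add: z_def Hr_def)
  qed
  ultimately show ?thesis using that by blast
qed

lemma Hr_cont: "in_range b \<Longrightarrow> continuous_on {0..b} Hr"
  unfolding Hr_def using Qp_pos in_range_mono[of b] by (intro continuous_intros) (auto, force)

lemma Hr_nonneg: "in_range t \<Longrightarrow> Hr t \<ge> 0"
  using Hr_pos[of t] by (cases "t = 0") (auto simp: in_range_def)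

text \<open>A continuous injective function that starts with its least value is increasing.\<close>

lemma Hr_strict:
  assumes "in_range t'" "0 \<le> t" "t < t'"
  shows "Hr t < Hr t'"
proof (rule ccontr)
  assume "\<not> Hr t < Hr t'"
  then have "\<exists>u. 0 \<le> u \<and> u \<le> t \<and> Hr u = Hr t'"
    using assms Hr_nonneg[of t'] Hr_cont[of t] in_range_mono[of t' t] by (intro IVT') auto
  then obtain u where "0 \<le> u" "u \<le> t" and "Hr u = Hr t'" by blast
  moreover have "in_range u" using \<open>0 \<le> u\<close> \<open>u \<le> t\<close> assms by (intro in_range_mono[OF assms(1)]) auto
  ultimately have "u = t'" using Hr_inj assms(1) by blast
  with \<open>u \<le> t\<close> assms(3) show False by simp
qed

definition t0 :: "real \<Rightarrow> real" where "t0 x = (THE t. in_range t \<and> Hr t = x)"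

lemma t0_eq: "in_range t \<Longrightarrow> t0 (Hr t) = t"
  unfolding t0_def by (rule the_equality) (auto intro: Hr_inj)

lemma t0: assumes "x \<ge> 0" shows "in_range (t0 x)" "Hr (t0 x) = x"
proof -
  obtain t where "in_range t" "Hr t = x" using Hr_surj[OF assms] .
  then show "in_range (t0 x)" "Hr (t0 x) = x" using t0_eq by auto
qed

lemma t0_0 [simp]: "t0 0 = 0"
  using t0_eq[of 0] by simp

lemma t0_nonneg: "x \<ge> 0 \<Longrightarrow> t0 x \<ge> 0"
  using t0(1)[of x] by (simp add: in_range_def)

lemma t0_strict: "0 \<le> x \<Longrightarrow> x < y \<Longrightarrow> t0 x < t0 y"
proof (rule ccontr)
  assume xy: "0 \<le> x" "x < y" and "\<not> t0 x < t0 y"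
  then have "Hr (t0 y) \<le> Hr (t0 x)"
    using Hr_strict[of "t0 x" "t0 y"] t0(1)[of x] t0(1)[of y]
    by (cases "t0 x = t0 y") (auto simp: in_range_def)
  then show False using t0(2)[of x] t0(2)[of y] xy by simp
qed

lemma t0_mono: "0 \<le> x \<Longrightarrow> x \<le> y \<Longrightarrow> t0 x \<le> t0 y"
  using t0_strict[of x y] by (cases "x = y") auto

lemma Rp_t0: "x \<ge> 0 \<Longrightarrow> poly Rp (t0 x) = x * poly Qp (t0 x)"
  using Rp_Hr[of "t0 x"] t0[of x] by simp

lemma t0_tendsto:
  assumes x: "x \<ge> 0"
  shows "(t0 \<longlongrightarrow> t0 x) (at x within {0..})"
proof -
  define b where "b = t0 (x + 1)"
  have b: "in_range b" "Hr b = x + 1" using x t0[of "x + 1"] by (auto simp: b_def)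
  have "continuous_on (Hr ` {0..b}) t0"
    using Hr_cont[OF b(1)] b by (intro continuous_on_inv) (auto intro!: t0_eq intro: in_range_mono[OF b(1)])
  moreover have "{0..x + 1} \<subseteq> Hr ` {0..b}"
  proof
    fix y assume y: "y \<in> {0..x + 1}"
    then have "t0 y \<in> {0..b}" using t0_mono[of y "x + 1"] t0_nonneg by (auto simp: b_def)
    then show "y \<in> Hr ` {0..b}" using y t0(2)[of y] by (intro image_eqI[of y Hr "t0 y"]) auto
  qed
  ultimately have "continuous_on {0..x + 1} t0" by (rule continuous_on_subset)
  then have "(t0 \<longlongrightarrow> t0 x) (at x within {0..x + 1})" using x by (auto simp: continuous_on_def)
  moreover have "at x within {0..x + 1} = at x within {0..}"
    by (rule at_within_nhd[of x "{..<x + 1}"]) auto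
  ultimately show ?thesis by simp
qed

lemma surf_pt_t0: "surf_pt S z = (z * cnj (Dt (t0 ((cmod z)\<^sup>2))), flow S (t0 ((cmod z)\<^sup>2)) (pt S))"
  by (rule surf_pt_eq) (simp_all add: t0)

subsection \<open>The parameter is a smooth function\<close>

text \<open>
  The derivative of \<open>R - x Q\<close> at its zero \<open>t0 x\<close>: the denominator of the derivative of \<open>t0\<close>.
\<close>

definition G1 :: "real \<Rightarrow> real" where
  "G1 x = poly (pderiv Rp) (t0 x) - x * poly (pderiv Qp) (t0 x)"

text \<open>
  The coordinates of \<open>surf_pt\<close> are differentiable functions of \<open>z\<close>, and one of them is a polynomial in
  the time whose derivative does not vanish at the time in question.  So the time is differentiable in
  the radius \<open>s = \<bar>z\<bar>\<close>.  At \<open>s = 0\<close> this says less than differentiability of \<open>t0\<close>.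
\<close>

lemma param_deriv_exists:
  assumes s: "s \<ge> 0"
  shows "\<exists>d. ((\<lambda>s. t0 (s\<^sup>2)) has_real_derivative d) (at s)"
proof -
  define t where "t = t0 (s\<^sup>2)"
  \<comment> \<open>otherwise the orbit would stand still\<close>
  obtain i where i: "poly (pderiv (flow_poly S (pt S) i)) t \<noteq> 0"
    using flow_stationary[OF flow, of "pt S" t] flow_not_fixed by blast
  obtain q where q: "\<And>u. poly (flow_poly S (pt S) i) u - poly (flow_poly S (pt S) i) t = (u - t) * poly q u"
    "poly q t = poly (pderiv (flow_poly S (pt S) i)) t"
    using poly_factor[of "flow_poly S (pt S) i" t] by blast
  define \<phi> where "\<phi> = (\<lambda>s. poly (flow_poly S (pt S) i) (t0 (s\<^sup>2)))"
  have "\<phi> = (\<lambda>s. snd (surf_pt S (of_real s)) $ i)"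
    by (simp add: \<phi>_def surf_pt_t0 flow_nth)
  moreover have "\<exists>D. (surf_pt S has_derivative D) (at z)" for z
  proof -
    have "smooth_plane (surf_pt S)" using coordinate by (simp add: complex_coordinate_def)
    then obtain d where d: "d 0 0 = surf_pt S" "\<forall>i j z. (d i j has_derivative
        (\<lambda>h. Re h *\<^sub>R d (Suc i) j z + Im h *\<^sub>R d i (Suc j) z)) (at z)"
      unfolding smooth_plane_def by auto
    show ?thesis using d(2)[rule_format, of 0 0 z] unfolding d(1)
      by (rule exI[of "\<lambda>D. (surf_pt S has_derivative D) (at z)"])
  qed
  then have "\<exists>D. (surf_pt S has_derivative D) (at (of_real s))" .
  then obtain D where D: "(surf_pt S has_derivative D) (at (of_real s))" by blast
  then have "((\<lambda>s. snd (surf_pt S (of_real s)) $ i) has_derivative (\<lambda>h. snd (D (of_real h)) $ i)) (at s)"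
    by (intro bounded_linear.has_derivative[OF bounded_linear_vec_nth] has_derivative_snd
        has_derivative_compose[of of_real of_real s UNIV "surf_pt S" D]) (auto intro!: derivative_eq_intros)
  ultimately have "\<phi> differentiable (at s)" unfolding differentiable_def by auto
  then obtain d where d: "(\<phi> has_real_derivative d) (at s)"
    using real_differentiable_def by blast
  have cont: "((\<lambda>s. t0 (s\<^sup>2)) \<longlongrightarrow> t) (at s)"
  proof -
    have c: "continuous_on {0..} t0" by (auto simp: continuous_on_def t0_tendsto)
    have "continuous_on UNIV (\<lambda>s. t0 (s\<^sup>2))"
      by (rule continuous_on_compose2[OF c]) (auto intro!: continuous_intros)
    then show ?thesis by (simp add: continuous_on_eq_continuous_at isCont_def t_def)
  qed
  have qt: "((\<lambda>s. poly q (t0 (s\<^sup>2))) \<longlongrightarrow> poly q t) (at s)" by (rule tendsto_poly[OF cont])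
  have lim: "((\<lambda>u. (\<phi> u - \<phi> s) / (u - s) / poly q (t0 (u\<^sup>2))) \<longlongrightarrow> d / poly q t) (at s)"
    using d i q(2) by (intro tendsto_divide qt) (auto simp: has_field_derivative_iff)
  have "\<forall>\<^sub>F u in at s. poly q (t0 (u\<^sup>2)) \<noteq> 0"
    using qt i q(2) by (intro tendsto_imp_eventually_ne) auto
  then have "\<forall>\<^sub>F u in at s. (\<phi> u - \<phi> s) / (u - s) / poly q (t0 (u\<^sup>2)) = (t0 (u\<^sup>2) - t0 (s\<^sup>2)) / (u - s)"
  proof eventually_elim
    case (elim u)
    have "\<phi> u - \<phi> s = (t0 (u\<^sup>2) - t) * poly q (t0 (u\<^sup>2))"
      using q(1)[of "t0 (u\<^sup>2)"] by (simp add: \<phi>_def t_def)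
    then show ?case using elim by (simp add: t_def)
  qed
  from Lim_transform_eventually[OF lim this] show ?thesis
    unfolding has_field_derivative_iff by blast
qed

text \<open>
  Differentiate \<open>R(\<theta>(s)) = s\<^sup>2 Q(\<theta>(s))\<close> for \<open>\<theta>(s) = t0(s\<^sup>2)\<close>: the result is \<open>G1 \<theta>' = 2 s Q \<noteq> 0\<close> for
  \<open>s > 0\<close>.  At \<open>s = 0\<close> it says nothing.  There the smoothness of the surface is used once more: the
  even function \<open>\<theta>\<close> has derivative 0, so \<open>\<theta>(s) = o(s)\<close>, and if \<open>R\<close> vanished to second order, then
  \<open>R(\<theta>(s)) = o(s\<^sup>2)\<close> would contradict \<open>Q(0) > 0\<close>.
\<close>

lemma G1_nonzero:
  assumes x: "x \<ge> 0"
  shows "G1 x \<noteq> 0"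
proof -
  define s where "s = sqrt x"
  have s: "s \<ge> 0" "s\<^sup>2 = x" using x by (auto simp: s_def)
  define \<theta> where "\<theta> = (\<lambda>s. t0 (s\<^sup>2))"
  obtain d where d: "(\<theta> has_real_derivative d) (at s)"
    using param_deriv_exists[OF s(1)] by (auto simp: \<theta>_def)
  have eq: "poly Rp (\<theta> u) = u\<^sup>2 * poly Qp (\<theta> u)" for u by (simp add: \<theta>_def Rp_t0)
  have Q: "poly Qp (\<theta> s) > 0" using t0(1)[of "s\<^sup>2"] by (simp add: \<theta>_def Qp_pos)
  have comp: "((\<lambda>u. poly p (\<theta> u)) has_real_derivative poly (pderiv p) (\<theta> s) * d) (at s)" for p
    using DERIV_chain2[OF poly_DERIV d] .
  have "((\<lambda>u. u\<^sup>2 * poly Qp (\<theta> u)) has_real_derivative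
      (2 * s * poly Qp (\<theta> s) + s\<^sup>2 * (poly (pderiv Qp) (\<theta> s) * d))) (at s)"
    by (rule derivative_eq_intros comp refl | simp)+
  with comp[of Rp] have id: "poly (pderiv Rp) (\<theta> s) * d = 2 * s * poly Qp (\<theta> s) + s\<^sup>2 * (poly (pderiv Qp) (\<theta> s) * d)"
    unfolding eq by (rule DERIV_unique)
  show ?thesis
  proof (cases "s = 0")
    case False
    with s have "s > 0" by simp
    then have "2 * s * poly Qp (\<theta> s) > 0" using Q by simp
    moreover have "G1 x * d = 2 * s * poly Qp (\<theta> s)"
      using id s by (simp add: G1_def \<theta>_def algebra_simps)
    ultimately show ?thesis by auto
  next
    case True
    \<comment> \<open>the derivative of an even function at 0 vanishes\<close>
    have "((\<lambda>u. \<theta> (- u)) has_real_derivative d * - 1) (at 0)"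
      by (rule DERIV_chain2[of \<theta>]) (use d True in \<open>auto intro!: derivative_eq_intros\<close>)
    moreover have "(\<lambda>u. \<theta> (- u)) = \<theta>" by (simp add: \<theta>_def)
    ultimately have "d = - d" using d True by (metis DERIV_unique mult_minus1_right)
    then have d0: "d = 0" by simp
    have \<theta>0: "\<theta> 0 = 0" by (simp add: \<theta>_def)
    show ?thesis
    proof
      assume "G1 x = 0"
      then have R1: "poly (pderiv Rp) 0 = 0" using s True by (simp add: G1_def)
      have "coeff Rp k = 0" if "k < 2" for k
      proof -
        have "k = 0 \<or> k = 1" using that by linarith
        then show ?thesis
          using Rp_0 R1 by (auto simp: poly_0_coeff_0 coeff_pderiv)
      qed
      then have "monom 1 2 dvd Rp" by (simp add: monom_1_dvd_iff')
      then obtain R2 where "Rp = monom 1 2 * R2" by blast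
      then have R2: "poly Rp u = u\<^sup>2 * poly R2 u" for u by (simp add: poly_monom)
      have lim0: "((\<lambda>u. \<theta> u / u) \<longlongrightarrow> 0) (at 0)"
        using d d0 True \<theta>0 by (simp add: has_field_derivative_iff)
      have cont: "(\<theta> \<longlongrightarrow> 0) (at 0)"
        using DERIV_isCont[OF d] True \<theta>0 by (simp add: isCont_def)
      have "((\<lambda>u. (\<theta> u / u)\<^sup>2 * poly R2 (\<theta> u)) \<longlongrightarrow> 0\<^sup>2 * poly R2 0) (at 0)"
        by (intro tendsto_intros lim0 tendsto_poly[OF cont])
      moreover have "\<forall>\<^sub>F u in at 0. (\<theta> u / u)\<^sup>2 * poly R2 (\<theta> u) = poly Qp (\<theta> u)"
        using eventually_neq_at_within[of 0 0 UNIV]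
      proof eventually_elim
        case (elim u)
        then show ?case using eq[of u] R2[of "\<theta> u"] by (simp add: field_simps)
      qed
      ultimately have "((\<lambda>u. poly Qp (\<theta> u)) \<longlongrightarrow> 0\<^sup>2 * poly R2 0) (at 0)"
        by (rule Lim_transform_eventually)
      moreover have "((\<lambda>u. poly Qp (\<theta> u)) \<longlongrightarrow> poly Qp 0) (at 0)" by (rule tendsto_poly[OF cont])
      ultimately have "poly Qp 0 = 0\<^sup>2 * poly R2 0" by (intro tendsto_unique[rotated]) auto
      then show False using Qp_pos[of 0] by simp
    qed
  qed
qed

text \<open>
  \<open>R - x Q\<close> has the sign of \<open>H - x\<close>, so it is positive to the right of its zero.
\<close>

lemma G1_pos:
  assumes x: "x \<ge> 0"
  shows "G1 x > 0"
proof (rule ccontr)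
  assume "\<not> G1 x > 0"
  with G1_nonzero[OF x] have neg: "G1 x < 0" by simp
  define g where "g = (\<lambda>t. poly Rp t - x * poly Qp t)"
  have "(g has_real_derivative G1 x) (at (t0 x))"
    unfolding g_def G1_def by (rule derivative_eq_intros refl | simp)+
  from DERIV_neg_dec_right[OF this neg] obtain d where d: "d > 0" "\<And>h. h > 0 \<Longrightarrow> h < d \<Longrightarrow> g (t0 x + h) < g (t0 x)"
    by blast
  have lt: "t0 x < t0 (x + 1)" using x by (intro t0_strict) auto
  define h where "h = min (d / 2) (t0 (x + 1) - t0 x)"
  have h: "h > 0" "h < d" "t0 x + h \<le> t0 (x + 1)" using lt d(1) by (auto simp: h_def)
  have r: "in_range (t0 x + h)" using in_range_mono[OF t0(1)[of "x + 1"], of "t0 x + h"] h x t0_nonneg[OF x] by simp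
  have "Hr (t0 x) < Hr (t0 x + h)" using r h t0_nonneg[OF x] by (intro Hr_strict) auto
  then have "x < Hr (t0 x + h)" using t0[OF x] by simp
  then have "g (t0 x + h) > 0" using Qp_pos[OF r] by (simp add: g_def Rp_Hr[OF r])
  moreover have "g (t0 x) = 0" using Rp_t0[OF x] by (simp add: g_def)
  ultimately show False using d(2)[of h] h by simp
qed

text \<open>
  Implicit differentiation of \<open>R(t0 y) = y Q(t0 y)\<close>.  The derivative at 0 is one-sided, since \<open>t0\<close> is
  defined by \<open>H\<close> on the half line only.
\<close>

lemma t0_deriv:
  assumes x: "x \<ge> 0"
  shows "(t0 has_real_derivative poly Qp (t0 x) / G1 x) (at x within {0..})"
proof -
  define g where "g = Rp - smult x Qp"
  obtain q where q: "\<And>t. poly g t - poly g (t0 x) = (t - t0 x) * poly q t" "poly q (t0 x) = poly (pderiv g) (t0 x)"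
    using poly_factor[of g "t0 x"] by blast
  have qG: "poly q (t0 x) = G1 x" unfolding q(2) by (simp add: g_def G1_def pderiv_diff pderiv_smult)
  have g0: "poly g (t0 x) = 0" using Rp_t0[OF x] by (simp add: g_def)
  note c = t0_tendsto[OF x]
  have lim: "((\<lambda>y. poly Qp (t0 y) / poly q (t0 y)) \<longlongrightarrow> poly Qp (t0 x) / G1 x) (at x within {0..})"
    unfolding qG[symmetric] using G1_nonzero[OF x] qG by (intro tendsto_divide tendsto_poly c) auto
  have "\<forall>\<^sub>F y in at x within {0..}. poly q (t0 y) \<noteq> 0"
    using tendsto_poly[OF c, of q] G1_nonzero[OF x] qG by (intro tendsto_imp_eventually_ne) auto
  moreover have "\<forall>\<^sub>F y in at x within {0..}. y \<in> {0..} \<and> y \<noteq> x"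
    by (simp add: eventually_at_filter)
  ultimately have "\<forall>\<^sub>F y in at x within {0..}. poly Qp (t0 y) / poly q (t0 y) = (t0 y - t0 x) / (y - x)"
  proof eventually_elim
    case (elim y)
    have "(t0 y - t0 x) * poly q (t0 y) = (y - x) * poly Qp (t0 y)"
      using q(1)[of "t0 y"] g0 Rp_t0[of y] elim by (simp add: g_def algebra_simps)
    then show ?case using elim by (simp add: field_simps)
  qed
  from Lim_transform_eventually[OF lim this] show ?thesis
    unfolding has_field_derivative_iff .
qed

end

section \<open>Entire functions as coefficient sequences\<close>

definition ser :: "(nat \<Rightarrow> complex) \<Rightarrow> complex \<Rightarrow> complex" where
  "ser a w = suminf (\<lambda>n. a n * w ^ n)"

definition entire_seq :: "(nat \<Rightarrow> complex) \<Rightarrow> bool" where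
  "entire_seq a \<longleftrightarrow> (\<forall>w. summable (\<lambda>n. a n * w ^ n))"

lemma ser_sums: "entire_seq a \<Longrightarrow> (\<lambda>n. a n * w ^ n) sums ser a w"
  by (simp add: entire_seq_def ser_def summable_sums)

lemma ser_0 [simp]: "ser a 0 = a 0"
  by (simp add: ser_def)

lemma entire_seq_diffs: "entire_seq a \<Longrightarrow> entire_seq (diffs a)"
  unfolding entire_seq_def using termdiff_converges_all by blast

lemma ser_has_deriv: "entire_seq a \<Longrightarrow> (ser a has_field_derivative ser (diffs a) w) (at w)"
  unfolding ser_def[abs_def] entire_seq_def by (rule termdiffs_strong_converges_everywhere) auto

lemma deriv_ser: "entire_seq a \<Longrightarrow> deriv (ser a) = ser (diffs a)"
  using DERIV_imp_deriv[OF ser_has_deriv] by blast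

lemma higher_deriv_ser:
  assumes "entire_seq a"
  shows "(deriv ^^ n) (ser a) = ser ((diffs ^^ n) a) \<and> entire_seq ((diffs ^^ n) a)"
  by (induction n) (simp_all add: assms deriv_ser entire_seq_diffs)

lemma diffs_iterate: "(diffs ^^ n) a k = (fact (n + k) / fact k) * (a (n + k) :: complex)"
proof (induction n arbitrary: k)
  case (Suc n)
  have "(diffs ^^ Suc n) a k = of_nat (Suc k) * ((fact (n + Suc k) / fact (Suc k)) * a (n + Suc k))"
    by (simp add: diffs_def Suc del: of_nat_Suc)
  also have "\<dots> = (fact (Suc n + k) / fact k) * a (Suc n + k)"
    by (simp add: field_simps del: of_nat_Suc)
  finally show ?case .
qed simp

lemma tcoeff_ser: "entire_seq a \<Longrightarrow> tcoeff (ser a) = a"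
  by (auto simp: tcoeff_def higher_deriv_ser diffs_iterate fun_eq_iff)

lemma ser_inj: "entire_seq a \<Longrightarrow> entire_seq b \<Longrightarrow> ser a = ser b \<longleftrightarrow> a = b"
  by (metis tcoeff_ser)

lemma entire_seq_add: "entire_seq a \<Longrightarrow> entire_seq b \<Longrightarrow> entire_seq (\<lambda>n. a n + b n)"
  by (auto simp: entire_seq_def distrib_right intro: summable_add)

lemma entire_seq_scale: "entire_seq a \<Longrightarrow> entire_seq (\<lambda>n. c * a n)"
  by (auto simp: entire_seq_def mult.assoc intro: summable_mult)

lemma entire_seq_0 [simp]: "entire_seq (\<lambda>n. 0)"
  by (simp add: entire_seq_def)

lemma entire_seq_shift_left: "entire_seq a \<Longrightarrow> entire_seq (\<lambda>n. a (Suc n))"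
  unfolding entire_seq_def using powser_split_head(3) by blast

definition shift_right :: "(nat \<Rightarrow> complex) \<Rightarrow> nat \<Rightarrow> complex" where
  "shift_right a n = (case n of 0 \<Rightarrow> 0 | Suc k \<Rightarrow> a k)"

lemma shift_right_sums:
  assumes "entire_seq a"
  shows "(\<lambda>n. shift_right a n * w ^ n) sums (w * ser a w)"
proof -
  have "(\<lambda>n. w * (a n * w ^ n)) sums (w * ser a w)" by (intro sums_mult ser_sums assms)
  then have "(\<lambda>n. shift_right a (Suc n) * w ^ Suc n) sums (w * ser a w)"
    by (simp add: shift_right_def mult_ac)
  then show ?thesis by (subst (asm) sums_Suc_iff) (simp add: shift_right_def)
qed

lemma entire_seq_shift_right: "entire_seq a \<Longrightarrow> entire_seq (shift_right a)"
  unfolding entire_seq_def using shift_right_sums[unfolded entire_seq_def] by (metis sums_summable)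

lemma ser_shift_right: "entire_seq a \<Longrightarrow> ser (shift_right a) w = w * ser a w"
  using sums_unique[OF shift_right_sums] by (simp add: ser_def)

lemma ser_add: "entire_seq a \<Longrightarrow> entire_seq b \<Longrightarrow> ser (\<lambda>n. a n + b n) w = ser a w + ser b w"
  unfolding ser_def by (subst suminf_add) (auto simp: entire_seq_def distrib_right)

lemma ser_scale: "entire_seq a \<Longrightarrow> ser (\<lambda>n. c * a n) w = c * ser a w"
  unfolding ser_def by (subst suminf_mult[symmetric]) (auto simp: entire_seq_def mult.assoc)

lemma euler_seq: "(\<lambda>n. of_nat n * a n) = shift_right (diffs a)"
  by (auto simp: shift_right_def diffs_def fun_eq_iff split: nat.splits)

lemma entire_seq_nat: "entire_seq a \<Longrightarrow> entire_seq (\<lambda>n. of_nat n * a n)"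
  unfolding euler_seq by (intro entire_seq_shift_right entire_seq_diffs)

lemma euler_ser: "entire_seq a \<Longrightarrow> euler h (ser a) = ser (\<lambda>n. of_real h * of_nat n * a n)"
  by (simp add: euler_def fun_eq_iff deriv_ser mult.assoc ser_scale[OF entire_seq_nat])
     (simp add: euler_seq ser_shift_right entire_seq_diffs)

lemma entire_seq_poly: "entire_seq a \<Longrightarrow> entire_seq (\<lambda>n. poly p (of_nat n) * a n)"
proof (induction p)
  case (pCons c p)
  have "entire_seq (\<lambda>n. c * a n + of_nat n * (poly p (of_nat n) * a n))"
    using pCons by (intro entire_seq_add entire_seq_scale entire_seq_nat) auto
  then show ?case by (simp add: algebra_simps)
qed simp

lemma entire_seq_poly': "entire_seq a \<Longrightarrow> entire_seq (\<lambda>n. poly p (\<alpha> * of_nat n + \<beta>) * a n)"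
  using entire_seq_poly[of a "pcompose p [:\<beta>, \<alpha>:]"] by (simp add: poly_pcompose algebra_simps)

lemma entire_seq_pow: "entire_seq a \<Longrightarrow> entire_seq (\<lambda>n. (\<alpha> * of_nat n + \<beta>) ^ k * a n)"
  using entire_seq_poly'[of a "monom 1 k" \<alpha> \<beta>] by (simp add: poly_monom)

lemma ser_sum: "(\<And>i. i \<in> I \<Longrightarrow> entire_seq (a i)) \<Longrightarrow>
  entire_seq (\<lambda>n. \<Sum>i\<in>I. a i n) \<and> ser (\<lambda>n. \<Sum>i\<in>I. a i n) w = (\<Sum>i\<in>I. ser (a i) w)"
proof (induction I rule: infinite_finite_induct)
  case (insert x I)
  then show ?case by (auto simp: ser_add entire_seq_add)
qed (simp_all add: ser_def)

text \<open>
  An operator that is diagonal in the monomials with entries \<open>\<alpha> n + \<beta>\<close> turns every polynomial in it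
  into a diagonal operator.  This covers both \<open>\<epsilon> = h w d/dw\<close> and \<open>\<epsilon> + h\<close>.
\<close>

lemma poly_op_ser:
  assumes T: "\<And>a. entire_seq a \<Longrightarrow> T (ser a) = ser (\<lambda>n. (\<alpha> * of_nat n + \<beta>) * a n)" and a: "entire_seq a"
  shows "poly_op p T (ser a) = ser (\<lambda>n. poly p (\<alpha> * of_nat n + \<beta>) * a n)"
proof
  fix w
  have it: "(T ^^ j) (ser a) = ser (\<lambda>n. (\<alpha> * of_nat n + \<beta>) ^ j * a n)" for j
    by (induction j) (simp_all add: T entire_seq_pow[OF a] mult.assoc)
  have "poly_op p T (ser a) w = (\<Sum>j\<le>degree p. ser (\<lambda>n. coeff p j * ((\<alpha> * of_nat n + \<beta>) ^ j * a n)) w)"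
    by (simp add: poly_op_def it ser_scale entire_seq_pow[OF a])
  also have "\<dots> = ser (\<lambda>n. \<Sum>j\<le>degree p. coeff p j * ((\<alpha> * of_nat n + \<beta>) ^ j * a n)) w"
    by (subst ser_sum[THEN conjunct2]) (auto intro!: entire_seq_scale entire_seq_pow[OF a])
  also have "\<dots> = ser (\<lambda>n. poly p (\<alpha> * of_nat n + \<beta>) * a n) w"
    by (simp add: poly_altdef sum_distrib_right mult.assoc)
  finally show "poly_op p T (ser a) w = ser (\<lambda>n. poly p (\<alpha> * of_nat n + \<beta>) * a n) w" .
qed

lemma poly_bound_nat:
  fixes p :: "complex poly"
  shows "\<exists>C k. C > 0 \<and> (\<forall>n. norm (poly p (of_nat n)) \<le> C * real (n + 1) ^ k)"
proof (induction p)
  case 0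
  show ?case by (rule exI[of _ 1]) auto
next
  case (pCons c p)
  then obtain C k where C: "C > 0" "\<And>n. norm (poly p (of_nat n)) \<le> C * real (n + 1) ^ k" by blast
  have "norm (poly (pCons c p) (of_nat n)) \<le> (norm c + C) * real (n + 1) ^ Suc k" for n
  proof -
    have "norm (poly (pCons c p) (of_nat n)) \<le> norm c + real n * norm (poly p (of_nat n))"
      using norm_triangle_ineq[of c "of_nat n * poly p (of_nat n)"] by (simp add: norm_mult)
    also have "\<dots> \<le> norm c * real (n + 1) ^ Suc k + real (n + 1) * (C * real (n + 1) ^ k)"
      using mult_left_mono[OF one_le_power[of "real (n + 1)" "Suc k"], of "norm c"]
      by (intro add_mono mult_mono C(2)) auto
    finally show ?thesis by (simp add: algebra_simps)
  qed
  moreover have "norm c + C > 0" using C(1) by (simp add: add_nonneg_pos)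
  ultimately show ?case by blast
qed

section \<open>The operators on coefficient sequences\<close>

locale quantized_surface = revolution_surface S for S :: "'n::finite surface" +
  fixes h :: real
  assumes adm: "admissible S h"
begin

lemma h_pos: "h > 0" using adm by (simp add: admissible_def)

definition wr :: "nat \<Rightarrow> real" where "wr n = (\<Prod>j=1..n. Hr (real j * h))"

lemma wt_wr: "wt S h n = of_real (wr n)"
  by (simp add: wt_def wr_def HH_eq)

lemma topN_cases:
  obtains "tstar S = \<infinity>" "topN S h = \<infinity>"
  | m where "tstar S = ereal ((real m + 1) * h)" "topN S h = enat m"
proof (cases "tstar S = \<infinity>")
  case False
  then obtain m where m: "tstar S = ereal ((real m + 1) * h)"
    using adm by (auto simp: admissible_def)
  have "(THE N. tstar S = ereal ((real N + 1) * h)) = m"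
    using m h_pos by (intro the_equality) auto
  then show ?thesis using that(2)[of m] m by (simp add: topN_def)
qed (use that(1) in \<open>simp add: topN_def\<close>)

lemma top_in_range: "enat n \<le> topN S h \<Longrightarrow> in_range (real n * h)"
  using h_pos by (cases rule: topN_cases) (auto simp: in_range_def)

lemma top_Suc: "enat (Suc n) \<le> topN S h \<Longrightarrow> enat n \<le> topN S h"
  by (meson Suc_n_not_le_n enat_ord_simps(1) le_cases order_trans)

lemma top_0 [simp]: "enat 0 \<le> topN S h" by (simp add: enat_0)

text \<open>
  The degree \<open>N + 1\<close> corresponds to the polar point, where \<open>D\<close> vanishes; this is what makes \<open>B\<close>
  preserve the polynomials of degree at most \<open>N\<close>.
\<close>

lemma Dt_top: "enat n \<le> topN S h \<Longrightarrow> \<not> enat (Suc n) \<le> topN S h \<Longrightarrow> Dt (real (Suc n) * h) = 0"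
proof (cases rule: topN_cases)
  case (2 m)
  assume "enat n \<le> topN S h" "\<not> enat (Suc n) \<le> topN S h"
  then have "n = m" using 2 by simp
  then show ?thesis using D_polar 2 by (simp add: Dt_cval add.commute)
qed auto

lemma Rp_top: "enat n \<le> topN S h \<Longrightarrow> \<not> enat (Suc n) \<le> topN S h \<Longrightarrow> poly Rp (real (Suc n) * h) = 0"
  using Dt_top[of n] DE[of "real (Suc n) * h"] by simp

lemma wr_Suc: "wr (Suc n) = wr n * Hr (real (Suc n) * h)"
  by (simp add: wr_def)

lemma wr_0 [simp]: "wr 0 = 1" by (simp add: wr_def)

lemma wr_pos: "enat n \<le> topN S h \<Longrightarrow> wr n > 0"
proof (induction n)
  case (Suc n)
  then show ?case using top_in_range[OF Suc.prems] h_pos top_Suc[of n]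
    by (simp add: wr_Suc Hr_pos del: of_nat_Suc)
qed simp

text \<open>
  The coefficients of the reproducing kernel.  Extended by 0 beyond \<open>N\<close>, they satisfy one recurrence
  for all \<open>n\<close> (\<open>W_rec\<close>), so that later arguments need not distinguish whether \<open>N\<close> is finite.
\<close>

definition W :: "nat \<Rightarrow> real" where "W n = (if enat n \<le> topN S h then 1 / wr n else 0)"

lemma W_nonneg: "W n \<ge> 0" using wr_pos[of n] by (auto simp: W_def)

lemma W_pos: "enat n \<le> topN S h \<Longrightarrow> W n > 0" using wr_pos[of n] by (simp add: W_def)

lemma W_0 [simp]: "W 0 = 1" by (simp add: W_def)

text \<open>
  Below \<open>N\<close> this is the product formula for the weights multiplied by \<open>Q\<close>; at \<open>n = N\<close> both sides vanish
  because the polar point is a zero of \<open>D\<close>.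
\<close>

lemma W_rec: "W (Suc n) * poly Rp (real (Suc n) * h) = W n * poly Qp (real (Suc n) * h)"
proof (cases "enat (Suc n) \<le> topN S h")
  case True
  let ?t = "real (Suc n) * h"
  have r: "in_range ?t" "?t > 0" using top_in_range[OF True] h_pos by (auto simp del: of_nat_Suc)
  have "W (Suc n) * poly Rp ?t = 1 / (wr n * Hr ?t) * (Hr ?t * poly Qp ?t)"
    using True by (simp add: W_def wr_Suc Rp_Hr[OF r(1)] del: of_nat_Suc)
  also have "\<dots> = W n * poly Qp ?t" using True top_Suc[OF True] Hr_pos[OF r] by (simp add: W_def)
  finally show ?thesis .
next
  case False
  show ?thesis
  proof (cases "enat n \<le> topN S h")
    case True
    then show ?thesis using False Dt_top[of n] Rp_top[of n] Qp_eq[of "real (Suc n) * h"] by simp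
  qed (use False in \<open>simp add: W_def\<close>)
qed

lemma entire_seq_W: "entire_seq (\<lambda>n. of_real (W n))"
  unfolding entire_seq_def
proof
  fix w :: complex
  show "summable (\<lambda>n. of_real (W n) * w ^ n)"
  proof (cases rule: topN_cases)
    case 1
    then have "summable (\<lambda>n. w ^ n / wt S h n)" using adm by (auto simp: admissible_def)
    then show ?thesis by (simp add: W_def 1 wt_wr)
  next
    case (2 m)
    show ?thesis by (rule summable_finite[of "{..m}"]) (auto simp: W_def 2)
  qed
qed

lemma kfun_eq: "kfun S h = ser (\<lambda>n. of_real (W n))"
  unfolding kfun_def ser_def fun_eq_iff by (intro allI suminf_cong) (simp add: W_def wt_wr)

definition kseq :: "complex \<Rightarrow> nat \<Rightarrow> complex" where "kseq z n = of_real (W n) * z ^ n"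

lemma ker_eq: "ker S h w z = ser (kseq z) w"
  by (simp add: ker_def kfun_eq ser_def kseq_def power_mult_distrib mult_ac)

lemma entire_seq_kseq: "entire_seq (kseq z)"
  unfolding entire_seq_def
proof
  fix w
  have "summable (\<lambda>n. of_real (W n) * (z * w) ^ n)" using entire_seq_W by (simp add: entire_seq_def)
  then show "summable (\<lambda>n. kseq z n * w ^ n)" by (simp add: kseq_def power_mult_distrib mult.assoc)
qed

subsection \<open>The domain\<close>

text \<open>
  The coefficient sequences of the domain: square summable with the weights \<open>wr\<close>, even after
  multiplication by any power of \<open>n\<close>.  Bounds instead of sums suffice because all powers are
  admitted.
\<close>

definition rapid :: "(nat \<Rightarrow> complex) \<Rightarrow> bool" where
  "rapid a \<longleftrightarrow> entire_seq a \<and> (\<forall>n. \<not> enat n \<le> topN S h \<longrightarrow> a n = 0) \<and>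
     (\<forall>p. \<exists>M. \<forall>n. real (n + 1) ^ p * (wr n * (norm (a n))\<^sup>2) \<le> M)"

lemma weight_nonneg: "(\<And>n. \<not> enat n \<le> topN S h \<Longrightarrow> a n = 0) \<Longrightarrow> wr n * (norm (a n))\<^sup>2 \<ge> 0"
  using wr_pos[of n] by (cases "enat n \<le> topN S h") auto

text \<open>
  The bound for the power \<open>p + 2\<close> leaves a factor \<open>1 / (n + 1)\<^sup>2\<close>.
\<close>

lemma rapid_summable:
  assumes "rapid a"
  shows "summable (\<lambda>n. real (n + 1) ^ p * (wr n * (norm (a n))\<^sup>2))"
proof -
  obtain M where M: "\<And>n. real (n + 1) ^ (p + 2) * (wr n * (norm (a n))\<^sup>2) \<le> M"
    using assms unfolding rapid_def by blast
  have "summable (\<lambda>n. 1 / real n ^ 2)" by (rule inverse_power_summable[of 2, where 'a = real, unfolded inverse_eq_divide]) simp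
  then have "summable (\<lambda>n. 1 / real (n + 1) ^ 2)" using summable_Suc_iff[of "\<lambda>n. 1 / real n ^ 2"] by simp
  then have s: "summable (\<lambda>n. M * (1 / real (n + 1) ^ 2))" by (rule summable_mult)
  show ?thesis
  proof (rule summable_comparison_test'[OF s, of 0])
    fix n
    have nn: "wr n * (norm (a n))\<^sup>2 \<ge> 0" using assms by (intro weight_nonneg) (auto simp: rapid_def)
    have "real (n + 1) ^ p * (wr n * (norm (a n))\<^sup>2) \<le> M * (1 / real (n + 1) ^ 2)"
    proof -
      have "(real (n + 1) ^ p * (wr n * (norm (a n))\<^sup>2)) * real (n + 1) ^ 2 \<le> M"
        using M[of n] by (simp only: power_add mult_ac)
      then show ?thesis by (simp add: pos_le_divide_eq)
    qed
    then show "norm (real (n + 1) ^ p * (wr n * (norm (a n))\<^sup>2)) \<le> M * (1 / real (n + 1) ^ 2)"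
      using mult_nonneg_nonneg[OF zero_le_power[of "real (n + 1)" p] nn]
      by (simp only: real_norm_def abs_of_nonneg of_nat_0_le_iff)
  qed
qed

text \<open>
  The powers of the number operator multiply \<open>u\<^sub>n\<close> by powers of \<open>n\<close>; the factor \<open>n + 1\<close> of \<open>rapid\<close>
  differs from \<open>n\<close> by at most a factor 2, apart from \<open>n = 0\<close>.
\<close>

lemma dom_L_iff: "u \<in> dom_L S h \<longleftrightarrow> (\<exists>a. rapid a \<and> u = ser a)"
proof
  assume u: "u \<in> dom_L S h"
  define a where "a = tcoeff u"
  have LL0: "u \<in> LL S h" using u unfolding dom_L_def by (auto dest: spec[of _ 0])
  then have sums: "(\<lambda>n. a n * w ^ n) sums u w" for w by (simp add: LL_def a_def)
  then have ent: "entire_seq a" unfolding entire_seq_def by (blast intro: sums_summable)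
  have ua: "u = ser a" using sums sums_unique unfolding ser_def by blast
  have top: "a n = 0" if "\<not> enat n \<le> topN S h" for n
    using LL0 that by (simp add: LL_def a_def not_le)
  have it: "(euler 1 ^^ p) u = ser (\<lambda>n. of_nat n ^ p * a n) \<and> entire_seq (\<lambda>n. of_nat n ^ p * a n)" for p
  proof (induction p)
    case (Suc p)
    then show ?case using entire_seq_nat[of "\<lambda>n. of_nat n ^ p * a n"] by (simp add: euler_ser mult.assoc)
  qed (simp_all add: ua ent)
  have sm: "summable (\<lambda>n. wr n * (norm (of_nat n ^ p * a n))\<^sup>2)" for p
  proof -
    have "ser (\<lambda>n. of_nat n ^ p * a n) \<in> LL S h" using u it[of p] by (simp add: dom_L_def) metis
    then show ?thesis using it[of p] by (simp add: LL_def tcoeff_ser wt_wr)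
  qed
  have "\<exists>M. \<forall>n. real (n + 1) ^ p * (wr n * (norm (a n))\<^sup>2) \<le> M" for p
  proof -
    obtain M where "\<And>n. norm (wr n * (norm (of_nat n ^ p * a n))\<^sup>2) \<le> M"
      using summable_imp_Bseq[OF sm[of p]] by (auto simp: Bseq_def)
    then have M: "wr n * (norm (of_nat n ^ p * a n))\<^sup>2 \<le> M" for n by (metis abs_le_D1 real_norm_def)
    have "real (n + 1) ^ p * (wr n * (norm (a n))\<^sup>2) \<le> 2 ^ p * M + (norm (a 0))\<^sup>2" for n
    proof (cases "n = 0")
      case True
      then show ?thesis using M[of 0] order_trans[OF weight_nonneg[of "\<lambda>n. of_nat n ^ p * a n" 0] M[of 0]] top by simp
    next
      case False
      have nn: "wr n * (norm (a n))\<^sup>2 \<ge> 0" using top by (rule weight_nonneg)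
      have "real (n + 1) ^ p \<le> (2 * real n) ^ p" using False by (intro power_mono) auto
      also have "\<dots> \<le> 2 ^ p * (real n ^ p)\<^sup>2"
        using False one_le_power[of "real n" p] by (simp add: power_mult_distrib power2_eq_square)
      finally have "real (n + 1) ^ p * (wr n * (norm (a n))\<^sup>2) \<le> 2 ^ p * (real n ^ p)\<^sup>2 * (wr n * (norm (a n))\<^sup>2)"
        using nn by (rule mult_right_mono)
      also have "\<dots> = 2 ^ p * (wr n * (norm (of_nat n ^ p * a n))\<^sup>2)"
        by (simp add: norm_mult norm_power power_mult_distrib mult_ac)
      also have "\<dots> \<le> 2 ^ p * M" using M[of n] by simp
      finally show ?thesis by (simp add: add_increasing2)
    qed
    then show ?thesis by blast
  qed
  then show "\<exists>a. rapid a \<and> u = ser a" using ent top ua by (auto simp: rapid_def intro!: exI[of _ a])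
next
  assume "\<exists>a. rapid a \<and> u = ser a"
  then obtain a where a: "rapid a" and u: "u = ser a" by blast
  then have ent: "entire_seq a" by (simp add: rapid_def)
  have it: "(euler 1 ^^ p) u = ser (\<lambda>n. of_nat n ^ p * a n) \<and> entire_seq (\<lambda>n. of_nat n ^ p * a n)" for p
  proof (induction p)
    case (Suc p)
    then show ?case using entire_seq_nat[of "\<lambda>n. of_nat n ^ p * a n"] by (simp add: euler_ser mult.assoc)
  qed (simp_all add: u ent)
  have "ser (\<lambda>n. of_nat n ^ p * a n) \<in> LL S h" for p
  proof -
    have "summable (\<lambda>n. wr n * (norm (of_nat n ^ p * a n))\<^sup>2)"
    proof (rule summable_comparison_test'[OF rapid_summable[OF a, of "2 * p"], of 0])
      fix n
      have nn: "wr n * (norm (a n))\<^sup>2 \<ge> 0" using a by (intro weight_nonneg) (auto simp: rapid_def)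
      have eq: "wr n * (norm (of_nat n ^ p * a n))\<^sup>2 = real n ^ (2 * p) * (wr n * (norm (a n))\<^sup>2)"
        by (simp add: norm_mult norm_power power_mult_distrib power_even_eq)
      have le: "real n ^ (2 * p) * (wr n * (norm (a n))\<^sup>2) \<le> real (n + 1) ^ (2 * p) * (wr n * (norm (a n))\<^sup>2)"
        using nn by (intro mult_right_mono power_mono) auto
      have "real n ^ (2 * p) * (wr n * (norm (a n))\<^sup>2) \<ge> 0" using nn by simp
      then show "norm (wr n * (norm (of_nat n ^ p * a n))\<^sup>2) \<le> real (n + 1) ^ (2 * p) * (wr n * (norm (a n))\<^sup>2)"
        unfolding eq using le by (simp only: real_norm_def abs_of_nonneg)
    qed
    then show ?thesis
      using it[of p] a by (auto simp: LL_def tcoeff_ser wt_wr not_le rapid_def intro: ser_sums)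
  qed
  then show "u \<in> dom_L S h" by (simp add: dom_L_def it)
qed

lemma rapid_entire: "rapid a \<Longrightarrow> entire_seq a" by (simp add: rapid_def)

lemma rapid_top: "rapid a \<Longrightarrow> \<not> enat n \<le> topN S h \<Longrightarrow> a n = 0" by (simp add: rapid_def)

lemma rapid_add: assumes a: "rapid a" and b: "rapid b" shows "rapid (\<lambda>n. a n + b n)"
  unfolding rapid_def
proof (intro conjI allI impI)
  fix p
  obtain M1 where M1: "\<And>n. real (n + 1) ^ p * (wr n * (norm (a n))\<^sup>2) \<le> M1" using a unfolding rapid_def by blast
  obtain M2 where M2: "\<And>n. real (n + 1) ^ p * (wr n * (norm (b n))\<^sup>2) \<le> M2" using b unfolding rapid_def by blast
  have "real (n + 1) ^ p * (wr n * (norm (a n + b n))\<^sup>2) \<le> 2 * M1 + 2 * M2" for n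
  proof (cases "enat n \<le> topN S h")
    case True
    have "(norm (a n + b n))\<^sup>2 \<le> (norm (a n) + norm (b n))\<^sup>2" by (intro power_mono norm_triangle_ineq) auto
    also have "\<dots> \<le> 2 * (norm (a n))\<^sup>2 + 2 * (norm (b n))\<^sup>2"
      using sum_squares_bound[of "norm (a n)" "norm (b n)"] by (simp add: power2_sum)
    finally have "real (n + 1) ^ p * (wr n * (norm (a n + b n))\<^sup>2) \<le>
      real (n + 1) ^ p * (wr n * (2 * (norm (a n))\<^sup>2 + 2 * (norm (b n))\<^sup>2))"
      using wr_pos[OF True] by (intro mult_left_mono) auto
    also have "\<dots> = 2 * (real (n + 1) ^ p * (wr n * (norm (a n))\<^sup>2)) + 2 * (real (n + 1) ^ p * (wr n * (norm (b n))\<^sup>2))"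
      by (simp only: distrib_left mult_ac)
    also have "\<dots> \<le> 2 * M1 + 2 * M2" using M1[of n] M2[of n] by (intro add_mono mult_left_mono) auto
    finally show ?thesis .
  next
    case False
    then show ?thesis using M1[of n] M2[of n] rapid_top[OF a] rapid_top[OF b] by simp
  qed
  then show "\<exists>M. \<forall>n. real (n + 1) ^ p * (wr n * (norm (a n + b n))\<^sup>2) \<le> M" by blast
qed (use assms in \<open>auto simp: rapid_def entire_seq_add\<close>)

text \<open>
  The weighted shifts change the index by at most one and the weighted squares by at most a polynomial
  factor, which \<open>rapid\<close> does not notice.  The map \<open>f\<close> is the change of the index.
\<close>

lemma rapid_dominated:
  assumes a: "rapid a" and b: "entire_seq b" "\<And>n. \<not> enat n \<le> topN S h \<Longrightarrow> b n = 0"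
    and le: "\<And>n. enat n \<le> topN S h \<Longrightarrow> wr n * (norm (b n))\<^sup>2 \<le> C * real (n + 1) ^ k * (wr (f n) * (norm (a (f n)))\<^sup>2)"
    and f: "\<And>n. n \<le> f n + 1" and C: "C \<ge> 0"
  shows "rapid b"
  unfolding rapid_def
proof (intro conjI allI impI)
  fix p
  obtain M where M: "\<And>n. real (n + 1) ^ (p + k) * (wr n * (norm (a n))\<^sup>2) \<le> M" using a unfolding rapid_def by blast
  have nn: "wr n * (norm (a n))\<^sup>2 \<ge> 0" for n using rapid_top[OF a] by (intro weight_nonneg) auto
  have M0: "M \<ge> 0" using order_trans[OF _ M[of 0]] nn[of 0] by simp
  have "real (n + 1) ^ p * (wr n * (norm (b n))\<^sup>2) \<le> C * 2 ^ (p + k) * M" for n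
  proof (cases "enat n \<le> topN S h")
    case True
    have "real (n + 1) ^ p * (wr n * (norm (b n))\<^sup>2) \<le>
       real (n + 1) ^ p * (C * real (n + 1) ^ k * (wr (f n) * (norm (a (f n)))\<^sup>2))"
      by (intro mult_left_mono le True) auto
    also have "\<dots> = C * (real (n + 1) ^ (p + k) * (wr (f n) * (norm (a (f n)))\<^sup>2))"
      by (simp add: power_add mult_ac)
    also have "\<dots> \<le> C * ((2 * real (f n + 1)) ^ (p + k) * (wr (f n) * (norm (a (f n)))\<^sup>2))"
      using f[of n] by (intro mult_left_mono mult_right_mono power_mono nn C) auto
    also have "\<dots> = C * 2 ^ (p + k) * (real (f n + 1) ^ (p + k) * (wr (f n) * (norm (a (f n)))\<^sup>2))"
      by (simp only: power_mult_distrib mult_ac)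
    also have "\<dots> \<le> C * 2 ^ (p + k) * M" using C by (intro mult_left_mono M) auto
    finally show ?thesis .
  qed (use b(2) M0 C in simp)
  then show "\<exists>M. \<forall>n. real (n + 1) ^ p * (wr n * (norm (b n))\<^sup>2) \<le> M" by blast
qed (use b in auto)

lemma poly_bound_sq:
  fixes p :: "complex poly"
  obtains C k where "C \<ge> 0" "\<And>n. (norm (poly p (of_nat n)))\<^sup>2 \<le> C * real (n + 1) ^ k"
proof -
  obtain C k where C: "C > 0" "\<And>n. norm (poly p (of_nat n)) \<le> C * real (n + 1) ^ k"
    using poly_bound_nat by blast
  have "(norm (poly p (of_nat n)))\<^sup>2 \<le> C\<^sup>2 * real (n + 1) ^ (2 * k)" for n
    using power_mono[OF C(2)[of n], of 2] by (simp add: power_mult_distrib power_even_eq)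
  then show ?thesis using that[of "C\<^sup>2" "2 * k"] by simp
qed

lemma rapid_poly:
  assumes a: "rapid a"
  shows "rapid (\<lambda>n. poly p (\<alpha> * of_nat n + \<beta>) * a n)"
proof -
  obtain C k where C: "C \<ge> 0" "\<And>n. (norm (poly (pcompose p [:\<beta>, \<alpha>:]) (of_nat n)))\<^sup>2 \<le> C * real (n + 1) ^ k"
    using poly_bound_sq by blast
  show ?thesis
  proof (rule rapid_dominated[OF a, where f = "\<lambda>n. n" and C = C and k = k])
    fix n assume "enat n \<le> topN S h"
    then have "wr n \<ge> 0" using wr_pos[of n] by simp
    then show "wr n * (norm (poly p (\<alpha> * of_nat n + \<beta>) * a n))\<^sup>2 \<le> C * real (n + 1) ^ k * (wr n * (norm (a n))\<^sup>2)"
      using mult_right_mono[OF C(2)[of n], of "wr n * (norm (a n))\<^sup>2"]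
      by (simp add: norm_mult power_mult_distrib poly_pcompose algebra_simps)
  qed (use C a rapid_top[OF a] in \<open>auto intro: entire_seq_poly' rapid_entire\<close>)
qed

lemma rapid_scale: "rapid a \<Longrightarrow> rapid (\<lambda>n. c * a n)"
  using rapid_poly[of a "[:c:]" 0 0] by simp

text \<open>
  With \<open>W\<close> reciprocal to the weights, the weighted squares are the terms of the entire series for
  \<open>k\<close> at \<open>\<bar>z\<bar>\<^sup>2\<close>.
\<close>

lemma rapid_kseq: "rapid (kseq z)"
  unfolding rapid_def
proof (intro conjI allI impI)
  fix p
  have "entire_seq (\<lambda>n. poly (monom 1 p) (1 * of_nat n + 1) * of_real (W n))"
    by (rule entire_seq_poly'[OF entire_seq_W])
  then have "summable (\<lambda>n. (of_nat n + 1) ^ p * of_real (W n) * complex_of_real ((norm z)\<^sup>2) ^ n)"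
    by (simp add: entire_seq_def poly_monom)
  from summable_imp_Bseq[OF this] obtain M where
    M: "\<And>n. norm ((of_nat n + 1) ^ p * of_real (W n) * complex_of_real ((norm z)\<^sup>2) ^ n) \<le> M"
    by (auto simp: Bseq_def)
  have "real (n + 1) ^ p * (wr n * (norm (kseq z n))\<^sup>2) \<le> M" for n
  proof -
    have n1: "norm (of_nat n + 1 :: complex) = real (n + 1)" by (metis norm_of_nat of_nat_Suc Suc_eq_plus1 add.commute)
    have e: "wr n * (W n)\<^sup>2 = W n" using wr_pos[of n] by (simp add: W_def power2_eq_square)
    have "real (n + 1) ^ p * (wr n * (norm (kseq z n))\<^sup>2) = real (n + 1) ^ p * (wr n * (W n)\<^sup>2) * ((norm z)\<^sup>2) ^ n"
      by (simp add: kseq_def norm_mult power_mult_distrib norm_power power_commutes mult_ac flip: power_mult)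
    also have "\<dots> = norm ((of_nat n + 1) ^ p * of_real (W n) * complex_of_real ((norm z)\<^sup>2) ^ n)"
      unfolding e using W_nonneg[of n] by (simp add: norm_mult norm_power n1 del: of_nat_add)
    finally show ?thesis using M[of n] by simp
  qed
  then show "\<exists>M. \<forall>n. real (n + 1) ^ p * (wr n * (norm (kseq z n))\<^sup>2) \<le> M" by blast
qed (auto simp: entire_seq_kseq kseq_def W_def)

subsection \<open>The generators\<close>

text \<open>
  The generators on coefficient sequences.  The time for \<open>opA\<close> is \<open>(n + 1) h\<close> because \<open>A\<close> is the
  flow at the time \<open>h w d/dw + h\<close>.
\<close>

definition opA :: "'n \<Rightarrow> (nat \<Rightarrow> complex) \<Rightarrow> nat \<Rightarrow> complex" where
  "opA i a n = of_real (flow S (real (Suc n) * h) (pt S) $ i) * a n"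

definition opB :: "(nat \<Rightarrow> complex) \<Rightarrow> nat \<Rightarrow> complex" where
  "opB a n = (case n of 0 \<Rightarrow> 0 | Suc k \<Rightarrow> Dt (real (Suc k) * h) * a k)"

definition opC :: "(nat \<Rightarrow> complex) \<Rightarrow> nat \<Rightarrow> complex" where
  "opC a n = Et (real (Suc n) * h) * a (Suc n)"

lemma opA_alt: "opA i a = (\<lambda>n. poly (base_poly S i) (of_real h * of_nat n + of_real h) * a n)"
  by (simp add: opA_def fun_eq_iff flip: poly_base_poly) (simp add: algebra_simps)

lemma opB_alt: "opB a = (\<lambda>n. poly (along S (Dp S)) (of_real h * of_nat n + 0) * shift_right a n)"
  by (auto simp: opB_def fun_eq_iff Dt_def shift_right_def mult_ac split: nat.splits)

lemma opC_alt: "opC a = (\<lambda>n. (\<lambda>n. poly (along S (Ep S)) (of_real h * of_nat n + 0) * a n) (Suc n))"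
  by (auto simp: opC_def fun_eq_iff Et_def mult_ac)

lemma entire_opA: "entire_seq a \<Longrightarrow> entire_seq (opA i a)"
  unfolding opA_alt by (rule entire_seq_poly')

lemma entire_opB: "entire_seq a \<Longrightarrow> entire_seq (opB a)"
  unfolding opB_alt by (intro entire_seq_poly' entire_seq_shift_right)

lemma entire_opC: "entire_seq a \<Longrightarrow> entire_seq (opC a)"
  unfolding opC_alt by (intro entire_seq_shift_left entire_seq_poly')

lemma A_op_ser: "entire_seq a \<Longrightarrow> A_op S h i (ser a) = ser (opA i a)"
  unfolding A_op_def opA_alt
proof (rule poly_op_ser)
  fix a assume a: "entire_seq a"
  show "(\<lambda>w. euler h (ser a) w + of_real h * ser a w) = ser (\<lambda>n. (of_real h * of_nat n + of_real h) * a n)"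
    using a by (simp add: euler_ser fun_eq_iff ser_add[symmetric] ser_scale[symmetric] entire_seq_scale
      entire_seq_nat distrib_right mult.assoc)
qed

lemma B_op_ser: assumes a: "entire_seq a" shows "B_op S h (ser a) = ser (opB a)"
proof -
  have "(\<lambda>w. w * ser a w) = ser (shift_right a)" by (simp add: fun_eq_iff ser_shift_right a)
  then show ?thesis
    unfolding B_op_def opB_alt
    using poly_op_ser[of "euler h" "of_real h" 0, OF _ entire_seq_shift_right[OF a]] euler_ser by simp
qed

lemma C_op_ser: assumes a: "entire_seq a" shows "C_op S h (ser a) = ser (opC a)"
proof -
  define b where "b = (\<lambda>n. poly (along S (Ep S)) (of_real h * of_nat n + 0) * a n)"
  have b: "entire_seq b" unfolding b_def by (rule entire_seq_poly'[OF a])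
  have b0: "b 0 = 0" using Et_0 by (simp add: b_def Et_def)
  have v: "poly_op (along S (Ep S)) (euler h) (ser a) = ser b"
    unfolding b_def by (rule poly_op_ser[OF _ a]) (simp add: euler_ser)
  have sr: "shift_right (\<lambda>n. b (Suc n)) = b"
    using b0 by (auto simp: shift_right_def fun_eq_iff split: nat.splits)
  have "ser b w = w * ser (\<lambda>n. b (Suc n)) w" for w
    using ser_shift_right[OF entire_seq_shift_left[OF b], of w] unfolding sr .
  then have "C_op S h (ser a) w = ser (\<lambda>n. b (Suc n)) w" for w
    by (simp add: C_op_def v Let_def deriv_ser[OF b] diffs_def)
  then show ?thesis by (auto simp: opC_alt b_def)
qed

lemma rapid_opA: "rapid a \<Longrightarrow> rapid (opA i a)"
  unfolding opA_alt by (rule rapid_poly)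

lemma Rp_bound: obtains C k where "C \<ge> 0" "\<And>n. poly Rp (real n * h) \<le> C * real (n + 1) ^ k"
proof -
  obtain C k where C: "C > 0" "\<And>n. norm (poly (map_poly of_real (pcompose Rp [:0, h:])) (of_nat n :: complex)) \<le> C * real (n + 1) ^ k"
    using poly_bound_nat by blast
  have "poly Rp (real n * h) \<le> C * real (n + 1) ^ k" for n
  proof -
    have "poly (map_poly of_real (pcompose Rp [:0, h:])) (of_nat n) = complex_of_real (poly Rp (real n * h))"
      using ring_hom_poly_comp[OF ring_hom_of_real, of "pcompose Rp [:0, h:]" "real n"] by (simp add: poly_pcompose)
    then show ?thesis using C(2)[of n] by (metis abs_le_D1 norm_of_real)
  qed
  then show ?thesis using that C(1) by (metis less_imp_le)
qed

text \<open>
  One step up multiplies the weighted square by \<open>H \<bar>D\<bar>\<^sup>2 = R\<close>, which is polynomial in \<open>n\<close>.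
\<close>

lemma rapid_opB: assumes a: "rapid a" shows "rapid (opB a)"
proof -
  obtain C k where C: "C \<ge> 0" "\<And>n. poly Rp (real n * h) \<le> C * real (n + 1) ^ k"
    using Rp_bound by blast
  show ?thesis
  proof (rule rapid_dominated[OF a, where f = "\<lambda>n. n - 1" and C = C and k = k])
    fix n assume n: "enat n \<le> topN S h"
    show "wr n * (norm (opB a n))\<^sup>2 \<le> C * real (n + 1) ^ k * (wr (n - 1) * (norm (a (n - 1)))\<^sup>2)"
    proof (cases n)
      case 0
      then show ?thesis using C(1) by (simp add: opB_def)
    next
      case (Suc m)
      let ?t = "real (Suc m) * h"
      have r: "in_range ?t" using top_in_range n Suc by blast
      have "wr n * (norm (opB a n))\<^sup>2 = (Hr ?t * poly Qp ?t) * (wr m * (norm (a m))\<^sup>2)"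
        by (simp add: Suc opB_def wr_Suc norm_mult power_mult_distrib Qp_eq del: of_nat_Suc)
      also have "\<dots> = poly Rp ?t * (wr m * (norm (a m))\<^sup>2)" by (simp only: Rp_Hr[OF r])
      also have "\<dots> \<le> (C * real (n + 1) ^ k) * (wr m * (norm (a m))\<^sup>2)"
        using C(2)[of n] n wr_pos[of m] top_Suc[of m] by (intro mult_right_mono) (auto simp: Suc simp del: of_nat_Suc)
      finally show ?thesis by (simp add: Suc)
    qed
  next
    fix n assume n: "\<not> enat n \<le> topN S h"
    then obtain m where m: "n = Suc m" by (cases n) auto
    show "opB a n = 0"
      using n Dt_top[of m] rapid_top[OF a, of m] by (cases "enat m \<le> topN S h") (auto simp: m opB_def simp del: of_nat_Suc)
  qed (use C rapid_entire[OF a] in \<open>auto intro: entire_opB\<close>)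
qed

text \<open>
  One step down multiplies the weighted square by \<open>\<bar>E\<bar>\<^sup>2 / H = R\<close>.
\<close>

lemma rapid_opC: assumes a: "rapid a" shows "rapid (opC a)"
proof -
  obtain C k where C: "C \<ge> 0" "\<And>n. poly Rp (real n * h) \<le> C * real (n + 1) ^ k"
    using Rp_bound by blast
  have top0: "opC a n = 0" if n: "\<not> enat (Suc n) \<le> topN S h" for n
    using rapid_top[OF a n] by (simp add: opC_def)
  show ?thesis
  proof (rule rapid_dominated[OF a, where f = Suc and C = "C * 2 ^ k" and k = k])
    fix n assume n: "enat n \<le> topN S h"
    show "wr n * (norm (opC a n))\<^sup>2 \<le> (C * 2 ^ k) * real (n + 1) ^ k * (wr (Suc n) * (norm (a (Suc n)))\<^sup>2)"
    proof (cases "enat (Suc n) \<le> topN S h")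
      case True
      let ?t = "real (Suc n) * h"
      have r: "in_range ?t" "?t > 0" using top_in_range[OF True] h_pos by (auto simp del: of_nat_Suc)
      have R: "poly Rp ?t > 0" "poly Qp ?t > 0" using Rp_pos[OF r] Qp_pos[OF r(1)] by auto
      have "(norm (Et ?t))\<^sup>2 * poly Qp ?t = (poly Rp ?t)\<^sup>2"
        using arg_cong[OF DE[of ?t], of norm] R by (simp add: Qp_eq norm_mult power_mult_distrib mult.commute del: of_nat_Suc flip: power_mult_distrib)
      then have "(norm (Et ?t))\<^sup>2 = poly Rp ?t * Hr ?t"
        using R by (simp add: Hr_def field_simps power2_eq_square del: of_nat_Suc)
      then have "wr n * (norm (opC a n))\<^sup>2 = poly Rp ?t * (wr (Suc n) * (norm (a (Suc n)))\<^sup>2)"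
        by (simp add: opC_def wr_Suc norm_mult power_mult_distrib del: of_nat_Suc)
      also have "\<dots> \<le> (C * real (Suc n + 1) ^ k) * (wr (Suc n) * (norm (a (Suc n)))\<^sup>2)"
        using C(2)[of "Suc n"] wr_pos[OF True] by (intro mult_right_mono) (auto simp del: of_nat_Suc)
      also have "\<dots> \<le> (C * (2 * real (n + 1)) ^ k) * (wr (Suc n) * (norm (a (Suc n)))\<^sup>2)"
        using C(1) wr_pos[OF True] by (intro mult_right_mono mult_left_mono power_mono) auto
      finally show ?thesis by (simp only: power_mult_distrib mult_ac)
    qed (use top0 rapid_top[OF a] in simp)
  qed (use C rapid_entire[OF a] top0 top_Suc in \<open>auto intro: entire_opC\<close>)
qed

end

section \<open>The representation on the domain\<close>

lemma ser_zero [simp]: "ser (\<lambda>n. 0) = (\<lambda>w. 0)"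
  by (rule ext) (simp add: ser_def)

context quantized_surface
begin

definition ips :: "(nat \<Rightarrow> complex) \<Rightarrow> (nat \<Rightarrow> complex) \<Rightarrow> complex" where
  "ips a b = suminf (\<lambda>n. of_real (wr n) * a n * cnj (b n))"

lemma ip_ser: "rapid a \<Longrightarrow> rapid b \<Longrightarrow> ip S h (ser a) (ser b) = ips a b"
  by (simp add: ip_def ips_def wt_wr tcoeff_ser rapid_entire)

lemma ips_summable:
  assumes a: "rapid a" and b: "rapid b"
  shows "summable (\<lambda>n. of_real (wr n) * a n * cnj (b n))"
proof (rule summable_comparison_test'[of "\<lambda>n. wr n * (norm (a n))\<^sup>2 + wr n * (norm (b n))\<^sup>2" 0])
  show "summable (\<lambda>n. wr n * (norm (a n))\<^sup>2 + wr n * (norm (b n))\<^sup>2)"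
    using rapid_summable[OF a, of 0] rapid_summable[OF b, of 0] by (intro summable_add) simp_all
  fix n
  show "norm (of_real (wr n) * a n * cnj (b n)) \<le> wr n * (norm (a n))\<^sup>2 + wr n * (norm (b n))\<^sup>2"
  proof (cases "enat n \<le> topN S h")
    case True
    then have w: "wr n > 0" by (rule wr_pos)
    have "norm (a n) * norm (b n) \<le> (norm (a n))\<^sup>2 + (norm (b n))\<^sup>2"
      using sum_squares_bound[of "norm (a n)" "norm (b n)"] mult_nonneg_nonneg[OF norm_ge_zero[of "a n"] norm_ge_zero[of "b n"]]
      by linarith
    then show ?thesis using w by (simp add: norm_mult mult.assoc flip: distrib_left)
  qed (simp add: rapid_top[OF a] rapid_top[OF b])
qed

lemma ips_add: "rapid a \<Longrightarrow> rapid b \<Longrightarrow> rapid c \<Longrightarrow> ips (\<lambda>n. a n + b n) c = ips a c + ips b c"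
  unfolding ips_def by (subst suminf_add[OF ips_summable ips_summable]) (simp_all add: algebra_simps)

lemma ips_scale: "rapid a \<Longrightarrow> rapid c \<Longrightarrow> ips (\<lambda>n. k * a n) c = k * ips a c"
  unfolding ips_def by (subst suminf_mult[OF ips_summable, symmetric]) (simp_all add: algebra_simps)

lemma ips_cnj: "rapid a \<Longrightarrow> rapid b \<Longrightarrow> cnj (ips a b) = ips b a"
proof -
  assume "rapid a" "rapid b"
  from sums_cnj[THEN iffD2, OF summable_sums[OF ips_summable[OF this]]]
  have "(\<lambda>n. of_real (wr n) * b n * cnj (a n)) sums cnj (ips a b)"
    by (simp add: ips_def mult_ac)
  then show ?thesis by (simp add: ips_def sums_iff)
qed

lemma ips_pos:
  assumes a: "rapid a" and z: "ips a a = 0"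
  shows "a n = 0"
proof -
  have s: "summable (\<lambda>n. wr n * (norm (a n))\<^sup>2)" using rapid_summable[OF a, of 0] by simp
  have nn: "wr n * (norm (a n))\<^sup>2 \<ge> 0" for n using rapid_top[OF a] by (intro weight_nonneg) auto
  have "ips a a = of_real (suminf (\<lambda>n. wr n * (norm (a n))\<^sup>2))"
    unfolding ips_def suminf_of_real[OF s] mult.assoc complex_norm_square[symmetric] by simp
  then have "suminf (\<lambda>n. wr n * (norm (a n))\<^sup>2) = 0" using z by simp
  then have "wr n * (norm (a n))\<^sup>2 = 0" using suminf_eq_zero_iff[OF s nn] by simp
  then show ?thesis using wr_pos[of n] rapid_top[OF a, of n] by (cases "enat n \<le> topN S h") auto
qed

lemma dom_L_E: assumes "u \<in> dom_L S h" obtains a where "rapid a" "u = ser a"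
  using assms by (auto simp: dom_L_iff)

lemma ser_in_dom: "rapid a \<Longrightarrow> ser a \<in> dom_L S h"
  by (auto simp: dom_L_iff)

lemma ser_lin: "rapid a \<Longrightarrow> rapid b \<Longrightarrow> (\<lambda>w. c * ser a w + ser b w) = ser (\<lambda>n. c * a n + b n)"
  by (simp add: fun_eq_iff ser_add ser_scale rapid_entire entire_seq_scale)

lemma rapid_lin: "rapid a \<Longrightarrow> rapid b \<Longrightarrow> rapid (\<lambda>n. c * a n + b n)"
  by (intro rapid_add rapid_scale)

lemma dom_L_lin: "u \<in> dom_L S h \<Longrightarrow> v \<in> dom_L S h \<Longrightarrow> (\<lambda>w. c * u w + v w) \<in> dom_L S h"
  by (elim dom_L_E) (simp add: ser_lin ser_in_dom rapid_lin)

lemma ip_lin: "u \<in> dom_L S h \<Longrightarrow> v \<in> dom_L S h \<Longrightarrow> x \<in> dom_L S h \<Longrightarrow>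
   ip S h (\<lambda>w. c * u w + v w) x = c * ip S h u x + ip S h v x"
  by (elim dom_L_E) (simp add: ser_lin ip_ser rapid_lin ips_add ips_scale rapid_scale)

lemma ip_cnj: "u \<in> dom_L S h \<Longrightarrow> v \<in> dom_L S h \<Longrightarrow> cnj (ip S h u v) = ip S h v u"
  by (elim dom_L_E) (simp add: ip_ser ips_cnj)

lemma ip_lin_right: "u \<in> dom_L S h \<Longrightarrow> v \<in> dom_L S h \<Longrightarrow> x \<in> dom_L S h \<Longrightarrow>
   ip S h x (\<lambda>w. c * u w + v w) = cnj c * ip S h x u + ip S h x v"
  by (subst (1 2 3) ip_cnj[symmetric]) (simp_all add: dom_L_lin ip_lin)

lemma ip_pos: "u \<in> dom_L S h \<Longrightarrow> ip S h u u = 0 \<Longrightarrow> u = (\<lambda>w. 0)"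
proof (elim dom_L_E)
  fix a assume a: "rapid a" "u = ser a" "ip S h u u = 0"
  then have "a = (\<lambda>n. 0)" using ips_pos[of a] by (auto simp: ip_ser)
  then show "u = (\<lambda>w. 0)" using a by (simp add: ser_def fun_eq_iff)
qed

subsection \<open>Operators with an adjoint\<close>

lemma operators_id: "id \<in> operators S h"
  by (auto simp: operators_def adjoint_on_def intro!: exI[of _ id])

lemma operators_comp:
  assumes "T \<in> operators S h" "U \<in> operators S h"
  shows "T \<circ> U \<in> operators S h"
proof -
  obtain T' where T': "\<forall>u\<in>dom_L S h. T' u \<in> dom_L S h" "adjoint_on S h T T'" using assms by (auto simp: operators_def)
  obtain U' where U': "\<forall>u\<in>dom_L S h. U' u \<in> dom_L S h" "adjoint_on S h U U'" using assms by (auto simp: operators_def)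
  have "adjoint_on S h (T \<circ> U) (U' \<circ> T')"
    using assms T' U' by (auto simp: adjoint_on_def operators_def)
  then show ?thesis using assms T' U' unfolding operators_def
    by (auto intro!: exI[of _ "U' \<circ> T'"])
qed

lemma operators_lin:
  assumes T: "T \<in> operators S h" and U: "U \<in> operators S h"
  shows "(\<lambda>u w. c * T u w + U u w) \<in> operators S h"
proof -
  obtain T' where T': "\<forall>u\<in>dom_L S h. T' u \<in> dom_L S h" "adjoint_on S h T T'" using T by (auto simp: operators_def)
  obtain U' where U': "\<forall>u\<in>dom_L S h. U' u \<in> dom_L S h" "adjoint_on S h U U'" using U by (auto simp: operators_def)
  have dom: "T u \<in> dom_L S h" "U u \<in> dom_L S h" if "u \<in> dom_L S h" for u
    using T U that by (auto simp: operators_def)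
  have lin: "T (\<lambda>w. d * u w + v w) = (\<lambda>w. d * T u w + T v w)" "U (\<lambda>w. d * u w + v w) = (\<lambda>w. d * U u w + U v w)"
    if "u \<in> dom_L S h" "v \<in> dom_L S h" for u v d
    using T U that by (auto simp: operators_def)
  have "adjoint_on S h (\<lambda>u w. c * T u w + U u w) (\<lambda>u w. cnj c * T' u w + U' u w)"
    using T' U' dom by (auto simp: adjoint_on_def ip_lin ip_lin_right)
  moreover have "(\<lambda>w. cnj c * T' u w + U' u w) \<in> dom_L S h" if "u \<in> dom_L S h" for u
    using T' U' that by (auto intro: dom_L_lin)
  ultimately have adj: "\<exists>V'. (\<forall>u\<in>dom_L S h. V' u \<in> dom_L S h) \<and> adjoint_on S h (\<lambda>u w. c * T u w + U u w) V'"
    by (intro exI[of _ "\<lambda>u w. cnj c * T' u w + U' u w"]) simp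
  show ?thesis unfolding operators_def mem_Collect_eq
  proof (intro conjI ballI allI adj)
    fix u v d assume uv: "u \<in> dom_L S h" "v \<in> dom_L S h"
    show "(\<lambda>w. c * T (\<lambda>w. d * u w + v w) w + U (\<lambda>w. d * u w + v w) w) =
       (\<lambda>w. d * (c * T u w + U u w) + (c * T v w + U v w))"
      by (simp only: lin[OF uv]) (simp add: algebra_simps)
  qed (intro dom_L_lin dom)
qed

lemma operators_0: "(\<lambda>u w. 0) \<in> operators S h"
  using operators_lin[OF operators_id operators_id, of "-1"] by simp

lemma adjoint_A: "adjoint_on S h (A_op S h i) (A_op S h i)"
  unfolding adjoint_on_def
proof (intro ballI)
  fix u v assume "u \<in> dom_L S h" "v \<in> dom_L S h"
  then obtain a b where *: "rapid a" "u = ser a" "rapid b" "v = ser b" by (elim dom_L_E) blast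
  then show "ip S h (A_op S h i u) v = ip S h u (A_op S h i v)"
    by (simp add: A_op_ser rapid_entire ip_ser rapid_opA) (simp add: ips_def opA_def mult_ac)
qed

text \<open>
  Comparing coefficients, the weights \<open>wr (n + 1) = wr n H\<close> leave to check that \<open>H D\<close> is the conjugate
  of \<open>E\<close> at the time \<open>(n + 1) h\<close>.  Beyond \<open>N\<close>, where \<open>D\<close> may vanish, the coefficients of the second vector do.
\<close>

lemma adjoint_B: "adjoint_on S h (B_op S h) (C_op S h)"
  unfolding adjoint_on_def
proof (intro ballI)
  fix u v assume "u \<in> dom_L S h" "v \<in> dom_L S h"
  then obtain a b where *: "rapid a" "u = ser a" "rapid b" "v = ser b" by (elim dom_L_E) blast
  have "ips (opB a) b = suminf (\<lambda>n. of_real (wr (Suc n)) * opB a (Suc n) * cnj (b (Suc n)))"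
    unfolding ips_def by (subst suminf_split_head[OF ips_summable[OF rapid_opB[OF *(1)] *(3)]]) (simp add: opB_def)
  also have "\<dots> = ips a (opC b)"
    unfolding ips_def
  proof (rule suminf_cong)
    fix n
    let ?t = "real (Suc n) * h"
    show "of_real (wr (Suc n)) * opB a (Suc n) * cnj (b (Suc n)) = of_real (wr n) * a n * cnj (opC b n)"
    proof (cases "enat (Suc n) \<le> topN S h")
      case True
      then have D: "Dt ?t \<noteq> 0" by (intro Dt_nonzero top_in_range)
      have "of_real (Hr ?t) * Dt ?t = cnj (Et ?t)"
        using HH_eq[of ?t, symmetric] D by (simp add: HH_def Dt_def Et_def)
      moreover have "of_real (wr (Suc n)) * opB a (Suc n) * cnj (b (Suc n)) =
          of_real (wr n) * a n * ((of_real (Hr ?t) * Dt ?t) * cnj (b (Suc n)))"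
        by (simp add: opB_def wr_Suc mult_ac del: of_nat_Suc)
      ultimately show ?thesis by (simp add: opC_def del: of_nat_Suc)
    qed (simp add: rapid_top[OF *(3)] opC_def)
  qed
  finally show "ip S h (B_op S h u) v = ip S h u (C_op S h v)"
    using * by (simp add: B_op_ser C_op_ser rapid_entire ip_ser rapid_opB rapid_opC)
qed

lemma gen_op_dom: "u \<in> dom_L S h \<Longrightarrow> gen_op S h v u \<in> dom_L S h"
  by (elim dom_L_E) (auto simp: gen_op_def A_op_ser B_op_ser C_op_ser rapid_entire split: gen.splits
    intro!: ser_in_dom rapid_opA rapid_opB rapid_opC)

lemma gen_op_lin:
  assumes "u \<in> dom_L S h" "v \<in> dom_L S h"
  shows "gen_op S h g (\<lambda>w. c * u w + v w) = (\<lambda>w. c * gen_op S h g u w + gen_op S h g v w)"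
proof -
  obtain a b where *: "rapid a" "u = ser a" "rapid b" "v = ser b" using assms by (elim dom_L_E) blast
  have lin: "entire_seq (\<lambda>n. c * a n + b n)" using rapid_lin * by (auto intro: rapid_entire)
  have "opA i (\<lambda>n. c * a n + b n) = (\<lambda>n. c * opA i a n + opA i b n)" for i
    by (simp add: opA_def fun_eq_iff algebra_simps)
  moreover have "opB (\<lambda>n. c * a n + b n) = (\<lambda>n. c * opB a n + opB b n)"
    by (simp add: opB_def fun_eq_iff algebra_simps split: nat.splits)
  moreover have "opC (\<lambda>n. c * a n + b n) = (\<lambda>n. c * opC a n + opC b n)"
    by (simp add: opC_def fun_eq_iff algebra_simps)
  ultimately show ?thesis
    using * by (cases g) (simp_all add: gen_op_def ser_lin A_op_ser B_op_ser C_op_ser rapid_entire lin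
      rapid_opA rapid_opB rapid_opC)
qed

lemma adjoint_C: "adjoint_on S h (C_op S h) (B_op S h)"
  unfolding adjoint_on_def
proof (intro ballI)
  fix u v assume uv: "u \<in> dom_L S h" "v \<in> dom_L S h"
  have d: "B_op S h v \<in> dom_L S h" "C_op S h u \<in> dom_L S h"
    using gen_op_dom[of v gB] gen_op_dom[of u gC] uv by (simp_all add: gen_op_def)
  then show "ip S h (C_op S h u) v = ip S h u (B_op S h v)"
    using adjoint_B uv ip_cnj by (metis adjoint_on_def)
qed

lemma gen_op_operators: "gen_op S h g \<in> operators S h"
proof -
  define g' where "g' = (case g of gB \<Rightarrow> gC | gA i \<Rightarrow> gA i | gC \<Rightarrow> gB)"
  have "adjoint_on S h (gen_op S h g) (gen_op S h g')"
    by (cases g) (simp_all add: g'_def gen_op_def adjoint_A adjoint_B adjoint_C)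
  then show ?thesis
    unfolding operators_def using gen_op_dom gen_op_lin by blast
qed

lemma word_operators: "foldr (gen_op S h) ls \<in> operators S h"
proof (induction ls)
  case (Cons g ls)
  from operators_comp[OF gen_op_operators this] show ?case by (simp add: comp_def fun_eq_iff[symmetric] o_def)
qed (simp add: operators_id flip: id_def)

lemma rep_zero: "rep S h 0 = (\<lambda>u w. 0)"
  by (intro ext) (simp add: rep_def)

lemma rep_add: "rep S h (x + y) u w = rep S h x u w + rep S h y u w"
  unfolding rep_def
  using keys_sum_add[of "\<lambda>q c. c * foldr (gen_op S h) (letters q) u w" x y] by (simp add: algebra_simps)

lemma rep_single: "rep S h (Poly_Mapping.single q c) u w = c * foldr (gen_op S h) (letters q) u w"
  unfolding rep_def by (cases "c = 0") auto

lemma rep_minus: "rep S h (x - y) u w = rep S h x u w - rep S h y u w"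
  using rep_add[of "x - y" y u w] by simp

lemma rep_operators: "rep S h x \<in> operators S h"
proof (induction x rule: poly_mapping_single_induct)
  case zero
  then show ?case by (simp add: rep_zero operators_0)
next
  case (single q c)
  have "rep S h (Poly_Mapping.single q c) = (\<lambda>u w. c * foldr (gen_op S h) (letters q) u w + (\<lambda>u w. 0) u w)"
    by (simp add: fun_eq_iff rep_single)
  then show ?case using operators_lin[OF word_operators operators_0, of c "letters q"] by simp
next
  case (add x y)
  have "rep S h (x + y) = (\<lambda>u w. 1 * rep S h x u w + rep S h y u w)"
    by (simp add: fun_eq_iff rep_add)
  then show ?case using operators_lin[OF add, of 1] by simp
qed

lemma rep_gen: "rep S h (fgen g) u = gen_op S h g u"
  by (simp add: fun_eq_iff fgen_def rep_single)

lemma rep_times_gen: "rep S h (x * fgen g) u = rep S h x (gen_op S h g u)"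
proof (rule ext)
  fix w
  show "rep S h (x * fgen g) u w = rep S h x (gen_op S h g u) w"
  proof (induction x rule: poly_mapping_single_induct)
    case (single q c)
    show ?case by (simp add: fgen_def mult_single rep_single plus_word_def)
  qed (simp_all add: rep_zero rep_add distrib_right)
qed

subsection \<open>Irreducibility\<close>

definition unit_seq :: "nat \<Rightarrow> nat \<Rightarrow> complex" where "unit_seq k n = (if n = k then 1 else 0)"

lemma rapid_unit: assumes "enat k \<le> topN S h" shows "rapid (unit_seq k)"
  unfolding rapid_def
proof (intro conjI allI impI)
  show "entire_seq (unit_seq k)" unfolding entire_seq_def
    by (intro allI summable_finite[of "{k}"]) (auto simp: unit_seq_def)
  fix p
  have "real (n + 1) ^ p * (wr n * (norm (unit_seq k n))\<^sup>2) \<le> real (k + 1) ^ p * wr k" for n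
    using wr_pos[OF assms] by (auto simp: unit_seq_def)
  then show "\<exists>M. \<forall>n. real (n + 1) ^ p * (wr n * (norm (unit_seq k n))\<^sup>2) \<le> M" by blast
qed (use assms in \<open>auto simp: unit_seq_def\<close>)

lemma ser_unit_0: "ser (unit_seq 0) = (\<lambda>w. 1)"
proof
  fix w :: complex
  have "(\<lambda>n. unit_seq 0 n * w ^ n) = (\<lambda>n. if n = 0 then w ^ n else 0)"
    by (simp add: unit_seq_def fun_eq_iff)
  then have "(\<lambda>n. unit_seq 0 n * w ^ n) sums 1"
    using sums_single[of 0 "\<lambda>n. w ^ n"] by simp
  then show "ser (unit_seq 0) w = 1" by (simp add: ser_def sums_iff)
qed

text \<open>
  Up to nonzero factors \<open>D(n h)\<close>, the powers of \<open>B\<close> turn the constant 1 into all monomials of degree at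
  most \<open>N\<close>, and only 0 is orthogonal to all of them.
\<close>

lemma vacuum_cyclic:
  assumes V: "invariant_subspace S h V" "(\<lambda>w. 1) \<in> V" and Y: "Y \<subseteq> dom_L S h"
    and orth: "\<And>v w. v \<in> V \<Longrightarrow> w \<in> Y \<Longrightarrow> ip S h v w = 0" and w: "w \<in> Y"
  shows "w = (\<lambda>x. 0)"
proof -
  obtain b where b: "rapid b" "w = ser b" using Y w by (blast elim: dom_L_E)
  have mem: "enat k \<le> topN S h \<Longrightarrow> ser (unit_seq k) \<in> V" for k
  proof (induction k)
    case 0
    then show ?case using V(2) by (simp add: ser_unit_0)
  next
    case (Suc k)
    then have k: "ser (unit_seq k) \<in> V" "rapid (unit_seq k)" using top_Suc rapid_unit by blast+
    let ?d = "Dt (real (Suc k) * h)"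
    have d: "?d \<noteq> 0" using Suc.prems by (intro Dt_nonzero top_in_range)
    have "opB (unit_seq k) = (\<lambda>n. ?d * unit_seq (Suc k) n + (\<lambda>n. 0) n)"
      by (auto simp: opB_def unit_seq_def fun_eq_iff split: nat.splits)
    moreover have "rep S h (fgen gB) (ser (unit_seq k)) \<in> V" using V k by (auto simp: invariant_subspace_def)
    ultimately have "ser (\<lambda>n. ?d * unit_seq (Suc k) n) \<in> V"
      using k by (simp add: rep_gen gen_op_def B_op_ser rapid_entire)
    moreover have "ser (\<lambda>n. ?d * unit_seq (Suc k) n) = (\<lambda>w. ?d * ser (unit_seq (Suc k)) w)"
      by (rule ext) (intro ser_scale rapid_entire rapid_unit Suc.prems)
    ultimately have "(\<lambda>w. ?d * ser (unit_seq (Suc k)) w) \<in> V" by simp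
    moreover have "(\<lambda>w. 0) \<in> V" and "\<And>u v c. u \<in> V \<Longrightarrow> v \<in> V \<Longrightarrow> (\<lambda>w. c * u w + v w) \<in> V"
      using V by (auto simp: invariant_subspace_def)
    ultimately have "(\<lambda>w. 1 / ?d * (?d * ser (unit_seq (Suc k)) w) + 0) \<in> V" by blast
    then show ?case using d by simp
  qed
  have "b n = 0" for n
  proof (cases "enat n \<le> topN S h")
    case True
    have "ips (unit_seq n) b = 0"
      using orth[OF mem[OF True] w] b rapid_unit[OF True] by (simp add: ip_ser)
    moreover have "(\<lambda>k. of_real (wr k) * unit_seq n k * cnj (b k)) sums (of_real (wr n) * cnj (b n))"
      using sums_If_finite_set[of "{n}" "\<lambda>k. of_real (wr k) * cnj (b k)"]
      by (simp add: unit_seq_def if_distrib if_distribR cong: if_cong)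
    ultimately show ?thesis using wr_pos[OF True] by (simp add: ips_def sums_iff)
  qed (rule rapid_top[OF b(1)])
  then have "b = (\<lambda>n. 0)" by auto
  then show ?thesis using b by (simp add: ser_def fun_eq_iff)
qed

text \<open>
  \<open>B C\<close> multiplies \<open>u\<^sub>n\<close> by \<open>R(n h)\<close>, which is positive for \<open>0 < n \<le> N\<close>.
\<close>

lemma number_kernel:
  assumes a: "rapid a" and z: "B_op S h (C_op S h (ser a)) = (\<lambda>w. 0)" and n: "n > 0"
  shows "a n = 0"
proof (cases "enat n \<le> topN S h")
  case True
  have "ser (opB (opC a)) = ser (\<lambda>n. 0)"
    using z a by (simp add: C_op_ser B_op_ser rapid_entire rapid_opC)
  then have "opB (opC a) = (\<lambda>n. 0)"
    using a by (subst (asm) ser_inj) (auto intro: rapid_entire rapid_opB rapid_opC)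
  then have "opB (opC a) n = 0" by simp
  moreover obtain m where m: "n = Suc m" using n by (cases n) auto
  moreover have "in_range (real n * h)" "real n * h > 0" using top_in_range[OF True] n h_pos by auto
  then have "poly Rp (real n * h) > 0" by (rule Rp_pos)
  ultimately show ?thesis using DE[of "real n * h"] by (auto simp: opB_def opC_def simp del: of_nat_Suc)
qed (rule rapid_top[OF a])

text \<open>
  Decompose \<open>1 = v + w\<close>.  As \<open>B C 1 = 0\<close>, the vectors \<open>B C v\<close> and \<open>B C w\<close> are opposite; they lie in
  orthogonal subspaces, so both vanish.  Hence \<open>v\<close> and \<open>w\<close> are constants, one of the two
  subspaces contains 1, and by cyclicity the other one is 0.
\<close>

lemma irreducible: "irreducible_rep S h"
  unfolding irreducible_rep_def
proof (intro conjI allI impI)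
  have one: "(\<lambda>w. 1) \<in> dom_L S h" using ser_in_dom[OF rapid_unit[of 0]] by (simp add: ser_unit_0)
  then show "dom_L S h \<noteq> {\<lambda>w. 0}" by (auto simp: fun_eq_iff)
  fix V Y
  assume "invariant_subspace S h V \<and> invariant_subspace S h Y \<and>
        (\<forall>v\<in>V. \<forall>w\<in>Y. ip S h v w = 0) \<and>
        (\<forall>u\<in>dom_L S h. \<exists>v\<in>V. \<exists>w\<in>Y. u = (\<lambda>x. v x + w x))"
  then have V: "invariant_subspace S h V" and Y: "invariant_subspace S h Y"
    and orth: "\<And>v w. v \<in> V \<Longrightarrow> w \<in> Y \<Longrightarrow> ip S h v w = 0"
    and sum: "\<And>u. u \<in> dom_L S h \<Longrightarrow> \<exists>v\<in>V. \<exists>w\<in>Y. u = (\<lambda>x. v x + w x)" by blast+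
  have Vd: "V \<subseteq> dom_L S h" and Yd: "Y \<subseteq> dom_L S h" using V Y by (auto simp: invariant_subspace_def)
  have linV: "(\<lambda>w. c * u w + v w) \<in> V" if "u \<in> V" "v \<in> V" for u v c
    using V that by (auto simp: invariant_subspace_def)
  have linY: "(\<lambda>w. c * u w + v w) \<in> Y" if "u \<in> Y" "v \<in> Y" for u v c
    using Y that by (auto simp: invariant_subspace_def)
  have zV: "(\<lambda>w. 0) \<in> V" and zY: "(\<lambda>w. 0) \<in> Y" using V Y by (auto simp: invariant_subspace_def)
  obtain v w where vw: "v \<in> V" "w \<in> Y" "(\<lambda>x. 1) = (\<lambda>x. v x + w x)" using sum[OF one] by blast
  define T where "T = rep S h (fgen gB * fgen gC)"
  have T: "T u = B_op S h (C_op S h u)" for u by (simp add: T_def rep_times_gen rep_gen gen_op_def)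
  have Tlin: "T (\<lambda>w. c * u w + x w) = (\<lambda>w. c * T u w + T x w)" if "u \<in> dom_L S h" "x \<in> dom_L S h" for u x c
    using rep_operators[of "fgen gB * fgen gC"] that by (simp add: T_def operators_def)
  have "T (\<lambda>x. 1) = (\<lambda>x. 0)"
  proof -
    have e: "entire_seq (unit_seq 0)" using rapid_unit[of 0] by (simp add: rapid_entire)
    have "opC (unit_seq 0) = (\<lambda>n. 0)" by (auto simp: opC_def unit_seq_def)
    moreover have "opB (\<lambda>n. 0) = (\<lambda>n. 0)" by (auto simp: opB_def split: nat.splits)
    ultimately show ?thesis using B_op_ser[OF entire_seq_0] C_op_ser[OF e]
      by (simp add: T flip: ser_unit_0)
  qed
  moreover have "T (\<lambda>x. 1) = (\<lambda>x. T v x + T w x)"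
    using Tlin[of v w 1] vw Vd Yd by auto
  ultimately have neg: "T w = (\<lambda>x. -1 * T v x + 0)" by (auto simp: fun_eq_iff add_eq_0_iff)
  have Tm: "T v \<in> V" "T w \<in> Y" using V Y vw by (auto simp: invariant_subspace_def T_def)
  have "T v \<in> dom_L S h" "T w \<in> dom_L S h" using Tm Vd Yd by auto
  have zd: "(\<lambda>x. 0) \<in> dom_L S h" using zV Vd by auto
  have "ip S h (T v) (T w) = 0" using orth Tm by blast
  moreover have z0: "ip S h x (\<lambda>x. 0) = 0" for x
    using tcoeff_ser[OF entire_seq_0] by (simp add: ip_def)
  ultimately have "ip S h (T v) (T v) = 0"
    unfolding neg using ip_lin_right[OF \<open>T v \<in> dom_L S h\<close> zd \<open>T v \<in> dom_L S h\<close>, of "-1"] by simp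
  then have Tv: "T v = (\<lambda>x. 0)" using ip_pos \<open>T v \<in> dom_L S h\<close> by blast
  then have Tw: "T w = (\<lambda>x. 0)" using neg by simp
  have const: "\<exists>c. u = (\<lambda>x. c)" if ud: "u \<in> dom_L S h" and Tu: "T u = (\<lambda>x. 0)" for u
  proof -
    obtain a where a: "rapid a" "u = ser a" using ud by (rule dom_L_E)
    have "a n = 0" if "n > 0" for n using number_kernel[OF a(1) _ that] Tu a(2) T by simp
    then have "a = (\<lambda>n. a 0 * unit_seq 0 n)" by (auto simp: unit_seq_def fun_eq_iff)
    then have "u = (\<lambda>x. a 0 * ser (unit_seq 0) x)"
      unfolding a(2) by (metis (no_types, lifting) ext rapid_entire rapid_unit ser_scale top_0)
    then show ?thesis by (auto simp: ser_unit_0)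
  qed
  obtain c where c: "v = (\<lambda>x. c)" using const[OF _ Tv] vw Vd by blast
  obtain d where d: "w = (\<lambda>x. d)" using const[OF _ Tw] vw Yd by blast
  have cd: "c + d = 1" using vw(3) c d by (metis)
  show "V = {\<lambda>w. 0} \<or> Y = {\<lambda>w. 0}"
  proof (cases "c = 0")
    case False
    have "(\<lambda>x. 1 / c * v x + 0) \<in> V" using linV[OF vw(1) zV] .
    then have "(\<lambda>x. 1) \<in> V" using False c by simp
    from vacuum_cyclic[OF V this Yd orth] zY have "Y = {\<lambda>w. 0}" by blast
    then show ?thesis ..
  next
    case True
    then have "(\<lambda>x. 1) \<in> Y" using cd d vw by simp
    moreover have "ip S h w v = 0" if "w \<in> Y" "v \<in> V" for v w
      using orth[OF that(2,1)] ip_cnj[of v w] that Vd Yd by auto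
    ultimately have "V = {\<lambda>w. 0}" using vacuum_cyclic[OF Y _ Vd] zV by blast
    then show ?thesis ..
  qed
qed

subsection \<open>An operator is determined by its Wick symbol\<close>

lemma ker_in_dom: "(\<lambda>w. ker S h w z) \<in> dom_L S h"
  unfolding ker_eq using ser_in_dom[OF rapid_kseq] by (simp add: eta_contract_eq)

text \<open>
  The weight \<open>wr n\<close> cancels the coefficient \<open>W n\<close> of the kernel.
\<close>

lemma reproducing:
  assumes "rapid c"
  shows "ip S h (\<lambda>w. ker S h w z) (ser c) = cnj (ser c (cnj z))"
proof -
  have "(\<lambda>n. cnj (c n * cnj z ^ n)) sums cnj (ser c (cnj z))"
    by (subst sums_cnj) (rule ser_sums[OF rapid_entire[OF assms]])
  moreover have "(\<lambda>n. cnj (c n * cnj z ^ n)) = (\<lambda>n. of_real (wr n) * kseq z n * cnj (c n))"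
  proof
    fix n
    show "cnj (c n * cnj z ^ n) = of_real (wr n) * kseq z n * cnj (c n)"
      using wr_pos[of n] rapid_top[OF assms, of n] by (cases "enat n \<le> topN S h") (auto simp: kseq_def W_def)
  qed
  ultimately have "ips (kseq z) c = cnj (ser c (cnj z))" unfolding ips_def by (metis sums_unique)
  then show ?thesis unfolding ker_eq using ip_ser[OF rapid_kseq assms, of z] by (simp add: eta_contract_eq)
qed

text \<open>
  The symbol determines the operator on the kernel functions: dividing by the kernel is harmless near
  \<open>w = 0\<close>, where the kernel is near 1, and entire functions that agree near 0 are equal.  By the
  reproducing property the adjoint is then determined on the whole domain, and therefore so is the
  operator.
\<close>

lemma wick_symbol_determines:
  assumes T: "T \<in> operators S h" and U: "U \<in> operators S h"
    and eq: "wick_symbol S h T = wick_symbol S h U" and u: "u \<in> dom_L S h"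
  shows "T u = U u"
proof -
  \<comment> \<open>equality on the kernel functions\<close>
  have K: "T (\<lambda>w. ker S h w z) = U (\<lambda>w. ker S h w z)" for z
  proof -
    have "T (\<lambda>w. ker S h w z) \<in> dom_L S h" "U (\<lambda>w. ker S h w z) \<in> dom_L S h"
      using T U ker_in_dom by (auto simp: operators_def)
    then obtain a b where a: "rapid a" "T (\<lambda>w. ker S h w z) = ser a" and b: "rapid b" "U (\<lambda>w. ker S h w z) = ser b"
      unfolding dom_L_iff by (elim exE conjE)
    have "isCont (ser (kseq z)) 0" using ser_has_deriv[OF entire_seq_kseq] by (rule DERIV_isCont)
    then have "(ser (kseq z) \<longlongrightarrow> ser (kseq z) 0) (nhds 0)"
      by (simp only: isCont_def tendsto_at_iff_tendsto_nhds)
    moreover have "ser (kseq z) 0 \<noteq> 0" by (simp add: kseq_def)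
    ultimately have "\<forall>\<^sub>F w in nhds 0. ser (kseq z) w \<noteq> 0"
      by (rule tendsto_imp_eventually_ne)
    then have "\<forall>\<^sub>F w in nhds 0. ser a w = ser b w"
    proof eventually_elim
      case (elim w)
      have "1 / ker S h w z * ser a w = 1 / ker S h w z * ser b w"
        using fun_cong[OF fun_cong[OF eq, of w], of z] a b by (simp add: wick_symbol_def)
      then show ?case using elim by (simp add: ker_eq)
    qed
    then have "(deriv ^^ n) (ser a) 0 = (deriv ^^ n) (ser b) 0" for n
      by (rule higher_deriv_cong_ev) simp
    then have "tcoeff (ser a) = tcoeff (ser b)" by (simp add: tcoeff_def fun_eq_iff)
    then show ?thesis using a b by (simp add: tcoeff_ser rapid_entire)
  qed
  obtain T' where T': "\<forall>u\<in>dom_L S h. T' u \<in> dom_L S h" "adjoint_on S h T T'" using T by (auto simp: operators_def)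
  obtain U' where U': "\<forall>u\<in>dom_L S h. U' u \<in> dom_L S h" "adjoint_on S h U U'" using U by (auto simp: operators_def)
  \<comment> \<open>equality of the adjoints: their values at a point are inner products with a kernel function\<close>
  have adj: "T' v = U' v" if v: "v \<in> dom_L S h" for v
  proof -
    have "T' v \<in> dom_L S h" "U' v \<in> dom_L S h" using T'(1) U'(1) v by auto
    then obtain a b where ab: "rapid a" "T' v = ser a" "rapid b" "U' v = ser b"
      unfolding dom_L_iff by (elim exE conjE)
    have "cnj (ser a (cnj z)) = cnj (ser b (cnj z))" for z
    proof -
      have "cnj (ser a (cnj z)) = ip S h (T (\<lambda>w. ker S h w z)) v"
        using T'(2) ker_in_dom v ab reproducing[of a z] by (simp add: adjoint_on_def)
      also have "\<dots> = cnj (ser b (cnj z))"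
        unfolding K using U'(2) ker_in_dom v ab reproducing[of b z] by (simp add: adjoint_on_def)
      finally show ?thesis .
    qed
    then have "ser a w = ser b w" for w by (metis complex_cnj_cnj)
    then show ?thesis using ab by auto
  qed
  have d: "T u \<in> dom_L S h" "U u \<in> dom_L S h" using T U u by (auto simp: operators_def)
  \<comment> \<open>the difference \<open>T u - U u\<close> is orthogonal to itself\<close>
  define x where "x = (\<lambda>w. -1 * U u w + T u w)"
  have xd: "x \<in> dom_L S h" unfolding x_def by (intro dom_L_lin d)
  have "ip S h (T u) x = ip S h (U u) x"
    using T'(2) U'(2) adj[OF xd] u xd by (simp add: adjoint_on_def)
  then have "ip S h x x = 0"
    using ip_lin[OF d(2,1) xd, of "-1"] by (simp add: x_def)
  then have "x = (\<lambda>w. 0)" using ip_pos xd by blast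
  then show ?thesis by (auto simp: x_def fun_eq_iff)
qed

text \<open>
  The operator that represents a symbol is only chosen; but all choices agree on the domain.
\<close>

lemma wick_prod_symbols:
  assumes T: "T \<in> operators S h" and U: "U \<in> operators S h"
  shows "wick_prod S h (wick_symbol S h T) (wick_symbol S h U) = wick_symbol S h (T \<circ> U)"
proof -
  define T1 where "T1 = wick_hat S h (wick_symbol S h T)"
  define U1 where "U1 = wick_hat S h (wick_symbol S h U)"
  have T1: "T1 \<in> operators S h" "wick_symbol S h T1 = wick_symbol S h T"
    unfolding T1_def wick_hat_def using someI[of "\<lambda>X. X \<in> operators S h \<and> wick_symbol S h X = wick_symbol S h T" T] T by auto
  have U1: "U1 \<in> operators S h" "wick_symbol S h U1 = wick_symbol S h U"
    unfolding U1_def wick_hat_def using someI[of "\<lambda>X. X \<in> operators S h \<and> wick_symbol S h X = wick_symbol S h U" U] U by auto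
  have "T1 (U1 (\<lambda>w. ker S h w z)) = T (U (\<lambda>w. ker S h w z))" for z
    using wick_symbol_determines[OF U1(1) U U1(2) ker_in_dom[of z]]
      wick_symbol_determines[OF T1(1) T T1(2), of "U (\<lambda>w. ker S h w z)"] U ker_in_dom[of z]
    by (auto simp: operators_def)
  then have "wick_symbol S h (T1 \<circ> U1) = wick_symbol S h (T \<circ> U)" by (simp add: wick_symbol_def)
  then show ?thesis by (simp only: wick_prod_def T1_def U1_def)
qed

end

section \<open>Normal ordering\<close>

subsection \<open>Symbols in the middle generators\<close>

definition mapA :: "('n::finite \<Rightarrow>\<^sub>0 nat) \<Rightarrow> ('n gen \<Rightarrow>\<^sub>0 nat)" where
  "mapA m = mfun (\<lambda>v. case v of gA i \<Rightarrow> Poly_Mapping.lookup m i | _ \<Rightarrow> 0)"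

lemma lookup_mapA [simp]: "Poly_Mapping.lookup (mapA m) (gA i) = Poly_Mapping.lookup m i"
  "Poly_Mapping.lookup (mapA m) gB = 0" "Poly_Mapping.lookup (mapA m) gC = 0"
  by (simp_all add: mapA_def)

lemma ring_hom_lift_coeff [simp]: "ring_hom (\<lambda>c. mp_const (complex_of_real c))"
  by (rule ring_hom_comp) simp_all

lemma ring_hom_lift_A [simp]: "ring_hom (lift_A :: ('n, real) mpoly \<Rightarrow> ('n gen, complex) mpoly)"
  unfolding lift_A_def by simp

lemma lift_A_single:
  fixes m :: "'a::finite \<Rightarrow>\<^sub>0 nat"
  shows "lift_A (Poly_Mapping.single m c) = Poly_Mapping.single (mapA m) (complex_of_real c)"
proof -
  have "mon (\<lambda>i. mp_var (gA i)) m = mon (mp_var :: 'a gen \<Rightarrow> ('a gen, complex) mpoly) (mapA m)"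
    by (simp add: mon_UNIV prod_gen)
  then show ?thesis
    unfolding single_conv_mon[of "mapA m"] by (simp add: lift_A_def mp_eval_single)
qed

lemma lift_A_zero [simp]: "lift_A 0 = 0"
  by (simp add: lift_A_def)

lemma lift_A_add: "lift_A (p + q) = lift_A p + lift_A q"
  by (rule ring_hom_simps(3)) simp

lemma set_idx_list: "distinct (idx_list :: 'n::finite list)" "set (idx_list :: 'n list) = UNIV"
proof -
  have "\<exists>xs :: 'n list. distinct xs \<and> set xs = UNIV" using finite_distinct_list[of "UNIV :: 'n set"] by auto
  from someI_ex[OF this] show "distinct (idx_list :: 'n list)" "set (idx_list :: 'n list) = UNIV"
    unfolding idx_list_def by auto
qed

lemma sum_fun_apply: "(\<Sum>i\<in>I. f i) w = (\<Sum>i\<in>I. f i w)"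
  by (induction I rule: infinite_finite_induct) auto

lemma sum_Suc_choose: "(\<Sum>n\<le>Suc b. of_nat (Suc b choose n) * x n) =
   (\<Sum>n\<le>b. of_nat (b choose n) * (x n + x (Suc n)))" for x :: "nat \<Rightarrow> 'a::comm_ring_1"
proof -
  have "(\<Sum>n\<le>Suc b. of_nat (Suc b choose n) * x n) =
      x 0 + (\<Sum>n\<le>b. of_nat (Suc b choose Suc n) * x (Suc n))"
    by (subst sum.atMost_Suc_shift) simp
  also have "\<dots> = x 0 + (\<Sum>n\<le>b. of_nat (b choose Suc n) * x (Suc n)) + (\<Sum>n\<le>b. of_nat (b choose n) * x (Suc n))"
    by (simp add: distrib_right sum.distrib)
  also have "x 0 + (\<Sum>n\<le>b. of_nat (b choose Suc n) * x (Suc n)) = (\<Sum>n\<le>Suc b. of_nat (b choose n) * x n)"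
    using sum.atMost_Suc_shift[of "\<lambda>n. of_nat (b choose n) * x n" b] by simp
  also have "\<dots> = (\<Sum>n\<le>b. of_nat (b choose n) * x n)" by (simp add: binomial_eq_0)
  finally show ?thesis by (simp add: distrib_left sum.distrib)
qed

lemma poly_map_poly_sum:
  fixes t :: "'a::comm_ring_1"
  assumes "f 0 = 0"
  shows "poly (map_poly f q) t = (\<Sum>j\<le>degree q. f (coeff q j) * t ^ j)"
proof -
  have "poly (map_poly f q) t = (\<Sum>j\<le>degree (map_poly f q). coeff (map_poly f q) j * t ^ j)"
    by (rule poly_altdef)
  also have "\<dots> = (\<Sum>j\<le>degree q. coeff (map_poly f q) j * t ^ j)"
    using map_poly_degree_leq[of f q] assms
    by (intro sum.mono_neutral_left) (auto simp: coeff_eq_0)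
  finally show ?thesis by (simp add: coeff_map_poly assms)
qed

definition fdiff :: "(nat \<Rightarrow> 'a::comm_ring_1) \<Rightarrow> nat \<Rightarrow> 'a" where "fdiff f k = f (Suc k) - f k"

lemma fdiff_Suc: "(fdiff ^^ Suc n) f k = (fdiff ^^ n) f (Suc k) - (fdiff ^^ n) f k"
  by (simp add: fdiff_def[of "(fdiff ^^ n) f" k])

text \<open>
  Newton's formula for the value \<open>b\<close> steps ahead; one step is the operator \<open>1 + \<Delta>\<close>.  It is the
  finite counterpart of the exponential in the definition of \<open>\<Lambda>\<close>.
\<close>

lemma newton_forward: "f (k + b) = (\<Sum>n\<le>b. of_nat (b choose n) * (fdiff ^^ n) f k)"
proof (induction b arbitrary: k)
  case (Suc b)
  have step: "(fdiff ^^ n) f (Suc k) = (fdiff ^^ n) f k + (fdiff ^^ Suc n) f k" for n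
    by (simp only: fdiff_Suc) simp
  have "f (k + Suc b) = (\<Sum>n\<le>b. of_nat (b choose n) * ((fdiff ^^ n) f k + (fdiff ^^ Suc n) f k))"
    unfolding step[symmetric] using Suc[of "Suc k"] by simp
  then show ?case by (simp only: sum_Suc_choose)
qed simp

context quantized_surface
begin

text \<open>
  The joint eigenvalue of the operators \<open>A\<close> on the monomial of degree \<open>k\<close>.
\<close>

definition orb :: "nat \<Rightarrow> real ^ 'n" where "orb k = flow S (real (Suc k) * h) (pt S)"

lemma flow_orb: "flow S (real b * h) (orb k) = orb (k + b)"
  unfolding orb_def by (simp add: flow_flow[OF flow] algebra_simps)

lemma flow_orb_Suc: "flow S h (orb k) = orb (Suc k)"
  using flow_orb[of 1 k] by simp

definition rseq :: "nat \<Rightarrow> real" where "rseq k = poly Rp (real k * h)"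

lemma rval_lam_orb: "rval (lam S h) (orb k) = rseq (Suc k) - rseq k"
proof -
  have "flow S (- h) (orb k) = flow S (real k * h) (pt S)"
    unfolding orb_def by (simp add: flow_flow[OF flow] algebra_simps)
  then show ?thesis by (simp add: rval_lam rseq_def Rp_eq orb_def)
qed

lemma opC_opB: "opC (opB x) = (\<lambda>n. of_real (rseq (Suc n)) * x n)"
  by (simp add: opC_def opB_def fun_eq_iff rseq_def DE mult_ac del: of_nat_Suc)

lemma opB_opC: "opB (opC x) = (\<lambda>n. of_real (rseq n) * x n)"
  by (auto simp: opC_def opB_def fun_eq_iff rseq_def DE mult_ac split: nat.splits simp del: of_nat_Suc)

lemma opB_0 [simp]: "opB x 0 = 0" by (simp add: opB_def)

lemma opB_Suc: "opB x (Suc k) = Dt (real (Suc k) * h) * x k" by (simp add: opB_def)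

lemma opB_pow_sum: "(opB ^^ b) (\<lambda>k. \<Sum>j\<in>J. c j * x j k) n = (\<Sum>j\<in>J. c j * (opB ^^ b) (x j) n)"
proof (induction b arbitrary: n)
  case (Suc b)
  then show ?case by (cases n) (simp_all add: opB_Suc sum_distrib_left mult_ac del: of_nat_Suc)
qed simp

lemma opB_pow_lin: "(opB ^^ b) (\<lambda>k. c * x k + d * y k) n = c * (opB ^^ b) x n + d * (opB ^^ b) y n"
proof (induction b arbitrary: n)
  case (Suc b)
  then show ?case by (cases n) (simp_all add: opB_Suc algebra_simps del: of_nat_Suc)
qed simp

lemma opB_pow_scale: "(opB ^^ b) (\<lambda>k. c * x k) n = c * (opB ^^ b) x n"
  using opB_pow_lin[of b c x 0 x n] by simp

text \<open>
  A diagonal operator passes through \<open>B\<^sup>b\<close> at the price of a shift by \<open>b\<close>.  For \<open>\<phi> n = \<gamma>\<^bsup>(n+1)h\<^esup>(a)\<close>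
  this is the relation \<open>A B\<^sup>b = B\<^sup>b \<gamma>\<^bsup>bh\<^esup>(A)\<close>.
\<close>

lemma opB_pow_diag: "\<phi> n * (opB ^^ b) x n = (opB ^^ b) (\<lambda>k. \<phi> (k + b) * x k) n"
proof (induction b arbitrary: n \<phi>)
  case (Suc b)
  show ?case
  proof (cases n)
    case (Suc m)
    have "\<phi> (Suc m) * (opB ^^ b) x m = (opB ^^ b) (\<lambda>k. \<phi> (Suc (k + b)) * x k) m"
      using Suc.IH[of "\<lambda>k. \<phi> (Suc k)" m] by simp
    then show ?thesis using Suc by (simp add: opB_Suc mult_ac del: of_nat_Suc)
  qed (simp add: opB_def)
qed simp

text \<open>
  A normally ordered monomial is first reduced to a sequence without its power of \<open>B\<close>: in \<open>midmon\<close>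
  the operators \<open>A\<close> are already replaced by their eigenvalues.  Then \<open>nmon\<close> applies the power of \<open>B\<close>,
  and \<open>nseq\<close> extends to polynomials by linearity.
\<close>

definition midmon :: "('n gen \<Rightarrow>\<^sub>0 nat) \<Rightarrow> (nat \<Rightarrow> complex) \<Rightarrow> nat \<Rightarrow> complex" where
  "midmon m a k = (\<Prod>i\<in>UNIV. of_real (orb k $ i) ^ Poly_Mapping.lookup m (gA i)) * (opC ^^ Poly_Mapping.lookup m gC) a k"

definition nmon :: "('n gen \<Rightarrow>\<^sub>0 nat) \<Rightarrow> (nat \<Rightarrow> complex) \<Rightarrow> nat \<Rightarrow> complex" where
  "nmon m a = (opB ^^ Poly_Mapping.lookup m gB) (midmon m a)"

definition nseq :: "('n gen, complex) mpoly \<Rightarrow> (nat \<Rightarrow> complex) \<Rightarrow> nat \<Rightarrow> complex" where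
  "nseq f a n = (\<Sum>m\<in>Poly_Mapping.keys f. Poly_Mapping.lookup f m * nmon m a n)"

lemma nseq_add: "nseq (f + g) a n = nseq f a n + nseq g a n"
  unfolding nseq_def using keys_sum_add[of "\<lambda>m c. c * nmon m a n" f g] by (simp add: algebra_simps)

lemma nseq_single: "nseq (Poly_Mapping.single m c) a n = c * nmon m a n"
  unfolding nseq_def by (cases "c = 0") auto

lemma nseq_zero [simp]: "nseq 0 a n = 0"
  by (simp add: nseq_def)

lemma nseq_sum: "nseq (sum f J) a n = (\<Sum>j\<in>J. nseq (f j) a n)"
  by (induction J rule: infinite_finite_induct) (auto simp: nseq_add)

lemma nseq_const: "nseq (mp_const c * f) a n = c * nseq f a n"
proof (induction f rule: poly_mapping_single_induct)
  case (single m d)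
  show ?case by (simp add: mp_const_def mult_single nseq_single)
qed (simp_all add: distrib_left nseq_add)

text \<open>
  In a normally ordered product a polynomial in \<open>A\<close> stands between \<open>B\<close> and \<open>C\<close>, where it acts by its
  eigenvalues.
\<close>

lemma nseq_lift:
  "nseq (lift_A p * Poly_Mapping.single m c) a n =
     c * (opB ^^ Poly_Mapping.lookup m gB) (\<lambda>k. of_real (rval p (orb k)) * midmon m a k) n"
proof (induction p rule: poly_mapping_single_induct)
  case zero
  then show ?case using opB_pow_scale[of _ 0 "\<lambda>k. 0" n] by (simp add: opB_pow_scale[where c = 0, simplified])
next
  case (single m' r)
  have "midmon (mapA m' + m) a = (\<lambda>k. of_real (mon (\<lambda>i. orb k $ i) m') * midmon m a k)"
    by (simp add: fun_eq_iff midmon_def lookup_add power_add prod.distrib mon_UNIV)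
  then have "nmon (mapA m' + m) a n = (opB ^^ Poly_Mapping.lookup m gB) (\<lambda>k. of_real (mon (\<lambda>i. orb k $ i) m') * midmon m a k) n"
    by (simp add: nmon_def lookup_add)
  moreover have "(\<lambda>k. of_real (rval (Poly_Mapping.single m' r) (orb k)) * midmon m a k) =
      (\<lambda>k. of_real r * (of_real (mon (\<lambda>i. orb k $ i) m') * midmon m a k))"
    by (simp add: rval_def mp_eval_single mult.assoc)
  ultimately show ?case
    by (simp add: lift_A_single mult_single nseq_single opB_pow_scale)
next
  case (add p q)
  have "(\<lambda>k. of_real (rval (p + q) (orb k)) * midmon m a k) =
    (\<lambda>k. 1 * (of_real (rval p (orb k)) * midmon m a k) + 1 * (of_real (rval q (orb k)) * midmon m a k))"
    by (simp add: ring_hom_simps[OF ring_hom_rval] fun_eq_iff algebra_simps)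
  then show ?case using add by (simp only: opB_pow_lin) (simp add: lift_A_add distrib_right nseq_add distrib_left)
qed

lemma nseq_lift_A: "nseq (lift_A p) a n = of_real (rval p (orb n)) * a n"
  using nseq_lift[of p 0 1 a n] by (simp add: midmon_def)

subsection \<open>The regular representation intertwines\<close>

lemma nseq_L_B: "nseq (L_B f) a = opB (nseq f a)"
proof
  fix n
  show "nseq (L_B f) a n = opB (nseq f a) n"
  proof (induction f rule: poly_mapping_single_induct)
    case zero
    then show ?case by (simp add: L_B_def opB_def split: nat.splits)
  next
    case (single m c)
    have "midmon (Poly_Mapping.single gB 1 + m) a = midmon m a"
      by (simp add: midmon_def fun_eq_iff lookup_add lookup_single)
    then have "nmon (Poly_Mapping.single gB 1 + m) a = opB (nmon m a)"
      by (simp add: nmon_def lookup_add)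
    then show ?case
      by (simp add: L_B_def mp_var_def mult_single nseq_single)
        (simp add: opB_def nseq_single split: nat.splits)
  next
    case (add p q)
    then show ?case by (simp add: L_B_def distrib_left nseq_add opB_def split: nat.splits)
  qed
qed

lemma pd_B_single: "mp_pd gB (Poly_Mapping.single m c) = Poly_Mapping.single (m - Poly_Mapping.single gB 1) (of_nat (Poly_Mapping.lookup m gB) * c)"
  by (simp add: mp_diff_single)

lemma mp_pd_add: "mp_pd v (p + q) = mp_pd v p + mp_pd v q"
  by (rule mp_diff_add)

lemma euler_single: "((\<lambda>p. mp_const c0 * (mp_var gB * mp_pd gB p)) ^^ j) (Poly_Mapping.single m c)
   = Poly_Mapping.single m ((c0 * of_nat (Poly_Mapping.lookup m gB)) ^ j * c)"
proof (induction j)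
  case (Suc j)
  have m: "Poly_Mapping.single gB (Suc 0) + (m - Poly_Mapping.single gB (Suc 0)) = m" if "Poly_Mapping.lookup m gB \<noteq> 0"
    by (rule poly_mapping_eqI) (use that in \<open>auto simp: lookup_add lookup_minus lookup_single when_def\<close>)
  show ?case
    unfolding funpow.simps comp_def Suc pd_B_single
    by (cases "Poly_Mapping.lookup m gB = 0") (simp_all add: mp_const_def mp_var_def mult_single m mult_ac)
qed simp

lemma funpow_add_hom:
  fixes T :: "'b::plus \<Rightarrow> 'b"
  shows "(\<And>x y. T (x + y) = T x + T y) \<Longrightarrow> (T ^^ j) (x + y) = (T ^^ j) x + (T ^^ j) y"
  by (induction j) auto

lemma L_A_add: "L_A S h i (f + g) = L_A S h i f + L_A S h i g"
  unfolding L_A_def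
  by (subst funpow_add_hom) (simp_all add: mp_pd_add distrib_left sum.distrib del: One_nat_def)

text \<open>
  On a monomial of degree \<open>b\<close> in \<open>B\<close>, the operator \<open>h B \<partial>/\<partial>B\<close> is the number \<open>h b\<close>, so \<open>L_A\<close> inserts
  \<open>\<gamma>\<^bsup>hb\<^esup>(A)\<close>; this is what remains when \<open>A\<close> passes through \<open>B\<^sup>b\<close>.
\<close>

lemma nseq_L_A: "nseq (L_A S h i f) a = opA i (nseq f a)"
proof
  fix n
  show "nseq (L_A S h i f) a n = opA i (nseq f a) n"
  proof (induction f rule: poly_mapping_single_induct)
    case zero
    have z: "((\<lambda>p. mp_const (of_real h) * (mp_var gB * mp_pd gB p)) ^^ j) 0 = 0" for j
      by (induction j) auto
    show ?case unfolding L_A_def z by (simp add: opA_def)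
  next
    case (single m c)
    let ?b = "Poly_Mapping.lookup m gB"
    have "nseq (L_A S h i (Poly_Mapping.single m c)) a n =
      (\<Sum>j\<le>degree (gam S i). c * ((of_real h * of_nat ?b) ^ j * (opB ^^ ?b) (\<lambda>k. of_real (rval (coeff (gam S i) j) (orb k)) * midmon m a k) n))"
      unfolding L_A_def nseq_sum euler_single nseq_lift by (simp add: mult_ac)
    also have "\<dots> = c * (opB ^^ ?b) (\<lambda>k. \<Sum>j\<le>degree (gam S i). (of_real h * of_nat ?b) ^ j * (of_real (rval (coeff (gam S i) j) (orb k)) * midmon m a k)) n"
      by (simp add: opB_pow_sum sum_distrib_left)
    also have "(\<lambda>k. \<Sum>j\<le>degree (gam S i). (of_real h * of_nat ?b) ^ j * (of_real (rval (coeff (gam S i) j) (orb k)) * midmon m a k))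
       = (\<lambda>k. of_real (orb (k + ?b) $ i) * midmon m a k)"
    proof
      fix k
      have "orb (k + ?b) $ i = poly (map_poly (\<lambda>q. rval q (orb k)) (gam S i)) (real ?b * h)"
        by (simp add: flow_orb[symmetric] flow_nth flow_poly_def)
      also have "\<dots> = (\<Sum>j\<le>degree (gam S i). rval (coeff (gam S i) j) (orb k) * (real ?b * h) ^ j)"
        by (rule poly_map_poly_sum) simp
      finally show "(\<Sum>j\<le>degree (gam S i). (of_real h * of_nat ?b) ^ j * (of_real (rval (coeff (gam S i) j) (orb k)) * midmon m a k))
        = of_real (orb (k + ?b) $ i) * midmon m a k"
        by (simp add: sum_distrib_right sum_distrib_left mult_ac)
    qed
    also have "c * (opB ^^ ?b) (\<lambda>k. of_real (orb (k + ?b) $ i) * midmon m a k) n = opA i (nseq (Poly_Mapping.single m c) a) n"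
      using opB_pow_diag[of "\<lambda>k. of_real (orb k $ i)" n ?b "midmon m a"]
      by (simp add: opA_def nseq_single nmon_def orb_def mult_ac)
    finally show ?case .
  next
    case (add p q)
    then show ?case by (simp add: L_A_add nseq_add opA_def distrib_left)
  qed
qed

lemma pd_B_iter: "(mp_pd gB ^^ j) (Poly_Mapping.single m c) =
   Poly_Mapping.single (m - Poly_Mapping.single gB j) (of_nat (fact j * (Poly_Mapping.lookup m gB choose j)) * c)"
proof (induction j)
  case (Suc j)
  let ?b = "Poly_Mapping.lookup m gB"
  have e: "m - Poly_Mapping.single gB j - Poly_Mapping.single gB 1 = m - Poly_Mapping.single gB (Suc j)"
    by (rule poly_mapping_eqI) (simp add: lookup_minus lookup_single when_def)
  have "(?b - j) * (fact j * (?b choose j)) = fact (Suc j) * (?b choose Suc j)"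
    by (simp only: falling_choose[symmetric] prod.lessThan_Suc mult.commute)
  then have f: "of_nat (?b - j) * (of_nat (fact j * (?b choose j)) * c) = of_nat (fact (Suc j) * (?b choose Suc j)) * c"
    by (simp only: mult.assoc[symmetric] of_nat_mult[symmetric])
  show ?case
    unfolding funpow.simps comp_def Suc pd_B_single e
    by (subst f[symmetric]) (simp add: lookup_minus lookup_single)
qed simp

lemma pd_B_vanish: "\<exists>N. \<forall>j\<ge>N. (mp_pd gB ^^ j) f = 0"
proof (induction f rule: poly_mapping_single_induct)
  case zero
  have "(mp_pd gB ^^ j) 0 = 0" for j by (induction j) auto
  then show ?case by auto
next
  case (single m c)
  show ?case by (rule exI[of _ "Suc (Poly_Mapping.lookup m gB)"]) (simp add: pd_B_iter binomial_eq_0 del: One_nat_def)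
next
  case (add p q)
  then obtain N1 N2 where N: "\<forall>j\<ge>N1. (mp_pd gB ^^ j) p = 0" "\<forall>j\<ge>N2. (mp_pd gB ^^ j) q = 0" by blast
  show ?case using N by (intro exI[of _ "max N1 N2"]) (simp add: funpow_add_hom mp_pd_add del: One_nat_def)
qed

definition lam_diff :: "nat \<Rightarrow> ('n, real) mpoly" where
  "lam_diff n = ((\<lambda>p. pull S h p - p) ^^ n) (lam S h)"

text \<open>
  \<open>\<lambda>\<close> is the first difference of \<open>R\<close> along the eigenvalues, and composition with \<open>\<gamma>\<^sup>h\<close> is the shift by one.
\<close>

lemma rval_lam_diff: "rval (lam_diff n) (orb k) = (fdiff ^^ Suc n) rseq k"
proof (induction n arbitrary: k)
  case 0
  then show ?case by (simp add: lam_diff_def rval_lam_orb fdiff_def)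
next
  case (Suc n)
  have "rval (lam_diff (Suc n)) (orb k) = rval (lam_diff n) (orb (Suc k)) - rval (lam_diff n) (orb k)"
    by (simp add: lam_diff_def ring_hom_simps[OF ring_hom_rval] rval_pull flow_orb_Suc)
  then show ?case unfolding Suc fdiff_Suc[of "Suc n"] .
qed

text \<open>The terms of the series \<open>\<Lambda>\<close> in \<open>L_C\<close>.\<close>

definition L_C2 :: "nat \<Rightarrow> ('n gen, complex) mpoly \<Rightarrow> ('n gen, complex) mpoly" where
  "L_C2 n f = mp_const (1 / fact (Suc n)) * lift_A (lam_diff n) * mp_var gB ^ n * (mp_pd gB ^^ Suc n) f"

lemma L_C_alt: "L_C S h f = mp_var gC * flow_subst S h f + Sum_any (\<lambda>n. L_C2 n f)"
  by (simp add: L_C_def L_C2_def lam_diff_def)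

lemma finite_L_C2: "finite {n. L_C2 n f \<noteq> 0}"
proof -
  obtain N where N: "\<forall>j\<ge>N. (mp_pd gB ^^ j) f = 0" using pd_B_vanish by blast
  have "{n. L_C2 n f \<noteq> 0} \<subseteq> {..N}"
  proof
    fix n assume n: "n \<in> {n. L_C2 n f \<noteq> 0}"
    show "n \<in> {..N}"
    proof (rule ccontr)
      assume "n \<notin> {..N}"
      then have "(mp_pd gB ^^ Suc n) f = 0" using N[rule_format, of "Suc n"] by simp
      then have "L_C2 n f = 0" unfolding L_C2_def by (simp only: mult_zero_right)
      then show False using n by simp
    qed
  qed
  then show ?thesis by (rule finite_subset) simp
qed

lemma L_C2_add: "L_C2 n (f + g) = L_C2 n f + L_C2 n g"
  unfolding L_C2_def by (subst funpow_add_hom[OF mp_pd_add]) (simp add: distrib_left)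

lemma L_C_add: "L_C S h (f + g) = L_C S h f + L_C S h g"
proof -
  have "flow_subst S h (f + g) = flow_subst S h f + flow_subst S h g"
    by (simp add: flow_subst_def mp_eval_add)
  moreover have "Sum_any (\<lambda>n. L_C2 n (f + g)) = Sum_any (\<lambda>n. L_C2 n f) + Sum_any (\<lambda>n. L_C2 n g)"
    unfolding L_C2_add by (rule Sum_any.distrib[OF finite_L_C2 finite_L_C2])
  ultimately show ?thesis by (simp add: L_C_alt distrib_left)
qed

lemma nseq_Sum_any: "nseq (Sum_any (\<lambda>n. L_C2 n f)) a k = Sum_any (\<lambda>n. nseq (L_C2 n f) a k)"
proof -
  have "Sum_any (\<lambda>n. nseq (L_C2 n f) a k) = (\<Sum>n\<in>{n. L_C2 n f \<noteq> 0}. nseq (L_C2 n f) a k)"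
    by (rule Sum_any.expand_superset[OF finite_L_C2]) auto
  then show ?thesis by (simp add: Sum_any.expand_set nseq_sum)
qed

lemma var_B_pow: "mp_var gB ^ n = Poly_Mapping.single (Poly_Mapping.single gB n) (1::complex)"
  by (induction n) (simp_all add: mp_var_def mult_single flip: single_add)

text \<open>
  The commutator of \<open>C\<close> with a power of \<open>B\<close>: both \<open>C B\<close> and \<open>B C\<close> are diagonal, and moving the
  first through \<open>B\<^sup>b\<close> evaluates \<open>R\<close> at a time that is \<open>(b + 1) h\<close> later than for the second.
\<close>

lemma opC_opB_pow: "opC ((opB ^^ Suc b) x) n = (opB ^^ Suc b) (opC x) n +
    (opB ^^ b) (\<lambda>k. of_real (rseq (k + Suc b) - rseq k) * x k) n"
proof -
  have "opC ((opB ^^ Suc b) x) n = of_real (rseq (Suc n)) * (opB ^^ b) x n"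
    using fun_cong[OF opC_opB, of "(opB ^^ b) x" n] by simp
  also have "\<dots> = (opB ^^ b) (\<lambda>k. of_real (rseq (Suc (k + b))) * x k) n"
    by (rule opB_pow_diag)
  also have "\<dots> = (opB ^^ b) (\<lambda>k. 1 * (of_real (rseq k) * x k) + 1 * (of_real (rseq (k + Suc b) - rseq k) * x k)) n"
    by (simp add: algebra_simps)
  also have "\<dots> = (opB ^^ b) (opB (opC x)) n + (opB ^^ b) (\<lambda>k. of_real (rseq (k + Suc b) - rseq k) * x k) n"
    unfolding opB_pow_lin by (simp add: opB_opC)
  finally show ?thesis by (simp only: funpow_Suc_right comp_def)
qed

text \<open>
  The factor \<open>1 / (n + 1)!\<close> of \<open>\<Lambda>\<close> and the derivative of order \<open>n + 1\<close> combine to the binomial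
  coefficient of Newton's formula.
\<close>

lemma nseq_L_C2_single:
  "nseq (L_C2 n (Poly_Mapping.single m c)) a k =
    of_nat (Poly_Mapping.lookup m gB choose Suc n) * c *
     (opB ^^ (Poly_Mapping.lookup m gB - 1)) (\<lambda>k. of_real ((fdiff ^^ Suc n) rseq k) * midmon m a k) k"
proof (cases "Suc n \<le> Poly_Mapping.lookup m gB")
  case False
  then show ?thesis unfolding L_C2_def pd_B_iter by (simp add: binomial_eq_0)
next
  case True
  let ?m = "m - Poly_Mapping.single gB 1"
  have m: "Poly_Mapping.single gB n + (m - Poly_Mapping.single gB (Suc n)) = ?m"
    by (rule poly_mapping_eqI) (use True in \<open>auto simp: lookup_add lookup_minus lookup_single when_def\<close>)
  have "L_C2 n (Poly_Mapping.single m c) = lift_A (lam_diff n) *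
     (mp_const (1 / fact (Suc n)) * (mp_var gB ^ n * (mp_pd gB ^^ Suc n) (Poly_Mapping.single m c)))"
    by (simp only: L_C2_def mult_ac)
  also have "mp_const (1 / fact (Suc n)) * (mp_var gB ^ n * (mp_pd gB ^^ Suc n) (Poly_Mapping.single m c))
     = Poly_Mapping.single ?m (of_nat (Poly_Mapping.lookup m gB choose Suc n) * c)"
    unfolding pd_B_iter var_B_pow mp_const_def mult_single m by (simp add: field_simps del: fact_Suc of_nat_Suc)
  finally have "nseq (L_C2 n (Poly_Mapping.single m c)) a k = of_nat (Poly_Mapping.lookup m gB choose Suc n) * c *
      (opB ^^ Poly_Mapping.lookup ?m gB) (\<lambda>k. of_real (rval (lam_diff n) (orb k)) * midmon ?m a k) k"
    by (simp only: nseq_lift)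
  moreover have "midmon ?m a = midmon m a"
    by (simp add: midmon_def fun_eq_iff lookup_minus lookup_single)
  ultimately show ?thesis by (simp add: rval_lam_diff lookup_minus)
qed

text \<open>
  The first summand of \<open>L_C\<close> moves \<open>C\<close> through the operators \<open>A\<close>, the second one is the commutator
  with the power of \<open>B\<close>: the terms of \<open>\<Lambda>\<close> add up, by Newton's formula, to the difference of the
  values of \<open>R\<close> in \<open>opC_opB_pow\<close>.
\<close>

lemma nseq_L_C: "nseq (L_C S h f) a = opC (nseq f a)"
proof
  fix n
  show "nseq (L_C S h f) a n = opC (nseq f a) n"
  proof (induction f rule: poly_mapping_single_induct)
    case zero
    have "L_C S h (0 + 0) = L_C S h 0 + L_C S h 0" by (rule L_C_add)
    then show ?case by (simp add: opC_def)
  next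
    case (single m c)
    let ?b = "Poly_Mapping.lookup m gB" and ?c = "Poly_Mapping.lookup m gC"
    define m' :: "'n gen \<Rightarrow>\<^sub>0 nat" where "m' = Poly_Mapping.single gC (Suc ?c) + Poly_Mapping.single gB ?b"
    define p where "p = (\<Prod>i\<in>UNIV. flow_at S h i ^ Poly_Mapping.lookup m (gA i))"
    have lp: "lift_A p = (\<Prod>i\<in>UNIV. lift_A (flow_at S h i) ^ Poly_Mapping.lookup m (gA i))"
      by (simp add: p_def ring_hom_prod[OF ring_hom_lift_A] ring_hom_simps[OF ring_hom_lift_A])
    have vC: "mp_var gC * mp_var gC ^ k = Poly_Mapping.single (Poly_Mapping.single gC (Suc k)) (1::complex)" for k
      by (induction k) (simp_all add: mp_var_def mult_single flip: single_add)
    have "mp_var gC * flow_subst S h (Poly_Mapping.single m c) =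
       lift_A p * (mp_const c * (mp_var gC * mp_var gC ^ ?c) * mp_var gB ^ ?b)"
      by (simp add: flow_subst_def mp_eval_single mon_UNIV prod_gen lp mult_ac)
    also have "mp_const c * (mp_var gC * mp_var gC ^ ?c) * mp_var gB ^ ?b = Poly_Mapping.single m' c"
      unfolding vC var_B_pow by (simp add: m'_def mp_const_def mult_single)
    finally have eq: "mp_var gC * flow_subst S h (Poly_Mapping.single m c) = lift_A p * Poly_Mapping.single m' c" .
    have "nseq (mp_var gC * flow_subst S h (Poly_Mapping.single m c)) a n =
       c * (opB ^^ ?b) (\<lambda>k. of_real (rval p (orb k)) * midmon m' a k) n"
      unfolding eq nseq_lift by (simp add: m'_def lookup_add lookup_single)
    also have "(\<lambda>k. of_real (rval p (orb k)) * midmon m' a k) = opC (midmon m a)"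
    proof
      fix k
      have "rval p (orb k) = (\<Prod>i\<in>UNIV. (orb (Suc k) $ i) ^ Poly_Mapping.lookup m (gA i))"
        by (simp add: p_def ring_hom_prod[OF ring_hom_rval] ring_hom_simps[OF ring_hom_rval] rval_flow_at flow_orb_Suc)
      moreover have "midmon m' a k = opC ((opC ^^ ?c) a) k"
        by (simp add: midmon_def m'_def lookup_add lookup_single)
      ultimately show "of_real (rval p (orb k)) * midmon m' a k = opC (midmon m a) k"
        by (simp add: opC_def[of "midmon m a"] opC_def[of "(opC ^^ ?c) a"] midmon_def[of m a] mult_ac)
    qed
    finally have 1: "nseq (mp_var gC * flow_subst S h (Poly_Mapping.single m c)) a n = c * (opB ^^ ?b) (opC (midmon m a)) n" .
    have 3: "opC (nseq (Poly_Mapping.single m c) a) n = c * opC ((opB ^^ ?b) (midmon m a)) n"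
      by (simp add: opC_def nseq_single nmon_def mult_ac)
    show ?case
    proof (cases ?b)
      case 0
      have "nseq (Sum_any (\<lambda>n. L_C2 n (Poly_Mapping.single m c))) a n = 0"
        unfolding nseq_Sum_any nseq_L_C2_single by (simp add: 0)
      then show ?thesis using 1 3 by (simp add: L_C_alt nseq_add 0)
    next
      case (Suc b)
      have "nseq (Sum_any (\<lambda>n. L_C2 n (Poly_Mapping.single m c))) a n =
         (\<Sum>j\<le>b. nseq (L_C2 j (Poly_Mapping.single m c)) a n)"
        unfolding nseq_Sum_any
      proof (rule Sum_any.expand_superset)
        show "{j. nseq (L_C2 j (Poly_Mapping.single m c)) a n \<noteq> 0} \<subseteq> {..b}"
        proof
          fix j assume "j \<in> {j. nseq (L_C2 j (Poly_Mapping.single m c)) a n \<noteq> 0}"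
          then have "Suc b choose Suc j \<noteq> 0" unfolding nseq_L_C2_single Suc by (auto simp del: binomial_Suc_Suc)
          then show "j \<in> {..b}" by (metis Suc_le_mono atMost_iff binomial_eq_0 not_le)
        qed
      qed simp
      also have "\<dots> = c * (opB ^^ b) (\<lambda>k. \<Sum>j\<le>b. of_nat (Suc b choose Suc j) * (of_real ((fdiff ^^ Suc j) rseq k) * midmon m a k)) n"
        unfolding nseq_L_C2_single Suc opB_pow_sum by (simp add: sum_distrib_left mult_ac del: binomial_Suc_Suc)
      also have "(\<lambda>k. \<Sum>j\<le>b. of_nat (Suc b choose Suc j) * (of_real ((fdiff ^^ Suc j) rseq k) * midmon m a k))
         = (\<lambda>k. of_real (rseq (k + Suc b) - rseq k) * midmon m a k)"
      proof
        fix k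
        have "rseq (k + Suc b) = rseq k + (\<Sum>j\<le>b. of_nat (Suc b choose Suc j) * (fdiff ^^ Suc j) rseq k)"
          unfolding newton_forward[of rseq k "Suc b"] by (subst sum.atMost_Suc_shift) simp
        then have "complex_of_real (rseq (k + Suc b) - rseq k) = (\<Sum>j\<le>b. of_nat (Suc b choose Suc j) * of_real ((fdiff ^^ Suc j) rseq k))"
          by (simp del: binomial_Suc_Suc)
        then show "(\<Sum>j\<le>b. of_nat (Suc b choose Suc j) * (of_real ((fdiff ^^ Suc j) rseq k) * midmon m a k))
          = of_real (rseq (k + Suc b) - rseq k) * midmon m a k"
          by (simp only: sum_distrib_right mult.assoc)
      qed
      finally show ?thesis
        using 1 3 by (simp add: L_C_alt nseq_add Suc opC_opB_pow distrib_left del: funpow.simps)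
    qed
  next
    case (add p q)
    then show ?case by (simp add: L_C_add nseq_add opC_def distrib_left)
  qed
qed

lemma nseq_foldr: "nseq (foldr (\<lambda>i. L_A S h i ^^ k i) is g) a = foldr (\<lambda>i. opA i ^^ k i) is (nseq g a)"
proof (induction "is")
  case (Cons i "is")
  have "nseq ((L_A S h i ^^ j) g) a = (opA i ^^ j) (nseq g a)" for j g
    by (induction j) (simp_all add: nseq_L_A)
  then show ?case using Cons by simp
qed simp

lemma opA_pow: "(opA i ^^ k) x n = of_real (orb n $ i) ^ k * x n"
  by (induction k) (simp_all add: opA_def orb_def)

lemma opA_foldr: "distinct is \<Longrightarrow> foldr (\<lambda>i. opA i ^^ k i) is x n = (\<Prod>i\<in>set is. of_real (orb n $ i) ^ k i) * x n"
  by (induction "is") (simp_all add: opA_pow)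

lemma nmon_words: "nmon m a = (opB ^^ Poly_Mapping.lookup m gB)
   (foldr (\<lambda>i. opA i ^^ Poly_Mapping.lookup m (gA i)) idx_list ((opC ^^ Poly_Mapping.lookup m gC) a))"
proof -
  have "midmon m a = foldr (\<lambda>i. opA i ^^ Poly_Mapping.lookup m (gA i)) idx_list ((opC ^^ Poly_Mapping.lookup m gC) a)"
    by (simp add: fun_eq_iff midmon_def opA_foldr set_idx_list)
  then show ?thesis by (simp add: nmon_def)
qed

text \<open>
  The product \<open>f \<star> g\<close> is \<open>f\<close> in the operators \<open>L\<close> applied to \<open>g\<close>, and each of these operators intertwines
  with the corresponding generator.
\<close>

lemma nseq_star: "nseq (star S h f g) a = nseq f (nseq g a)"
proof
  fix n
  have "nseq ((L_B ^^ b) p) a = (opB ^^ b) (nseq p a)" for b p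
    by (induction b) (simp_all add: nseq_L_B)
  moreover have "nseq ((L_C S h ^^ b) p) a = (opC ^^ b) (nseq p a)" for b p
    by (induction b) (simp_all add: nseq_L_C)
  ultimately show "nseq (star S h f g) a n = nseq f (nseq g a) n"
    unfolding star_def normal_ordered_def nseq_sum nseq_const nseq_foldr
    by (simp add: nseq_foldr nseq_def[of f] nmon_words)
qed

subsection \<open>The representation of normally ordered elements\<close>

text \<open>
  The word of a normally ordered monomial; with it the free algebra, the operators and the
  coefficient sequences can be compared letter by letter.
\<close>

definition nword :: "('n gen \<Rightarrow>\<^sub>0 nat) \<Rightarrow> 'n gen list" where
  "nword m = replicate (Poly_Mapping.lookup m gB) gB @
     concat (map (\<lambda>i. replicate (Poly_Mapping.lookup m (gA i)) (gA i)) idx_list) @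
     replicate (Poly_Mapping.lookup m gC) gC"

lemma foldr_nword: "foldr G (nword m) u = (G gB ^^ Poly_Mapping.lookup m gB)
   (foldr (\<lambda>i. G (gA i) ^^ Poly_Mapping.lookup m (gA i)) idx_list ((G gC ^^ Poly_Mapping.lookup m gC) u))"
proof -
  have "foldr G (concat (map (\<lambda>i. replicate (k i) (gA i)) is)) v = foldr (\<lambda>i. G (gA i) ^^ k i) is v"
    for k v and "is" :: "'n list"
    by (induction "is") (simp_all add: foldr_replicate)
  then show ?thesis by (simp add: nword_def foldr_replicate)
qed

lemma free_word: "((*) (fgen gB) ^^ Poly_Mapping.lookup m gB)
   (foldr (\<lambda>i. (*) (fgen (gA i)) ^^ Poly_Mapping.lookup m (gA i)) idx_list (((*) (fgen gC) ^^ Poly_Mapping.lookup m gC) 1))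
   = Poly_Mapping.single (Word (nword m)) 1"
proof -
  have "foldr (\<lambda>v. (*) (fgen v)) ls 1 = Poly_Mapping.single (Word ls) 1" for ls :: "'n gen list"
    by (induction ls) (simp_all add: fgen_def mult_single plus_word_def flip: zero_word_def)
  from this[of "nword m"] show ?thesis by (simp add: foldr_nword)
qed

lemma rep_sum: "rep S h (sum f J) u w = (\<Sum>j\<in>J. rep S h (f j) u w)"
  by (induction J rule: infinite_finite_induct) (simp_all add: rep_zero rep_add)

lemma rep_fnormal: "rep S h (fnormal f) u w =
   (\<Sum>m\<in>Poly_Mapping.keys f. Poly_Mapping.lookup f m * foldr (gen_op S h) (nword m) u w)"
  unfolding fnormal_def normal_ordered_def free_word rep_sum
  by (simp add: mult_single rep_single)

lemma rep_fnormal_normal_ordered: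
  "rep S h (fnormal f) u w = normal_ordered (\<lambda>c u x. c * u x) (B_op S h) (A_op S h) (C_op S h) f u w"
  unfolding rep_fnormal normal_ordered_def sum_fun_apply foldr_nword by (simp add: gen_op_def)

definition gops :: "'n gen \<Rightarrow> (nat \<Rightarrow> complex) \<Rightarrow> nat \<Rightarrow> complex" where
  "gops v = (case v of gB \<Rightarrow> opB | gA i \<Rightarrow> opA i | gC \<Rightarrow> opC)"

lemma gen_op_ser: "entire_seq a \<Longrightarrow> gen_op S h v (ser a) = ser (gops v a) \<and> entire_seq (gops v a)"
  by (cases v) (auto simp: gen_op_def gops_def A_op_ser B_op_ser C_op_ser entire_opA entire_opB entire_opC)

lemma word_ser: "entire_seq a \<Longrightarrow> foldr (gen_op S h) ls (ser a) = ser (foldr gops ls a) \<and> entire_seq (foldr gops ls a)"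
  by (induction ls) (simp_all add: gen_op_ser)

lemma nmon_nword: "nmon m a = foldr gops (nword m) a"
  unfolding foldr_nword nmon_words by (simp add: gops_def)

lemma rep_fnormal_ser:
  assumes a: "entire_seq a"
  shows "rep S h (fnormal f) (ser a) = ser (nseq f a) \<and> entire_seq (nseq f a)"
proof -
  have w: "entire_seq (nmon m a)" "foldr (gen_op S h) (nword m) (ser a) = ser (nmon m a)" for m
    using word_ser[OF a, of "nword m"] by (simp_all add: nmon_nword)
  have *: "entire_seq (\<lambda>n. Poly_Mapping.lookup f m * nmon m a n)" for m by (rule entire_seq_scale[OF w(1)])
  have "rep S h (fnormal f) (ser a) z = ser (nseq f a) z" for z
    unfolding rep_fnormal w nseq_def[abs_def] using *
    by (subst ser_sum[THEN conjunct2]) (simp_all add: ser_scale[OF w(1)])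
  moreover have "entire_seq (nseq f a)"
    unfolding nseq_def[abs_def] by (rule ser_sum[THEN conjunct1]) (rule *)
  ultimately show ?thesis by auto
qed

lemma rep_star:
  assumes "u \<in> dom_L S h"
  shows "rep S h (fnormal f) (rep S h (fnormal g) u) = rep S h (fnormal (star S h f g)) u"
proof -
  obtain a where a: "rapid a" "u = ser a" using assms by (rule dom_L_E)
  then show ?thesis
    using rep_fnormal_ser[of a g] rep_fnormal_ser[of "nseq g a" f] rep_fnormal_ser[of a "star S h f g"]
    by (simp add: nseq_star rapid_entire)
qed

lemma quantum_restriction_star:
  "wick_prod S h (quantum_restriction S h f) (quantum_restriction S h g) = quantum_restriction S h (star S h f g)"
  unfolding quantum_restriction_def wick_prod_symbols[OF rep_operators rep_operators]
  by (simp add: wick_symbol_def rep_star ker_in_dom)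

lemma quantum_restriction_eq:
  "quantum_restriction S h f w z = 1 / ker S h w z *
     normal_ordered (\<lambda>c u x. c * u x) (B_op S h) (A_op S h) (C_op S h) f (\<lambda>x. ker S h x z) w"
  by (simp add: quantum_restriction_def wick_symbol_def rep_fnormal_normal_ordered)

text \<open>
  On coefficients: \<open>C B - B C\<close> has the entries \<open>R((n+1)h) - R(n h) = \<lambda>(\<gamma>\<^bsup>(n+1)h\<^esup>(a))\<close>; lowering the
  degree shifts the eigenvalue of \<open>A\<close> by \<open>\<gamma>\<^sup>h\<close>; the operators \<open>A\<close> are simultaneously diagonal.
\<close>

lemma relators_vanish:
  assumes x: "x \<in> relators S h" and u: "u \<in> dom_L S h"
  shows "rep S h x u = (\<lambda>w. 0)"
proof -
  obtain a where a: "rapid a" "u = ser a" using u by (rule dom_L_E)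
  then have e: "entire_seq a" by (simp add: rapid_entire)
  have eA: "entire_seq (opA i a)" "entire_seq (opB a)" "entire_seq (opC a)" for i using e by (simp_all add: entire_opA entire_opB entire_opC)
  have gg: "rep S h (fgen v * fgen v') (ser a) = ser (gops v (gops v' a))" for v v'
    using gen_op_ser[OF e, of v'] gen_op_ser[of "gops v' a" v] by (simp add: rep_times_gen rep_gen a)
  have nf: "rep S h (fnormal (lift_A p)) (ser b) = ser (\<lambda>n. of_real (rval p (orb n)) * b n)" if "entire_seq b" for p b
    using rep_fnormal_ser[OF that] by (simp add: nseq_lift_A[abs_def])
  consider "x = fgen gC * fgen gB - fgen gB * fgen gC - fnormal (lift_A (lam S h))"
    | i where "x = fgen gC * fgen (gA i) - fnormal (lift_A (flow_at S h i)) * fgen gC"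
    | i j where "x = fgen (gA i) * fgen (gA j) - fgen (gA j) * fgen (gA i)"
    using x unfolding relators_def by blast
  then show ?thesis
  proof cases
    case 1
    have s: "(\<lambda>n. opC (opB a) n) = (\<lambda>n. opB (opC a) n + of_real (rval (lam S h) (orb n)) * a n)"
      by (simp add: fun_eq_iff opC_opB opB_opC rval_lam_orb algebra_simps)
    have "entire_seq (opB (opC a))" using eA by (simp add: entire_opB)
    moreover have "entire_seq (\<lambda>n. of_real (rval (lam S h) (orb n)) * a n)"
      using rep_fnormal_ser[OF e, of "lift_A (lam S h)"] by (simp add: nseq_lift_A[abs_def])
    ultimately have "ser (opC (opB a)) w = ser (opB (opC a)) w + ser (\<lambda>n. of_real (rval (lam S h) (orb n)) * a n) w" for w
      unfolding s by (rule ser_add)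
    then show ?thesis unfolding 1 using nf[OF e, of "lam S h"]
      by (simp add: fun_eq_iff rep_minus gg gops_def a)
  next
    case 2
    have "opC (opA i a) = (\<lambda>n. of_real (rval (flow_at S h i) (orb n)) * opC a n)"
      by (simp add: fun_eq_iff opC_def opA_def rval_flow_at flow_orb_Suc) (simp add: orb_def mult_ac)
    then show ?thesis unfolding 2 using nf[OF eA(3), of "flow_at S h i"] C_op_ser[OF e]
      by (intro ext) (simp add: rep_minus gg gops_def rep_times_gen[of "fnormal (lift_A (flow_at S h i))" gC] a gen_op_def)
  next
    case 3
    have "opA i (opA j a) = opA j (opA i a)" by (simp add: opA_def fun_eq_iff)
    then show ?thesis unfolding 3 by (intro ext) (simp add: rep_minus gg gops_def a)
  qed
qed

lemma hermitian: "hermitian_rep S h"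
  unfolding hermitian_rep_def using rep_operators relators_vanish adjoint_B adjoint_A by blast

end

section \<open>Positivity of the Kaehler form\<close>

lemma has_derivative_cmod_sq:
  "((\<lambda>y. (cmod y)\<^sup>2) has_derivative (\<lambda>v. 2 * (z \<bullet> v))) (at z)"
proof -
  have "((\<lambda>y. y \<bullet> y) has_derivative (\<lambda>v. z \<bullet> v + v \<bullet> z)) (at z)"
    by (rule derivative_eq_intros refl)+
  then show ?thesis by (simp add: dot_square_norm inner_commute)
qed

lemma wirt_has_derivative:
  assumes "(\<phi> has_derivative D) (at z)"
  shows "wirt_z \<phi> z = (D 1 - \<i> * D \<i>) / 2" "wirt_zbar \<phi> z = (D 1 + \<i> * D \<i>) / 2"
  using frechet_derivative_at[OF assms, symmetric] by (simp_all add: wirt_z_def wirt_zbar_def)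

context quantized_surface
begin

text \<open>
  The function \<open>k\<close> of the reproducing kernel on the half line, with its first two derivatives.
\<close>

definition kr :: "real \<Rightarrow> real" where "kr r = suminf (\<lambda>n. W n * r ^ n)"

definition kr1 :: "real \<Rightarrow> real" where "kr1 r = suminf (\<lambda>n. diffs W n * r ^ n)"

definition kr2 :: "real \<Rightarrow> real" where "kr2 r = suminf (\<lambda>n. diffs (diffs W) n * r ^ n)"

lemma summable_W_poly: "summable (\<lambda>n. poly p (real n) * (W n * r ^ n))"
proof -
  have "entire_seq (\<lambda>n. poly (map_poly of_real p) (of_nat n) * of_real (W n))"
    by (rule entire_seq_poly[OF entire_seq_W])
  then have "summable (\<lambda>n. poly (map_poly of_real p) (of_nat n) * of_real (W n) * complex_of_real r ^ n)"
    by (simp add: entire_seq_def)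
  moreover have "poly (map_poly of_real p) (of_nat n) * of_real (W n) * of_real r ^ n =
     complex_of_real (poly p (real n) * (W n * r ^ n))" for n
    using ring_hom_poly_comp[OF ring_hom_of_real, of p "real n"] by simp
  ultimately have "summable (\<lambda>n. complex_of_real (poly p (real n) * (W n * r ^ n)))" by simp
  then show ?thesis by (simp only: summable_of_real_iff)
qed

lemma summable_W: "summable (\<lambda>n. W n * r ^ n)"
  using summable_W_poly[of 1 r] by simp

lemma kr_deriv: "(kr has_real_derivative kr1 r) (at r)"
  unfolding kr_def[abs_def] kr1_def by (rule termdiffs_strong_converges_everywhere) (rule summable_W)

lemma kr1_deriv: "(kr1 has_real_derivative kr2 r) (at r)"
  unfolding kr1_def[abs_def] kr2_def
  by (rule termdiffs_strong_converges_everywhere) (rule termdiff_converges_all[OF summable_W])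

lemma kr_pos: "r \<ge> 0 \<Longrightarrow> kr r > 0"
proof -
  assume r: "r \<ge> 0"
  have "(\<Sum>n<1. W n * r ^ n) \<le> kr r"
    unfolding kr_def by (rule sum_le_suminf[OF summable_W]) (auto simp: W_nonneg r)
  then show ?thesis by simp
qed

lemma kfun_real: "kfun S h (of_real r) = of_real (kr r)"
proof -
  have "of_real (kr r) = suminf (\<lambda>n. complex_of_real (W n * r ^ n))"
    unfolding kr_def by (rule suminf_of_real[OF summable_W])
  then show ?thesis by (simp add: kfun_eq ser_def)
qed

lemma r_kr1: "r * kr1 r = suminf (\<lambda>n. real n * (W n * r ^ n))"
proof -
  have s: "summable (\<lambda>n. diffs W n * r ^ n)" by (rule termdiff_converges_all[OF summable_W])
  have "r * kr1 r = suminf (\<lambda>n. r * (diffs W n * r ^ n))"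
    unfolding kr1_def by (rule suminf_mult[OF s, symmetric])
  also have "\<dots> = suminf (\<lambda>n. real (Suc n) * (W (Suc n) * r ^ Suc n))"
    by (simp add: diffs_def mult_ac)
  also have "\<dots> = suminf (\<lambda>n. real n * (W n * r ^ n))"
    using suminf_split_head[of "\<lambda>n. real n * (W n * r ^ n)"] summable_W_poly[of "[:0, 1:]" r] by simp
  finally show ?thesis .
qed

lemma r_kr2: "r * (kr1 r + r * kr2 r) = suminf (\<lambda>n. (real n)\<^sup>2 * (W n * r ^ n))"
proof -
  have s: "summable (\<lambda>n. diffs (diffs W) n * r ^ n)"
    by (rule termdiff_converges_all[OF termdiff_converges_all[OF summable_W]])
  have "r * (r * kr2 r) = suminf (\<lambda>n. r * (r * (diffs (diffs W) n * r ^ n)))"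
    unfolding kr2_def by (subst suminf_mult[OF s, symmetric], subst suminf_mult[OF summable_mult[OF s], symmetric]) simp
  also have "\<dots> = suminf (\<lambda>n. (\<lambda>n. real n * (real n - 1) * (W n * r ^ n)) (Suc (Suc n)))"
    by (rule suminf_cong) (simp add: diffs_def algebra_simps)
  also have "\<dots> = suminf (\<lambda>n. (\<lambda>n. real n * (real n - 1) * (W n * r ^ n)) (Suc n))"
    using suminf_split_head[of "\<lambda>n. (\<lambda>n. real n * (real n - 1) * (W n * r ^ n)) (Suc n)"]
      summable_Suc_iff[of "\<lambda>n. real n * (real n - 1) * (W n * r ^ n)"] summable_W_poly[of "[:0, 1:] * [:-1, 1:]" r]
    by (simp add: algebra_simps)
  also have "\<dots> = suminf (\<lambda>n. real n * (real n - 1) * (W n * r ^ n))"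
    using suminf_split_head[of "\<lambda>n. real n * (real n - 1) * (W n * r ^ n)"] summable_W_poly[of "[:0, 1:] * [:-1, 1:]" r]
    by (simp add: algebra_simps)
  finally have "r * (kr1 r + r * kr2 r) = suminf (\<lambda>n. real n * (W n * r ^ n)) + suminf (\<lambda>n. real n * (real n - 1) * (W n * r ^ n))"
    using r_kr1[of r] by (simp add: distrib_left)
  also have "\<dots> = suminf (\<lambda>n. real n * (W n * r ^ n) + real n * (real n - 1) * (W n * r ^ n))"
    using summable_W_poly[of "[:0, 1:] * [:-1, 1:]" r] summable_W_poly[of "[:0, 1:]" r]
    by (intro suminf_add) (simp_all add: algebra_simps)
  finally show ?thesis by (simp add: power2_eq_square algebra_simps)
qed

text \<open>
  With \<open>n\<close> distributed according to the weights \<open>W n r\<^sup>n\<close>, the left-hand side is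
  \<open>k\<^sup>2 / r\<close> times the variance of \<open>n\<close>, for \<open>r > 0\<close>.  It is positive because \<open>n = 0\<close> and \<open>n = 1\<close> both
  have positive weight.
\<close>

lemma variance_pos:
  assumes r: "r \<ge> 0" and top: "topN S h \<noteq> 0"
  shows "(kr1 r + r * kr2 r) * kr r - r * (kr1 r)\<^sup>2 > 0"
proof -
  have top1: "enat 1 \<le> topN S h" using top by (metis Suc_ile_eq One_nat_def enat_0 i0_less)
  have k: "kr r > 0" by (rule kr_pos[OF r])
  show ?thesis
  proof (cases "r = 0")
    case True
    have "kr1 0 = W 1" by (simp add: kr1_def diffs_def)
    then show ?thesis using W_pos[OF top1] k by (simp add: True)
  next
    case False
    then have r0: "r > 0" using r by simp
    define c where "c = r * kr1 r / kr r"
    have p: "poly ([:-c, 1:] * [:-c, 1:]) (real n) = (real n - c)\<^sup>2" for n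
      by (simp add: power2_eq_square algebra_simps)
    have s: "summable (\<lambda>n. (real n - c)\<^sup>2 * (W n * r ^ n))"
      using summable_W_poly[of "[:-c, 1:] * [:-c, 1:]" r] unfolding p .
    have nn: "(real n - c)\<^sup>2 * (W n * r ^ n) \<ge> 0" for n using r W_nonneg by simp
    have "suminf (\<lambda>n. (real n - c)\<^sup>2 * (W n * r ^ n)) > 0"
    proof (cases "c = 0")
      case True
      then show ?thesis using W_pos[OF top1] r0 by (intro suminf_pos2[OF s nn, of 1]) simp
    next
      case False
      then show ?thesis by (intro suminf_pos2[OF s nn, of 0]) simp
    qed
    also have "suminf (\<lambda>n. (real n - c)\<^sup>2 * (W n * r ^ n)) =
      suminf (\<lambda>n. (real n)\<^sup>2 * (W n * r ^ n) + ((- 2 * c) * (real n * (W n * r ^ n)) + c\<^sup>2 * (W n * r ^ n)))"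
      by (rule suminf_cong) (simp add: power2_eq_square algebra_simps)
    also have "\<dots> = suminf (\<lambda>n. (real n)\<^sup>2 * (W n * r ^ n)) + ((- 2 * c) * suminf (\<lambda>n. real n * (W n * r ^ n)) + c\<^sup>2 * kr r)"
    proof -
      have s1: "summable (\<lambda>n. real n * (W n * r ^ n))" using summable_W_poly[of "[:0, 1:]" r] by simp
      have s2: "summable (\<lambda>n. (real n)\<^sup>2 * (W n * r ^ n))"
        using summable_W_poly[of "[:0, 1:] * [:0, 1:]" r] by (simp add: power2_eq_square)
      have s3: "summable (\<lambda>n. (- 2 * c) * (real n * (W n * r ^ n)))" by (rule summable_mult[OF s1])
      have s4: "summable (\<lambda>n. c\<^sup>2 * (W n * r ^ n))" by (rule summable_mult[OF summable_W])
      show ?thesis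
        unfolding kr_def suminf_mult[OF s1, symmetric] suminf_mult[OF summable_W, symmetric]
        by (simp only: suminf_add[OF s3 s4] suminf_add[OF s2 summable_add[OF s3 s4]])
    qed
    also have "\<dots> = r * (kr1 r + r * kr2 r) - r\<^sup>2 * (kr1 r)\<^sup>2 / kr r"
      unfolding r_kr1[symmetric] r_kr2[symmetric] using k by (simp add: c_def field_simps power2_eq_square)
    finally have "r * ((kr1 r + r * kr2 r) * kr r - r * (kr1 r)\<^sup>2) > 0"
      using k by (simp add: field_simps power2_eq_square)
    then show ?thesis using r0 by (simp add: zero_less_mult_iff)
  qed
qed

text \<open>
  For a function of \<open>r = \<bar>z\<bar>\<^sup>2\<close> the mixed derivative is \<open>(r \<phi>')'\<close>; with \<open>\<phi> = ln k\<close> it is the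
  expression of \<open>variance_pos\<close> divided by \<open>k\<^sup>2\<close>.
\<close>

lemma kahler_positive:
  assumes top: "topN S h \<noteq> 0"
  shows "\<exists>p>0. kahler_coeff S h z = \<i> * complex_of_real p"
proof -
  define L1 where "L1 = (\<lambda>r. kr1 r / kr r)"
  define L2 where "L2 = (\<lambda>r. (kr2 r * kr r - (kr1 r)\<^sup>2) / (kr r)\<^sup>2)"
  have k0: "kr ((cmod y)\<^sup>2) > 0" for y by (rule kr_pos) simp
  have Ln: "Ln (kfun S h (of_real ((norm y)\<^sup>2))) = of_real (ln (kr ((cmod y)\<^sup>2)))" for y
    unfolding kfun_real by (rule Ln_of_real[OF k0])
  have d1: "((\<lambda>r. ln (kr r)) has_real_derivative L1 ((cmod y)\<^sup>2)) (at ((cmod y)\<^sup>2))" for y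
    using k0[of y] unfolding L1_def by (auto intro!: derivative_eq_intros kr_deriv simp: field_simps)
  have d2: "(L1 has_real_derivative L2 ((cmod y)\<^sup>2)) (at ((cmod y)\<^sup>2))" for y
    using k0[of y] unfolding L1_def L2_def
    by (auto intro!: derivative_eq_intros kr_deriv kr1_deriv simp: field_simps power2_eq_square)
  have D1: "((\<lambda>y. complex_of_real (ln (kr ((cmod y)\<^sup>2)))) has_derivative
      (\<lambda>v. complex_of_real (L1 ((cmod y)\<^sup>2) * (2 * (y \<bullet> v))))) (at y)" for y
    by (intro has_derivative_of_real has_derivative_compose[OF has_derivative_cmod_sq d1[unfolded has_field_derivative_def], unfolded o_def])
  have w1: "wirt_z (\<lambda>y. Ln (kfun S h (of_real ((norm y)\<^sup>2)))) y = of_real (L1 ((cmod y)\<^sup>2)) * cnj y" for y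
    unfolding Ln wirt_has_derivative[OF D1]
    by (simp add: complex_eq_iff inner_complex_def algebra_simps)
  have D2: "((\<lambda>y. of_real (L1 ((cmod y)\<^sup>2)) * cnj y) has_derivative
      (\<lambda>v. of_real (L1 ((cmod z)\<^sup>2)) * cnj v + complex_of_real (L2 ((cmod z)\<^sup>2) * (2 * (z \<bullet> v))) * cnj z)) (at z)"
    by (intro has_derivative_mult has_derivative_of_real has_derivative_cnj has_derivative_ident
       has_derivative_compose[OF has_derivative_cmod_sq d2[unfolded has_field_derivative_def], unfolded o_def])
  let ?r = "(cmod z)\<^sup>2"
  have "wirt_zbar (wirt_z (\<lambda>y. Ln (kfun S h (of_real ((norm y)\<^sup>2))))) z = of_real (L1 ?r + ?r * L2 ?r)"
  proof -
    define l1 where "l1 = L1 ?r"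
    define l2 where "l2 = L2 ?r"
    have "wirt_zbar (\<lambda>y. of_real (L1 ((cmod y)\<^sup>2)) * cnj y) z =
       (of_real l1 * cnj 1 + complex_of_real (l2 * (2 * (z \<bullet> 1))) * cnj z +
        \<i> * (of_real l1 * cnj \<i> + complex_of_real (l2 * (2 * (z \<bullet> \<i>))) * cnj z)) / 2"
      by (rule wirt_has_derivative(2)[OF D2, folded l1_def l2_def])
    also have "\<dots> = of_real (l1 + ?r * l2)"
      unfolding cmod_power2 by (simp add: complex_eq_iff inner_complex_def power2_eq_square algebra_simps)
    finally have "wirt_zbar (\<lambda>y. of_real (L1 ((cmod y)\<^sup>2)) * cnj y) z = of_real (l1 + ?r * l2)" .
    then show ?thesis unfolding w1[abs_def] l1_def l2_def .
  qed
  then have "kahler_coeff S h z = \<i> * of_real (h * (L1 ?r + ?r * L2 ?r))"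
    by (simp add: kahler_coeff_def)
  moreover have "h * (L1 ?r + ?r * L2 ?r) > 0"
  proof -
    have "L1 ?r + ?r * L2 ?r = ((kr1 ?r + ?r * kr2 ?r) * kr ?r - ?r * (kr1 ?r)\<^sup>2) / (kr ?r)\<^sup>2"
      using k0[of z] unfolding L1_def L2_def by (simp add: field_simps power2_eq_square)
    also have "\<dots> > 0" using variance_pos[of ?r, OF _ top] k0[of z] by simp
    finally show ?thesis using h_pos by simp
  qed
  ultimately show ?thesis by blast
qed

end

section \<open>Coefficient functions on the plane\<close>

text \<open>
  The partial derivatives in \<open>Re z\<close> and \<open>Im z\<close> as functions, so that they can be iterated;
  they are meaningful for functions with \<open>has_pd\<close>.
\<close>

definition pd1 :: "(complex \<Rightarrow> complex) \<Rightarrow> complex \<Rightarrow> complex" where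
  "pd1 f z = frechet_derivative f (at z) 1"

definition pd2 :: "(complex \<Rightarrow> complex) \<Rightarrow> complex \<Rightarrow> complex" where
  "pd2 f z = frechet_derivative f (at z) \<i>"

lemma pd_eqI:
  assumes "\<And>z. (f has_derivative (\<lambda>v. of_real (Re v) * a z + of_real (Im v) * b z)) (at z)"
  shows "pd1 f = a" "pd2 f = b"
  using frechet_derivative_at[OF assms, symmetric] by (simp_all add: pd1_def pd2_def fun_eq_iff)

definition has_pd :: "(complex \<Rightarrow> complex) \<Rightarrow> bool" where
  "has_pd f \<longleftrightarrow> (\<forall>z. (f has_derivative (\<lambda>v. of_real (Re v) * pd1 f z + of_real (Im v) * pd2 f z)) (at z))"

lemma has_pdI:
  assumes "\<And>z. (f has_derivative (\<lambda>v. of_real (Re v) * a z + of_real (Im v) * b z)) (at z)"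
  shows "has_pd f"
  using assms pd_eqI[OF assms] by (simp add: has_pd_def)

lemma has_pdD: "has_pd f \<Longrightarrow> (f has_derivative (\<lambda>v. of_real (Re v) * pd1 f z + of_real (Im v) * pd2 f z)) (at z)"
  by (simp add: has_pd_def)

lemma pd_add:
  assumes "has_pd f" "has_pd g"
  shows "has_pd (\<lambda>z. f z + g z)" "pd1 (\<lambda>z. f z + g z) = (\<lambda>z. pd1 f z + pd1 g z)"
    "pd2 (\<lambda>z. f z + g z) = (\<lambda>z. pd2 f z + pd2 g z)"
proof -
  have *: "((\<lambda>z. f z + g z) has_derivative (\<lambda>v. of_real (Re v) * (pd1 f z + pd1 g z) + of_real (Im v) * (pd2 f z + pd2 g z))) (at z)" for z
    using has_derivative_add[OF has_pdD[OF assms(1)] has_pdD[OF assms(2)]]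
    by (rule has_derivative_eq_rhs) (simp add: fun_eq_iff algebra_simps)
  show "has_pd (\<lambda>z. f z + g z)" by (rule has_pdI[OF *])
  show "pd1 (\<lambda>z. f z + g z) = (\<lambda>z. pd1 f z + pd1 g z)" "pd2 (\<lambda>z. f z + g z) = (\<lambda>z. pd2 f z + pd2 g z)"
    by (rule pd_eqI[OF *])+
qed

lemma pd_mult:
  assumes "has_pd f" "has_pd g"
  shows "has_pd (\<lambda>z. f z * g z)" "pd1 (\<lambda>z. f z * g z) = (\<lambda>z. pd1 f z * g z + f z * pd1 g z)"
    "pd2 (\<lambda>z. f z * g z) = (\<lambda>z. pd2 f z * g z + f z * pd2 g z)"
proof -
  have *: "((\<lambda>z. f z * g z) has_derivative (\<lambda>v. of_real (Re v) * (pd1 f z * g z + f z * pd1 g z) + of_real (Im v) * (pd2 f z * g z + f z * pd2 g z))) (at z)" for z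
    using has_derivative_mult[OF has_pdD[OF assms(1)] has_pdD[OF assms(2)]]
    by (rule has_derivative_eq_rhs) (simp add: fun_eq_iff algebra_simps)
  show "has_pd (\<lambda>z. f z * g z)" by (rule has_pdI[OF *])
  show "pd1 (\<lambda>z. f z * g z) = (\<lambda>z. pd1 f z * g z + f z * pd1 g z)" "pd2 (\<lambda>z. f z * g z) = (\<lambda>z. pd2 f z * g z + f z * pd2 g z)"
    by (rule pd_eqI[OF *])+
qed

lemma pd_const: "has_pd (\<lambda>z. c)" "pd1 (\<lambda>z. c) = (\<lambda>z. 0)" "pd2 (\<lambda>z. c) = (\<lambda>z. 0)"
proof -
  have *: "((\<lambda>z. c) has_derivative (\<lambda>v. of_real (Re v) * 0 + of_real (Im v) * 0)) (at z)" for z :: complex and c :: complex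
    by simp
  show "has_pd (\<lambda>z. c)" by (rule has_pdI[OF *])
  show "pd1 (\<lambda>z. c) = (\<lambda>z. 0)" "pd2 (\<lambda>z. c) = (\<lambda>z. 0)" by (rule pd_eqI[OF *])+
qed

lemma pd_z: "has_pd (\<lambda>z. z)" "pd1 (\<lambda>z. z) = (\<lambda>z. 1)" "pd2 (\<lambda>z. z) = (\<lambda>z. \<i>)"
proof -
  have *: "((\<lambda>z. z) has_derivative (\<lambda>v. of_real (Re v) * 1 + of_real (Im v) * \<i>)) (at z)" for z :: complex
    by (rule has_derivative_eq_rhs[OF has_derivative_ident]) (simp add: fun_eq_iff complex_eq_iff)
  show "has_pd (\<lambda>z. z)" by (rule has_pdI[OF *])
  show "pd1 (\<lambda>z. z) = (\<lambda>z. 1)" "pd2 (\<lambda>z. z) = (\<lambda>z. \<i>)" by (rule pd_eqI[OF *])+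
qed

lemma pd_cnj: "has_pd cnj" "pd1 cnj = (\<lambda>z. 1)" "pd2 cnj = (\<lambda>z. - \<i>)"
proof -
  have *: "(cnj has_derivative (\<lambda>v. of_real (Re v) * 1 + of_real (Im v) * (- \<i>))) (at z)" for z :: complex
    by (rule has_derivative_eq_rhs[OF has_derivative_cnj[OF has_derivative_ident]]) (simp add: fun_eq_iff complex_eq_iff)
  show "has_pd cnj" by (rule has_pdI[OF *])
  show "pd1 cnj = (\<lambda>z. 1)" "pd2 cnj = (\<lambda>z. - \<i>)" by (rule pd_eqI[OF *])+
qed

lemma pd_radial:
  assumes "\<And>z. (f has_derivative (\<lambda>v. of_real (2 * (z \<bullet> v)) * f' z)) (at z)"
  shows "has_pd f" "pd1 f = (\<lambda>z. (z + cnj z) * f' z)" "pd2 f = (\<lambda>z. - \<i> * (z - cnj z) * f' z)"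
proof -
  have *: "(f has_derivative (\<lambda>v. of_real (Re v) * ((z + cnj z) * f' z) + of_real (Im v) * (- \<i> * (z - cnj z) * f' z))) (at z)" for z
    by (rule has_derivative_eq_rhs[OF assms])
      (simp add: fun_eq_iff complex_eq_iff inner_complex_def algebra_simps)
  show "has_pd f" by (rule has_pdI[OF *])
  show "pd1 f = (\<lambda>z. (z + cnj z) * f' z)" "pd2 f = (\<lambda>z. - \<i> * (z - cnj z) * f' z)" by (rule pd_eqI[OF *])+
qed

context revolution_surface
begin

text \<open>
  The classical time of the point with coordinate \<open>z\<close>, and the reciprocal of \<open>G1\<close>, which is what
  differentiating the time produces.
\<close>

definition Tc :: "complex \<Rightarrow> complex" where "Tc z = of_real (t0 ((cmod z)\<^sup>2))"

definition Vc :: "complex \<Rightarrow> complex" where "Vc z = 1 / of_real (G1 ((cmod z)\<^sup>2))"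

definition cR :: "complex poly" where "cR = map_poly of_real Rp"
definition cQ :: "complex poly" where "cQ = map_poly of_real Qp"

lemma poly_cR: "poly cR (of_real t) = of_real (poly Rp t)"
  by (simp add: cR_def ring_hom_poly_comp[OF ring_hom_of_real])

lemma poly_cQ: "poly cQ (of_real t) = of_real (poly Qp t)"
  by (simp add: cQ_def ring_hom_poly_comp[OF ring_hom_of_real])

text \<open>
  The coefficients of the expansions are built from the classical time and what its derivatives need.
  The class is chosen to be closed under differentiation, so that smoothness follows without computing
  derivatives of higher order.
\<close>

inductive_set radial_fns :: "(complex \<Rightarrow> complex) set" where
  const: "(\<lambda>z. c) \<in> radial_fns"
| T: "Tc \<in> radial_fns"
| V: "Vc \<in> radial_fns"
| rad: "(\<lambda>z. z * cnj z) \<in> radial_fns"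
| add: "f \<in> radial_fns \<Longrightarrow> g \<in> radial_fns \<Longrightarrow> (\<lambda>z. f z + g z) \<in> radial_fns"
| mult: "f \<in> radial_fns \<Longrightarrow> g \<in> radial_fns \<Longrightarrow> (\<lambda>z. f z * g z) \<in> radial_fns"

inductive_set coeff_fns :: "(complex \<Rightarrow> complex) set" where
  radial: "f \<in> radial_fns \<Longrightarrow> f \<in> coeff_fns"
| z: "(\<lambda>z. z) \<in> coeff_fns"
| cnj: "cnj \<in> coeff_fns"
| add: "f \<in> coeff_fns \<Longrightarrow> g \<in> coeff_fns \<Longrightarrow> (\<lambda>z. f z + g z) \<in> coeff_fns"
| mult: "f \<in> coeff_fns \<Longrightarrow> g \<in> coeff_fns \<Longrightarrow> (\<lambda>z. f z * g z) \<in> coeff_fns"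

lemma radial_poly: "f \<in> radial_fns \<Longrightarrow> (\<lambda>z. poly p (f z)) \<in> radial_fns"
proof (induction p)
  case (pCons a p)
  have "(\<lambda>z. a + f z * poly p (f z)) \<in> radial_fns"
    by (intro radial_fns.add radial_fns.const radial_fns.mult pCons)
  then show ?case by simp
qed (simp add: radial_fns.const)

lemma coeff_const: "(\<lambda>z. c) \<in> coeff_fns"
  by (intro coeff_fns.radial radial_fns.const)

lemma coeff_poly: "f \<in> coeff_fns \<Longrightarrow> (\<lambda>z. poly p (f z)) \<in> coeff_fns"
proof (induction p)
  case (pCons a p)
  have "(\<lambda>z. a + f z * poly p (f z)) \<in> coeff_fns"
    by (intro coeff_fns.add coeff_const coeff_fns.mult pCons)
  then show ?case by simp
qed (simp add: coeff_const)

lemma coeff_T: "Tc \<in> coeff_fns"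
  by (intro coeff_fns.radial radial_fns.T)

lemma coeff_scale: "f \<in> coeff_fns \<Longrightarrow> (\<lambda>z. c * f z) \<in> coeff_fns"
  by (intro coeff_fns.mult coeff_const)

lemma Tc_deriv: "(Tc has_derivative (\<lambda>v. of_real (2 * (z \<bullet> v)) * (poly cQ (Tc z) * Vc z))) (at z)"
proof -
  have "(t0 has_derivative (*) (poly Qp (t0 ((cmod z)\<^sup>2)) / G1 ((cmod z)\<^sup>2))) (at ((cmod z)\<^sup>2) within {0..})"
    using t0_deriv[of "(cmod z)\<^sup>2"] by (simp add: has_field_derivative_def)
  moreover have "range (\<lambda>y. (cmod y)\<^sup>2) \<subseteq> {0..}" by auto
  ultimately have "(t0 has_derivative (*) (poly Qp (t0 ((cmod z)\<^sup>2)) / G1 ((cmod z)\<^sup>2)))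
      (at ((cmod z)\<^sup>2) within range (\<lambda>y. (cmod y)\<^sup>2))" by (rule has_derivative_subset)
  from has_derivative_in_compose[OF has_derivative_cmod_sq this] have "((\<lambda>y. t0 ((cmod y)\<^sup>2)) has_derivative
      (\<lambda>v. poly Qp (t0 ((cmod z)\<^sup>2)) / G1 ((cmod z)\<^sup>2) * (2 * (z \<bullet> v)))) (at z)" .
  from has_derivative_of_real[OF this, where 'a = complex] show ?thesis
    unfolding Tc_def[abs_def] by (rule has_derivative_eq_rhs) (simp add: Tc_def Vc_def poly_cQ fun_eq_iff)
qed

lemma Vc_eq: "Vc z = 1 / (poly (pderiv cR) (Tc z) - z * cnj z * poly (pderiv cQ) (Tc z))"
proof -
  have "pderiv cR = map_poly of_real (pderiv Rp)" "pderiv cQ = map_poly of_real (pderiv Qp)"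
    by (simp_all add: cR_def cQ_def poly_eq_iff coeff_pderiv coeff_map_poly)
  moreover have "z * cnj z = of_real ((cmod z)\<^sup>2)" by (metis complex_norm_square of_real_power)
  ultimately show ?thesis
    by (simp add: Vc_def G1_def Tc_def ring_hom_poly_comp[OF ring_hom_of_real, symmetric])
qed

lemma Vc_nonzero: "of_real (G1 ((cmod z)\<^sup>2)) \<noteq> (0::complex)"
  using G1_nonzero[of "(cmod z)\<^sup>2"] by simp

definition has_radial :: "(complex \<Rightarrow> complex) \<Rightarrow> (complex \<Rightarrow> complex) \<Rightarrow> bool" where
  "has_radial f f' \<longleftrightarrow> (\<forall>z. (f has_derivative (\<lambda>v. of_real (2 * (z \<bullet> v)) * f' z)) (at z))"

lemma has_radial_T: "has_radial Tc (\<lambda>z. poly cQ (Tc z) * Vc z)"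
  unfolding has_radial_def using Tc_deriv by blast

lemma has_radial_rad: "has_radial (\<lambda>z. z * cnj z) (\<lambda>z. 1)"
proof -
  have "((\<lambda>z. z * cnj z) has_derivative (\<lambda>v. z * cnj v + v * cnj z)) (at z)" for z
    by (intro has_derivative_mult has_derivative_cnj has_derivative_ident)
  note * = this
  show ?thesis unfolding has_radial_def
  proof
    fix z
    show "((\<lambda>z. z * cnj z) has_derivative (\<lambda>v. complex_of_real (2 * (z \<bullet> v)) * 1)) (at z)"
      by (rule has_derivative_eq_rhs[OF *]) (auto simp: fun_eq_iff complex_eq_iff inner_complex_def algebra_simps)
  qed
qed

lemma has_radial_const: "has_radial (\<lambda>z. c) (\<lambda>z. 0)"
  by (simp add: has_radial_def)

lemma has_radial_add: "has_radial f f' \<Longrightarrow> has_radial g g' \<Longrightarrow> has_radial (\<lambda>z. f z + g z) (\<lambda>z. f' z + g' z)"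
  unfolding has_radial_def
proof
  fix z
  assume f: "\<forall>z. (f has_derivative (\<lambda>v. complex_of_real (2 * (z \<bullet> v)) * f' z)) (at z)"
    and g: "\<forall>z. (g has_derivative (\<lambda>v. complex_of_real (2 * (z \<bullet> v)) * g' z)) (at z)"
  show "((\<lambda>z. f z + g z) has_derivative (\<lambda>v. complex_of_real (2 * (z \<bullet> v)) * (f' z + g' z))) (at z)"
    by (rule has_derivative_eq_rhs[OF has_derivative_add[OF f[rule_format] g[rule_format]]]) (simp add: fun_eq_iff algebra_simps)
qed

lemma has_radial_mult: "has_radial f f' \<Longrightarrow> has_radial g g' \<Longrightarrow> has_radial (\<lambda>z. f z * g z) (\<lambda>z. f' z * g z + f z * g' z)"
  unfolding has_radial_def
proof
  fix z
  assume f: "\<forall>z. (f has_derivative (\<lambda>v. complex_of_real (2 * (z \<bullet> v)) * f' z)) (at z)"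
    and g: "\<forall>z. (g has_derivative (\<lambda>v. complex_of_real (2 * (z \<bullet> v)) * g' z)) (at z)"
  show "((\<lambda>z. f z * g z) has_derivative (\<lambda>v. complex_of_real (2 * (z \<bullet> v)) * (f' z * g z + f z * g' z))) (at z)"
    by (rule has_derivative_eq_rhs[OF has_derivative_mult[OF f[rule_format] g[rule_format]]]) (simp add: fun_eq_iff algebra_simps)
qed

lemma has_radial_poly:
  assumes "has_radial f f'"
  shows "has_radial (\<lambda>z. poly p (f z)) (\<lambda>z. poly (pderiv p) (f z) * f' z)"
proof (induction p)
  case 0
  show ?case by (simp add: has_radial_const)
next
  case (pCons a p)
  from has_radial_add[OF has_radial_const[of a] has_radial_mult[OF assms pCons(2)]]
  show ?case by (simp add: pderiv_pCons algebra_simps)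
qed

text \<open>
  The derivative in \<open>\<bar>z\<bar>\<^sup>2\<close> of a radial function is radial: \<open>t0\<close> is the inverse of \<open>H\<close>, so its
  derivative is the rational expression \<open>Q / G1\<close>, and \<open>G1\<close> is itself polynomial in \<open>t0\<close> and \<open>\<bar>z\<bar>\<^sup>2\<close>.
\<close>

lemma radial_deriv: "f \<in> radial_fns \<Longrightarrow> \<exists>f'\<in>radial_fns. has_radial f f'"
proof (induction rule: radial_fns.induct)
  case (const c)
  show ?case by (rule bexI, rule has_radial_const, rule radial_fns.const)
next
  case T
  show ?case
    by (rule bexI, rule has_radial_T, rule radial_fns.mult[OF radial_poly[OF radial_fns.T] radial_fns.V])
next
  case V
  \<comment> \<open>\<open>u\<close> is \<open>G1\<close> as a polynomial in the time and \<open>\<bar>z\<bar>\<^sup>2\<close>, and \<open>u'\<close> is its radial derivative in the form produced by the rules\<close>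
  define u where "u = (\<lambda>z. poly (pderiv cR) (Tc z) + (\<lambda>z. -1) z * (z * cnj z * poly (pderiv cQ) (Tc z)))"
  define u' where "u' = (\<lambda>z. poly (pderiv (pderiv cR)) (Tc z) * (poly cQ (Tc z) * Vc z) +
     (0 * (z * cnj z * poly (pderiv cQ) (Tc z)) + (-1) *
       (1 * poly (pderiv cQ) (Tc z) + z * cnj z * (poly (pderiv (pderiv cQ)) (Tc z) * (poly cQ (Tc z) * Vc z)))))"
  have u: "has_radial u u'" unfolding u_def u'_def
    by (rule has_radial_add[OF has_radial_poly[OF has_radial_T] has_radial_mult[OF has_radial_const
        has_radial_mult[OF has_radial_rad has_radial_poly[OF has_radial_T]]]])
  have Vu: "Vc z = 1 / u z" for z unfolding Vc_eq u_def by simp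
  have nz: "u z \<noteq> 0" for z using Vc_nonzero[of z] Vu[of z] by (auto simp: Vc_def)
  have "has_radial Vc (\<lambda>z. (-1) * (u' z * (Vc z * Vc z)))" unfolding has_radial_def
  proof
    fix z
    have "((\<lambda>z. inverse (u z)) has_derivative (\<lambda>v. - (inverse (u z) * (of_real (2 * (z \<bullet> v)) * u' z) * inverse (u z)))) (at z)"
      by (rule Deriv.has_derivative_inverse[OF nz u[unfolded has_radial_def, rule_format]])
    moreover have "(\<lambda>z. inverse (u z)) = Vc" by (rule ext) (simp add: Vu inverse_eq_divide)
    ultimately show "(Vc has_derivative (\<lambda>v. complex_of_real (2 * (z \<bullet> v)) * (- 1 * (u' z * (Vc z * Vc z))))) (at z)"
      by (simp add: Vu inverse_eq_divide mult_ac)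
  qed
  moreover have "(\<lambda>z. (-1) * (u' z * (Vc z * Vc z))) \<in> radial_fns"
  proof -
    have p: "(\<lambda>z. poly p (Tc z)) \<in> radial_fns" for p by (rule radial_poly[OF radial_fns.T])
    note m = radial_fns.mult and c = radial_fns.const
    have u': "u' \<in> radial_fns" unfolding u'_def
      by (rule radial_fns.add[OF m[OF p m[OF p radial_fns.V]] radial_fns.add[OF m[OF c m[OF radial_fns.rad p]]
          m[OF c radial_fns.add[OF m[OF c p] m[OF radial_fns.rad m[OF p m[OF p radial_fns.V]]]]]]])
    show ?thesis by (rule m[OF c m[OF u' m[OF radial_fns.V radial_fns.V]]])
  qed
  ultimately show ?case by (rule bexI)
next
  case rad
  show ?case by (rule bexI, rule has_radial_rad, rule radial_fns.const)
next
  case (add f g)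
  obtain f' g' where fg: "f' \<in> radial_fns" "has_radial f f'" "g' \<in> radial_fns" "has_radial g g'"
    using add.IH by (elim bexE)
  show ?case
    by (rule bexI, rule has_radial_add[OF fg(2,4)], rule radial_fns.add[OF fg(1,3)])
next
  case (mult f g)
  obtain f' g' where fg: "f' \<in> radial_fns" "has_radial f f'" "g' \<in> radial_fns" "has_radial g g'"
    using mult.IH by (elim bexE)
  show ?case
    by (rule bexI, rule has_radial_mult[OF fg(2,4)])
      (rule radial_fns.add[OF radial_fns.mult[OF fg(1) mult.hyps(2)] radial_fns.mult[OF mult.hyps(1) fg(3)]])
qed

lemma radial_pd:
  assumes "f \<in> radial_fns"
  obtains f' where "f' \<in> radial_fns" "has_pd f" "pd1 f = (\<lambda>z. (z + cnj z) * f' z)" "pd2 f = (\<lambda>z. - \<i> * (z - cnj z) * f' z)"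
proof -
  obtain f' where f': "f' \<in> radial_fns" "has_radial f f'" using radial_deriv[OF assms] by blast
  show ?thesis using that[OF f'(1)] pd_radial[OF f'(2)[unfolded has_radial_def, rule_format]] by blast
qed

lemma coeff_minus_i: "(\<lambda>z. - \<i> * (z - cnj z)) \<in> coeff_fns" "(\<lambda>z. z + cnj z) \<in> coeff_fns"
proof -
  have "(\<lambda>z. - \<i> * (z + (-1) * cnj z)) \<in> coeff_fns"
    by (intro coeff_scale coeff_fns.add coeff_fns.z coeff_fns.cnj)
  then show "(\<lambda>z. - \<i> * (z - cnj z)) \<in> coeff_fns" by simp
qed (intro coeff_fns.add coeff_fns.z coeff_fns.cnj)

lemma coeff_has_pd: "f \<in> coeff_fns \<Longrightarrow> has_pd f \<and> pd1 f \<in> coeff_fns \<and> pd2 f \<in> coeff_fns"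
proof (induction rule: coeff_fns.induct)
  case (radial f)
  obtain f' where f': "f' \<in> radial_fns" "has_pd f" "pd1 f = (\<lambda>z. (z + cnj z) * f' z)" "pd2 f = (\<lambda>z. - \<i> * (z - cnj z) * f' z)"
    using radial_pd[OF radial] by blast
  show ?case unfolding f'(3,4) using f'(1,2)
    by (intro conjI coeff_fns.mult coeff_minus_i coeff_fns.radial)
next
  case z then show ?case by (simp add: pd_z coeff_const)
next
  case cnj then show ?case by (simp add: pd_cnj coeff_const)
next
  case (add f g)
  then show ?case by (auto simp: pd_add intro: coeff_fns.add)
next
  case (mult f g)
  then show ?case by (auto simp: pd_mult intro!: coeff_fns.add intro: coeff_fns.mult)
qed

text \<open>
  Radial functions have the derivatives \<open>2 x f'\<close> and \<open>2 y f'\<close>, whose cross derivatives are both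
  \<open>4 x y f''\<close>.
\<close>

lemma pd_commute: "f \<in> coeff_fns \<Longrightarrow> pd2 (pd1 f) = pd1 (pd2 f)"
proof (induction rule: coeff_fns.induct)
  case (radial f)
  obtain f' where f': "f' \<in> radial_fns" "has_pd f" "pd1 f = (\<lambda>z. (z + cnj z) * f' z)" "pd2 f = (\<lambda>z. - \<i> * (z - cnj z) * f' z)"
    using radial_pd[OF radial] by blast
  obtain f'' where f'': "has_pd f'" "pd1 f' = (\<lambda>z. (z + cnj z) * f'' z)" "pd2 f' = (\<lambda>z. - \<i> * (z - cnj z) * f'' z)"
    using radial_pd[OF f'(1)] by blast
  have 1: "has_pd (\<lambda>z. z + cnj z)" "pd2 (\<lambda>z. z + cnj z) = (\<lambda>z. 0)"
    using pd_add[OF pd_z(1) pd_cnj(1)] by (simp_all add: pd_z pd_cnj)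
  have mc: "has_pd (\<lambda>z. (-1) * cnj z)" "pd1 (\<lambda>z. (-1) * cnj z) = (\<lambda>z. -1)"
    using pd_mult[OF pd_const(1)[of "-1"] pd_cnj(1)] by (simp_all add: pd_const pd_cnj)
  have zc: "has_pd (\<lambda>z. z + (-1) * cnj z)" "pd1 (\<lambda>z. z + (-1) * cnj z) = (\<lambda>z. 0)"
    using pd_add[OF pd_z(1) mc(1)] by (simp_all add: pd_z mc[simplified])
  have "has_pd (\<lambda>z. - \<i> * (z + (-1) * cnj z))" "pd1 (\<lambda>z. - \<i> * (z + (-1) * cnj z)) = (\<lambda>z. 0)"
    using pd_mult[OF pd_const(1)[of "- \<i>"] zc(1)] unfolding pd_const zc(2) by simp_all
  then have 2: "has_pd (\<lambda>z. - \<i> * (z - cnj z))" "pd1 (\<lambda>z. - \<i> * (z - cnj z)) = (\<lambda>z. 0)" by simp_all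
  show ?case unfolding f'(3,4) pd_mult(3)[OF 1(1) f''(1)] pd_mult(2)[OF 2(1) f''(1)] 1(2) 2(2) f''(2,3)
    by (simp add: fun_eq_iff)
next
  case (add f g)
  then show ?case using coeff_has_pd by (simp add: pd_add)
next
  case (mult f g)
  then have h: "has_pd f" "has_pd g" "has_pd (pd1 f)" "has_pd (pd1 g)" "has_pd (pd2 f)" "has_pd (pd2 g)"
    using coeff_has_pd by blast+
  then show ?case using mult
    by (simp add: pd_mult pd_add fun_eq_iff algebra_simps)
qed (simp_all add: pd_z pd_cnj pd_const)

text \<open>
  All iterated partial derivatives stay in the class; as they commute, the array required for smoothness
  consists of those taken first in \<open>Im z\<close> and then in \<open>Re z\<close>.
\<close>

lemma coeff_smooth:
  assumes f: "f \<in> coeff_fns"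
  shows "smooth_plane f"
proof -
  have mem2: "(pd2 ^^ j) f \<in> coeff_fns" for j
    by (induction j) (use f coeff_has_pd in auto)
  have mem: "(pd1 ^^ i) g \<in> coeff_fns" if "g \<in> coeff_fns" for i g
    by (induction i) (use that coeff_has_pd in auto)
  have comm: "pd2 ((pd1 ^^ i) g) = (pd1 ^^ i) (pd2 g)" if "g \<in> coeff_fns" for i g
    by (induction i) (use that pd_commute mem in auto)
  show ?thesis
    unfolding smooth_plane_def
  proof (rule exI[of _ "\<lambda>i j. (pd1 ^^ i) ((pd2 ^^ j) f)"], intro conjI allI)
    fix i j z
    show "((pd1 ^^ i) ((pd2 ^^ j) f) has_derivative (\<lambda>v. Re v *\<^sub>R (pd1 ^^ Suc i) ((pd2 ^^ j) f) z
        + Im v *\<^sub>R (pd1 ^^ i) ((pd2 ^^ Suc j) f) z)) (at z)"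
      using has_pdD[of "(pd1 ^^ i) ((pd2 ^^ j) f)" z] coeff_has_pd[OF mem[OF mem2]] comm[OF mem2]
      by (simp add: scaleR_conv_of_real)
  qed simp
qed

lemma coeff_bounded:
  assumes f: "f \<in> coeff_fns" and K: "bounded K"
  shows "\<exists>M. \<forall>z\<in>K. norm (f z) \<le> M"
proof -
  have "continuous_on UNIV f"
    using has_derivative_continuous[OF has_pdD] coeff_has_pd[OF f]
    by (auto simp: continuous_on_eq_continuous_at)
  then have "compact (f ` closure K)"
    using K by (intro compact_continuous_image) (auto intro: continuous_on_subset simp: compact_closure)
  then have "bounded (f ` closure K)" by (rule compact_imp_bounded)
  then obtain M where "\<forall>y\<in>f ` closure K. norm y \<le> M" by (auto simp: bounded_iff)
  then show ?thesis using closure_subset[of K] by blast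
qed

section \<open>Asymptotic expansions\<close>

abbreviation small :: "real filter" where "small \<equiv> at 0 within {h. admissible S h}"

lemma small_adm: "\<forall>\<^sub>F h in small. admissible S h"
  by (simp add: eventually_at_filter)

lemma small_less: "e > 0 \<Longrightarrow> \<forall>\<^sub>F h in small. 0 < h \<and> h < e"
  unfolding eventually_at by (intro exI[of _ e]) (auto simp: dist_real_def admissible_def)

text \<open>
  Uniformly for \<open>z\<close> in bounded sets; only admissible \<open>h\<close> are considered.
\<close>

definition bigO :: "nat \<Rightarrow> (complex \<Rightarrow> real \<Rightarrow> 'b::real_normed_vector) \<Rightarrow> bool" where
  "bigO L \<psi> \<longleftrightarrow> (\<forall>K. bounded K \<longrightarrow> (\<exists>M\<ge>0. \<forall>\<^sub>F h in small. \<forall>z\<in>K. norm (\<psi> z h) \<le> M * h ^ L))"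

lemma bigOD:
  assumes "bigO L \<psi>" "bounded K"
  obtains M where "M \<ge> 0" "\<forall>\<^sub>F h in small. \<forall>z\<in>K. norm (\<psi> z h) \<le> M * h ^ L"
  using assms by (auto simp: bigO_def)

lemma bigO_mono:
  assumes \<phi>: "bigO L \<phi>" and le: "\<And>z h. admissible S h \<Longrightarrow> norm (\<psi> z h) \<le> norm (\<phi> z h)"
  shows "bigO L \<psi>"
  unfolding bigO_def
proof (intro allI impI)
  fix K :: "complex set" assume "bounded K"
  with \<phi> obtain M where M: "M \<ge> 0" "\<forall>\<^sub>F h in small. \<forall>z\<in>K. norm (\<phi> z h) \<le> M * h ^ L" by (rule bigOD)
  from M(2) small_adm have "\<forall>\<^sub>F h in small. \<forall>z\<in>K. norm (\<psi> z h) \<le> M * h ^ L"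
    by eventually_elim (use le order_trans in blast)
  with M(1) show "\<exists>M\<ge>0. \<forall>\<^sub>F h in small. \<forall>z\<in>K. norm (\<psi> z h) \<le> M * h ^ L" by blast
qed

lemma bigO_cong: "bigO L \<phi> \<Longrightarrow> (\<And>z h. admissible S h \<Longrightarrow> \<psi> z h = \<phi> z h) \<Longrightarrow> bigO L \<psi>"
  by (erule bigO_mono) simp

lemma bigO_add:
  assumes f: "bigO L f" and g: "bigO L g"
  shows "bigO L (\<lambda>z h. f z h + g z h)"
  unfolding bigO_def
proof (intro allI impI)
  fix K :: "complex set" assume K: "bounded K"
  obtain M1 where M1: "M1 \<ge> 0" "\<forall>\<^sub>F h in small. \<forall>z\<in>K. norm (f z h) \<le> M1 * h ^ L" by (rule bigOD[OF f K])
  obtain M2 where M2: "M2 \<ge> 0" "\<forall>\<^sub>F h in small. \<forall>z\<in>K. norm (g z h) \<le> M2 * h ^ L" by (rule bigOD[OF g K])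
  from M1(2) M2(2) have "\<forall>\<^sub>F h in small. \<forall>z\<in>K. norm (f z h + g z h) \<le> (M1 + M2) * h ^ L"
    by eventually_elim (auto simp: distrib_right intro!: norm_triangle_le add_mono)
  then show "\<exists>M\<ge>0. \<forall>\<^sub>F h in small. \<forall>z\<in>K. norm (f z h + g z h) \<le> M * h ^ L"
    using M1(1) M2(1) by (intro exI[of _ "M1 + M2"]) auto
qed

lemma bigO_mult_h:
  fixes f :: "complex \<Rightarrow> real \<Rightarrow> 'b::real_normed_field"
  assumes f: "bigO L f"
  shows "bigO (L + q) (\<lambda>z h. of_real h ^ q * f z h)"
  unfolding bigO_def
proof (intro allI impI)
  fix K :: "complex set" assume K: "bounded K"
  obtain M where M: "M \<ge> 0" "\<forall>\<^sub>F h in small. \<forall>z\<in>K. norm (f z h) \<le> M * h ^ L" by (rule bigOD[OF f K])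
  from M(2) small_adm have "\<forall>\<^sub>F h in small. \<forall>z\<in>K. norm (of_real h ^ q * f z h) \<le> M * h ^ (L + q)"
  proof eventually_elim
    case (elim h)
    have "h \<ge> 0" using elim(2) by (simp add: admissible_def)
    show ?case
    proof
      fix z assume "z \<in> K"
      then have "h ^ q * norm (f z h) \<le> h ^ q * (M * h ^ L)"
        using elim(1) \<open>h \<ge> 0\<close> by (intro mult_left_mono) auto
      then show "norm (of_real h ^ q * f z h) \<le> M * h ^ (L + q)"
        using \<open>h \<ge> 0\<close> by (simp add: norm_mult norm_power power_add mult_ac)
    qed
  qed
  with M(1) show "\<exists>M\<ge>0. \<forall>\<^sub>F h in small. \<forall>z\<in>K. norm (of_real h ^ q * f z h) \<le> M * h ^ (L + q)" by blast
qed

lemma bigO_mult_coeff: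
  assumes f: "bigO L f" and c: "c \<in> coeff_fns"
  shows "bigO L (\<lambda>z h. c z * f z h)"
  unfolding bigO_def
proof (intro allI impI)
  fix K :: "complex set" assume K: "bounded K"
  obtain M where M: "M \<ge> 0" "\<forall>\<^sub>F h in small. \<forall>z\<in>K. norm (f z h) \<le> M * h ^ L" by (rule bigOD[OF f K])
  obtain N where N: "\<forall>z\<in>K. norm (c z) \<le> N" using coeff_bounded[OF c K] by blast
  from M(2) small_adm have "\<forall>\<^sub>F h in small. \<forall>z\<in>K. norm (c z * f z h) \<le> (\<bar>N\<bar> * M) * h ^ L"
  proof eventually_elim
    case (elim h)
    show ?case
    proof
      fix z assume z: "z \<in> K"
      have "norm (c z * f z h) \<le> \<bar>N\<bar> * (M * h ^ L)"
        unfolding norm_mult using N elim(1) z by (intro mult_mono) auto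
      then show "norm (c z * f z h) \<le> (\<bar>N\<bar> * M) * h ^ L" by (simp add: mult_ac)
    qed
  qed
  then show "\<exists>M\<ge>0. \<forall>\<^sub>F h in small. \<forall>z\<in>K. norm (c z * f z h) \<le> M * h ^ L"
    using M(1) by (intro exI[of _ "\<bar>N\<bar> * M"]) auto
qed

lemma bigO_zero: "bigO L (\<lambda>z h. 0)"
  unfolding bigO_def by (auto intro!: exI[of _ 0])

lemma bigO_coeff: "c \<in> coeff_fns \<Longrightarrow> bigO 0 (\<lambda>z h. c z)"
proof -
  assume c: "c \<in> coeff_fns"
  have "bigO 0 (\<lambda>z h. 1 :: complex)" unfolding bigO_def by (auto intro!: exI[of _ 1])
  from bigO_mult_coeff[OF this c] show ?thesis by simp
qed

lemma bigO_weaken: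
  assumes f: "bigO L f" and le: "L' \<le> L"
  shows "bigO L' f"
  unfolding bigO_def
proof (intro allI impI)
  fix K :: "complex set" assume K: "bounded K"
  obtain M where M: "M \<ge> 0" "\<forall>\<^sub>F h in small. \<forall>z\<in>K. norm (f z h) \<le> M * h ^ L" by (rule bigOD[OF f K])
  from M(2) small_less[OF zero_less_one] have "\<forall>\<^sub>F h in small. \<forall>z\<in>K. norm (f z h) \<le> M * h ^ L'"
  proof eventually_elim
    case (elim h)
    then have "M * h ^ L \<le> M * h ^ L'" using M(1) le by (intro mult_left_mono power_decreasing) auto
    then show ?case using elim(1) by force
  qed
  with M(1) show "\<exists>M\<ge>0. \<forall>\<^sub>F h in small. \<forall>z\<in>K. norm (f z h) \<le> M * h ^ L'" by blast
qed

lemma bigO_sum: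
  fixes f :: "'i \<Rightarrow> complex \<Rightarrow> real \<Rightarrow> 'b::real_normed_vector"
  shows "(\<And>i. i \<in> I \<Longrightarrow> bigO L (f i)) \<Longrightarrow> bigO L (\<lambda>z h. \<Sum>i\<in>I. f i z h)"
  by (induction I rule: infinite_finite_induct) (auto intro: bigO_zero bigO_add)

text \<open>
  An expansion up to the order \<open>L\<close>, in which a function of weight \<open>w\<close> has no terms of order less than
  \<open>w / 2\<close>: \<open>h\<close> has twice the weight of an increment of the time.
\<close>

definition expands :: "nat \<Rightarrow> nat \<Rightarrow> (complex \<Rightarrow> real \<Rightarrow> complex) \<Rightarrow> bool" where
  "expands L w \<psi> \<longleftrightarrow> (\<exists>s. (\<forall>i. s i \<in> coeff_fns) \<and> (\<forall>i. 2 * i < w \<longrightarrow> s i = (\<lambda>z. 0)) \<and>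
      bigO L (\<lambda>z h. \<psi> z h - (\<Sum>i<L. of_real h ^ i * s i z)))"

lemma expands_cong: "expands L w \<phi> \<Longrightarrow> (\<And>z h. admissible S h \<Longrightarrow> \<psi> z h = \<phi> z h) \<Longrightarrow> expands L w \<psi>"
  unfolding expands_def by (elim ex_forward conj_forward) (auto elim: bigO_cong)

lemma expands_weaken: "expands L w \<psi> \<Longrightarrow> w' \<le> w \<Longrightarrow> expands L w' \<psi>"
  unfolding expands_def by (elim ex_forward conj_forward) auto

lemma expands_small: "bigO L \<psi> \<Longrightarrow> expands L w \<psi>"
  unfolding expands_def by (rule exI[of _ "\<lambda>i z. 0"]) (simp add: coeff_const)

lemma expands_add:
  assumes "expands L w f" "expands L w g"
  shows "expands L w (\<lambda>z h. f z h + g z h)"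
proof -
  obtain s where s: "\<forall>i. s i \<in> coeff_fns" "\<forall>i. 2 * i < w \<longrightarrow> s i = (\<lambda>z. 0)"
    "bigO L (\<lambda>z h. f z h - (\<Sum>i<L. of_real h ^ i * s i z))" using assms(1) by (auto simp: expands_def)
  obtain t where t: "\<forall>i. t i \<in> coeff_fns" "\<forall>i. 2 * i < w \<longrightarrow> t i = (\<lambda>z. 0)"
    "bigO L (\<lambda>z h. g z h - (\<Sum>i<L. of_real h ^ i * t i z))" using assms(2) by (auto simp: expands_def)
  have "bigO L (\<lambda>z h. f z h + g z h - (\<Sum>i<L. of_real h ^ i * (s i z + t i z)))"
    using bigO_add[OF s(3) t(3)] by (rule bigO_cong) (simp add: distrib_left sum.distrib)
  then show ?thesis unfolding expands_def using s t
    by (intro exI[of _ "\<lambda>i z. s i z + t i z"]) (auto intro: coeff_fns.add)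
qed

lemma expands_mult_coeff:
  assumes "expands L w f" and c: "c \<in> coeff_fns"
  shows "expands L w (\<lambda>z h. c z * f z h)"
proof -
  obtain s where s: "\<forall>i. s i \<in> coeff_fns" "\<forall>i. 2 * i < w \<longrightarrow> s i = (\<lambda>z. 0)"
    "bigO L (\<lambda>z h. f z h - (\<Sum>i<L. of_real h ^ i * s i z))" using assms(1) by (auto simp: expands_def)
  have "bigO L (\<lambda>z h. c z * f z h - (\<Sum>i<L. of_real h ^ i * (c z * s i z)))"
    using bigO_mult_coeff[OF s(3) c] by (rule bigO_cong) (simp add: right_diff_distrib sum_distrib_left mult_ac)
  then show ?thesis unfolding expands_def using s c
    by (intro exI[of _ "\<lambda>i z. c z * s i z"]) (auto intro: coeff_fns.mult)
qed

lemma expands_mult_h: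
  assumes "expands L w f"
  shows "expands (Suc L) (w + 2) (\<lambda>z h. of_real h * f z h)"
proof -
  obtain s where s: "\<forall>i. s i \<in> coeff_fns" "\<forall>i. 2 * i < w \<longrightarrow> s i = (\<lambda>z. 0)"
    "bigO L (\<lambda>z h. f z h - (\<Sum>i<L. of_real h ^ i * s i z))" using assms(1) by (auto simp: expands_def)
  define t where "t = (\<lambda>i. case i of 0 \<Rightarrow> (\<lambda>z. 0) | Suc j \<Rightarrow> s j)"
  have "bigO (Suc L) (\<lambda>z h. of_real h * f z h - (\<Sum>i<Suc L. of_real h ^ i * t i z))"
    using bigO_mult_h[OF s(3), of 1] unfolding sum.lessThan_Suc_shift t_def
    by (simp add: right_diff_distrib sum_distrib_left mult_ac)
  then show ?thesis unfolding expands_def using s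
    by (intro exI[of _ t]) (auto simp: t_def coeff_const split: nat.splits)
qed

lemma expands_lower:
  assumes "expands (Suc L) w f"
  shows "expands L w f"
proof -
  obtain s where s: "\<forall>i. s i \<in> coeff_fns" "\<forall>i. 2 * i < w \<longrightarrow> s i = (\<lambda>z. 0)"
    "bigO (Suc L) (\<lambda>z h. f z h - (\<Sum>i<Suc L. of_real h ^ i * s i z))" using assms(1) by (auto simp: expands_def)
  have "bigO (0 + L) (\<lambda>z h. of_real h ^ L * s L z)"
    by (rule bigO_mult_h[OF bigO_coeff]) (use s in blast)
  from bigO_add[OF bigO_weaken[OF s(3), of L] this[simplified]]
  have "bigO L (\<lambda>z h. f z h - (\<Sum>i<L. of_real h ^ i * s i z))" by simp
  then show ?thesis using s by (auto simp: expands_def)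
qed

lemma expands_mult_h_pow: "expands L w f \<Longrightarrow> expands L (w + 2 * q) (\<lambda>z h. of_real h ^ q * f z h)"
proof (induction q)
  case (Suc q)
  from expands_lower[OF expands_mult_h[OF Suc.IH[OF Suc.prems]]] show ?case by (simp add: mult_ac)
qed simp

text \<open>
  The coefficient of order 0 is a limit as \<open>h\<close> tends to 0; the others follow after division by \<open>h\<close>.
  The limit says something only if there are arbitrarily small admissible \<open>h\<close>.
\<close>

lemma expansion_unique:
  assumes nt: "small \<noteq> bot" and d: "bigO L (\<lambda>z h. \<Sum>i<L. of_real h ^ i * d i z)" and i: "i < L"
  shows "d i z = (0::complex)"
  using d i
proof (induction L arbitrary: d i)
  case (Suc L)
  obtain M where M: "M \<ge> 0" "\<forall>\<^sub>F h in small. \<forall>z\<in>{z}. norm (\<Sum>i<Suc L. of_real h ^ i * d i z) \<le> M * h ^ Suc L"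
    by (rule bigOD[OF Suc.prems(1), of "{z}"]) auto
  have id: "((\<lambda>h. h) \<longlongrightarrow> 0) small" by (rule tendsto_ident_at)
  have l1: "((\<lambda>h. M * h ^ Suc L) \<longlongrightarrow> 0) small"
    using tendsto_mult[OF tendsto_const[of M] tendsto_power[OF id, of "Suc L"]] by simp
  have "((\<lambda>h. \<Sum>i<Suc L. of_real h ^ i * d i z) \<longlongrightarrow> 0) small"
    by (rule Lim_null_comparison[OF _ l1]) (use M(2) in \<open>auto elim: eventually_mono\<close>)
  moreover have "((\<lambda>h. \<Sum>i<Suc L. of_real h ^ i * d i z) \<longlongrightarrow> (\<Sum>i<Suc L. of_real 0 ^ i * d i z)) small"
    by (intro tendsto_intros id)
  ultimately have "(\<Sum>i<Suc L. of_real 0 ^ i * d i z) = 0" using nt tendsto_unique by blast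
  then have d0: "d 0 z = 0" unfolding sum.lessThan_Suc_shift by simp
  show ?case
  proof (cases i)
    case (Suc j)
    define d' where "d' = (\<lambda>k (y::complex). d (Suc k) z)"
    have "bigO L (\<lambda>y h. \<Sum>k<L. of_real h ^ k * d' k y)"
      unfolding bigO_def
    proof (intro allI impI exI conjI)
      fix K :: "complex set"
      from M(2) small_less[OF zero_less_one] show "\<forall>\<^sub>F h in small. \<forall>y\<in>K. norm (\<Sum>k<L. of_real h ^ k * d' k y) \<le> M * h ^ L"
      proof eventually_elim
        case (elim h)
        have "norm (of_real h * (\<Sum>k<L. of_real h ^ k * d (Suc k) z)) \<le> h * (M * h ^ L)"
          using elim(1) d0 unfolding sum.lessThan_Suc_shift by (simp add: sum_distrib_left mult_ac)
        then have "norm (\<Sum>k<L. of_real h ^ k * d (Suc k) z) \<le> M * h ^ L"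
          using elim(2) by (simp add: norm_mult)
        then show ?case by (simp add: d'_def)
      qed
    qed (rule M(1))
    from Suc.IH[OF this, of j] show ?thesis using Suc Suc.prems(2) by (simp add: d'_def)
  qed (simp add: d0)
qed simp

text \<open>
  Expansions of different orders \<open>L\<close> might have unrelated coefficients; uniqueness makes them agree.  If
  there are no arbitrarily small admissible \<open>h\<close>, every estimate holds trivially and any coefficients do.
\<close>

lemma expands_all:
  assumes "\<And>L. expands L w \<psi>"
  shows "\<exists>s. (\<forall>i. s i \<in> coeff_fns) \<and> (\<forall>i. 2 * i < w \<longrightarrow> s i = (\<lambda>z. 0)) \<and>
      (\<forall>L. bigO L (\<lambda>z h. \<psi> z h - (\<Sum>i<L. of_real h ^ i * s i z)))"
proof (cases "small = bot")
  case True
  then have "bigO L \<phi>" for L and \<phi> :: "complex \<Rightarrow> real \<Rightarrow> complex" by (auto simp: bigO_def intro: exI[of _ 0])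
  then show ?thesis by (intro exI[of _ "\<lambda>i z. 0"]) (auto simp: coeff_const)
next
  case False
  have "\<forall>L. \<exists>s. (\<forall>i. s i \<in> coeff_fns) \<and> (\<forall>i. 2 * i < w \<longrightarrow> s i = (\<lambda>z. 0)) \<and>
      bigO L (\<lambda>z h. \<psi> z h - (\<Sum>i<L. of_real h ^ i * s i z))"
    using assms by (simp add: expands_def)
  from choice[OF this] obtain S' where S0: "\<forall>L. (\<forall>i. S' L i \<in> coeff_fns) \<and> (\<forall>i. 2 * i < w \<longrightarrow> S' L i = (\<lambda>z. 0)) \<and>
      bigO L (\<lambda>z h. \<psi> z h - (\<Sum>i<L. of_real h ^ i * S' L i z))" ..
  then have S': "S' L i \<in> coeff_fns" "2 * i < w \<Longrightarrow> S' L i = (\<lambda>z. 0)"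
    "bigO L (\<lambda>z h. \<psi> z h - (\<Sum>i<L. of_real h ^ i * S' L i z))" for L i by blast+
  have step: "S' (Suc L) i = S' L i" if "i < L" for L i
  proof
    fix z
    have "bigO (0 + L) (\<lambda>z h. of_real h ^ L * S' (Suc L) L z)"
      by (rule bigO_mult_h[OF bigO_coeff[OF S'(1)]])
    from bigO_add[OF bigO_weaken[OF S'(3), of L "Suc L"] this[simplified]]
    have a: "bigO L (\<lambda>z h. \<psi> z h - (\<Sum>i<L. of_real h ^ i * S' (Suc L) i z))" by simp
    have "bigO L (\<lambda>z h. \<Sum>i<L. of_real h ^ i * (S' (Suc L) i z - S' L i z))"
      using bigO_add[OF S'(3)[of L] bigO_mult_coeff[OF a coeff_const[of "-1"]]]
      by (rule bigO_cong) (simp add: right_diff_distrib sum_subtractf)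
    from expansion_unique[OF False this that, of z] show "S' (Suc L) i z = S' L i z" by simp
  qed
  have eq: "S' (i + Suc k) i = S' (Suc i) i" for i k
    by (induction k) (use step in auto)
  have eq': "S' L i = S' (Suc i) i" if "i < L" for L i
    using eq[of i "L - Suc i"] that by simp
  have "bigO L (\<lambda>z h. \<psi> z h - (\<Sum>i<L. of_real h ^ i * S' (Suc i) i z))" for L
    using S'(3)[of L] by (rule bigO_cong) (simp add: eq'[symmetric, of _ L])
  then show ?thesis using S' by (intro exI[of _ "\<lambda>i. S' (Suc i) i"]) auto
qed

end

section \<open>The weight filtration\<close>

context revolution_surface
begin

text \<open>
  Functions of \<open>z\<close>, three increments of the time and \<open>h\<close>; an increment has weight 1 and \<open>h\<close> has
  weight 2, as increments are of the size \<open>\<surd>h\<close>.  The three increments, for the factors \<open>B\<close>, \<open>A\<close> and \<open>C\<close>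
  of a normally ordered monomial, are equal in the end.  They are kept apart because multiplication by
  \<open>B\<close> or \<open>C\<close> shifts the time of its own factor only.
\<close>

inductive filt :: "nat \<Rightarrow> (complex \<Rightarrow> complex \<Rightarrow> complex \<Rightarrow> complex \<Rightarrow> real \<Rightarrow> complex) \<Rightarrow> bool" where
  monomial: "s \<in> coeff_fns \<Longrightarrow> w \<le> p + q + r + 2 * k \<Longrightarrow>
     filt w (\<lambda>z a b c h. s z * a ^ p * b ^ q * c ^ r * of_real h ^ k)"
| add: "filt w \<phi> \<Longrightarrow> filt w \<psi> \<Longrightarrow> filt w (\<lambda>z a b c h. \<phi> z a b c h + \<psi> z a b c h)"

lemma filt_cong:
  assumes "filt w \<phi>" "\<And>z a b c h. \<psi> z a b c h = \<phi> z a b c h"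
  shows "filt w \<psi>"
proof -
  have "\<psi> = \<phi>" by (intro ext assms(2))
  with assms(1) show ?thesis by simp
qed

lemma filt_weaken: "filt w \<phi> \<Longrightarrow> w' \<le> w \<Longrightarrow> filt w' \<phi>"
proof (induction rule: filt.induct)
  case (monomial s w p q r k)
  then show ?case by (intro filt.monomial) auto
next
  case (add w \<phi> \<psi>)
  then show ?case by (intro filt.add) auto
qed

lemma filt_zero: "filt w (\<lambda>z a b c h. 0)"
  by (rule filt_cong[OF filt.monomial[OF coeff_const[of 0], of w w 0 0 0]]) auto

lemma filt_coeff: "s \<in> coeff_fns \<Longrightarrow> filt 0 (\<lambda>z a b c h. s z)"
  by (rule filt_cong[OF filt.monomial[of s 0 0 0 0 0]]) auto

lemma filt_a: "filt 1 (\<lambda>z a b c h. a)"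
  by (rule filt_cong[OF filt.monomial[OF coeff_const[of 1], of 1 1 0 0 0]]) auto

lemma filt_b: "filt 1 (\<lambda>z a b c h. b)"
  by (rule filt_cong[OF filt.monomial[OF coeff_const[of 1], of 1 0 1 0 0]]) auto

lemma filt_c: "filt 1 (\<lambda>z a b c h. c)"
  by (rule filt_cong[OF filt.monomial[OF coeff_const[of 1], of 1 0 0 1 0]]) auto

lemma filt_h: "filt 2 (\<lambda>z a b c h. of_real h)"
  by (rule filt_cong[OF filt.monomial[OF coeff_const[of 1], of 2 0 0 0 1]]) auto

lemma filt_swap: "filt w \<phi> \<Longrightarrow> filt w (\<lambda>z a b c h. \<phi> z c b a h)"
proof (induction rule: filt.induct)
  case (monomial s w p q r k)
  show ?case by (rule filt_cong[OF filt.monomial[of s w r q p k]]) (use monomial in auto)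
next
  case (add w \<phi> \<psi>)
  from filt.add[OF add.IH] show ?case .
qed

lemma filt_mult:
  assumes "filt v \<phi>" "filt w \<psi>"
  shows "filt (v + w) (\<lambda>z a b c h. \<phi> z a b c h * \<psi> z a b c h)"
  using assms(1)
proof (induction rule: filt.induct)
  case (monomial s v p q r k)
  show ?case using assms(2)
  proof (induction rule: filt.induct)
    case (monomial s' w p' q' r' k')
    show ?case
      by (rule filt_cong[OF filt.monomial[of "\<lambda>z. s z * s' z" "v + w" "p + p'" "q + q'" "r + r'" "k + k'"]])
        (use monomial \<open>s \<in> coeff_fns\<close> \<open>v \<le> p + q + r + 2 * k\<close> in \<open>auto intro: coeff_fns.mult simp: power_add mult_ac\<close>)
  next
    case (add w \<phi> \<psi>)
    show ?case by (rule filt_cong[OF filt.add[OF add.IH]]) (simp add: algebra_simps)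
  qed
next
  case (add v \<phi>1 \<phi>2)
  show ?case by (rule filt_cong[OF filt.add[OF add.IH]]) (simp add: algebra_simps)
qed

lemma filt_mult_0: "filt 0 \<phi> \<Longrightarrow> filt 0 \<psi> \<Longrightarrow> filt 0 (\<lambda>z a b c h. \<phi> z a b c h * \<psi> z a b c h)"
  using filt_mult[of 0 \<phi> 0 \<psi>] by simp

lemma filt_mult_coeff: "filt w \<psi> \<Longrightarrow> s \<in> coeff_fns \<Longrightarrow> filt w (\<lambda>z a b c h. s z * \<psi> z a b c h)"
  using filt_mult[OF filt_coeff, of s w \<psi>] by simp

lemma filt_minus:
  assumes "filt w \<phi>" "filt w \<psi>"
  shows "filt w (\<lambda>z a b c h. \<phi> z a b c h - \<psi> z a b c h)"
  by (rule filt_cong[OF filt.add[OF assms(1) filt_mult_coeff[OF assms(2) coeff_const[of "-1"]]]]) simp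

lemma filt_a_pow: "filt p (\<lambda>z a b c h. a ^ p)"
  by (rule filt_cong[OF filt.monomial[OF coeff_const[of 1], of p p 0 0 0]]) auto

text \<open>Replacing the time in a polynomial by the classical time is an error of weight 1.\<close>

lemma filt_poly:
  assumes u: "filt 1 u"
  shows "filt 0 (\<lambda>z a b c h. poly p (Tc z + u z a b c h)) \<and>
     filt 1 (\<lambda>z a b c h. poly p (Tc z + u z a b c h) - poly p (Tc z))"
proof (induction p)
  case 0
  then show ?case using filt_zero by simp
next
  case (pCons d p)
  have x: "filt 0 (\<lambda>z a b c h. Tc z + u z a b c h)"
    by (rule filt.add[OF filt_coeff[OF coeff_T] filt_weaken[OF u]]) simp
  have 1: "filt 0 (\<lambda>z a b c h. poly (pCons d p) (Tc z + u z a b c h))"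
    using filt.add[OF filt_coeff[OF coeff_const[of d]] filt_mult_0[OF x pCons.IH[THEN conjunct1]]] by simp
  have "filt 1 (\<lambda>z a b c h. u z a b c h * poly p (Tc z + u z a b c h) + Tc z * (poly p (Tc z + u z a b c h) - poly p (Tc z)))"
    using filt_mult[OF u pCons.IH[THEN conjunct1]] filt_mult_coeff[OF pCons.IH[THEN conjunct2] coeff_T]
    by (intro filt.add) simp_all
  then have "filt 1 (\<lambda>z a b c h. poly (pCons d p) (Tc z + u z a b c h) - poly (pCons d p) (Tc z))"
    by (rule filt_cong) (simp add: algebra_simps)
  with 1 show ?case ..
qed

text \<open>
  The difference of \<open>(a + h)\<^sup>p\<close> and \<open>a\<^sup>p\<close> is \<open>h\<close> times a polynomial of weight \<open>p - 1\<close> in \<open>a\<close> and \<open>h\<close>.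
\<close>

lemma filt_shift:
  assumes "filt w \<phi>"
  shows "\<exists>\<xi>. filt (w - 1) \<xi> \<and>
    (\<forall>z a b c h. \<phi> z (a + of_real h) b c h - \<phi> z a b c h = of_real h * \<xi> z a b c h)"
  using assms
proof (induction rule: filt.induct)
  case (monomial s w p q r k)
  have pow: "\<exists>\<xi>. filt (p - 1) \<xi> \<and> (\<forall>z a b c h. (a + of_real h) ^ p - a ^ p = of_real h * \<xi> z a b c h)" for p
  proof (induction p)
    case 0
    then show ?case using filt_zero by (intro exI[of _ "\<lambda>z a b c h. 0"]) simp
  next
    case (Suc p)
    then obtain \<xi> where \<xi>: "filt (p - 1) \<xi>" "\<And>z a b c h. (a + of_real h) ^ p - a ^ p = of_real h * \<xi> z a b c h" by blast
    show ?case
    proof (cases p)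
      case 0
      then show ?thesis using filt_coeff[OF coeff_const[of 1]] by (intro exI[of _ "\<lambda>z a b c h. 1"]) simp
    next
      case (Suc p')
      have "filt 1 (\<lambda>z a b c h. a + of_real h)"
        by (rule filt.add[OF filt_a filt_weaken[OF filt_h]]) simp
      from filt_mult[OF this \<xi>(1)] have "filt p (\<lambda>z a b c h. (a + of_real h) * \<xi> z a b c h)"
        by (rule filt_weaken) (simp add: Suc)
      from filt.add[OF this filt_a_pow] have "filt (Suc p - 1) (\<lambda>z a b c h. (a + of_real h) * \<xi> z a b c h + a ^ p)" by simp
      moreover have "(a + of_real h) ^ Suc p - a ^ Suc p = of_real h * ((a + of_real h) * \<xi> z a b c h + a ^ p)" for z a b c and h :: real
      proof -
        have "(a + of_real h) ^ Suc p - a ^ Suc p = (a + of_real h) * ((a + of_real h) ^ p - a ^ p) + of_real h * a ^ p"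
          by (simp add: algebra_simps)
        then show ?thesis unfolding \<xi>(2)[of a h z b c] by (simp add: algebra_simps)
      qed
      ultimately show ?thesis by (intro exI[of _ "\<lambda>z a b c h. (a + of_real h) * \<xi> z a b c h + a ^ p"]) blast
    qed
  qed
  show ?case
  proof (cases "p = 0")
    case True
    then show ?thesis using filt_zero by (intro exI[of _ "\<lambda>z a b c h. 0"]) simp
  next
    case False
    obtain \<xi> where \<xi>: "filt (p - 1) \<xi>" "\<And>z a b c h. (a + of_real h) ^ p - a ^ p = of_real h * \<xi> z a b c h" using pow by blast
    have "filt (q + r + 2 * k) (\<lambda>z a b c h. s z * a ^ 0 * b ^ q * c ^ r * of_real h ^ k)"
      by (rule filt.monomial) (use monomial in auto)
    from filt_mult[OF \<xi>(1) this] have "filt (w - 1) (\<lambda>z a b c h. \<xi> z a b c h * (s z * a ^ 0 * b ^ q * c ^ r * of_real h ^ k))"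
      by (rule filt_weaken) (use monomial(2) False in simp)
    moreover have "s z * (a + of_real h) ^ p * b ^ q * c ^ r * of_real h ^ k - s z * a ^ p * b ^ q * c ^ r * of_real h ^ k
       = of_real h * (\<xi> z a b c h * (s z * a ^ 0 * b ^ q * c ^ r * of_real h ^ k))" for z a b c and h :: real
    proof -
      have "s z * (a + of_real h) ^ p * b ^ q * c ^ r * of_real h ^ k - s z * a ^ p * b ^ q * c ^ r * of_real h ^ k
         = ((a + of_real h) ^ p - a ^ p) * (s z * b ^ q * c ^ r * of_real h ^ k)" by (simp add: algebra_simps)
      then show ?thesis unfolding \<xi>(2)[of a h z b c] by simp
    qed
    ultimately show ?thesis by (intro exI[of _ "\<lambda>z a b c h. \<xi> z a b c h * (s z * a ^ 0 * b ^ q * c ^ r * of_real h ^ k)"]) blast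
  qed
next
  case (add w \<phi> \<psi>)
  obtain \<xi>1 where 1: "filt (w - 1) \<xi>1" "\<And>z a b c h. \<phi> z (a + of_real h) b c h - \<phi> z a b c h = of_real h * \<xi>1 z a b c h"
    using add.IH(1) by blast
  obtain \<xi>2 where 2: "filt (w - 1) \<xi>2" "\<And>z a b c h. \<psi> z (a + of_real h) b c h - \<psi> z a b c h = of_real h * \<xi>2 z a b c h"
    using add.IH(2) by blast
  show ?case
  proof (intro exI[of _ "\<lambda>z a b c h. \<xi>1 z a b c h + \<xi>2 z a b c h"] conjI allI)
    fix z a b c :: complex and h :: real
    show "\<phi> z (a + of_real h) b c h + \<psi> z (a + of_real h) b c h - (\<phi> z a b c h + \<psi> z a b c h) =
        of_real h * (\<xi>1 z a b c h + \<xi>2 z a b c h)"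
      using 1(2)[of z a h b c] 2(2)[of z a h b c] by (simp add: algebra_simps)
  qed (rule filt.add[OF 1(1) 2(1)])
qed

text \<open>As \<open>h\<close> has weight 2, the shift raises the weight by 1 in total.\<close>

lemma filt_shift':
  assumes \<phi>: "filt w \<phi>"
  shows "filt w (\<lambda>z a b c h. \<phi> z (a + of_real h) b c h)"
    "filt (Suc w) (\<lambda>z a b c h. \<phi> z (a + of_real h) b c h - \<phi> z a b c h)"
proof -
  obtain \<xi> where \<xi>: "filt (w - 1) \<xi>" "\<And>z a b c h. \<phi> z (a + of_real h) b c h - \<phi> z a b c h = of_real h * \<xi> z a b c h"
    using filt_shift[OF \<phi>] by blast
  have "filt (Suc w) (\<lambda>z a b c h. of_real h * \<xi> z a b c h)"
    by (rule filt_weaken[OF filt_mult[OF filt_h \<xi>(1)]]) simp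
  then show d: "filt (Suc w) (\<lambda>z a b c h. \<phi> z (a + of_real h) b c h - \<phi> z a b c h)"
    by (rule filt_cong) (simp add: \<xi>(2))
  show "filt w (\<lambda>z a b c h. \<phi> z (a + of_real h) b c h)"
    by (rule filt_cong[OF filt.add[OF \<phi> filt_weaken[OF d]]]) simp_all
qed

lemma filt_taylor:
  "\<exists>\<psi>. filt 0 \<psi> \<and> (\<forall>z a b c h. poly p (Tc z + a) = poly p (Tc z) + a * poly (pderiv p) (Tc z) + a\<^sup>2 * \<psi> z a b c h)"
proof (induction p)
  case 0
  then show ?case using filt_zero by (intro exI[of _ "\<lambda>z a b c h. 0"]) simp
next
  case (pCons d p)
  then obtain \<psi> where \<psi>: "filt 0 \<psi>" "\<And>z a b c h. poly p (Tc z + a) = poly p (Tc z) + a * poly (pderiv p) (Tc z) + a\<^sup>2 * \<psi> z a b c h"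
    by blast
  have x: "filt 0 (\<lambda>z a b c h. Tc z + a)"
    by (rule filt.add[OF filt_coeff[OF coeff_T] filt_weaken[OF filt_a]]) simp
  show ?case
  proof (intro exI[of _ "\<lambda>z a b c h. poly (pderiv p) (Tc z) + (Tc z + a) * \<psi> z a b c h"] conjI allI)
    show "filt 0 (\<lambda>z a b c h. poly (pderiv p) (Tc z) + (Tc z + a) * \<psi> z a b c h)"
      using filt.add[OF filt_coeff[OF coeff_poly[OF coeff_T, of "pderiv p"]] filt_mult_0[OF x \<psi>(1)]] by simp
    fix z a b c :: complex and h :: real
    have "poly (pCons d p) (Tc z + a) = d + (Tc z + a) * poly p (Tc z + a)" by simp
    also have "\<dots> = d + (Tc z + a) * (poly p (Tc z) + a * poly (pderiv p) (Tc z) + a\<^sup>2 * \<psi> z a b c h)"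
      unfolding \<psi>(2)[of z a b c h] ..
    also have "\<dots> = poly (pCons d p) (Tc z) + a * poly (pderiv (pCons d p)) (Tc z) + a\<^sup>2 * (poly (pderiv p) (Tc z) + (Tc z + a) * \<psi> z a b c h)"
      by (simp add: pderiv_pCons algebra_simps power2_eq_square)
    finally show "poly (pCons d p) (Tc z + a) = poly (pCons d p) (Tc z) + a * poly (pderiv (pCons d p)) (Tc z) + a\<^sup>2 * (poly (pderiv p) (Tc z) + (Tc z + a) * \<psi> z a b c h)" .
  qed
qed

subsection \<open>The symbols of polynomials in the generators\<close>

definition DP :: "complex poly" where "DP = along S (Dp S)"
definition cDP :: "complex poly" where "cDP = map_poly cnj DP"

text \<open>
  The function of the time whose expectation is the symbol of a monomial, with
  separate times \<open>x\<close>, \<open>y\<close>, \<open>w\<close> for the factors \<open>B\<close>, \<open>A\<close>, \<open>C\<close>.  The powers of \<open>B\<close> and \<open>C\<close> become products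
  of \<open>D\<close> and its conjugate over consecutive times.
\<close>

definition fmon :: "real \<Rightarrow> complex \<Rightarrow> ('n gen \<Rightarrow>\<^sub>0 nat) \<Rightarrow> complex \<Rightarrow> complex \<Rightarrow> complex \<Rightarrow> complex" where
  "fmon h z m x y w =
    (cnj z ^ Poly_Mapping.lookup m gB * (\<Prod>j<Poly_Mapping.lookup m gB. poly DP (x + of_nat (Suc j) * of_real h))) *
    (\<Prod>i\<in>UNIV. poly (base_poly S i) (y + of_real h) ^ Poly_Mapping.lookup m (gA i)) *
    (z ^ Poly_Mapping.lookup m gC * (\<Prod>j<Poly_Mapping.lookup m gC. poly cDP (w + of_nat (Suc j) * of_real h)))"

definition fsym :: "real \<Rightarrow> complex \<Rightarrow> ('n gen, complex) mpoly \<Rightarrow> complex \<Rightarrow> complex \<Rightarrow> complex \<Rightarrow> complex" where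
  "fsym h z f x y w = (\<Sum>m\<in>Poly_Mapping.keys f. Poly_Mapping.lookup f m * fmon h z m x y w)"

lemma fsym_add: "fsym h z (f + g) x y w = fsym h z f x y w + fsym h z g x y w"
  unfolding fsym_def using keys_sum_add[of "\<lambda>m c. c * fmon h z m x y w" f g] by (simp add: algebra_simps)

lemma fsym_single: "fsym h z (Poly_Mapping.single m c) x y w = c * fmon h z m x y w"
  unfolding fsym_def by (cases "c = 0") auto

lemma fsym_zero [simp]: "fsym h z 0 x y w = 0"
  by (simp add: fsym_def)

lemma fsym_const: "fsym h z (mp_const c * f) x y w = c * fsym h z f x y w"
proof (induction f rule: poly_mapping_single_induct)
  case (single m d)
  show ?case by (simp add: mp_const_def mult_single fsym_single)
qed (simp_all add: distrib_left fsym_add)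

lemma fsym_diff: "fsym h z (f - g) x y w = fsym h z f x y w - fsym h z g x y w"
  using fsym_add[of h z "f - g" g x y w] by simp

lemma fsym_sum: "fsym h z (sum f J) x y w = (\<Sum>j\<in>J. fsym h z (f j) x y w)"
  by (induction J rule: infinite_finite_induct) (simp_all add: fsym_add)

lemma fsym_one: "fsym h z 1 x y w = 1"
  using fsym_single[of h z 0 1 x y w] by (simp add: fmon_def)

text \<open>
  Multiplication by a generator acts on the function of the time as a factor and, for \<open>B\<close> and \<open>C\<close>, a
  shift by \<open>h\<close>, because the products over consecutive times lose their first factor.
\<close>

lemma fsym_B: "fsym h z (mp_var gB * f) x y w = cnj z * poly DP (x + of_real h) * fsym h z f (x + of_real h) y w"
proof (induction f rule: poly_mapping_single_induct)
  case (single m d)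
  have "fmon h z (Poly_Mapping.single gB 1 + m) x y w = cnj z * poly DP (x + of_real h) * fmon h z m (x + of_real h) y w"
    by (simp add: fmon_def lookup_add lookup_single prod.lessThan_Suc_shift algebra_simps del: prod.lessThan_Suc)
  then show ?case by (simp add: mp_var_def mult_single fsym_single)
qed (simp_all add: distrib_left fsym_add)

lemma fsym_C: "fsym h z (mp_var gC * f) x y w = z * poly cDP (w + of_real h) * fsym h z f x y (w + of_real h)"
proof (induction f rule: poly_mapping_single_induct)
  case (single m d)
  have "fmon h z (Poly_Mapping.single gC 1 + m) x y w = z * poly cDP (w + of_real h) * fmon h z m x y (w + of_real h)"
    by (simp add: fmon_def lookup_add lookup_single prod.lessThan_Suc_shift algebra_simps del: prod.lessThan_Suc)
  then show ?case by (simp add: mp_var_def mult_single fsym_single)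
qed (simp_all add: distrib_left fsym_add)

lemma fsym_A: "fsym h z (mp_var (gA i) * f) x y w = poly (base_poly S i) (y + of_real h) * fsym h z f x y w"
proof (induction f rule: poly_mapping_single_induct)
  case (single m d)
  have "(\<Prod>k\<in>UNIV. poly (base_poly S k) (y + of_real h) ^ Poly_Mapping.lookup (Poly_Mapping.single (gA i) 1 + m) (gA k))
    = poly (base_poly S i) (y + of_real h) * (\<Prod>k\<in>UNIV. poly (base_poly S k) (y + of_real h) ^ Poly_Mapping.lookup m (gA k))"
    by (simp add: lookup_add power_add prod.distrib lookup_single when_def if_distrib[of "\<lambda>n. _ ^ n"] prod.delta' cong: if_cong)
  then have "fmon h z (Poly_Mapping.single (gA i) 1 + m) x y w = poly (base_poly S i) (y + of_real h) * fmon h z m x y w"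
    unfolding fmon_def by (simp add: lookup_add lookup_single)
  then show ?case by (simp add: mp_var_def mult_single fsym_single)
qed (simp_all add: distrib_left fsym_add)

text \<open>
  The values of the generators at the point of the surface with the coordinate \<open>z\<close>.
\<close>

definition Ypt :: "complex \<Rightarrow> 'n gen \<Rightarrow> complex" where
  "Ypt z v = (case v of gB \<Rightarrow> cnj z * poly DP (Tc z) | gA i \<Rightarrow> poly (base_poly S i) (Tc z) | gC \<Rightarrow> z * poly cDP (Tc z))"

lemma coeff_Ypt: "(\<lambda>z. Ypt z v) \<in> coeff_fns"
proof (cases v)
  case gB
  show ?thesis unfolding gB Ypt_def gen.case by (intro coeff_fns.mult coeff_fns.cnj coeff_poly coeff_T)
next
  case (gA i)
  show ?thesis unfolding gA Ypt_def gen.case by (intro coeff_poly coeff_T)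
next
  case gC
  show ?thesis unfolding gC Ypt_def gen.case by (intro coeff_fns.mult coeff_fns.z coeff_poly coeff_T)
qed

abbreviation fsymT :: "(complex \<Rightarrow> ('n gen, complex) mpoly) \<Rightarrow> complex \<Rightarrow> complex \<Rightarrow> complex \<Rightarrow> complex \<Rightarrow> real \<Rightarrow> complex" where
  "fsymT f z a b c h \<equiv> fsym h z (f z) (Tc z + a) (Tc z + b) (Tc z + c)"

text \<open>
  \<open>P \<psi> - P\<^sub>0 \<phi> = P (\<psi> - \<phi>) + (P - P\<^sub>0) \<phi>\<close>, and each summand has a factor that gains weight.
\<close>

lemma filt_times_difference:
  assumes P: "filt 0 P" "filt 1 (\<lambda>z a b c h. P z a b c h - P0 z)" and \<phi>: "filt w \<phi>" and s: "s \<in> coeff_fns"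
    and \<psi>: "filt w \<psi>" "filt (Suc w) (\<lambda>z a b c h. \<psi> z a b c h - \<phi> z a b c h)"
  shows "filt (Suc w) (\<lambda>z a b c h. s z * P z a b c h * \<psi> z a b c h - s z * P0 z * \<phi> z a b c h)"
proof -
  have "filt (Suc w) (\<lambda>z a b c h. P z a b c h * (\<psi> z a b c h - \<phi> z a b c h) + (P z a b c h - P0 z) * \<phi> z a b c h)"
    using filt_mult[OF P(1) \<psi>(2)] filt_mult[OF P(2) \<phi>] by (intro filt.add) simp_all
  from filt_mult_coeff[OF this s] show ?thesis by (rule filt_cong) (simp add: algebra_simps)
qed

text \<open>
  A centred factor \<open>X - y\<close> gains one unit of weight: \<open>X\<close> acts as a factor close to its classical value
  \<open>y\<close> and a shift by \<open>h\<close>.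
\<close>

lemma filt_fsym_factor:
  assumes \<phi>: "filt w (fsymT f)"
  shows "filt (Suc w) (fsymT (\<lambda>z. (mp_var v - mp_const (Ypt z v)) * f z))"
proof (cases v)
  case gB
  have u: "filt 1 (\<lambda>z a b c h. a + of_real h)"
    by (rule filt.add[OF filt_a filt_weaken[OF filt_h]]) simp
  note P = filt_poly[OF u, of DP]
  from filt_times_difference[OF P[THEN conjunct1] P[THEN conjunct2] \<phi> coeff_fns.cnj filt_shift'[OF \<phi>]]
  show ?thesis
    by (rule filt_cong) (simp add: gB left_diff_distrib fsym_diff fsym_const fsym_B Ypt_def add.assoc)
next
  case (gA i)
  have u: "filt 1 (\<lambda>z a b c h. b + of_real h)"
    by (rule filt.add[OF filt_b filt_weaken[OF filt_h]]) simp
  note P = filt_poly[OF u, of "base_poly S i"]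
  have "filt (Suc w) (\<lambda>z a b c h. fsymT f z a b c h - fsymT f z a b c h)"
    by (rule filt_cong[OF filt_zero]) simp
  from filt_times_difference[OF P[THEN conjunct1] P[THEN conjunct2] \<phi> coeff_const[of 1] \<phi> this]
  show ?thesis
    by (rule filt_cong) (simp add: gA left_diff_distrib fsym_diff fsym_const fsym_A Ypt_def add.assoc)
next
  case gC
  have u: "filt 1 (\<lambda>z a b c h. c + of_real h)"
    by (rule filt.add[OF filt_c filt_weaken[OF filt_h]]) simp
  note P = filt_poly[OF u, of cDP]
  note sw = filt_swap[OF \<phi>]
  note sh = filt_swap[OF filt_shift'(1)[OF sw]] filt_swap[OF filt_shift'(2)[OF sw]]
  from filt_times_difference[OF P[THEN conjunct1] P[THEN conjunct2] \<phi> coeff_fns.z sh]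
  show ?thesis
    by (rule filt_cong) (simp add: gC left_diff_distrib fsym_diff fsym_const fsym_C Ypt_def add.assoc)
qed

text \<open>
  The generators of the polynomial ring commute, so the centred factors can be multiplied one by one.
\<close>

lemma filt_fsym_monomial:
  "filt (tdeg \<beta>) (fsymT (\<lambda>z. mon (\<lambda>v. mp_var v - mp_const (Ypt z v)) \<beta>))"
proof -
  have pow: "filt (w + k) (fsymT (\<lambda>z. (mp_var v - mp_const (Ypt z v)) ^ k * f z))" if "filt w (fsymT f)" for w k v f
  proof (induction k)
    case (Suc k)
    from filt_fsym_factor[OF this, of v] show ?case by (simp add: mult.assoc)
  qed (use that in simp)
  have "filt (\<Sum>v\<in>V. Poly_Mapping.lookup \<beta> v) (fsymT (\<lambda>z. \<Prod>v\<in>V. (mp_var v - mp_const (Ypt z v)) ^ Poly_Mapping.lookup \<beta> v))"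
    if "finite V" for V :: "'n gen set"
    using that
  proof (induction V rule: finite_induct)
    case empty
    have "filt 0 (\<lambda>z a b c h. 1)" by (rule filt_coeff[OF coeff_const])
    then show ?case by (simp add: fsym_one)
  next
    case (insert v V)
    have "filt ((\<Sum>v\<in>V. Poly_Mapping.lookup \<beta> v) + Poly_Mapping.lookup \<beta> v)
       (fsymT (\<lambda>z. (mp_var v - mp_const (Ypt z v)) ^ Poly_Mapping.lookup \<beta> v *
          (\<Prod>v\<in>V. (mp_var v - mp_const (Ypt z v)) ^ Poly_Mapping.lookup \<beta> v)))"
      by (rule pow[OF insert.IH])
    then show ?case
      using insert.hyps by (simp add: add.commute)
  qed
  from this[of UNIV] show ?thesis by (simp add: tdeg_def mon_UNIV)
qed

end

section \<open>Expectations\<close>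

text \<open>
  Growth at most polynomial on the half line, which the series over the weights tolerate.
\<close>

definition tame :: "(real \<Rightarrow> 'b::real_normed_field) \<Rightarrow> bool" where
  "tame \<phi> \<longleftrightarrow> (\<exists>C P. C \<ge> 0 \<and> (\<forall>t\<ge>0. norm (\<phi> t) \<le> C * (1 + t) ^ P))"

lemma tameI: "C \<ge> 0 \<Longrightarrow> (\<And>t. t \<ge> 0 \<Longrightarrow> norm (\<phi> t) \<le> C * (1 + t) ^ P) \<Longrightarrow> tame \<phi>"
  by (auto simp: tame_def)

lemma tameE:
  assumes "tame \<phi>"
  obtains C P where "C \<ge> 0" "\<And>t. t \<ge> 0 \<Longrightarrow> norm (\<phi> t) \<le> C * (1 + t) ^ P"
  using assms by (auto simp: tame_def)

lemma tame_const: "tame (\<lambda>t. c)"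
  by (rule tameI[of "norm c" _ 0]) auto

lemma tame_ident: "tame (\<lambda>t. of_real t)"
  by (rule tameI[of 1 _ 1]) auto

lemma tame_add:
  assumes "tame f" "tame g"
  shows "tame (\<lambda>t. f t + g t)"
proof -
  obtain C P where f: "C \<ge> 0" "\<And>t. t \<ge> 0 \<Longrightarrow> norm (f t) \<le> C * (1 + t) ^ P" using tameE[OF assms(1)] by blast
  obtain D Q where g: "D \<ge> 0" "\<And>t. t \<ge> 0 \<Longrightarrow> norm (g t) \<le> D * (1 + t) ^ Q" using tameE[OF assms(2)] by blast
  show ?thesis
  proof (rule tameI[of "C + D" _ "P + Q"])
    fix t :: real assume t: "t \<ge> 0"
    have "C * (1 + t) ^ P \<le> C * (1 + t) ^ (P + Q)" "D * (1 + t) ^ Q \<le> D * (1 + t) ^ (P + Q)"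
      using t f g by (auto intro!: mult_left_mono power_increasing)
    then show "norm (f t + g t) \<le> (C + D) * (1 + t) ^ (P + Q)"
      using f(2)[OF t] g(2)[OF t] norm_triangle_ineq[of "f t" "g t"] by (simp add: distrib_right)
  qed (use f g in auto)
qed

lemma tame_mult:
  assumes "tame f" "tame g"
  shows "tame (\<lambda>t. f t * g t)"
proof -
  obtain C P where f: "C \<ge> 0" "\<And>t. t \<ge> 0 \<Longrightarrow> norm (f t) \<le> C * (1 + t) ^ P" using tameE[OF assms(1)] by blast
  obtain D Q where g: "D \<ge> 0" "\<And>t. t \<ge> 0 \<Longrightarrow> norm (g t) \<le> D * (1 + t) ^ Q" using tameE[OF assms(2)] by blast
  show ?thesis
  proof (rule tameI[of "C * D" _ "P + Q"])
    fix t :: real assume t: "t \<ge> 0"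
    have "norm (f t) * norm (g t) \<le> (C * (1 + t) ^ P) * (D * (1 + t) ^ Q)"
      using f g t by (intro mult_mono) auto
    then show "norm (f t * g t) \<le> (C * D) * (1 + t) ^ (P + Q)"
      by (simp add: norm_mult power_add mult_ac)
  qed (use f g in auto)
qed

lemma tame_diff:
  assumes "tame f" "tame g"
  shows "tame (\<lambda>t. f t - g t)"
  using tame_add[OF assms(1) tame_mult[OF tame_const[of "-1"] assms(2)]] by simp

lemma tame_power: "tame f \<Longrightarrow> tame (\<lambda>t. f t ^ k)"
  by (induction k) (auto intro: tame_const tame_mult)

lemma tame_poly: "tame f \<Longrightarrow> tame (\<lambda>t. poly p (f t))"
proof (induction p)
  case (pCons a p)
  from tame_add[OF tame_const[of a] tame_mult[OF pCons.prems pCons.IH[OF pCons.prems]]] show ?case by simp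
qed (simp add: tame_const)

lemma tame_sum: "(\<And>i. i \<in> I \<Longrightarrow> tame (f i)) \<Longrightarrow> tame (\<lambda>t. \<Sum>i\<in>I. f i t)"
  by (induction I rule: infinite_finite_induct) (auto intro: tame_const tame_add)

lemma tame_prod: "(\<And>i. i \<in> I \<Longrightarrow> tame (f i)) \<Longrightarrow> tame (\<lambda>t. \<Prod>i\<in>I. f i t)"
  by (induction I rule: infinite_finite_induct) (auto intro: tame_const tame_mult)

lemma tame_norm: "tame f \<Longrightarrow> tame (\<lambda>t. norm (f t))"
  by (auto simp: tame_def)

context quantized_surface
begin

text \<open>
  The expectation of \<open>\<phi>\<close> at the random time \<open>n h\<close>, whose probability is proportional to \<open>W n x\<^sup>n\<close>.
\<close>

definition EE :: "real \<Rightarrow> (real \<Rightarrow> 'b::{real_normed_field, banach}) \<Rightarrow> 'b" where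
  "EE x \<phi> = suminf (\<lambda>n. of_real (W n * x ^ n) * \<phi> (real n * h)) / of_real (kr x)"

lemma EE_summable:
  assumes x: "x \<ge> 0" and \<phi>: "tame (\<phi> :: real \<Rightarrow> 'b::{real_normed_field, banach})"
  shows "summable (\<lambda>n. of_real (W n * x ^ n) * \<phi> (real n * h))"
proof -
  obtain C P where C: "C \<ge> 0" "\<And>t. t \<ge> 0 \<Longrightarrow> norm (\<phi> t) \<le> C * (1 + t) ^ P" using tameE[OF \<phi>] by blast
  have "summable (\<lambda>n. poly ([:1, h:] ^ P) (real n) * (W n * x ^ n))" by (rule summable_W_poly)
  then have s: "summable (\<lambda>n. C * (poly ([:1, h:] ^ P) (real n) * (W n * x ^ n)))" by (rule summable_mult)
  show ?thesis
  proof (rule summable_comparison_test'[OF s, of 0])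
    fix n
    have "norm (of_real (W n * x ^ n) * \<phi> (real n * h)) = (W n * x ^ n) * norm (\<phi> (real n * h))"
      using x W_nonneg[of n] by (simp add: norm_mult norm_power)
    also have "\<dots> \<le> (W n * x ^ n) * (C * (1 + real n * h) ^ P)"
      using x W_nonneg[of n] h_pos by (intro mult_left_mono C) auto
    finally show "norm (of_real (W n * x ^ n) * \<phi> (real n * h)) \<le> C * (poly ([:1, h:] ^ P) (real n) * (W n * x ^ n))"
      by (simp add: poly_power mult_ac)
  qed
qed

lemma EE_add: "x \<ge> 0 \<Longrightarrow> tame \<phi> \<Longrightarrow> tame \<psi> \<Longrightarrow> EE x (\<lambda>t. \<phi> t + \<psi> t) = EE x \<phi> + EE x \<psi>"
  unfolding EE_def by (simp add: distrib_left suminf_add[symmetric] EE_summable[unfolded of_real_mult of_real_power] add_divide_distrib)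

lemma EE_cmult: "x \<ge> 0 \<Longrightarrow> tame \<phi> \<Longrightarrow> EE x (\<lambda>t. c * \<phi> t) = c * EE x \<phi>"
proof -
  assume "x \<ge> 0" "tame \<phi>"
  from suminf_mult[OF EE_summable[OF this], of c] show ?thesis by (simp add: EE_def mult_ac)
qed

lemma EE_const: "x \<ge> 0 \<Longrightarrow> EE x (\<lambda>t. c) = c"
proof -
  assume x: "x \<ge> 0"
  have "EE x (\<lambda>t. c) = c * EE x (\<lambda>t. 1)" using EE_cmult[OF x tame_const[of 1], of c] by simp
  moreover have "EE x (\<lambda>t. 1 :: 'a) = 1"
    unfolding EE_def using suminf_of_real[OF summable_W[of x], symmetric, where 'a = 'a] kr_pos[OF x]
    by (simp add: kr_def)
  ultimately show ?thesis by simp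
qed

lemma EE_mono:
  fixes \<phi> \<psi> :: "real \<Rightarrow> real"
  assumes x: "x \<ge> 0" and t: "tame \<phi>" "tame \<psi>" and le: "\<And>t. in_range t \<Longrightarrow> \<phi> t \<le> \<psi> t"
  shows "EE x \<phi> \<le> EE x \<psi>"
proof -
  have "suminf (\<lambda>n. of_real (W n * x ^ n) * \<phi> (real n * h)) \<le> suminf (\<lambda>n. of_real (W n * x ^ n) * \<psi> (real n * h))"
  proof (rule suminf_le[OF _ EE_summable[OF x t(1)] EE_summable[OF x t(2)]])
    fix n
    show "of_real (W n * x ^ n) * \<phi> (real n * h) \<le> of_real (W n * x ^ n) * \<psi> (real n * h)"
    proof (cases "enat n \<le> topN S h")
      case True
      then show ?thesis using x W_nonneg[of n] le[OF top_in_range[OF True]] by (simp add: mult_left_mono)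
    qed (simp add: W_def)
  qed
  then show ?thesis unfolding EE_def using kr_pos[OF x] by (simp add: divide_right_mono)
qed

lemma EE_norm:
  assumes x: "x \<ge> 0" and t: "tame (\<phi> :: real \<Rightarrow> 'b::{real_normed_field, banach})"
  shows "norm (EE x \<phi>) \<le> EE x (\<lambda>t. norm (\<phi> t))"
proof -
  have e: "norm (of_real (W n * x ^ n) * \<phi> (real n * h)) = of_real (W n * x ^ n) * norm (\<phi> (real n * h))" for n
    using x W_nonneg[of n] by (simp add: norm_mult norm_power)
  have "summable (\<lambda>n. norm (of_real (W n * x ^ n) * \<phi> (real n * h)))"
    unfolding e by (rule EE_summable[OF x tame_norm[OF t]])
  from summable_norm[OF this]
  have "norm (suminf (\<lambda>n. of_real (W n * x ^ n) * \<phi> (real n * h))) \<le> suminf (\<lambda>n. of_real (W n * x ^ n) * norm (\<phi> (real n * h)))"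
    unfolding e .
  then show ?thesis unfolding EE_def using kr_pos[OF x] by (simp add: norm_divide divide_right_mono)
qed

lemma EE_of_real:
  assumes x: "x \<ge> 0" and t: "tame \<phi>"
  shows "EE x (\<lambda>t. complex_of_real (\<phi> t)) = of_real (EE x \<phi>)"
  unfolding EE_def using suminf_of_real[OF EE_summable[OF x t], where 'a = complex] by simp

text \<open>
  The recurrence between the weights, integrated against a test function.  The term \<open>n = 0\<close> drops out
  because \<open>R(0) = 0\<close>.
\<close>

lemma EE_stein:
  fixes s :: "real \<Rightarrow> complex"
  assumes x: "x \<ge> 0" and s: "tame s"
  shows "EE x (\<lambda>t. of_real (poly Rp t) * s t) = of_real x * EE x (\<lambda>t. of_real (poly Qp (t + h)) * s (t + h))"
proof -
  have tR: "tame (\<lambda>t. complex_of_real (poly Rp t) * s t)"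
    using tame_mult[OF tame_poly[OF tame_ident, of cR] s] by (simp add: poly_cR)
  have ts: "tame (\<lambda>t. s (t + h))"
  proof -
    obtain C P where C: "C \<ge> 0" "\<And>t. t \<ge> 0 \<Longrightarrow> norm (s t) \<le> C * (1 + t) ^ P" using tameE[OF s] by blast
    show ?thesis
    proof (rule tameI[of "C * (1 + h) ^ P" _ P])
      fix t :: real assume t: "t \<ge> 0"
      have "norm (s (t + h)) \<le> C * (1 + (t + h)) ^ P" using C(2)[of "t + h"] t h_pos by simp
      also have "\<dots> \<le> C * ((1 + h) * (1 + t)) ^ P"
        using t h_pos C(1) by (intro mult_left_mono power_mono) (auto simp: algebra_simps)
      finally show "norm (s (t + h)) \<le> C * (1 + h) ^ P * (1 + t) ^ P" by (simp add: power_mult_distrib mult.assoc)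
    qed (use C h_pos in auto)
  qed
  have tQ: "tame (\<lambda>t. complex_of_real (poly Qp (t + h)) * s (t + h))"
    using tame_mult[OF tame_poly[OF tame_add[OF tame_ident tame_const[of "of_real h"]], of cQ] ts]
    by (simp add: poly_cQ flip: of_real_add)
  have "suminf (\<lambda>n. of_real (W n * x ^ n) * (of_real (poly Rp (real n * h)) * s (real n * h))) =
      suminf (\<lambda>n. of_real (W (Suc n) * x ^ Suc n) * (of_real (poly Rp (real (Suc n) * h)) * s (real (Suc n) * h)))"
    using suminf_split_head[OF EE_summable[OF x tR]] by simp
  also have "\<dots> = suminf (\<lambda>n. of_real x * (of_real (W n * x ^ n) * (of_real (poly Qp (real n * h + h)) * s (real n * h + h))))"
  proof (rule suminf_cong)
    fix n
    have e: "real (Suc n) * h = real n * h + h" by (simp add: algebra_simps)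
    have "complex_of_real (W (Suc n) * x ^ Suc n) * (of_real (poly Rp (real (Suc n) * h)) * s (real (Suc n) * h)) =
       of_real x * of_real (x ^ n) * of_real (W (Suc n) * poly Rp (real (Suc n) * h)) * s (real (Suc n) * h)"
      by (simp add: mult_ac del: of_nat_Suc)
    also have "\<dots> = of_real x * (of_real (W n * x ^ n) * (of_real (poly Qp (real n * h + h)) * s (real n * h + h)))"
      unfolding W_rec unfolding e by (simp add: mult_ac)
    finally show "complex_of_real (W (Suc n) * x ^ Suc n) * (of_real (poly Rp (real (Suc n) * h)) * s (real (Suc n) * h)) =
       of_real x * (of_real (W n * x ^ n) * (of_real (poly Qp (real n * h + h)) * s (real n * h + h)))" .
  qed
  also have "\<dots> = of_real x * suminf (\<lambda>n. of_real (W n * x ^ n) * (of_real (poly Qp (real n * h + h)) * s (real n * h + h)))"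
    by (rule suminf_mult[OF EE_summable[OF x tQ]])
  finally show ?thesis by (simp add: EE_def)
qed

text \<open>
  Beyond \<open>t0 (4 X)\<close> one has \<open>H > 4 X\<close>, so for \<open>x \<le> X\<close> each step divides the weight by at least 4, and for
  small \<open>h\<close> the polynomial factor gives back at most a factor 2.  From \<open>t1\<close> to \<open>t2\<close> there are
  about \<open>(t2 - t1) / h\<close> steps, which makes the tail exponentially small in \<open>1 / h\<close>.
\<close>

lemma EE_tail:
  assumes x: "0 \<le> x" "x \<le> X" and X: "X > 0" and h1: "h \<le> 1" and hP: "(1 + h) ^ P \<le> 2"
    and t1: "t1 = t0 (4 * X)" and t2: "t1 < t2"
  shows "\<exists>d. real d + 1 \<ge> (t2 - t1) / h \<and>
     EE x (\<lambda>t. if t > t2 then (1 + t) ^ P else 0) \<le> 2 * (2 + t1) ^ P * (1 / 2) ^ d"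
proof -
  have t1n: "t1 \<ge> 0" unfolding t1 using X by (intro t0_nonneg) simp
  define n1 where "n1 = nat \<lceil>t1 / h\<rceil>"
  define n2 where "n2 = nat \<lceil>t2 / h\<rceil>"
  have n1: "t1 / h \<le> real n1" "real n1 \<le> t1 / h + 1" using t1n h_pos by (auto simp: n1_def)
  have n1h: "t1 \<le> real n1 * h" "real n1 * h \<le> t1 + 1"
    using n1 h_pos h1 by (auto simp: field_simps)
  have n2: "t2 / h \<le> real n2" using t1n t2 h_pos by (auto simp: n2_def)
  have n12: "n1 \<le> n2" unfolding n1_def n2_def using t2 h_pos by (intro nat_mono ceiling_mono divide_right_mono) auto
  have big: "n2 \<le> n" if "real n * h > t2" for n
  proof -
    have "t2 / h \<le> real n" using that h_pos by (simp add: field_simps)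
    then show ?thesis by (simp add: n2_def ceiling_le_iff)
  qed
  \<comment> \<open>the terms of the tail; they halve from \<open>n1\<close> on\<close>
  define w where "w = (\<lambda>n. W n * x ^ n * (1 + real n * h) ^ P)"
  have w0: "w n \<ge> 0" for n using W_nonneg x h_pos by (simp add: w_def)
  have dec: "w (Suc n) \<le> w n / 2" if n: "n1 \<le> n" for n
  proof (cases "enat (Suc n) \<le> topN S h")
    case False
    then have "w (Suc n) = 0" by (simp add: w_def W_def)
    then show ?thesis using w0[of n] by simp
  next
    case True
    let ?t = "real (Suc n) * h"
    have r: "in_range ?t" by (rule top_in_range[OF True])
    have "real n1 * h \<le> real n * h" using n h_pos by (intro mult_right_mono) auto
    then have "t1 \<le> real n * h" using n1h(1) by simp
    then have lt: "t1 < ?t" using h_pos by (simp add: algebra_simps)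
    have "4 * X = Hr t1" using X t0(2)[of "4 * X"] by (simp add: t1)
    also have "\<dots> < Hr ?t" by (rule Hr_strict[OF r t1n lt])
    finally have H: "4 * X < Hr ?t" .
    have "W (Suc n) * Hr ?t = W n" using W_rec[of n] Qp_pos[OF r] by (simp add: Rp_Hr[OF r] del: of_nat_Suc)
    moreover have "W (Suc n) * (4 * x) \<le> W (Suc n) * Hr ?t" using H x W_nonneg by (intro mult_left_mono) auto
    ultimately have W4: "W (Suc n) * x \<le> W n / 4" by simp
    have "(1 + ?t) ^ P \<le> ((1 + h) * (1 + real n * h)) ^ P"
      using h_pos by (intro power_mono) (auto simp: algebra_simps)
    also have "\<dots> \<le> 2 * (1 + real n * h) ^ P"
      unfolding power_mult_distrib using hP h_pos by (intro mult_right_mono) auto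
    finally have P2: "(1 + ?t) ^ P \<le> 2 * (1 + real n * h) ^ P" .
    have "w (Suc n) = (W (Suc n) * x) * (x ^ n * (1 + ?t) ^ P)" by (simp add: w_def mult_ac)
    also have "\<dots> \<le> (W n / 4) * (x ^ n * (2 * (1 + real n * h) ^ P))"
      using W4 P2 x W_nonneg h_pos by (intro mult_mono) (auto simp del: of_nat_Suc)
    finally show ?thesis by (simp add: w_def mult_ac)
  qed
  have geo: "w (n1 + k) \<le> w n1 * (1 / 2) ^ k" for k
  proof (induction k)
    case (Suc k)
    then show ?case using dec[of "n1 + k"] by simp
  qed simp
  have wn1: "w n1 \<le> kr x * (2 + t1) ^ P"
  proof -
    have "(\<Sum>n\<in>{n1}. W n * x ^ n) \<le> kr x"
      unfolding kr_def by (rule sum_le_suminf[OF summable_W]) (auto simp: W_nonneg x)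
    then have "W n1 * x ^ n1 \<le> kr x" by simp
    moreover have "(1 + real n1 * h) ^ P \<le> (2 + t1) ^ P" using n1h h_pos by (intro power_mono) auto
    ultimately show ?thesis unfolding w_def using kr_pos[OF x(1)] h_pos by (intro mult_mono) auto
  qed
  \<comment> \<open>geometric majorant from \<open>n2\<close> on\<close>
  define A where "A = w n1 * (1 / 2) ^ (n2 - n1)"
  define g where "g = (\<lambda>n. if n < n2 then 0 else A * (1 / 2) ^ (n - n2))"
  have "(\<lambda>k. A * (1 / 2) ^ k) sums (A * 2)"
    using sums_mult[OF geometric_sums[of "1 / 2 :: real"], of A] by simp
  then have "(\<lambda>k. g (k + n2)) sums (A * 2)" by (simp add: g_def)
  then have g: "g sums (A * 2)" by (subst (asm) sums_zero_iff_shift) (auto simp: g_def)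
  have tm: "tame (\<lambda>t :: real. if t > t2 then (1 + t) ^ P else 0)"
    by (rule tameI[of 1 _ P]) auto
  have "suminf (\<lambda>n. of_real (W n * x ^ n) * (if real n * h > t2 then (1 + real n * h) ^ P else 0)) \<le> suminf g"
  proof (rule suminf_le[OF _ EE_summable[OF x(1) tm] sums_summable[OF g]])
    fix n
    show "of_real (W n * x ^ n) * (if real n * h > t2 then (1 + real n * h) ^ P else 0) \<le> g n"
    proof (cases "real n * h > t2")
      case True
      then have n: "n2 \<le> n" by (rule big)
      have "w n \<le> w n1 * (1 / 2) ^ (n - n1)" using geo[of "n - n1"] n n12 by simp
      also have "(1 / 2 :: real) ^ (n - n1) = (1 / 2) ^ (n2 - n1) * (1 / 2) ^ (n - n2)"
        using n n12 by (simp only: power_add[symmetric]) simp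
      finally show ?thesis using n True by (simp add: g_def A_def w_def mult.assoc)
    qed (use w0[of n1] in \<open>auto simp: g_def A_def\<close>)
  qed
  also have "suminf g = A * 2" using g by (rule sums_unique[symmetric])
  finally have "EE x (\<lambda>t. if t > t2 then (1 + t) ^ P else 0) \<le> A * 2 / kr x"
    unfolding EE_def using kr_pos[OF x(1)] by (simp add: divide_right_mono)
  also have "\<dots> \<le> (kr x * (2 + t1) ^ P * (1 / 2) ^ (n2 - n1)) * 2 / kr x"
    unfolding A_def using wn1 kr_pos[OF x(1)] by (intro divide_right_mono mult_right_mono) auto
  also have "\<dots> = 2 * (2 + t1) ^ P * (1 / 2) ^ (n2 - n1)" using kr_pos[OF x(1)] by simp
  finally have "EE x (\<lambda>t. if t > t2 then (1 + t) ^ P else 0) \<le> 2 * (2 + t1) ^ P * (1 / 2) ^ (n2 - n1)" .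
  moreover have "real (n2 - n1) + 1 \<ge> (t2 - t1) / h"
    using n1 n2 n12 by (simp add: of_nat_diff diff_divide_distrib)
  ultimately show ?thesis by blast
qed

subsection \<open>The symbol as an expectation\<close>

text \<open>
  Lowering the kernel multiplies it by \<open>z\<close> and the conjugate of \<open>D\<close> at the current time, because \<open>E\<close>
  meets the factor \<open>1 / H\<close> of the kernel.  At the top degree both sides vanish.
\<close>

lemma kseq_rec: "Et (real (Suc n) * h) * kseq z (Suc n) = z * cnj (Dt (real (Suc n) * h)) * kseq z n"
proof -
  let ?t = "real (Suc n) * h"
  have "Et ?t * of_real (W (Suc n)) = cnj (Dt ?t) * of_real (W n)"
  proof (cases "Dt ?t = 0")
    case True
    then have "\<not> enat (Suc n) \<le> topN S h" using Dt_nonzero top_in_range by blast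
    then have "W (Suc n) = 0" by (simp add: W_def)
    then show ?thesis using True by simp
  next
    case False
    have "complex_of_real (W (Suc n) * poly Rp ?t) = of_real (W n * poly Qp ?t)" by (simp only: W_rec)
    then have "of_real (W (Suc n)) * (Dt ?t * Et ?t) = of_real (W n) * (Dt ?t * cnj (Dt ?t))"
      by (simp only: of_real_mult DE Qp_eq')
    then have "Dt ?t * (Et ?t * of_real (W (Suc n))) = Dt ?t * (cnj (Dt ?t) * of_real (W n))" by (simp only: mult_ac)
    then show ?thesis using False by (simp only: mult_cancel_left) simp
  qed
  then have "(Et ?t * of_real (W (Suc n))) * z ^ Suc n = (cnj (Dt ?t) * of_real (W n)) * z ^ Suc n" by simp
  then show ?thesis by (simp add: kseq_def mult_ac del: of_nat_Suc)
qed

lemma opC_pow_kseq: "(opC ^^ c) (kseq z) n = z ^ c * (\<Prod>j<c. cnj (Dt (real (n + Suc j) * h))) * kseq z n"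
proof (induction c arbitrary: n)
  case (Suc c)
  have "(opC ^^ Suc c) (kseq z) n = Et (real (Suc n) * h) * (z ^ c * (\<Prod>j<c. cnj (Dt (real (Suc n + Suc j) * h))) * kseq z (Suc n))"
    by (simp add: opC_def[of "(opC ^^ c) (kseq z)" n] Suc del: of_nat_Suc)
  also have "\<dots> = z ^ c * (\<Prod>j<c. cnj (Dt (real (Suc n + Suc j) * h))) * (z * cnj (Dt (real (Suc n) * h)) * kseq z n)"
    unfolding kseq_rec[symmetric] by (simp only: mult_ac)
  also have "\<dots> = z ^ Suc c * (\<Prod>j<Suc c. cnj (Dt (real (n + Suc j) * h))) * kseq z n"
    unfolding prod.lessThan_Suc_shift by (simp add: mult_ac del: of_nat_Suc of_nat_add)
  finally show ?case .
qed simp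

lemma entire_opB_pow: "entire_seq x \<Longrightarrow> entire_seq ((opB ^^ b) x)"
  by (induction b) (simp_all add: entire_opB)

lemma entire_opC_pow: "entire_seq x \<Longrightarrow> entire_seq ((opC ^^ b) x)"
  by (induction b) (simp_all add: entire_opC)

lemma entire_Dt_prod: "entire_seq x \<Longrightarrow> entire_seq (\<lambda>k. (\<Prod>j<b. Dt (real (k + Suc j) * h)) * x k)"
proof (induction b arbitrary: x)
  case (Suc b)
  have "entire_seq (\<lambda>k. poly (along S (Dp S)) (of_real h * of_nat k + of_real (real (Suc b) * h)) * x k)"
    by (rule entire_seq_poly'[OF Suc.prems])
  moreover have "Dt (real (k + Suc b) * h) = poly (along S (Dp S)) (of_real h * of_nat k + of_real (real (Suc b) * h))" for k
    by (simp add: Dt_def algebra_simps)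
  ultimately have "entire_seq (\<lambda>k. Dt (real (k + Suc b) * h) * x k)" by simp
  from Suc.IH[OF this] show ?case by (simp add: mult.assoc)
qed simp

text \<open>
  Evaluation at \<open>w\<close> moves the powers of \<open>B\<close> to the function of the time: raising the degree is
  multiplication by \<open>w\<close>, and the factors \<open>D\<close> are collected by \<open>opB_pow_diag\<close>.
\<close>

lemma ser_opB_pow: "entire_seq x \<Longrightarrow>
   ser ((opB ^^ b) x) w = w ^ b * ser (\<lambda>k. (\<Prod>j<b. Dt (real (k + Suc j) * h)) * x k) w"
proof (induction b arbitrary: x)
  case (Suc b)
  have eb: "entire_seq ((opB ^^ b) x)" by (rule entire_opB_pow[OF Suc.prems])
  have d: "Dt (real (Suc k) * h) * (opB ^^ b) x k = (opB ^^ b) (\<lambda>k. Dt (real (k + Suc b) * h) * x k) k" for k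
    using opB_pow_diag[of "\<lambda>k. Dt (real (Suc k) * h)" k b x] by simp
  have e1: "entire_seq (\<lambda>k. Dt (real (k + Suc b) * h) * x k)"
  proof -
    have "entire_seq (\<lambda>k. poly (along S (Dp S)) (of_real h * of_nat k + of_real (real (Suc b) * h)) * x k)"
      by (rule entire_seq_poly'[OF Suc.prems])
    moreover have "Dt (real (k + Suc b) * h) = poly (along S (Dp S)) (of_real h * of_nat k + of_real (real (Suc b) * h))" for k
      by (simp add: Dt_def algebra_simps)
    ultimately show ?thesis by simp
  qed
  have e2: "entire_seq ((opB ^^ b) (\<lambda>k. Dt (real (k + Suc b) * h) * x k))" by (rule entire_opB_pow[OF e1])
  have "(opB ^^ Suc b) x = shift_right (\<lambda>k. Dt (real (Suc k) * h) * (opB ^^ b) x k)"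
    by (auto simp: fun_eq_iff opB_def[of "(opB ^^ b) x"] shift_right_def split: nat.splits)
  also have "\<dots> = shift_right ((opB ^^ b) (\<lambda>k. Dt (real (k + Suc b) * h) * x k))" unfolding d ..
  finally have sr: "(opB ^^ Suc b) x = shift_right ((opB ^^ b) (\<lambda>k. Dt (real (k + Suc b) * h) * x k))" .
  have "ser ((opB ^^ Suc b) x) w = w * ser ((opB ^^ b) (\<lambda>k. Dt (real (k + Suc b) * h) * x k)) w"
    unfolding sr by (rule ser_shift_right[OF e2])
  also have "\<dots> = w ^ Suc b * ser (\<lambda>k. (\<Prod>j<b. Dt (real (k + Suc j) * h)) * (Dt (real (k + Suc b) * h) * x k)) w"
    unfolding Suc.IH[OF e1] by simp
  finally show ?case by (simp add: mult.assoc)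
qed simp

lemma poly_cDP: "poly cDP (of_real t) = cnj (Dt t)"
  unfolding cDP_def DP_def Dt_def poly_cnj by simp

lemma fmon_real:
  "fmon h z m (of_real t) (of_real t) (of_real t) =
    (cnj z ^ Poly_Mapping.lookup m gB * (\<Prod>j<Poly_Mapping.lookup m gB. Dt (t + real (Suc j) * h))) *
    (\<Prod>i\<in>UNIV. of_real (flow S (t + h) (pt S) $ i) ^ Poly_Mapping.lookup m (gA i)) *
    (z ^ Poly_Mapping.lookup m gC * (\<Prod>j<Poly_Mapping.lookup m gC. cnj (Dt (t + real (Suc j) * h))))"
proof -
  have 1: "poly DP (of_real t + of_nat (Suc j) * of_real h) = Dt (t + real (Suc j) * h)" for j
    by (simp add: Dt_def DP_def)
  have 2: "poly cDP (of_real t + of_nat (Suc j) * of_real h) = cnj (Dt (t + real (Suc j) * h))" for j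
    using poly_cDP[of "t + real (Suc j) * h"] by simp
  have 3: "poly (base_poly S i) (of_real t + of_real h) = of_real (flow S (t + h) (pt S) $ i)" for i
    using poly_base_poly[of S i "t + h"] by simp
  show ?thesis unfolding fmon_def 1 2 3 ..
qed

lemma tame_fmon: "tame (\<lambda>t. fmon h z m (of_real t) (of_real t) (of_real t))"
  unfolding fmon_def
  by (intro tame_mult tame_prod tame_const tame_power tame_poly tame_add tame_ident)

lemma tame_fsym: "tame (\<lambda>t. fsym h z f (of_real t) (of_real t) (of_real t))"
  unfolding fsym_def by (intro tame_sum tame_mult tame_const tame_fmon)

text \<open>
  On the diagonal \<open>w\<close> is the conjugate of \<open>z\<close>, so the coefficients of the kernel times the powers of \<open>w\<close>
  are the weights \<open>W n \<bar>z\<bar>\<^bsup>2n\<^esup>\<close>.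
\<close>

lemma ser_nmon_kseq:
  "ser (nmon m (kseq z)) (cnj z) = of_real (kr ((cmod z)\<^sup>2)) * EE ((cmod z)\<^sup>2) (\<lambda>t. fmon h z m (of_real t) (of_real t) (of_real t))"
proof -
  let ?b = "Poly_Mapping.lookup m gB" and ?c = "Poly_Mapping.lookup m gC"
  have zz: "kseq z n * cnj z ^ n = of_real (W n * ((cmod z)\<^sup>2) ^ n)" for n
  proof -
    have "z ^ n * cnj z ^ n = of_real ((cmod z)\<^sup>2) ^ n"
      by (metis complex_norm_square of_real_power power_mult_distrib)
    then show ?thesis by (simp add: kseq_def mult.assoc)
  qed
  have em: "entire_seq (midmon m (kseq z))"
  proof -
    have "entire_seq ((opC ^^ ?c) (kseq z))" by (rule entire_opC_pow[OF entire_seq_kseq])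
    then have "entire_seq (nseq (Poly_Mapping.single (m - Poly_Mapping.single gB ?b) 1) (kseq z))"
      using rep_fnormal_ser[OF entire_seq_kseq] by blast
    moreover have "nseq (Poly_Mapping.single (m - Poly_Mapping.single gB ?b) 1) (kseq z) = midmon m (kseq z)"
      by (simp add: fun_eq_iff nseq_single nmon_def lookup_minus lookup_single midmon_def)
    ultimately show ?thesis by simp
  qed
  have "ser (nmon m (kseq z)) (cnj z) = cnj z ^ ?b * suminf (\<lambda>k. (\<Prod>j<?b. Dt (real (k + Suc j) * h)) * midmon m (kseq z) k * cnj z ^ k)"
    unfolding nmon_def ser_opB_pow[OF em] by (simp add: ser_def)
  also have "\<dots> = suminf (\<lambda>k. cnj z ^ ?b * ((\<Prod>j<?b. Dt (real (k + Suc j) * h)) * midmon m (kseq z) k * cnj z ^ k))"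
    using entire_Dt_prod[OF em, of ?b] by (intro suminf_mult[symmetric]) (simp add: entire_seq_def)
  also have "\<dots> = suminf (\<lambda>k. of_real (W k * ((cmod z)\<^sup>2) ^ k) * fmon h z m (of_real (real k * h)) (of_real (real k * h)) (of_real (real k * h)))"
  proof (rule suminf_cong)
    fix k
    have s: "real (k + Suc j) * h = real k * h + real (Suc j) * h" for j by (simp add: algebra_simps)
    have o: "orb k = flow S (real k * h + h) (pt S)" by (simp add: orb_def algebra_simps)
    show "cnj z ^ ?b * ((\<Prod>j<?b. Dt (real (k + Suc j) * h)) * midmon m (kseq z) k * cnj z ^ k) =
      of_real (W k * ((cmod z)\<^sup>2) ^ k) * fmon h z m (of_real (real k * h)) (of_real (real k * h)) (of_real (real k * h))"
      unfolding zz[symmetric] midmon_def opC_pow_kseq fmon_real s o by (simp only: mult_ac)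
  qed
  also have "\<dots> = of_real (kr ((cmod z)\<^sup>2)) * EE ((cmod z)\<^sup>2) (\<lambda>t. fmon h z m (of_real t) (of_real t) (of_real t))"
    using kr_pos[of "(cmod z)\<^sup>2"] by (simp add: EE_def)
  finally show ?thesis .
qed

text \<open>
  By linearity it suffices to consider monomials; the denominator of the symbol, the kernel on the
  diagonal, normalizes the weights.
\<close>

lemma quantum_restriction_EE:
  "quantum_restriction S h f (cnj z) z = EE ((cmod z)\<^sup>2) (\<lambda>t. fsym h z f (of_real t) (of_real t) (of_real t))"
proof -
  let ?x = "(cmod z)\<^sup>2"
  have ker: "ker S h (cnj z) z = of_real (kr ?x)"
  proof -
    have "cnj z * z = of_real ?x" by (metis complex_norm_square mult.commute of_real_power)
    then show ?thesis by (simp only: ker_def kfun_real)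
  qed
  have K: "(\<lambda>w'. ker S h w' z) = ser (kseq z)" by (simp add: fun_eq_iff ker_eq)
  have "rep S h (fnormal f) (ser (kseq z)) (cnj z) =
     of_real (kr ?x) * EE ?x (\<lambda>t. fsym h z f (of_real t) (of_real t) (of_real t))"
  proof (induction f rule: poly_mapping_single_induct)
    case zero
    show ?case by (simp add: rep_fnormal EE_def)
  next
    case (single m c)
    have "rep S h (fnormal (Poly_Mapping.single m c)) (ser (kseq z)) (cnj z) = c * ser (nmon m (kseq z)) (cnj z)"
      unfolding rep_fnormal nmon_nword using word_ser[OF entire_seq_kseq, of "nword m" z] by (cases "c = 0") simp_all
    then show ?case unfolding ser_nmon_kseq fsym_single using EE_cmult[OF _ tame_fmon, of ?x c z m] by simp
  next
    case (add p q)
    have "rep S h (fnormal (p + q)) (ser (kseq z)) (cnj z) =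
      rep S h (fnormal p) (ser (kseq z)) (cnj z) + rep S h (fnormal q) (ser (kseq z)) (cnj z)"
      unfolding rep_fnormal
      using keys_sum_add[of "\<lambda>m c. c * foldr (gen_op S h) (nword m) (ser (kseq z)) (cnj z)" p q]
      by (simp add: distrib_right)
    then show ?case using add EE_add[OF _ tame_fsym tame_fsym, of ?x z p z q] by (simp add: fsym_add distrib_left)
  qed
  then show ?thesis
    using kr_pos[of ?x] by (simp add: quantum_restriction_def wick_symbol_def K ker)
qed

end

section \<open>Concentration\<close>

lemma power_le_fact_exp: "x \<ge> 0 \<Longrightarrow> x ^ n / fact n \<le> exp (x :: real)"
proof -
  assume x: "x \<ge> 0"
  have s: "(\<lambda>n. x ^ n / fact n) sums exp x" using exp_converges[of x] by (simp add: divide_inverse mult.commute)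
  have "(\<Sum>k\<in>{n}. x ^ k / fact k) \<le> suminf (\<lambda>n. x ^ n / fact n)"
    by (rule sum_le_suminf[OF sums_summable[OF s]]) (use x in auto)
  then show ?thesis using s by (simp add: sums_iff)
qed

text \<open>
  With a constant that depends on \<open>L\<close> only; it turns exponential smallness in \<open>1 / h\<close> into \<open>O(h\<^sup>L)\<close>.
\<close>

lemma power_le_two_power: "\<exists>C\<ge>0. \<forall>d. (real d + 1) ^ L \<le> C * 2 ^ d"
proof (intro exI[of _ "2 * fact L / ln 2 ^ L"] conjI allI)
  fix d
  have "((real d + 1) * ln 2) ^ L / fact L \<le> exp ((real d + 1) * ln 2)" by (rule power_le_fact_exp) simp
  also have "exp ((real d + 1) * ln 2) = 2 * 2 ^ d"
    by (metis Suc_eq_plus1 exp_of_nat_mult exp_ln of_nat_Suc add.commute power_Suc zero_less_numeral)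
  finally have "(real d + 1) ^ L * ln 2 ^ L / fact L \<le> 2 * 2 ^ d" by (simp only: power_mult_distrib)
  then show "(real d + 1) ^ L \<le> 2 * fact L / ln 2 ^ L * 2 ^ d"
    by (simp add: field_simps)
qed simp

context revolution_surface
begin

lemma quantized: "admissible S h \<Longrightarrow> quantized_surface S h"
  by unfold_locales

text \<open>
  The expectation as a function of \<open>h\<close>: asymptotics need to vary \<open>h\<close>, which is fixed where \<open>EE\<close> is
  defined.
\<close>

definition mean :: "real \<Rightarrow> complex \<Rightarrow> (real \<Rightarrow> 'b::{real_normed_field, banach}) \<Rightarrow> 'b" where
  "mean h z \<phi> = quantized_surface.EE S h ((cmod z)\<^sup>2) \<phi>"

definition Tr :: "complex \<Rightarrow> real" where "Tr z = t0 ((cmod z)\<^sup>2)"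

lemma Tc_Tr: "Tc z = of_real (Tr z)"
  by (simp add: Tc_def Tr_def)

lemma mean_add: "admissible S h \<Longrightarrow> tame \<phi> \<Longrightarrow> tame \<psi> \<Longrightarrow> mean h z (\<lambda>t. \<phi> t + \<psi> t) = mean h z \<phi> + mean h z \<psi>"
  unfolding mean_def by (rule quantized_surface.EE_add[OF quantized]) simp_all

lemma mean_cmult: "admissible S h \<Longrightarrow> tame \<phi> \<Longrightarrow> mean h z (\<lambda>t. c * \<phi> t) = c * mean h z \<phi>"
  unfolding mean_def by (rule quantized_surface.EE_cmult[OF quantized]) simp_all

lemma mean_const: "admissible S h \<Longrightarrow> mean h z (\<lambda>t. c) = c"
  unfolding mean_def by (rule quantized_surface.EE_const[OF quantized]) simp_all

lemma mean_norm: "admissible S h \<Longrightarrow> tame \<phi> \<Longrightarrow> norm (mean h z \<phi>) \<le> mean h z (\<lambda>t. norm (\<phi> t))"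
  unfolding mean_def by (rule quantized_surface.EE_norm[OF quantized]) simp_all

lemma mean_mono: "admissible S h \<Longrightarrow> tame \<phi> \<Longrightarrow> tame \<psi> \<Longrightarrow> (\<And>t. in_range t \<Longrightarrow> \<phi> t \<le> \<psi> t) \<Longrightarrow> mean h z \<phi> \<le> mean h z \<psi>"
  for \<phi> \<psi> :: "real \<Rightarrow> real"
  unfolding mean_def by (rule quantized_surface.EE_mono[OF quantized]) simp_all

lemma mean_of_real: "admissible S h \<Longrightarrow> tame \<phi> \<Longrightarrow> mean h z (\<lambda>t. complex_of_real (\<phi> t)) = of_real (mean h z \<phi>)"
  unfolding mean_def by (rule quantized_surface.EE_of_real[OF quantized]) simp_all

lemma mean_diff: "admissible S h \<Longrightarrow> tame \<phi> \<Longrightarrow> tame \<psi> \<Longrightarrow> mean h z (\<lambda>t. \<phi> t - \<psi> t) = mean h z \<phi> - mean h z \<psi>"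
  using mean_add[of h \<phi> "\<lambda>t. -1 * \<psi> t" z] mean_cmult[of h \<psi> z "-1"] tame_mult[OF tame_const[of "-1"], of \<psi>] by simp

lemma mean_sum: "admissible S h \<Longrightarrow> (\<And>i. i \<in> I \<Longrightarrow> tame (\<phi> i)) \<Longrightarrow> mean h z (\<lambda>t. \<Sum>i\<in>I. \<phi> i t) = (\<Sum>i\<in>I. mean h z (\<phi> i))"
  by (induction I rule: infinite_finite_induct) (simp_all add: mean_const mean_add tame_sum)

text \<open>
  Moments about the classical time; the absolute ones are real and can be compared with the drift.
\<close>

definition mom :: "nat \<Rightarrow> complex \<Rightarrow> real \<Rightarrow> complex" where
  "mom p z h = mean h z (\<lambda>t. (of_real t - Tc z) ^ p)"

definition absm :: "nat \<Rightarrow> complex \<Rightarrow> real \<Rightarrow> real" where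
  "absm p z h = mean h z (\<lambda>t. \<bar>t - Tr z\<bar> ^ p)"

lemma tame_tau: "tame (\<lambda>t. of_real t - Tc z)"
  by (intro tame_diff tame_ident tame_const)

lemma tame_abs: "tame (\<lambda>t. \<bar>t - Tr z\<bar> ^ p)"
  using tame_power[OF tame_norm[OF tame_diff[OF tame_ident tame_const[of "Tr z"]]]] by simp

lemma absm_nonneg: "admissible S h \<Longrightarrow> absm p z h \<ge> 0"
  using mean_mono[OF _ tame_const[of 0] tame_abs, of h z p] by (simp add: absm_def mean_const)

lemma mom_le_absm: "admissible S h \<Longrightarrow> norm (mom p z h) \<le> norm (absm p z h)"
proof -
  assume h: "admissible S h"
  have "norm ((of_real t - Tc z) ^ p) = \<bar>t - Tr z\<bar> ^ p" for t
  proof -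
    have "complex_of_real t - Tc z = of_real (t - Tr z)" by (simp add: Tc_Tr)
    then show ?thesis by (simp only: norm_power norm_of_real)
  qed
  then show ?thesis
    using mean_norm[OF h tame_power[OF tame_tau], of z z p] absm_nonneg[OF h, of p z] by (simp add: mom_def absm_def)
qed

text \<open>
  A filtered function with all three increments equal to the deviation from the classical time.
\<close>

abbreviation at_time ::
  "(complex \<Rightarrow> complex \<Rightarrow> complex \<Rightarrow> complex \<Rightarrow> real \<Rightarrow> complex) \<Rightarrow> complex \<Rightarrow> real \<Rightarrow> real \<Rightarrow> complex" where
  "at_time \<phi> z h t \<equiv> \<phi> z (of_real t - Tc z) (of_real t - Tc z) (of_real t - Tc z) h"

lemma filt_tame: "filt w \<phi> \<Longrightarrow> tame (\<lambda>t. at_time \<phi> z h t)"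
proof (induction rule: filt.induct)
  case (monomial s w p q r k)
  show ?case by (intro tame_mult tame_const tame_power tame_tau)
qed (rule tame_add)

text \<open>
  The property \<open>Q\<close> passes from monomials to their sums, and the expectations of monomials are
  moments.  The power \<open>m\<close> is an additional factor
  that counts fully as increments.
\<close>

lemma mean_filt:
  assumes "filt w \<phi>"
    and mono: "\<And>s p k. s \<in> coeff_fns \<Longrightarrow> m \<le> p \<Longrightarrow> w + m \<le> p + 2 * k \<Longrightarrow> Q (\<lambda>z h. s z * of_real h ^ k * mom p z h)"
    and add: "\<And>f g. Q f \<Longrightarrow> Q g \<Longrightarrow> Q (\<lambda>z h. f z h + g z h)"
    and cong: "\<And>f g. Q f \<Longrightarrow> (\<And>z h. admissible S h \<Longrightarrow> g z h = f z h) \<Longrightarrow> Q g"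
  shows "Q (\<lambda>z h. mean h z (\<lambda>t. (of_real t - Tc z) ^ m * at_time \<phi> z h t))"
  using assms(1) mono
proof (induction rule: filt.induct)
  case (monomial s w p q r k)
  show ?case
  proof (rule cong)
    show "Q (\<lambda>z h. s z * of_real h ^ k * mom (m + p + q + r) z h)"
      using monomial(1,2) by (intro monomial.prems) auto
    fix z h assume h: "admissible S h"
    have "(\<lambda>t. (of_real t - Tc z) ^ m * (s z * (of_real t - Tc z) ^ p * (of_real t - Tc z) ^ q * (of_real t - Tc z) ^ r * of_real h ^ k))
      = (\<lambda>t. (s z * of_real h ^ k) * (of_real t - Tc z) ^ (m + p + q + r))"
      by (simp add: power_add mult_ac)
    then show "mean h z (\<lambda>t. (of_real t - Tc z) ^ m * (s z * (of_real t - Tc z) ^ p * (of_real t - Tc z) ^ q * (of_real t - Tc z) ^ r * of_real h ^ k))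
      = s z * of_real h ^ k * mom (m + p + q + r) z h"
      using mean_cmult[OF h tame_power[OF tame_tau]] by (simp add: mom_def)
  qed
next
  case (add w \<phi> \<psi>)
  have 1: "Q (\<lambda>z h. mean h z (\<lambda>t. (of_real t - Tc z) ^ m * at_time \<phi> z h t))"
    by (rule add.IH(1)) (rule add.prems; assumption)
  have 2: "Q (\<lambda>z h. mean h z (\<lambda>t. (of_real t - Tc z) ^ m * at_time \<psi> z h t))"
    by (rule add.IH(2)) (rule add.prems; assumption)
  show ?case
  proof (rule cong[OF assms(3)[OF 1 2]])
    fix z h assume h: "admissible S h"
    let ?t = "\<lambda>t. complex_of_real t - Tc z"
    have "mean h z (\<lambda>t. ?t t ^ m * at_time \<phi> z h t + ?t t ^ m * at_time \<psi> z h t) =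
      mean h z (\<lambda>t. ?t t ^ m * at_time \<phi> z h t) + mean h z (\<lambda>t. ?t t ^ m * at_time \<psi> z h t)"
      by (rule mean_add[OF h tame_mult[OF tame_power[OF tame_tau] filt_tame[OF add.hyps(1)]]
            tame_mult[OF tame_power[OF tame_tau] filt_tame[OF add.hyps(2)]]])
    then show "mean h z (\<lambda>t. ?t t ^ m * (at_time \<phi> z h t + at_time \<psi> z h t)) =
      mean h z (\<lambda>t. ?t t ^ m * at_time \<phi> z h t) + mean h z (\<lambda>t. ?t t ^ m * at_time \<psi> z h t)"
      by (simp add: distrib_left)
  qed
qed

lemma tame_tail: "tame (\<lambda>t :: real. if t > b then (1 + t) ^ P else 0)"
  by (rule tameI[of 1 _ P]) auto

lemma mean_tail:
  assumes X: "X > 0" and t2: "t2 = t0 (4 * X + 1)"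
  shows "\<exists>M\<ge>0. \<forall>\<^sub>F h in small. \<forall>z. (cmod z)\<^sup>2 \<le> X \<longrightarrow>
    mean h z (\<lambda>t. if t > t2 then (1 + t) ^ P else 0) \<le> M * h ^ L"
proof -
  define t1 where "t1 = t0 (4 * X)"
  have t12: "t1 < t2" unfolding t1_def t2 using X by (intro t0_strict) auto
  have t1n: "t1 \<ge> 0" unfolding t1_def using X by (intro t0_nonneg) auto
  obtain C where C: "C \<ge> 0" "\<And>d. (real d + 1) ^ L \<le> C * 2 ^ d" using power_le_two_power by blast
  define M where "M = 2 * (2 + t1) ^ P * (C / (t2 - t1) ^ L)"
  have "((\<lambda>h. (1 + h) ^ P) \<longlongrightarrow> (1 + 0) ^ P) small" by (intro tendsto_intros)
  then have "\<forall>\<^sub>F h in small. (1 + h) ^ P < (2::real)" by (rule order_tendstoD) simp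
  with small_adm small_less[OF zero_less_one]
  have "\<forall>\<^sub>F h in small. \<forall>z. (cmod z)\<^sup>2 \<le> X \<longrightarrow> mean h z (\<lambda>t. if t > t2 then (1 + t) ^ P else 0) \<le> M * h ^ L"
  proof eventually_elim
    case (elim h)
    interpret quantized_surface S h by (rule quantized[OF elim(1)])
    show ?case
    proof (intro allI impI)
      fix z assume z: "(cmod z)\<^sup>2 \<le> X"
      obtain d where d: "real d + 1 \<ge> (t2 - t1) / h"
        "EE ((cmod z)\<^sup>2) (\<lambda>t. if t > t2 then (1 + t) ^ P else 0) \<le> 2 * (2 + t1) ^ P * (1 / 2) ^ d"
        using EE_tail[of "(cmod z)\<^sup>2" X P t1 t2] z X elim t12 t1_def by auto
      have "((t2 - t1) / h) ^ L \<le> (real d + 1) ^ L" using d(1) t12 elim(2) by (intro power_mono) auto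
      also have "\<dots> \<le> C * 2 ^ d" by (rule C(2))
      finally have "(1 / 2) ^ d \<le> C / (t2 - t1) ^ L * h ^ L"
        using t12 elim(2) by (simp add: field_simps power_divide)
      then have "2 * (2 + t1) ^ P * (1 / 2) ^ d \<le> 2 * (2 + t1) ^ P * (C / (t2 - t1) ^ L * h ^ L)"
        using t1n by (intro mult_left_mono) auto
      then show "mean h z (\<lambda>t. if t > t2 then (1 + t) ^ P else 0) \<le> M * h ^ L"
        using d(2) by (simp add: mean_def M_def mult_ac)
    qed
  qed
  moreover have "M \<ge> 0" using C t12 t1n by (simp add: M_def)
  ultimately show ?thesis by blast
qed

lemma Tr_bound:
  assumes "X > 0" "(cmod z)\<^sup>2 \<le> X"
  shows "0 \<le> Tr z" "Tr z \<le> t0 (4 * X + 1)"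
  using assms by (auto simp: Tr_def intro!: t0_nonneg t0_mono)

text \<open>
  Up to the time \<open>t2\<close> the deviation from the classical time is bounded; beyond it the tail is used.
\<close>

lemma abs_power_split:
  assumes X: "X > 0" and z: "(cmod z)\<^sup>2 \<le> X" and t2: "t2 = t0 (4 * X + 1)" and t: "t \<ge> 0" and pq: "q \<le> p"
  shows "\<bar>t - Tr z\<bar> ^ p \<le> t2 ^ (p - q) * \<bar>t - Tr z\<bar> ^ q + (if t > t2 then (1 + t) ^ p else 0)"
proof (cases "t > t2")
  case True
  have "\<bar>t - Tr z\<bar> ^ p \<le> (1 + t) ^ p" using Tr_bound[OF X z] True t2 by (intro power_mono) auto
  moreover have "t2 ^ (p - q) * \<bar>t - Tr z\<bar> ^ q \<ge> 0" using Tr_bound[OF X z] t2 by simp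
  ultimately show ?thesis using True by simp
next
  case False
  have "\<bar>t - Tr z\<bar> ^ p = \<bar>t - Tr z\<bar> ^ (p - q) * \<bar>t - Tr z\<bar> ^ q" using pq by (simp flip: power_add)
  also have "\<dots> \<le> t2 ^ (p - q) * \<bar>t - Tr z\<bar> ^ q"
    using Tr_bound[OF X z] False t t2 by (intro mult_right_mono power_mono) auto
  finally show ?thesis using False by simp
qed

lemma absm_le:
  assumes h: "admissible S h" and X: "X > 0" and z: "(cmod z)\<^sup>2 \<le> X" and t2: "t2 = t0 (4 * X + 1)" and pq: "q \<le> p"
  shows "absm p z h \<le> t2 ^ (p - q) * absm q z h + mean h z (\<lambda>t. if t > t2 then (1 + t) ^ p else 0)"
proof -
  have "absm p z h \<le> mean h z (\<lambda>t. t2 ^ (p - q) * \<bar>t - Tr z\<bar> ^ q + (if t > t2 then (1 + t) ^ p else 0))"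
    unfolding absm_def
    by (intro mean_mono[OF h] tame_add tame_mult tame_const tame_abs tame_tail abs_power_split[OF X z t2 _ pq])
      (simp add: in_range_def)
  also have "\<dots> = t2 ^ (p - q) * absm q z h + mean h z (\<lambda>t. if t > t2 then (1 + t) ^ p else 0)"
    unfolding absm_def using mean_add[OF h tame_mult[OF tame_const tame_abs] tame_tail] mean_cmult[OF h tame_abs] by simp
  finally show ?thesis .
qed

lemma bounded_radius:
  assumes "bounded K"
  obtains X where "X > 0" "\<And>z. z \<in> K \<Longrightarrow> (cmod z)\<^sup>2 \<le> X"
proof -
  obtain r where r: "r > 0" "\<And>z. z \<in> K \<Longrightarrow> cmod z \<le> r" using assms bounded_pos by metis
  have "(cmod z)\<^sup>2 \<le> r\<^sup>2" if "z \<in> K" for z using r(2)[OF that] by (intro power_mono) auto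
  then show ?thesis using that[of "r\<^sup>2"] r(1) by simp
qed

subsection \<open>The drift towards the classical time\<close>

text \<open>
  The function \<open>R - x Q\<close> of the recurrence between the weights.  Its zero is the classical
  time.
\<close>

definition drift :: "complex \<Rightarrow> real \<Rightarrow> real" where
  "drift z t = poly Rp t - (cmod z)\<^sup>2 * poly Qp t"

lemma drift_eq: "in_range t \<Longrightarrow> drift z t = poly Qp t * (Hr t - Hr (Tr z))"
  using t0(2)[of "(cmod z)\<^sup>2"] by (simp add: drift_def Tr_def Rp_Hr algebra_simps)

lemma Hr_deriv:
  assumes t: "in_range t"
  shows "(Hr has_real_derivative G1 (Hr t) / poly Qp t) (at t)"
proof -
  have Q: "poly Qp t > 0" by (rule Qp_pos[OF t])
  have g: "G1 (Hr t) = poly (pderiv Rp) t - Hr t * poly (pderiv Qp) t" by (simp add: G1_def t0_eq[OF t])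
  have "(Hr has_real_derivative (poly (pderiv Rp) t * poly Qp t - poly Rp t * poly (pderiv Qp) t) / (poly Qp t * poly Qp t)) (at t)"
    unfolding Hr_def[abs_def] by (intro DERIV_divide poly_DERIV) (use Q in simp)
  moreover have "(poly (pderiv Rp) t * poly Qp t - poly Rp t * poly (pderiv Qp) t) / (poly Qp t * poly Qp t) = G1 (Hr t) / poly Qp t"
    using Q unfolding g Rp_Hr[OF t] by (simp add: field_simps)
  ultimately show ?thesis by simp
qed

lemma drift_sign:
  assumes t: "in_range t"
  shows "drift z t * (t - Tr z) \<ge> 0"
proof -
  have r: "in_range (Tr z)" using t0(1)[of "(cmod z)\<^sup>2"] by (simp add: Tr_def)
  have "(Hr t - Hr (Tr z)) * (t - Tr z) \<ge> 0"
    using Hr_strict[OF t, of "Tr z"] Hr_strict[OF r, of t] t r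
    by (cases "t < Tr z"; cases "t = Tr z") (auto simp: in_range_def mult_nonpos_nonpos intro: less_imp_le)
  then show ?thesis using Qp_pos[OF t] by (simp add: drift_eq[OF t] mult.assoc)
qed

text \<open>
  \<open>H\<close> has a positive derivative on the compact interval, so the mean value theorem bounds
  \<open>H(t) - H(T)\<close> from below by a multiple of \<open>t - T\<close>.
\<close>

lemma drift_coercive:
  assumes X: "X > 0" and t2: "t2 = t0 (4 * X + 1)"
  shows "\<exists>c>0. \<forall>z t. (cmod z)\<^sup>2 \<le> X \<longrightarrow> 0 \<le> t \<longrightarrow> t \<le> t2 \<longrightarrow> c * (t - Tr z)\<^sup>2 \<le> drift z t * (t - Tr z)"
proof -
  have r2: "in_range t2" unfolding t2 using X by (intro t0) auto
  have rg: "in_range t" if "0 \<le> t" "t \<le> t2" for t by (rule in_range_mono[OF r2 that])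
  have t2n: "0 \<le> t2" using r2 by (simp add: in_range_def)
  have "continuous_on {0..t2} (poly Qp)" by (intro continuous_intros)
  then obtain u where u: "u \<in> {0..t2}" "\<And>t. t \<in> {0..t2} \<Longrightarrow> poly Qp u \<le> poly Qp t"
    using continuous_attains_inf[of "{0..t2}" "poly Qp"] t2n by auto
  define D where "D = (\<lambda>t. (poly (pderiv Rp) t - Hr t * poly (pderiv Qp) t) / poly Qp t)"
  have D: "G1 (Hr t) / poly Qp t = D t" if "in_range t" for t by (simp add: D_def G1_def t0_eq[OF that])
  have "continuous_on {0..t2} D" unfolding D_def
    by (intro continuous_intros Hr_cont[OF r2]) (use Qp_pos rg in force)
  then obtain v where v: "v \<in> {0..t2}" "\<And>t. t \<in> {0..t2} \<Longrightarrow> D v \<le> D t"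
    using continuous_attains_inf[of "{0..t2}" D] t2n by auto
  have rv: "in_range v" using v(1) rg by simp
  have Dv: "D v > 0" unfolding D[OF rv, symmetric] using G1_pos[OF Hr_nonneg[OF rv]] Qp_pos[OF rv] by simp
  have Qu: "poly Qp u > 0" using Qp_pos rg u(1) by simp
  show ?thesis
  proof (intro exI[of _ "poly Qp u * D v"] conjI allI impI)
    show "poly Qp u * D v > 0" using Dv Qu by simp
    fix z t assume z: "(cmod z)\<^sup>2 \<le> X" and t: "0 \<le> t" "t \<le> t2"
    have T: "0 \<le> Tr z" "Tr z \<le> t2" using Tr_bound[OF X z] t2 by auto
    have mvt: "D v * (b - a)\<^sup>2 \<le> (Hr b - Hr a) * (b - a)" if ab: "0 \<le> a" "a < b" "b \<le> t2" for a b
    proof -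
      have der: "\<And>x. \<lbrakk>a \<le> x; x \<le> b\<rbrakk> \<Longrightarrow> DERIV Hr x :> D x"
        using ab Hr_deriv D rg by (metis order_trans)
      obtain w where w: "a < w" "w < b" "Hr b - Hr a = (b - a) * D w" using MVT2[OF ab(2) der] by blast
      have "D v \<le> D w" using w ab by (intro v(2)) auto
      then have "D v * (b - a)\<^sup>2 \<le> D w * (b - a)\<^sup>2" by (intro mult_right_mono) auto
      then show ?thesis by (simp add: w(3) power2_eq_square mult_ac)
    qed
    have "D v * (t - Tr z)\<^sup>2 \<le> (Hr t - Hr (Tr z)) * (t - Tr z)"
    proof (cases "t < Tr z" "t = Tr z" rule: bool.exhaust[case_product bool.exhaust])
      case True_True then show ?thesis by simp
    next
      case True_False
      then show ?thesis using mvt[of t "Tr z"] t T by (simp add: power2_commute algebra_simps)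
    next
      case False_True then show ?thesis by simp
    next
      case False_False then show ?thesis using mvt[of "Tr z" t] t T by simp
    qed
    then have "poly Qp u * (D v * (t - Tr z)\<^sup>2) \<le> poly Qp t * ((Hr t - Hr (Tr z)) * (t - Tr z))"
      by (rule mult_mono[rotated]) (use u(2)[of t] t Dv Qp_nonneg in auto)
    then show "poly Qp u * D v * (t - Tr z)\<^sup>2 \<le> drift z t * (t - Tr z)"
      using drift_eq[OF rg[OF t]] by (simp add: mult.assoc)
  qed
qed

text \<open>
  \<open>EE_stein\<close> for \<open>s = (t - T)\<^sup>j\<close>: after subtracting \<open>x\<close> times the expectation of \<open>Q s\<close> on both sides,
  the right-hand side is a difference with step \<open>h\<close>, which gains a factor \<open>h\<close> and loses one unit of
  weight.
\<close>

lemma mean_drift: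
  "\<exists>\<xi>. filt (j - 1) \<xi> \<and> (\<forall>z h. admissible S h \<longrightarrow>
     mean h z (\<lambda>t. complex_of_real (drift z t) * (of_real t - Tc z) ^ j) =
     z * cnj z * (of_real h * mean h z (\<lambda>t. at_time \<xi> z h t)))"
proof -
  have "filt (0 + j) (\<lambda>z a b c h. poly cQ (Tc z + a) * a ^ j)"
    by (rule filt_mult[OF filt_poly[OF filt_a, THEN conjunct1] filt_a_pow])
  from filt_shift[OF this] obtain \<xi> where \<xi>: "filt (j - 1) \<xi>"
    "\<And>z a b c h. poly cQ (Tc z + (a + of_real h)) * (a + of_real h) ^ j - poly cQ (Tc z + a) * a ^ j = of_real h * \<xi> z a b c h"
    by auto
  have "mean h z (\<lambda>t. complex_of_real (drift z t) * (of_real t - Tc z) ^ j) =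
     z * cnj z * (of_real h * mean h z (\<lambda>t. at_time \<xi> z h t))"
    if h: "admissible S h" for z h
  proof -
    interpret quantized_surface S h by (rule quantized[OF h])
    let ?\<tau> = "\<lambda>t. complex_of_real t - Tc z"
    have x: "of_real ((cmod z)\<^sup>2) = z * cnj z" by (metis complex_norm_square of_real_power)
    have tR: "tame (\<lambda>t. complex_of_real (poly Rp t) * ?\<tau> t ^ j)"
      using tame_mult[OF tame_poly[OF tame_ident, of cR] tame_power[OF tame_tau]] by (simp add: poly_cR)
    have tQ: "tame (\<lambda>t. complex_of_real (poly Qp t) * ?\<tau> t ^ j)"
      using tame_mult[OF tame_poly[OF tame_ident, of cQ] tame_power[OF tame_tau]] by (simp add: poly_cQ)
    have th: "tame (\<lambda>t. complex_of_real h * at_time \<xi> z h t)"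
      by (rule tame_mult[OF tame_const filt_tame[OF \<xi>(1)]])
    have sh: "complex_of_real (poly Qp (t + h)) * ?\<tau> (t + h) ^ j =
        complex_of_real h * at_time \<xi> z h t + complex_of_real (poly Qp t) * ?\<tau> t ^ j" for t
    proof -
      have a: "?\<tau> t + of_real h = ?\<tau> (t + h)" "Tc z + ?\<tau> (t + h) = of_real (t + h)" "Tc z + ?\<tau> t = of_real t"
        by simp_all
      show ?thesis using \<xi>(2)[of z "?\<tau> t" h "?\<tau> t" "?\<tau> t"] unfolding a poly_cQ by (simp add: algebra_simps)
    qed
    have stein: "mean h z (\<lambda>t. of_real (poly Rp t) * ?\<tau> t ^ j) =
      of_real ((cmod z)\<^sup>2) * mean h z (\<lambda>t. of_real (poly Qp (t + h)) * ?\<tau> (t + h) ^ j)"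
      unfolding mean_def by (rule EE_stein[OF _ tame_power[OF tame_tau]]) simp
    have "mean h z (\<lambda>t. complex_of_real (drift z t) * ?\<tau> t ^ j) =
      mean h z (\<lambda>t. of_real (poly Rp t) * ?\<tau> t ^ j - of_real ((cmod z)\<^sup>2) * (of_real (poly Qp t) * ?\<tau> t ^ j))"
      by (simp add: drift_def left_diff_distrib mult.assoc)
    also have "\<dots> = of_real ((cmod z)\<^sup>2) * mean h z (\<lambda>t. of_real (poly Qp (t + h)) * ?\<tau> (t + h) ^ j) -
       of_real ((cmod z)\<^sup>2) * mean h z (\<lambda>t. of_real (poly Qp t) * ?\<tau> t ^ j)"
      using mean_diff[OF h tR tame_mult[OF tame_const tQ]] mean_cmult[OF h tQ] stein by simp
    also have "mean h z (\<lambda>t. of_real (poly Qp (t + h)) * ?\<tau> (t + h) ^ j) =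
       of_real h * mean h z (\<lambda>t. at_time \<xi> z h t) + mean h z (\<lambda>t. of_real (poly Qp t) * ?\<tau> t ^ j)"
      unfolding sh using mean_add[OF h th tQ] mean_cmult[OF h filt_tame[OF \<xi>(1)]] by simp
    finally show ?thesis unfolding x by (simp add: algebra_simps)
  qed
  with \<xi>(1) show ?thesis by blast
qed

text \<open>
  By coercivity the absolute moment of
  order \<open>2 l\<close> is controlled by the expectation of the drift times \<open>(t - T)\<^bsup>2l-1\<^esup>\<close>, which is \<open>h\<close>
  times moments of weight \<open>2 l - 2\<close>; these are \<open>O(h\<^bsup>l-1\<^esup>)\<close> by induction.  Higher moments are
  reduced to the order \<open>2 l\<close>, up to the tail.
\<close>

lemma concentration: "\<forall>p. 2 * l \<le> p \<longrightarrow> bigO l (absm p)"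
proof (induction l rule: less_induct)
  case (less l)
  show ?case
  proof (cases l)
    case 0
    have "bigO 0 (absm p)" for p
      unfolding bigO_def
    proof (intro allI impI)
      fix K :: "complex set" assume "bounded K"
      then obtain X where X: "X > 0" "\<And>z. z \<in> K \<Longrightarrow> (cmod z)\<^sup>2 \<le> X" by (rule bounded_radius) blast
      define t2 where "t2 = t0 (4 * X + 1)"
      have t2n: "t2 \<ge> 0" unfolding t2_def using X by (intro t0_nonneg) auto
      obtain M where M: "M \<ge> 0" "\<forall>\<^sub>F h in small. \<forall>z. (cmod z)\<^sup>2 \<le> X \<longrightarrow>
          mean h z (\<lambda>t. if t > t2 then (1 + t) ^ p else 0) \<le> M * h ^ 0"
        using mean_tail[OF X(1) t2_def, of p 0] by blast
      from small_adm M(2) have "\<forall>\<^sub>F h in small. \<forall>z\<in>K. norm (absm p z h) \<le> (t2 ^ p + M) * h ^ 0"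
      proof eventually_elim
        case (elim h)
        show ?case
        proof
          fix z assume z: "z \<in> K"
          have "absm 0 z h = 1" by (simp add: absm_def mean_const[OF elim(1)])
          then show "norm (absm p z h) \<le> (t2 ^ p + M) * h ^ 0"
            using absm_le[OF elim(1) X(1) X(2)[OF z] t2_def, of 0 p] elim(2) X(2)[OF z] absm_nonneg[OF elim(1), of p z]
            by (auto intro: order_trans)
        qed
      qed
      then show "\<exists>M\<ge>0. \<forall>\<^sub>F h in small. \<forall>z\<in>K. norm (absm p z h) \<le> M * h ^ 0"
        using M(1) t2n by (intro exI[of _ "t2 ^ p + M"]) auto
    qed
    then show ?thesis using 0 by simp
  next
    case (Suc l')
    have IH: "bigO j (mom p)" if "j \<le> l'" "2 * j \<le> p" for j p
      by (rule bigO_mono[of j "absm p"]) (use less[of j] that Suc mom_le_absm in auto)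
    obtain \<xi> where \<xi>: "filt (2 * l' + 1 - 1) \<xi>" "\<And>z h. admissible S h \<Longrightarrow>
       mean h z (\<lambda>t. complex_of_real (drift z t) * (of_real t - Tc z) ^ (2 * l' + 1)) =
       z * cnj z * (of_real h * mean h z (\<lambda>t. at_time \<xi> z h t))"
      using mean_drift[of "2 * l' + 1"] by blast
    have "bigO l (\<lambda>z h. of_real h * mean h z (\<lambda>t. (of_real t - Tc z) ^ 0 * at_time \<xi> z h t))"
    proof (rule mean_filt[OF \<xi>(1), where m = 0 and Q = "\<lambda>f. bigO l (\<lambda>z h. of_real h * f z h)"])
      fix s p k assume s: "s \<in> coeff_fns" and p: "2 * l' + 1 - 1 + 0 \<le> p + 2 * k"
      define j where "j = min (p div 2) l'"
      have "bigO j (mom p)" by (rule IH) (auto simp: j_def)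
      from bigO_mult_coeff[OF bigO_mult_h[OF this, of "Suc k"] s]
      have "bigO l (\<lambda>z h. s z * (of_real h ^ Suc k * mom p z h))"
        by (rule bigO_weaken) (use p in \<open>auto simp: j_def Suc\<close>)
      then show "bigO l (\<lambda>z h. of_real h * (s z * of_real h ^ k * mom p z h))"
        by (rule bigO_cong) (simp add: mult_ac)
    next
      fix f g :: "complex \<Rightarrow> real \<Rightarrow> complex"
      assume "bigO l (\<lambda>z h. of_real h * f z h)" "bigO l (\<lambda>z h. of_real h * g z h)"
      from bigO_add[OF this] show "bigO l (\<lambda>z h. of_real h * (f z h + g z h))" by (simp add: distrib_left)
    next
      fix f g :: "complex \<Rightarrow> real \<Rightarrow> complex"
      assume "bigO l (\<lambda>z h. of_real h * f z h)" "\<And>z h. admissible S h \<Longrightarrow> g z h = f z h"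
      then show "bigO l (\<lambda>z h. of_real h * g z h)" by (auto intro: bigO_cong)
    qed
    from bigO_mult_coeff[OF this coeff_fns.mult[OF coeff_fns.z coeff_fns.cnj]]
    have D: "bigO l (\<lambda>z h. mean h z (\<lambda>t. complex_of_real (drift z t) * (of_real t - Tc z) ^ (2 * l' + 1)))"
      by (rule bigO_cong) (simp only: \<xi>(2) power_0 mult_1)
    show ?thesis
    proof (intro allI impI)
      fix p assume p: "2 * l \<le> p"
      show "bigO l (absm p)" unfolding bigO_def
      proof (intro allI impI)
        fix K :: "complex set" assume K: "bounded K"
        then obtain X where X: "X > 0" "\<And>z. z \<in> K \<Longrightarrow> (cmod z)\<^sup>2 \<le> X" by (rule bounded_radius) blast
        define t2 where "t2 = t0 (4 * X + 1)"
        have t2n: "t2 \<ge> 0" unfolding t2_def using X by (intro t0_nonneg) auto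
        obtain c where c: "c > 0" "\<And>z t. (cmod z)\<^sup>2 \<le> X \<Longrightarrow> 0 \<le> t \<Longrightarrow> t \<le> t2 \<Longrightarrow> c * (t - Tr z)\<^sup>2 \<le> drift z t * (t - Tr z)"
          using drift_coercive[OF X(1) t2_def] by blast
        obtain M1 where M1: "M1 \<ge> 0" "\<forall>\<^sub>F h in small. \<forall>z\<in>K.
            norm (mean h z (\<lambda>t. complex_of_real (drift z t) * (of_real t - Tc z) ^ (2 * l' + 1))) \<le> M1 * h ^ l"
          by (rule bigOD[OF D K])
        obtain M2 where M2: "M2 \<ge> 0" "\<forall>\<^sub>F h in small. \<forall>z. (cmod z)\<^sup>2 \<le> X \<longrightarrow>
            mean h z (\<lambda>t. if t > t2 then (1 + t) ^ (2 * l) else 0) \<le> M2 * h ^ l"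
          using mean_tail[OF X(1) t2_def, of "2 * l" l] by blast
        obtain M3 where M3: "M3 \<ge> 0" "\<forall>\<^sub>F h in small. \<forall>z. (cmod z)\<^sup>2 \<le> X \<longrightarrow>
            mean h z (\<lambda>t. if t > t2 then (1 + t) ^ p else 0) \<le> M3 * h ^ l"
          using mean_tail[OF X(1) t2_def, of p l] by blast
        define M where "M = t2 ^ (p - 2 * l) * (M1 / c + M2) + M3"
        from small_adm M1(2) M2(2) M3(2) have "\<forall>\<^sub>F h in small. \<forall>z\<in>K. norm (absm p z h) \<le> M * h ^ l"
        proof eventually_elim
          case (elim h)
          show ?case
          proof
            fix z assume zK: "z \<in> K"
            note z = X(2)[OF zK] and h = elim(1)
            \<comment> \<open>as \<open>2 * l = 2 * l' + 2\<close>, the integrand is drift times deviation times an even power\<close>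
            let ?dr = "\<lambda>t. drift z t * (t - Tr z) ^ (2 * l' + 1)"
            have dr_tame: "tame ?dr"
              unfolding drift_def by (intro tame_mult tame_diff tame_power tame_const tame_poly tame_ident[where 'a = real, unfolded of_real_eq_id id_def])
            have dr_alt: "?dr t = (drift z t * (t - Tr z)) * (t - Tr z) ^ (2 * l')" for t by simp
            have "c * \<bar>t - Tr z\<bar> ^ (2 * l) \<le> ?dr t + c * (if t > t2 then (1 + t) ^ (2 * l) else 0)" if t: "in_range t" for t
            proof (cases "t > t2")
              case True
              have "\<bar>t - Tr z\<bar> ^ (2 * l) \<le> (1 + t) ^ (2 * l)"
                using Tr_bound[OF X(1) z] True t2_def by (intro power_mono) auto
              moreover have "?dr t \<ge> 0" unfolding dr_alt using drift_sign[OF t] by simp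
              ultimately show ?thesis using True c(1) by (simp add: add_increasing)
            next
              case False
              have "c * \<bar>t - Tr z\<bar> ^ (2 * l) = c * (t - Tr z)\<^sup>2 * (t - Tr z) ^ (2 * l')"
                by (simp add: Suc power_even_abs power_add power2_eq_square mult_ac)
              also have "\<dots> \<le> ?dr t" unfolding dr_alt
                using c(2)[OF z, of t] t False by (intro mult_right_mono) (auto simp: in_range_def)
              finally show ?thesis using False by simp
            qed
            then have "mean h z (\<lambda>t. c * \<bar>t - Tr z\<bar> ^ (2 * l)) \<le> mean h z (\<lambda>t. ?dr t + c * (if t > t2 then (1 + t) ^ (2 * l) else 0))"
              by (intro mean_mono[OF h] tame_add tame_mult tame_const tame_abs tame_tail dr_tame) auto
            also have "\<dots> = mean h z ?dr + c * mean h z (\<lambda>t. if t > t2 then (1 + t) ^ (2 * l) else 0)"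
              using mean_add[OF h dr_tame tame_mult[OF tame_const tame_tail]] mean_cmult[OF h tame_tail] by simp
            finally have "c * absm (2 * l) z h \<le> mean h z ?dr + c * mean h z (\<lambda>t. if t > t2 then (1 + t) ^ (2 * l) else 0)"
              using mean_cmult[OF h tame_abs] by (simp add: absm_def)
            moreover have "mean h z ?dr \<le> M1 * h ^ l"
            proof -
              have e: "(\<lambda>t. complex_of_real (drift z t) * (of_real t - Tc z) ^ (2 * l' + 1)) = (\<lambda>t. complex_of_real (?dr t))"
                unfolding Tc_Tr by simp
              have "norm (mean h z (\<lambda>t. complex_of_real (drift z t) * (of_real t - Tc z) ^ (2 * l' + 1))) \<le> M1 * h ^ l"
                using elim(2) zK by blast
              then have "norm (complex_of_real (mean h z ?dr)) \<le> M1 * h ^ l"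
                unfolding e mean_of_real[OF h dr_tame] .
              then show ?thesis by simp
            qed
            moreover have "c * mean h z (\<lambda>t. if t > t2 then (1 + t) ^ (2 * l) else 0) \<le> c * (M2 * h ^ l)"
              using elim(3) z c(1) by (intro mult_left_mono) auto
            ultimately have "c * absm (2 * l) z h \<le> M1 * h ^ l + c * (M2 * h ^ l)" by linarith
            then have "absm (2 * l) z h \<le> (M1 / c + M2) * h ^ l" using c(1) by (simp add: field_simps)
            then have "t2 ^ (p - 2 * l) * absm (2 * l) z h \<le> t2 ^ (p - 2 * l) * ((M1 / c + M2) * h ^ l)"
              using t2n by (intro mult_left_mono) auto
            moreover have "mean h z (\<lambda>t. if t > t2 then (1 + t) ^ p else 0) \<le> M3 * h ^ l" using elim(4) z by blast
            ultimately have "absm p z h \<le> M * h ^ l"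
              using absm_le[OF h X(1) z t2_def p] by (simp add: M_def distrib_right mult.assoc)
            then show "norm (absm p z h) \<le> M * h ^ l" using absm_nonneg[OF h] by simp
          qed
        qed
        moreover have "M \<ge> 0" using M1(1) M2(1) M3(1) c(1) t2n by (simp add: M_def)
        ultimately show "\<exists>M\<ge>0. \<forall>\<^sub>F h in small. \<forall>z\<in>K. norm (absm p z h) \<le> M * h ^ l" by blast
      qed
    qed
  qed
qed

lemma bigO_mom: "2 * l \<le> p \<Longrightarrow> bigO l (mom p)"
  by (rule bigO_mono[of l "absm p"]) (use concentration mom_le_absm in auto)

section \<open>The semiclassical expansion\<close>

lemma expands_coeff: "s \<in> coeff_fns \<Longrightarrow> expands L 0 (\<lambda>z h. s z)"
proof (cases L)
  case 0
  assume "s \<in> coeff_fns"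
  then show ?thesis using expands_small[OF bigO_coeff] 0 by simp
next
  case (Suc L')
  assume s: "s \<in> coeff_fns"
  have "bigO L (\<lambda>z h. s z - (\<Sum>i<L. of_real h ^ i * (if i = 0 then s else (\<lambda>z. 0)) z))"
    unfolding Suc sum.lessThan_Suc_shift by (simp add: bigO_zero)
  then show ?thesis unfolding expands_def using s
    by (intro exI[of _ "\<lambda>i. if i = 0 then s else (\<lambda>z. 0)"]) (auto simp: coeff_const)
qed

text \<open>
  At the classical time the drift vanishes and has the derivative \<open>G1 = 1 / Vc\<close>.
\<close>

lemma drift_taylor:
  "\<exists>\<psi>. filt 0 \<psi> \<and> (\<forall>z t h. complex_of_real (drift z t) =
     (of_real t - Tc z) / Vc z + (of_real t - Tc z)\<^sup>2 * at_time \<psi> z h t)"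
proof -
  obtain \<psi>R where R: "filt 0 \<psi>R" "\<And>z a b c h. poly cR (Tc z + a) = poly cR (Tc z) + a * poly (pderiv cR) (Tc z) + a\<^sup>2 * \<psi>R z a b c h"
    using filt_taylor[of cR] by blast
  obtain \<psi>Q where Q: "filt 0 \<psi>Q" "\<And>z a b c h. poly cQ (Tc z + a) = poly cQ (Tc z) + a * poly (pderiv cQ) (Tc z) + a\<^sup>2 * \<psi>Q z a b c h"
    using filt_taylor[of cQ] by blast
  define \<psi> where "\<psi> = (\<lambda>z a b c h. \<psi>R z a b c h - z * cnj z * \<psi>Q z a b c h)"
  have "filt 0 \<psi>" unfolding \<psi>_def
    by (rule filt_minus[OF R(1) filt_mult_coeff[OF Q(1) coeff_fns.mult[OF coeff_fns.z coeff_fns.cnj]]])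
  moreover have "complex_of_real (drift z t) =
     (of_real t - Tc z) / Vc z + (of_real t - Tc z)\<^sup>2 * at_time \<psi> z h t" for z t h
  proof -
    let ?\<tau> = "complex_of_real t - Tc z"
    have x: "of_real ((cmod z)\<^sup>2) = z * cnj z" by (metis complex_norm_square of_real_power)
    have a: "Tc z + ?\<tau> = of_real t" by simp
    have "poly Rp (Tr z) = (cmod z)\<^sup>2 * poly Qp (Tr z)" unfolding Tr_def by (rule Rp_t0) simp
    then have 0: "poly cR (Tc z) = z * cnj z * poly cQ (Tc z)"
      unfolding Tc_Tr poly_cR poly_cQ x[symmetric] by simp
    have "complex_of_real (drift z t) = poly cR (Tc z + ?\<tau>) - z * cnj z * poly cQ (Tc z + ?\<tau>)"
      unfolding a poly_cR poly_cQ x[symmetric] by (simp add: drift_def)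
    also have "\<dots> = ?\<tau> * (poly (pderiv cR) (Tc z) - z * cnj z * poly (pderiv cQ) (Tc z)) + ?\<tau>\<^sup>2 * \<psi> z ?\<tau> ?\<tau> ?\<tau> h"
      unfolding R(2)[of z ?\<tau> ?\<tau> ?\<tau> h] Q(2)[of z ?\<tau> ?\<tau> ?\<tau> h] 0 \<psi>_def by (simp add: algebra_simps)
    finally show ?thesis by (simp add: Vc_eq)
  qed
  ultimately show ?thesis by blast
qed

lemma Vc_neq_0: "Vc z \<noteq> 0"
  using Vc_nonzero[of z] by (simp add: Vc_def)

lemma expands_mom_term:
  assumes "s \<in> coeff_fns" "expands L p (mom p)" "w \<le> p + 2 * k"
  shows "expands L w (\<lambda>z h. s z * of_real h ^ k * mom p z h)"
  using expands_weaken[OF expands_mult_coeff[OF expands_mult_h_pow[OF assms(2), of k] assms(1)] assms(3)]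
  by (simp add: mult.assoc)

text \<open>
  The expectation of the drift times \<open>(t - T)\<^sup>j\<close> is \<open>h\<close> times moments that are already known to order
  \<open>L\<close>.  On the other hand the drift is \<open>G1 (t - T)\<close> plus terms of higher order, so this expectation
  is \<open>G1\<close> times the moment of order \<open>j + 1\<close> plus higher moments.  Solving for the moment
  of order \<open>j + 1\<close> works downwards from the moments of order at least \<open>2 (L + 1)\<close>, which are \<open>O(h\<^bsup>L+1\<^esup>)\<close>
  by concentration.
\<close>

lemma expands_moments: "expands L p (mom p)"
proof (induction L arbitrary: p)
  case 0
  show ?case by (rule expands_small[OF bigO_mom]) simp
next
  case (Suc L)
  show ?case
  proof (induction "2 * Suc L - p" arbitrary: p rule: less_induct)
    case less
    consider "p = 0" | "0 < p" "p < 2 * Suc L" | "2 * Suc L \<le> p" by linarith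
    then show ?case
    proof cases
      case 1
      show ?thesis unfolding 1
        by (rule expands_cong[OF expands_coeff[OF coeff_const[of 1]]]) (simp add: mom_def mean_const)
    next
      case 3
      show ?thesis by (rule expands_small[OF bigO_mom[OF 3]])
    next
      case pos: 2
      then obtain j where 2: "p = Suc j" "p < 2 * Suc L" by (cases p) auto
      have IH: "expands (Suc L) q (mom q)" if "p < q" for q
        using less[of q] that 2(2) by auto
      obtain \<xi> where \<xi>: "filt (j - 1) \<xi>" "\<And>z h. admissible S h \<Longrightarrow>
         mean h z (\<lambda>t. complex_of_real (drift z t) * (of_real t - Tc z) ^ j) =
         z * cnj z * (of_real h * mean h z (\<lambda>t. at_time \<xi> z h t))"
        using mean_drift[of j] by blast
      obtain \<psi> where \<psi>: "filt 0 \<psi>" "\<And>z t h. complex_of_real (drift z t) =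
         (of_real t - Tc z) / Vc z + (of_real t - Tc z)\<^sup>2 * at_time \<psi> z h t"
        using drift_taylor by blast
      let ?E1 = "\<lambda>z h. mean h z (\<lambda>t. (of_real t - Tc z) ^ 0 * at_time \<xi> z h t)"
      let ?E2 = "\<lambda>z h. mean h z (\<lambda>t. (of_real t - Tc z) ^ (j + 2) * at_time \<psi> z h t)"
      have "expands L (j - 1) ?E1"
        by (rule mean_filt[OF \<xi>(1)]) (auto intro: expands_mom_term Suc.IH expands_add elim: expands_cong)
      from expands_mult_coeff[OF expands_mult_h[OF this] coeff_fns.mult[OF coeff_fns.z coeff_fns.cnj]]
      have a: "expands (Suc L) p (\<lambda>z h. z * cnj z * (of_real h * ?E1 z h))"
        by (rule expands_weaken) (simp add: 2)
      have "expands (Suc L) (j + 2) ?E2"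
        by (rule mean_filt[OF \<psi>(1)]) (auto intro!: expands_mom_term IH intro: expands_add elim: expands_cong simp: 2)
      then have b: "expands (Suc L) p ?E2" by (rule expands_weaken) (simp add: 2)
      have c: "expands (Suc L) p (\<lambda>z h. Vc z * (z * cnj z * (of_real h * ?E1 z h) + (-1) * ?E2 z h))"
        by (intro expands_mult_coeff expands_add a b coeff_const coeff_fns.radial radial_fns.V)
      show ?thesis
      proof (rule expands_cong[OF c])
        fix z h assume h: "admissible S h"
        let ?\<tau> = "\<lambda>t. complex_of_real t - Tc z"
        have e: "complex_of_real (drift z t) * ?\<tau> t ^ j = (1 / Vc z) * ?\<tau> t ^ Suc j + ?\<tau> t ^ (j + 2) * at_time \<psi> z h t" for t
        proof -
          have "(x / v + x\<^sup>2 * y) * x ^ j = (1 / v) * x ^ Suc j + x ^ (j + 2) * y" for x v y :: complex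
            by (simp add: power_add power2_eq_square algebra_simps)
          then show ?thesis by (simp only: \<psi>(2)[of z t h])
        qed
        have "z * cnj z * (of_real h * ?E1 z h) = mean h z (\<lambda>t. (1 / Vc z) * ?\<tau> t ^ Suc j + ?\<tau> t ^ (j + 2) * at_time \<psi> z h t)"
          using \<xi>(2)[OF h, of z] unfolding e by simp
        also have "\<dots> = (1 / Vc z) * mom p z h + ?E2 z h"
          unfolding 2(1) mom_def
          by (simp only: mean_cmult[OF h tame_power[OF tame_tau]]
            mean_add[OF h tame_mult[OF tame_const tame_power[OF tame_tau]] tame_mult[OF tame_power[OF tame_tau] filt_tame[OF \<psi>(1)]]])
        finally show "mom p z h = Vc z * (z * cnj z * (of_real h * ?E1 z h) + (-1) * ?E2 z h)"
          using Vc_neq_0[of z] by (simp add: algebra_simps)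
      qed
    qed
  qed
qed

lemma expands_filt:
  assumes "filt w \<phi>"
  shows "expands L w (\<lambda>z h. mean h z (\<lambda>t. at_time \<phi> z h t))"
proof -
  have "expands L w (\<lambda>z h. mean h z (\<lambda>t. (of_real t - Tc z) ^ 0 * at_time \<phi> z h t))"
    by (rule mean_filt[OF assms]) (auto intro: expands_mom_term expands_moments expands_add elim: expands_cong)
  then show ?thesis by simp
qed

text \<open>
  The monomials centred at the classical point; they depend on \<open>z\<close> through the centre.
\<close>

definition ctr :: "('n gen \<Rightarrow>\<^sub>0 nat) \<Rightarrow> complex \<Rightarrow> ('n gen, complex) mpoly" where
  "ctr \<beta> z = mon (\<lambda>v. mp_var v - mp_const (Ypt z v)) \<beta>"

definition sym_mean :: "('n gen, complex) mpoly \<Rightarrow> complex \<Rightarrow> real \<Rightarrow> complex" where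
  "sym_mean f z h = mean h z (\<lambda>t. fsym h z f (of_real t) (of_real t) (of_real t))"

lemma quantum_restriction_mean: "admissible S h \<Longrightarrow> quantum_restriction S h f (cnj z) z = sym_mean f z h"
  unfolding sym_mean_def mean_def by (rule quantized_surface.quantum_restriction_EE[OF quantized])

lemma expands_ctr: "expands L (tdeg \<beta>) (\<lambda>z h. sym_mean (ctr \<beta> z) z h)"
  using expands_filt[OF filt_fsym_monomial[of \<beta>], of L] by (simp add: sym_mean_def ctr_def)

lemma tame_fsym': "admissible S h \<Longrightarrow> tame (\<lambda>t. fsym h z f (of_real t) (of_real t) (of_real t))"
  by (rule quantized_surface.tame_fsym[OF quantized])

lemma sym_mean_lin: "admissible S h \<Longrightarrow> sym_mean (\<Sum>\<beta>\<in>B. mp_const (c \<beta>) * g \<beta>) z h = (\<Sum>\<beta>\<in>B. c \<beta> * sym_mean (g \<beta>) z h)"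
  unfolding sym_mean_def fsym_sum fsym_const
  by (subst mean_sum) (auto intro!: tame_mult tame_const tame_fsym' simp: mean_cmult tame_fsym')

lemma classical_restriction_eval: "classical_restriction S f z = mp_eval (\<lambda>c. c) (Ypt z) f"
proof -
  have "poly DP (Tc z) = Dt (Tr z)" by (simp add: Tc_Tr DP_def Dt_def)
  moreover have "poly cDP (Tc z) = cnj (Dt (Tr z))"
    unfolding Tc_Tr cDP_def DP_def Dt_def poly_cnj by simp
  moreover have "poly (base_poly S i) (Tc z) = of_real (flow S (Tr z) (pt S) $ i)" for i
    by (simp add: Tc_Tr poly_base_poly)
  ultimately have "(\<lambda>v. case v of gB \<Rightarrow> cnj (z * cnj (Dt (Tr z))) | gA i \<Rightarrow> of_real (flow S (Tr z) (pt S) $ i) | gC \<Rightarrow> z * cnj (Dt (Tr z))) = Ypt z"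
    by (auto simp: Ypt_def fun_eq_iff split: gen.splits)
  moreover have "classical_restriction S f z = mp_eval (\<lambda>c. c)
      (\<lambda>v. case v of gB \<Rightarrow> cnj (z * cnj (Dt (Tr z))) | gA i \<Rightarrow> of_real (flow S (Tr z) (pt S) $ i) | gC \<Rightarrow> z * cnj (Dt (Tr z))) f"
    unfolding classical_restriction_def surf_pt_t0[folded Tr_def] Let_def prod.case ..
  ultimately show ?thesis by (simp only:)
qed

lemma coeff_eval: "(\<lambda>z. mp_eval (\<lambda>c. c) (Ypt z) p) \<in> coeff_fns"
proof (induction p rule: mpoly_induct)
  case (const c)
  then show ?case by (simp add: coeff_const)
next
  case (var v)
  then show ?case using coeff_Ypt[of v] by simp
next
  case (add p q)
  then show ?case by (simp add: mp_eval_add coeff_fns.add)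
next
  case (mult p q)
  then show ?case by (simp add: mp_eval_mult coeff_fns.mult)
qed

lemma mp_diff_0 [simp]: "mp_diff 0 f = f" for f :: "('v, complex) mpoly"
  by (induction f rule: poly_mapping_single_induct) (simp_all add: mp_diff_single mp_diff_add)

lemma tdeg_eq_0: "tdeg \<beta> = 0 \<longleftrightarrow> \<beta> = 0" for \<beta> :: "'v::finite \<Rightarrow>\<^sub>0 nat"
  by (auto simp: tdeg_def poly_mapping_eq_iff fun_eq_iff)

lemma pfact_0: "pfact 0 = 1"
  by (simp add: pfact_def)

text \<open>
  Taylor's formula at the classical point writes the symbol of \<open>f\<close> as the sum of the derivatives
  of \<open>f\<close>, divided by factorials, times the symbols of the centred monomials.  The expansions
  of the latter provide the coefficients of the differential operators.  A centred monomial of degree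
  \<open>d\<close> has no terms of order less than \<open>d / 2\<close>, so the operator with index \<open>j\<close> has order at most \<open>2 j\<close>.
\<close>

theorem semiclassical_expansion:
  "\<exists>e :: nat \<Rightarrow> ('n gen \<Rightarrow>\<^sub>0 nat) \<Rightarrow> complex \<Rightarrow> complex.
        (\<forall>j. diff_op_coeffs (e j)) \<and>
        (\<forall>f J K. bounded K \<longrightarrow>
           (\<exists>M. \<forall>\<^sub>F h in small. \<forall>z\<in>K.
              norm (quantum_restriction S h f (cnj z) z -
                    (classical_restriction S f z +
                     (\<Sum>j=1..J. of_real h ^ j * diff_op S (e j) f z))) \<le> M * h ^ Suc J))"
proof -
  have "\<forall>\<beta>. \<exists>s. (\<forall>i. s i \<in> coeff_fns) \<and> (\<forall>i. 2 * i < tdeg \<beta> \<longrightarrow> s i = (\<lambda>z. 0)) \<and>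
      (\<forall>L. bigO L (\<lambda>z h. sym_mean (ctr \<beta> z) z h - (\<Sum>i<L. of_real h ^ i * s i z))) \<and> (\<beta> = 0 \<longrightarrow> s 0 = (\<lambda>z. 1))"
  proof
    fix \<beta> :: "'n gen \<Rightarrow>\<^sub>0 nat"
    show "\<exists>s. (\<forall>i. s i \<in> coeff_fns) \<and> (\<forall>i. 2 * i < tdeg \<beta> \<longrightarrow> s i = (\<lambda>z. 0)) \<and>
      (\<forall>L. bigO L (\<lambda>z h. sym_mean (ctr \<beta> z) z h - (\<Sum>i<L. of_real h ^ i * s i z))) \<and> (\<beta> = 0 \<longrightarrow> s 0 = (\<lambda>z. 1))"
    proof (cases "\<beta> = 0")
      case False
      then show ?thesis using expands_all[OF expands_ctr[of _ \<beta>]] by simp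
    next
      case True
      define s :: "nat \<Rightarrow> complex \<Rightarrow> complex" where "s = (\<lambda>i z. if i = 0 then 1 else 0)"
      \<comment> \<open>the term without derivatives is exact, so that the leading term is the classical restriction\<close>
      have one: "sym_mean (ctr \<beta> z) z h = 1" if "admissible S h" for z h
        by (simp add: sym_mean_def ctr_def True fsym_one mean_const[OF that])
      have "bigO L (\<lambda>z h. sym_mean (ctr \<beta> z) z h - (\<Sum>i<L. of_real h ^ i * s i z))" for L
      proof (cases L)
        case 0
        then show ?thesis using bigO_coeff[OF coeff_const[of 1]] one by (auto intro: bigO_cong)
      next
        case (Suc L')
        show ?thesis unfolding Suc sum.lessThan_Suc_shift
          by (rule bigO_cong[OF bigO_zero]) (simp add: one s_def)
      qed
      moreover have "s i \<in> coeff_fns" for i unfolding s_def by (rule coeff_const)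
      moreover have "tdeg \<beta> = 0" by (simp add: True tdeg_def)
      moreover have "s 0 = (\<lambda>z. 1)" by (simp add: s_def)
      ultimately show ?thesis by (intro exI[of _ s]) simp
    qed
  qed
  from choice[OF this] obtain s where s0: "\<forall>\<beta>. (\<forall>i. s \<beta> i \<in> coeff_fns) \<and> (\<forall>i. 2 * i < tdeg \<beta> \<longrightarrow> s \<beta> i = (\<lambda>z. 0)) \<and>
      (\<forall>L. bigO L (\<lambda>z h. sym_mean (ctr \<beta> z) z h - (\<Sum>i<L. of_real h ^ i * s \<beta> i z))) \<and> (\<beta> = 0 \<longrightarrow> s \<beta> 0 = (\<lambda>z. 1))" ..
  have s: "s \<beta> i \<in> coeff_fns" "2 * i < tdeg \<beta> \<Longrightarrow> s \<beta> i = (\<lambda>z. 0)"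
    "bigO L (\<lambda>z h. sym_mean (ctr \<beta> z) z h - (\<Sum>i<L. of_real h ^ i * s \<beta> i z))" "s 0 0 = (\<lambda>z. 1)" for \<beta> i L
    using s0 by blast+
  define e where "e = (\<lambda>j \<beta> z. 1 / of_nat (pfact \<beta>) * s \<beta> j z)"
  have e_zero: "e j \<beta> = (\<lambda>z. 0)" if "2 * j < tdeg \<beta>" for j \<beta>
    using s(2)[OF that] by (simp add: e_def)
  have diffop: "diff_op_coeffs (e j)" for j
    unfolding diff_op_coeffs_def
  proof (intro conjI allI)
    have "{\<alpha>. e j \<alpha> \<noteq> (\<lambda>z. 0)} \<subseteq> {\<alpha>. tdeg \<alpha> \<le> 2 * j}" using e_zero by (auto simp: not_less[symmetric])
    then show "finite {\<alpha>. e j \<alpha> \<noteq> (\<lambda>z. 0)}" using finite_tdeg finite_subset by blast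
    show "smooth_plane (e j \<alpha>)" for \<alpha> unfolding e_def by (intro coeff_smooth coeff_scale s)
  qed
  have "\<exists>M. \<forall>\<^sub>F h in small. \<forall>z\<in>K. norm (quantum_restriction S h f (cnj z) z -
          (classical_restriction S f z + (\<Sum>j=1..J. of_real h ^ j * diff_op S (e j) f z))) \<le> M * h ^ Suc J"
    if K: "bounded K" for f J and K :: "complex set"
  proof -
    obtain A where A: "finite A" "\<And>B y. finite B \<Longrightarrow> A \<subseteq> B \<Longrightarrow>
      f = (\<Sum>\<alpha>\<in>B. taylor_term f y \<alpha>)"
    proof -
      obtain A where "finite A \<and> (\<forall>\<alpha>. \<alpha> \<notin> A \<longrightarrow> mp_diff \<alpha> f = 0) \<and> (\<forall>B y. finite B \<and> A \<subseteq> B \<longrightarrow>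
         f = (\<Sum>\<alpha>\<in>B. taylor_term f y \<alpha>))" using mp_taylor[of f] by (rule exE)
      then show ?thesis by (intro that[of A]) auto
    qed
    \<comment> \<open>large enough for Taylor's formula and for all operators with index at most \<open>J\<close>\<close>
    define B where "B = A \<union> {\<beta>. tdeg \<beta> \<le> 2 * J}"
    have B: "finite B" "A \<subseteq> B" using A(1) finite_tdeg by (auto simp: B_def)
    have B0: "0 \<in> B" by (simp add: B_def tdeg_def)
    define cl where "cl = (\<lambda>\<beta> z. classical_restriction S (mp_diff \<beta> f) z)"
    have cl: "(\<lambda>z. cl \<beta> z) \<in> coeff_fns" for \<beta> unfolding cl_def classical_restriction_eval by (rule coeff_eval)
    have tay: "f = (\<Sum>\<beta>\<in>B. mp_const (cl \<beta> z / of_nat (pfact \<beta>)) * ctr \<beta> z)" for z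
      using A(2)[OF B, of "Ypt z"] unfolding cl_def classical_restriction_eval ctr_def .
    have main: "bigO (Suc J) (\<lambda>z h. \<Sum>\<beta>\<in>B. (1 / of_nat (pfact \<beta>) * cl \<beta> z) *
        (sym_mean (ctr \<beta> z) z h - (\<Sum>i<Suc J. of_real h ^ i * s \<beta> i z)))"
      by (intro bigO_sum bigO_mult_coeff s coeff_scale cl)
    have op: "diff_op S (e i) f z = (\<Sum>\<beta>\<in>B. (1 / of_nat (pfact \<beta>) * cl \<beta> z) * s \<beta> i z)" if "i \<le> J" for i z
    proof -
      have "{\<alpha>. e i \<alpha> \<noteq> (\<lambda>z. 0)} \<subseteq> B"
        using e_zero[of i] that by (force simp: B_def not_less[symmetric])
      then have "diff_op S (e i) f z = (\<Sum>\<beta>\<in>B. e i \<beta> z * cl \<beta> z)"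
        unfolding diff_op_def cl_def using B(1) by (intro sum.mono_neutral_left) auto
      then show ?thesis by (simp add: e_def mult_ac)
    qed
    have op0: "diff_op S (e 0) f z = classical_restriction S f z" for z
    proof -
      have "(\<Sum>\<beta>\<in>B. (1 / of_nat (pfact \<beta>) * cl \<beta> z) * s \<beta> 0 z) = (\<Sum>\<beta>\<in>{0}. (1 / of_nat (pfact \<beta>) * cl \<beta> z) * s \<beta> 0 z)"
      proof (rule sum.mono_neutral_right)
        show "\<forall>\<beta>\<in>B - {0}. (1 / of_nat (pfact \<beta>) * cl \<beta> z) * s \<beta> 0 z = 0"
        proof
          fix \<beta> assume "\<beta> \<in> B - {0}"
          then have "tdeg \<beta> > 0" using tdeg_eq_0[of \<beta>] by simp
          then show "(1 / of_nat (pfact \<beta>) * cl \<beta> z) * s \<beta> 0 z = 0" using s(2)[of 0 \<beta>] by simp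
        qed
      qed (use B B0 in auto)
      then show ?thesis using op[of 0 z] by (simp add: s(4) pfact_0 cl_def)
    qed
    have "bigO (Suc J) (\<lambda>z h. quantum_restriction S h f (cnj z) z -
          (classical_restriction S f z + (\<Sum>j=1..J. of_real h ^ j * diff_op S (e j) f z)))"
    proof (rule bigO_cong[OF main])
      fix z h assume h: "admissible S h"
      have "quantum_restriction S h f (cnj z) z = sym_mean (\<Sum>\<beta>\<in>B. mp_const (cl \<beta> z / of_nat (pfact \<beta>)) * ctr \<beta> z) z h"
        using quantum_restriction_mean[OF h, of f z] tay[of z] by simp
      also have "\<dots> = (\<Sum>\<beta>\<in>B. (1 / of_nat (pfact \<beta>) * cl \<beta> z) * sym_mean (ctr \<beta> z) z h)"
        unfolding sym_mean_lin[OF h] by simp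
      finally have q: "quantum_restriction S h f (cnj z) z = (\<Sum>\<beta>\<in>B. (1 / of_nat (pfact \<beta>) * cl \<beta> z) * sym_mean (ctr \<beta> z) z h)" .
      have "(\<Sum>\<beta>\<in>B. (1 / of_nat (pfact \<beta>) * cl \<beta> z) * (\<Sum>i<Suc J. of_real h ^ i * s \<beta> i z)) =
         (\<Sum>i<Suc J. of_real h ^ i * (\<Sum>\<beta>\<in>B. (1 / of_nat (pfact \<beta>) * cl \<beta> z) * s \<beta> i z))"
        unfolding sum_distrib_left by (subst sum.swap) (simp add: mult_ac)
      also have "\<dots> = (\<Sum>i<Suc J. of_real h ^ i * diff_op S (e i) f z)"
        by (intro sum.cong) (simp_all add: op)
      also have "\<dots> = classical_restriction S f z + (\<Sum>j=1..J. of_real h ^ j * diff_op S (e j) f z)"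
        unfolding sum.lessThan_Suc_shift by (simp add: op0 sum.atLeast1_atMost_eq)
      finally show "quantum_restriction S h f (cnj z) z -
          (classical_restriction S f z + (\<Sum>j=1..J. of_real h ^ j * diff_op S (e j) f z)) =
         (\<Sum>\<beta>\<in>B. (1 / of_nat (pfact \<beta>) * cl \<beta> z) * (sym_mean (ctr \<beta> z) z h - (\<Sum>i<Suc J. of_real h ^ i * s \<beta> i z)))"
        unfolding q by (simp add: right_diff_distrib sum_subtractf)
    qed
    then obtain M where "M \<ge> 0" "\<forall>\<^sub>F h in small. \<forall>z\<in>K. norm (quantum_restriction S h f (cnj z) z -
          (classical_restriction S f z + (\<Sum>j=1..J. of_real h ^ j * diff_op S (e j) f z))) \<le> M * h ^ Suc J"
      using K by (rule bigOD)
    then show ?thesis by blast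
  qed
  with diffop show ?thesis by (intro exI[of _ e]) blast
qed

end

theorem theorem6p1:
  fixes S :: "'n::finite surface"
  assumes flow: "is_flow S"
    and kap_independent: "kap_independent S"
    and kap_annulled: "kap_annulled S"
    and not_extremal:
      "\<not> (\<forall>\<^sub>F A in nhds (pt S). rval (rho S) (pt S) \<le> rval (rho S) A)"
      "\<not> (\<forall>\<^sub>F A in nhds (pt S). rval (rho S) A \<le> rval (rho S) (pt S))"
    and tstar:
      "tstar S = \<infinity> \<and> (\<forall>t>0. rval (rho S) (flow S t (pt S)) > rval (rho S) (pt S)) \<or>
       (\<exists>T>0. tstar S = ereal T \<and>
          (\<forall>t. 0 < t \<and> t < T \<longrightarrow> rval (rho S) (flow S t (pt S)) > rval (rho S) (pt S)) \<and>
          rval (rho S) (flow S T (pt S)) = rval (rho S) (pt S))"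
    and points: "\<forall>(C, A)\<in>XX S. \<exists>t\<ge>0. ereal t \<le> tstar S \<and> A = flow S t (pt S)"
    and g_integral: "\<forall>t A. rval (igm S) (flow S t A) = rval (igm S) A"
    and g_base: "rval (igm S) (pt S) = rval (rho S) (pt S)"
    and g_near: "\<exists>\<epsilon>>0. \<forall>(C, A)\<in>XX S. A \<noteq> pt S \<and> dist A (pt S) < \<epsilon> \<longrightarrow>
                   rval (rho S) A > rval (igm S) A"
    and factorization:
      "\<forall>A. complex_of_real (rval (rho S) A - rval (igm S) A) = cval (Dp S) A * cval (Ep S) A"
    and D_base: "cval (Dp S) (pt S) \<noteq> 0"
    and E_base: "cval (Ep S) (pt S) = 0"
    and D_polar: "tstar S \<noteq> \<infinity> \<longrightarrow> cval (Dp S) (flow S (real_of_ereal (tstar S)) (pt S)) = 0"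
    and coordinate: "complex_coordinate S"
  shows
    "(\<forall>h. admissible S h \<longrightarrow>
        hermitian_rep S h \<and> irreducible_rep S h \<and>
        (topN S h \<noteq> 0 \<longrightarrow> (\<forall>z. \<exists>p>0. kahler_coeff S h z = \<i> * complex_of_real p)) \<and>
        (\<forall>f w z. quantum_restriction S h f w z =
           1 / ker S h w z *
           normal_ordered (\<lambda>c u x. c * u x) (B_op S h) (A_op S h) (C_op S h) f
             (\<lambda>x. ker S h x z) w) \<and>
        (\<forall>f g. wick_prod S h (quantum_restriction S h f) (quantum_restriction S h g) =
               quantum_restriction S h (star S h f g))) \<and>
     (\<exists>e :: nat \<Rightarrow> ('n gen \<Rightarrow>\<^sub>0 nat) \<Rightarrow> complex \<Rightarrow> complex.
        (\<forall>j. diff_op_coeffs (e j)) \<and>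
        (\<forall>f J K. bounded K \<longrightarrow>
           (\<exists>M. \<forall>\<^sub>F h in at 0 within {h. admissible S h}. \<forall>z\<in>K.
              norm (quantum_restriction S h f (cnj z) z -
                    (classical_restriction S f z +
                     (\<Sum>j=1..J. of_real h ^ j * diff_op S (e j) f z))) \<le> M * h ^ Suc J)))"
proof -
  interpret revolution_surface S
    using flow kap_annulled tstar points g_integral g_base factorization D_base E_base D_polar coordinate
    by unfold_locales
  show ?thesis
  proof (intro conjI allI impI)
    fix h assume "admissible S h"
    then interpret quantized_surface S h by (rule quantized)
    show "hermitian_rep S h" by (rule hermitian)
    show "irreducible_rep S h" by (rule irreducible)
    show "\<exists>p>0. kahler_coeff S h z = \<i> * complex_of_real p" if "topN S h \<noteq> 0" for z
      using that by (rule kahler_positive)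
    show "quantum_restriction S h f w z = 1 / ker S h w z *
           normal_ordered (\<lambda>c u x. c * u x) (B_op S h) (A_op S h) (C_op S h) f (\<lambda>x. ker S h x z) w" for f w z
      by (rule quantum_restriction_eq)
    show "wick_prod S h (quantum_restriction S h f) (quantum_restriction S h g) =
           quantum_restriction S h (star S h f g)" for f g
      by (rule quantum_restriction_star)
  qed (rule semiclassical_expansion)
qed

end
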